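(* Let $\mathbb{F}$ be an algebraically closed field of characteristic zero and let $\Gamma_6$ be the fine grading, with universal group $G_6=\mathbb{Z}_2\times\mathbb{Z}_2^2\times\mathbb{Z}^2$, on the Lie algebra $\mathbf{L}$ of type $E_6$ described in the context. Identify the Weyl group $\mathcal{W}(\Gamma_6)$ with a subgroup of $\mathrm{Aut}(G_6)$, and elements of $\mathrm{Aut}(G_6)$ with their matrices (by columns, in $1+2+2$ blocks) relative to the canonical basis of $G_6$. Then $\mathcal{W}(\Gamma_6)$ is $$\left\{\begin{pmatrix} \bar1 & (a\ \ b) & (c\ \ d) \\ \begin{matrix} \bar0 \\ \bar0 \end{matrix} & A & \begin{matrix} e & e \\ f & f \end{matrix} \\ 0 & 0 & B \end{pmatrix}\;\middle|\; a,b,c,d,e,f\in\mathbb{Z}_2,\ A\in\mathrm{GL}_2(\mathbb{Z}_2),\ B\in\langle\sigma_1,\sigma_2,-\mathrm{id}\rangle\right\},$$ where $\sigma_1=\begin{pmatrix} 0 & 1 \\ 1 & 0 \end{pmatrix}$, $\sigma_2=\begin{pmatrix} 1 & 0 \\ 0 & -1 \end{pmatrix}$ (as integer matrices), and the set $\{\sigma_1,\sigma_2,-\mathrm{id}\}$ generates a group isomorphic to $\mathbb{Z}_2^2\rtimes\mathbb{Z}_2$. Hence $$\mathcal{W}(\Gamma_6)\cong\mathbb{Z}_2^4\rtimes\big((\mathbb{Z}_2^2\rtimes S_3)\times(\mathbb{Z}_2^2\rtimes\mathbb{Z}_2)\big).$$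
   Context: **Gradings.** For an abelian group $G$, a $G$-grading on an algebra $A$ is a decomposition $\Gamma: A=\bigoplus_{g\in G}A_g$ with $A_gA_h\subseteq A_{g+h}$; $\mathrm{Supp}\,\Gamma=\{g:A_g\ne0\}$. It is fine if it has no proper refinement (a decomposition graded by some abelian group whose components are contained in components of $\Gamma$, some properly). The universal group of $\Gamma$ is the abelian group $G$ realizing $\Gamma$ such that for any other realization over a group $H$ there is a unique homomorphism $G\to H$ restricting to the identity on the support. $\mathrm{Aut}(\Gamma)$ is the group of algebra automorphisms permuting the components, $\mathrm{Stab}(\Gamma)$ the subgroup fixing every component, and $\mathcal{W}(\Gamma)=\mathrm{Aut}(\Gamma)/\mathrm{Stab}(\Gamma)$. Each $f\in\mathrm{Aut}(\Gamma)$ induces $\alpha_f\in\mathrm{Aut}(G)$ ($G$ universal) with $f(A_s)=A_{\alpha_f(s)}$ for $s\in\mathrm{Supp}\,\Gamma$, which identifies $\mathcal{W}(\Gamma)$ with a subgroup of $\mathrm{Aut}(G)$. For $G=\mathbb{Z}_p^m\times\mathbb{Z}^n$, the matrix of $\alpha\in\mathrm{Aut}(G)$ has as $j$-th column the coordinates of the image of the $j$-th canonical basis element; its first $m$ rows have entries in $\mathbb{Z}_p$ and the last $n$ rows in $\mathbb{Z}$. $S_3$ is the symmetric group on 3 elements. **The Lie algebra $\mathbf{L}$.** $\mathcal{V}=\mathbb{F}^8$ with symplectic form $b(u,v)=u^tCv$, where $C$ is the $4\times4$ array of $2\times2$ blocks having $\sigma_3=\begin{pmatrix} 0 & -1 \\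 1 & 0 \end{pmatrix}$ in block positions $(1,2),(2,1),(3,4),(4,3)$ and $0$ elsewhere. $\mathbf{L}_0=\mathfrak{sp}(\mathcal{V},b)$ (type $C_4$), and $\mathbf{L}_1$ is the irreducible $\mathbf{L}_0$-submodule isomorphic to $V(\lambda_4)$ (highest weight the fourth fundamental weight) in the kernel of the contraction $\bigwedge^4\mathcal{V}\to\bigwedge^2\mathcal{V}$, $v_1\wedge v_2\wedge v_3\wedge v_4\mapsto\sum(-1)^\sigma b(v_{\sigma(1)},v_{\sigma(2)})\,v_{\sigma(3)}\wedge v_{\sigma(4)}$, the sum being over $\sigma\in S_4$ with $\sigma(1)<\sigma(2)$ and $\sigma(3)<\sigma(4)$. $\mathbf{L}=\mathbf{L}_0\oplus\mathbf{L}_1$ carries a $\mathbb{Z}_2$-graded Lie algebra structure of type $E_6$ extending the bracket of $\mathbf{L}_0$ and its action on $\mathbf{L}_1$. $\Theta$ is the automorphism equal to $\mathrm{id}$ on $\mathbf{L}_0$ and $-\mathrm{id}$ on $\mathbf{L}_1$. For $f\in\mathrm{GL}_8(\mathbb{F})$ with $f^tCf=\pm C$, $f^\diamondsuit\in\mathrm{Aut}(\mathbf{L})$ is given by $g\mapsto fgf^{-1}$ on $\mathbf{L}_0$ and by the restriction of $\bigwedge^4f$ on $\mathbf{L}_1$. **The grading $\Gamma_6$.** Let $\tau_{\alpha,\beta}=\mathrm{diag}(\alpha,\alpha,\frac1\alpha,\frac1\alpha,\beta,\beta,\frac1\beta,\frac1\beta)$, $g_1=\mathrm{diag}(\sigma_1,\sigma_1,\sigma_1,\sigma_1)$,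 $g_2=\mathrm{diag}(\sigma_2,\sigma_2,\sigma_2,\sigma_2)$ with $\sigma_1=\begin{pmatrix} 0 & 1 \\ 1 & 0 \end{pmatrix}$, $\sigma_2=\begin{pmatrix} 1 & 0 \\ 0 & -1 \end{pmatrix}$. Since $\tau_{-1,-1}^\diamondsuit=\mathrm{id}$, the torus $\{\tau_{\alpha,\beta}^\diamondsuit\}$ is parametrized isomorphically by $(\mathbb{F}^\times)^2$ through $\tau'^{\,\diamondsuit}_{\alpha\beta,\alpha/\beta}:=\tau^\diamondsuit_{\alpha,\beta}$. $\Gamma_6$ is the grading produced by $P_6=\langle\Theta,g_1^\diamondsuit,g_2^\diamondsuit\rangle\cdot\{\tau'^{\,\diamondsuit}_{\alpha,\beta}\mid\alpha,\beta\in\mathbb{F}^\times\}$: a homogeneous element of degree $(\bar k_0;\bar k_1,\bar k_2;n_1,n_2)\in\mathbb{Z}_2\times\mathbb{Z}_2^2\times\mathbb{Z}^2$ is one on which $\Theta$ acts as $(-1)^{k_0}$, $g_i^\diamondsuit$ acts as $(-1)^{k_i}$ ($i=1,2$), and $\tau'^{\,\diamondsuit}_{\alpha,\beta}$ acts as $\alpha^{n_1}\beta^{n_2}$ for all $\alpha,\beta\in\mathbb{F}^\times$. *)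

theory Defs
  imports
    "HOL-Analysis.Analysis"
    "HOL-Algebra.Algebra"
    "HOL-Library.Z2"
begin

unbundle no m_inv_syntax

section \<open>Lie algebras, gradings and their Weyl groups\<close>

text \<open>A Lie algebra is given by a carrier \<open>L\<close> inside an ambient type, the scalar multiplication
  \<open>sc\<close> of that type and a bracket \<open>br\<close>, of which only the values on \<open>L\<close> matter.\<close>

definition lie_algebra ::
    "('k::field \<Rightarrow> 'v::ab_group_add \<Rightarrow> 'v) \<Rightarrow> 'v set \<Rightarrow> ('v \<Rightarrow> 'v \<Rightarrow> 'v) \<Rightarrow> bool" where
  "lie_algebra sc L br \<longleftrightarrow>
     vector_space sc \<and> module.subspace sc L \<and>
     (\<forall>x\<in>L. \<forall>y\<in>L. br x y \<in> L) \<and>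
     (\<forall>x\<in>L. \<forall>y\<in>L. \<forall>z\<in>L. br (x + y) z = br x z + br y z \<and> br z (x + y) = br z x + br z y) \<and>
     (\<forall>c. \<forall>x\<in>L. \<forall>y\<in>L. br (sc c x) y = sc c (br x y) \<and> br x (sc c y) = sc c (br x y)) \<and>
     (\<forall>x\<in>L. br x x = 0) \<and>
     (\<forall>x\<in>L. \<forall>y\<in>L. \<forall>z\<in>L. br x (br y z) + br y (br z x) + br z (br x y) = 0)"

definition simple_lie_algebra ::
    "('k::field \<Rightarrow> 'v::ab_group_add \<Rightarrow> 'v) \<Rightarrow> 'v set \<Rightarrow> ('v \<Rightarrow> 'v \<Rightarrow> 'v) \<Rightarrow> bool" where
  "simple_lie_algebra sc L br \<longleftrightarrow>
     lie_algebra sc L br \<and> (\<exists>x\<in>L. \<exists>y\<in>L. br x y \<noteq> 0) \<and>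
     (\<forall>I. module.subspace sc I \<and> I \<subseteq> L \<and> (\<forall>x\<in>L. \<forall>y\<in>I. br x y \<in> I) \<longrightarrow> I = {0} \<or> I = L)"

text \<open>The Cartan matrix of the Dynkin diagram \<open>E\<^sub>6\<close> in Bourbaki's labelling: the chain
  1 - 3 - 4 - 5 - 6 with 2 attached to 4.\<close>

definition cartan_E6 :: "nat \<Rightarrow> nat \<Rightarrow> int" where
  "cartan_E6 i j =
     (if i = j then 2
      else if {i, j} \<in> {{1, 3}, {3, 4}, {4, 5}, {5, 6}, {2, 4}} then -1 else 0)"

text \<open>Type \<open>E\<^sub>6\<close>: simple and generated by Chevalley generators satisfying the Chevalley--Serre
  relations of the Cartan matrix \<open>E\<^sub>6\<close>.\<close>

definition lie_algebra_type_E6 ::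
    "('k::field \<Rightarrow> 'v::ab_group_add \<Rightarrow> 'v) \<Rightarrow> 'v set \<Rightarrow> ('v \<Rightarrow> 'v \<Rightarrow> 'v) \<Rightarrow> bool" where
  "lie_algebra_type_E6 sc L br \<longleftrightarrow>
     simple_lie_algebra sc L br \<and>
     (\<exists>e f h :: nat \<Rightarrow> 'v.
        e ` {1..6} \<subseteq> L \<and> f ` {1..6} \<subseteq> L \<and> h ` {1..6} \<subseteq> L \<and>
        (\<forall>i\<in>{1..6}. \<forall>j\<in>{1..6}.
           br (h i) (h j) = 0 \<and>
           br (e i) (f j) = (if i = j then h i else 0) \<and>
           br (h i) (e j) = sc (of_int (cartan_E6 i j)) (e j) \<and>
           br (h i) (f j) = sc (- of_int (cartan_E6 i j)) (f j) \<and>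
           (i \<noteq> j \<longrightarrow> (br (e i) ^^ nat (1 - cartan_E6 i j)) (e j) = 0 \<and>
                     (br (f i) ^^ nat (1 - cartan_E6 i j)) (f j) = 0)) \<and>
        (\<forall>M. module.subspace sc M \<and> M \<subseteq> L \<and> (\<forall>x\<in>M. \<forall>y\<in>M. br x y \<in> M) \<and>
             e ` {1..6} \<subseteq> M \<and> f ` {1..6} \<subseteq> M \<longrightarrow> M = L))"

text \<open>The automorphisms are extensional functions on \<open>L\<close>, so that they form a subset of the
  carrier of \<^term>\<open>BijGroup L\<close>.\<close>

definition lie_auts ::
    "('k \<Rightarrow> 'v::ab_group_add \<Rightarrow> 'v) \<Rightarrow> 'v set \<Rightarrow> ('v \<Rightarrow> 'v \<Rightarrow> 'v) \<Rightarrow> ('v \<Rightarrow> 'v) set" where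
  "lie_auts sc L br =
     {f \<in> Bij L. (\<forall>x\<in>L. \<forall>y\<in>L. f (x + y) = f x + f y) \<and> (\<forall>c. \<forall>x\<in>L. f (sc c x) = sc c (f x)) \<and>
                (\<forall>x\<in>L. \<forall>y\<in>L. f (br x y) = br (f x) (f y))}"

text \<open>A grading by the abelian group \<open>'g\<close> is a family of subspaces indexed by \<open>'g\<close>, possibly
  zero; its components are the nonzero ones.\<close>

definition grading ::
    "('k::field \<Rightarrow> 'v::ab_group_add \<Rightarrow> 'v) \<Rightarrow> 'v set \<Rightarrow> ('v \<Rightarrow> 'v \<Rightarrow> 'v)
       \<Rightarrow> ('g::ab_group_add \<Rightarrow> 'v set) \<Rightarrow> bool" where
  "grading sc L br A \<longleftrightarrow>
     (\<forall>g. module.subspace sc (A g) \<and> A g \<subseteq> L) \<and>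
     (\<forall>x\<in>L. \<exists>!y. (\<forall>g. y g \<in> A g) \<and> finite {g. y g \<noteq> 0} \<and> x = (\<Sum>g | y g \<noteq> 0. y g)) \<and>
     (\<forall>g h. \<forall>x\<in>A g. \<forall>y\<in>A h. br x y \<in> A (g + h))"

definition supp :: "('g \<Rightarrow> 'v::zero set) \<Rightarrow> 'g set" where
  "supp A = {g. A g \<noteq> {0}}"

definition comps :: "('g \<Rightarrow> 'v::zero set) \<Rightarrow> 'v set set" where
  "comps A = A ` supp A"

definition proper_refinement :: "('h \<Rightarrow> 'v::zero set) \<Rightarrow> ('g \<Rightarrow> 'v set) \<Rightarrow> bool" where
  "proper_refinement A' A \<longleftrightarrow>
     (\<forall>V\<in>comps A'. \<exists>W\<in>comps A. V \<subseteq> W) \<and> (\<exists>V\<in>comps A'. \<exists>W\<in>comps A. V \<subset> W)"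

text \<open>One cannot quantify over all abelian groups inside a formula. The type argument \<open>'h\<close> of the
  next two notions is the group grading the refinement (resp. the other realization); a theorem in
  which \<open>'h\<close> is a type variable makes the assertion for every abelian group.\<close>

definition fine_grading ::
    "'h::ab_group_add itself \<Rightarrow> ('k::field \<Rightarrow> 'v::ab_group_add \<Rightarrow> 'v) \<Rightarrow> 'v set \<Rightarrow> ('v \<Rightarrow> 'v \<Rightarrow> 'v)
       \<Rightarrow> ('g::ab_group_add \<Rightarrow> 'v set) \<Rightarrow> bool" where
  "fine_grading (T :: 'h itself) sc L br A \<longleftrightarrow>
     grading sc L br A \<and>
     \<not> (\<exists>A' :: 'h \<Rightarrow> 'v set. grading sc L br A' \<and> proper_refinement A' A)"

definition graded_by_universal_group ::
    "'h::ab_group_add itself \<Rightarrow> ('k::field \<Rightarrow> 'v::ab_group_add \<Rightarrow> 'v) \<Rightarrow> 'v set \<Rightarrow> ('v \<Rightarrow> 'v \<Rightarrow> 'v)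
       \<Rightarrow> ('g::ab_group_add \<Rightarrow> 'v set) \<Rightarrow> bool" where
  "graded_by_universal_group (T :: 'h itself) sc L br A \<longleftrightarrow>
     grading sc L br A \<and>
     (\<forall>A' :: 'h \<Rightarrow> 'v set. grading sc L br A' \<and> comps A' = comps A \<longrightarrow>
        (\<exists>!\<phi>. Modules.additive \<phi> \<and> (\<forall>s\<in>supp A. A' (\<phi> s) = A s)))"

definition grading_auts ::
    "('k \<Rightarrow> 'v::ab_group_add \<Rightarrow> 'v) \<Rightarrow> 'v set \<Rightarrow> ('v \<Rightarrow> 'v \<Rightarrow> 'v) \<Rightarrow> ('g \<Rightarrow> 'v set) \<Rightarrow> ('v \<Rightarrow> 'v) set" where
  "grading_auts sc L br A = {f \<in> lie_auts sc L br. bij_betw (\<lambda>V. f ` V) (comps A) (comps A)}"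

definition grading_aut_group ::
    "('k \<Rightarrow> 'v::ab_group_add \<Rightarrow> 'v) \<Rightarrow> 'v set \<Rightarrow> ('v \<Rightarrow> 'v \<Rightarrow> 'v) \<Rightarrow> ('g \<Rightarrow> 'v set)
       \<Rightarrow> ('v \<Rightarrow> 'v) monoid" where
  "grading_aut_group sc L br A = BijGroup L \<lparr>carrier := grading_auts sc L br A\<rparr>"

definition grading_stab ::
    "('k \<Rightarrow> 'v::ab_group_add \<Rightarrow> 'v) \<Rightarrow> 'v set \<Rightarrow> ('v \<Rightarrow> 'v \<Rightarrow> 'v) \<Rightarrow> ('g \<Rightarrow> 'v set) \<Rightarrow> ('v \<Rightarrow> 'v) set" where
  "grading_stab sc L br A = {f \<in> grading_auts sc L br A. \<forall>V\<in>comps A. f ` V = V}"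

definition weyl_group ::
    "('k \<Rightarrow> 'v::ab_group_add \<Rightarrow> 'v) \<Rightarrow> 'v set \<Rightarrow> ('v \<Rightarrow> 'v \<Rightarrow> 'v) \<Rightarrow> ('g \<Rightarrow> 'v set)
       \<Rightarrow> ('v \<Rightarrow> 'v) set monoid" where
  "weyl_group sc L br A = grading_aut_group sc L br A Mod grading_stab sc L br A"

definition plus_group :: "'g::ab_group_add monoid" where
  "plus_group = \<lparr>carrier = UNIV, monoid.mult = (+), one = 0\<rparr>"

definition induces :: "('g \<Rightarrow> 'v::zero set) \<Rightarrow> ('v \<Rightarrow> 'v) \<Rightarrow> ('g \<Rightarrow> 'g) \<Rightarrow> bool" where
  "induces A f \<alpha> \<longleftrightarrow> (\<forall>s\<in>supp A. f ` A s = A (\<alpha> s))"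

text \<open>The subgroup of the automorphism group of \<open>'g\<close> formed by the automorphisms \<open>\<alpha>\<^sub>f\<close>.\<close>

definition induced_auts ::
    "('k \<Rightarrow> 'v::ab_group_add \<Rightarrow> 'v) \<Rightarrow> 'v set \<Rightarrow> ('v \<Rightarrow> 'v \<Rightarrow> 'v) \<Rightarrow> ('g::ab_group_add \<Rightarrow> 'v set)
       \<Rightarrow> ('g \<Rightarrow> 'g) set" where
  "induced_auts sc L br A =
     {\<alpha> \<in> carrier (AutoGroup plus_group). \<exists>f\<in>grading_auts sc L br A. induces A f \<alpha>}"

section \<open>Groups\<close>

definition semidirect ::
    "('n, 'a) monoid_scheme \<Rightarrow> ('h, 'b) monoid_scheme \<Rightarrow> ('h \<Rightarrow> 'n \<Rightarrow> 'n) \<Rightarrow> ('n \<times> 'h) monoid" where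
  "semidirect N H \<theta> =
     \<lparr>carrier = carrier N \<times> carrier H,
      monoid.mult = (\<lambda>(n, h) (n', h'). (n \<otimes>\<^bsub>N\<^esub> \<theta> h n', h \<otimes>\<^bsub>H\<^esub> h')),
      one = (\<one>\<^bsub>N\<^esub>, \<one>\<^bsub>H\<^esub>)\<rparr>"

abbreviation C2 :: "int monoid" where
  "C2 \<equiv> integer_mod_group 2"

definition GL_group :: "('a::semiring_1 ^ 'n ^ 'n) monoid" where
  "GL_group = \<lparr>carrier = {A. invertible A}, monoid.mult = (**), one = mat 1\<rparr>"

definition sigma1 :: "'a::comm_ring_1 ^ 2 ^ 2" where
  "sigma1 = vector [vector [0, 1], vector [1, 0]]"

definition sigma2 :: "'a::comm_ring_1 ^ 2 ^ 2" where
  "sigma2 = vector [vector [1, 0], vector [0, -1]]"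

definition sigma3 :: "'a::comm_ring_1 ^ 2 ^ 2" where
  "sigma3 = vector [vector [0, -1], vector [1, 0]]"

section \<open>The Lie algebra \<open>L\<close>\<close>

text \<open>The coordinates of \<open>F\<^sup>8\<close> are indexed by (block, position in the block); the numeral 4 of the
  type \<open>4\<close> equals 0, and likewise 2 in the type \<open>2\<close>.\<close>

type_synonym idx = "4 \<times> 2"
type_synonym 'a mat8 = "'a ^ idx ^ idx"
type_synonym 'a tensor4 = "'a ^ idx ^ idx ^ idx ^ idx"
type_synonym 'a elt = "'a mat8 \<times> 'a tensor4"

definition C_mat :: "'a::field mat8" where
  "C_mat = (\<chi> p q. if (fst p, fst q) \<in> {(1, 2), (2, 1), (3, 4), (4, 3)}
                   then sigma3 $ snd p $ snd q else 0)"

definition bform :: "'a::field ^ idx \<Rightarrow> 'a ^ idx \<Rightarrow> 'a" where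
  "bform u v = (\<Sum>p\<in>UNIV. \<Sum>q\<in>UNIV. u $ p * C_mat $ p $ q * v $ q)"

definition L0 :: "'a::field mat8 set" where
  "L0 = {x. \<forall>u v. bform (x *v u) v + bform u (x *v v) = 0}"

text \<open>In characteristic 0 the fourth exterior power is the space of alternating tensors, with
  \<open>v\<^sub>1 \<and> v\<^sub>2 \<and> v\<^sub>3 \<and> v\<^sub>4\<close> being the sum of \<open>sign \<sigma> v\<^bsub>\<sigma> 1\<^esub> \<otimes> v\<^bsub>\<sigma> 2\<^esub> \<otimes> v\<^bsub>\<sigma> 3\<^esub> \<otimes> v\<^bsub>\<sigma> 4\<^esub>\<close> over all
  permutations \<open>\<sigma>\<close>. A tensor is alternating iff it changes sign under adjacent transpositions.\<close>

definition Ext4 :: "'a::field tensor4 set" where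
  "Ext4 = {w. \<forall>p q r s. w $ q $ p $ r $ s = - w $ p $ q $ r $ s \<and>
                        w $ p $ r $ q $ s = - w $ p $ q $ r $ s \<and>
                        w $ p $ q $ s $ r = - w $ p $ q $ r $ s}"

definition tensor_scale :: "'a::field \<Rightarrow> 'a tensor4 \<Rightarrow> 'a tensor4" where
  "tensor_scale c w = (\<chi> p q r s. c * w $ p $ q $ r $ s)"

text \<open>The derivation action of matrices and the fourth exterior power of a matrix.\<close>

definition act :: "'a::field mat8 \<Rightarrow> 'a tensor4 \<Rightarrow> 'a tensor4" where
  "act x w = (\<chi> p q r s. \<Sum>t\<in>UNIV. x $ p $ t * w $ t $ q $ r $ s + x $ q $ t * w $ p $ t $ r $ s +
                                    x $ r $ t * w $ p $ q $ t $ s + x $ s $ t * w $ p $ q $ r $ t)"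

definition ext4_map :: "'a::field mat8 \<Rightarrow> 'a tensor4 \<Rightarrow> 'a tensor4" where
  "ext4_map f w = (\<chi> p q r s. \<Sum>p'\<in>UNIV. \<Sum>q'\<in>UNIV. \<Sum>r'\<in>UNIV. \<Sum>s'\<in>UNIV.
     f $ p $ p' * f $ q $ q' * f $ r $ r' * f $ s $ s' * w $ p' $ q' $ r' $ s')"

text \<open>The contraction sends \<open>v\<^sub>1 \<and> v\<^sub>2 \<and> v\<^sub>3 \<and> v\<^sub>4\<close> to the sum of
  \<open>sign \<sigma> b(v\<^bsub>\<sigma> 1\<^esub>, v\<^bsub>\<sigma> 2\<^esub>) v\<^bsub>\<sigma> 3\<^esub> \<and> v\<^bsub>\<sigma> 4\<^esub>\<close> over the \<open>\<sigma>\<close> with \<open>\<sigma> 1 < \<sigma> 2\<close> and \<open>\<sigma> 3 < \<sigma> 4\<close>.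
  Contracting the first two slots with \<open>C\<close> counts each such term twice, whence the factor 1/2.
  Lemma \<open>contraction_wedge4\<close> below checks this.\<close>

definition contraction :: "'a::field tensor4 \<Rightarrow> 'a ^ idx ^ idx" where
  "contraction w = (\<chi> r s. (\<Sum>p\<in>UNIV. \<Sum>q\<in>UNIV. C_mat $ p $ q * w $ p $ q $ r $ s) / 2)"

definition wedge2 :: "'a::field ^ idx \<Rightarrow> 'a ^ idx \<Rightarrow> 'a ^ idx ^ idx" where
  "wedge2 u v = (\<chi> p q. u $ p * v $ q - v $ p * u $ q)"

definition wedge4 :: "'a::field ^ idx \<Rightarrow> 'a ^ idx \<Rightarrow> 'a ^ idx \<Rightarrow> 'a ^ idx \<Rightarrow> 'a tensor4" where
  "wedge4 v1 v2 v3 v4 = (\<chi> p q r s.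
      wedge2 v1 v2 $ p $ q * wedge2 v3 v4 $ r $ s - wedge2 v1 v3 $ p $ q * wedge2 v2 v4 $ r $ s
    + wedge2 v1 v4 $ p $ q * wedge2 v2 v3 $ r $ s + wedge2 v2 v3 $ p $ q * wedge2 v1 v4 $ r $ s
    - wedge2 v2 v4 $ p $ q * wedge2 v1 v3 $ r $ s + wedge2 v3 v4 $ p $ q * wedge2 v1 v2 $ r $ s)"

text \<open>To speak of highest weights, take the diagonal Cartan subalgebra of \<open>L\<^sub>0\<close> and the Borel
  subalgebra of the matrices that are upper triangular in the order
  (1,1), (1,2), (3,1), (3,2), (4,1), (4,2), (2,1), (2,2) of the indices. The weights of \<open>F\<^sup>8\<close> in this
  order are \<open>\<epsilon>\<^sub>1, \<epsilon>\<^sub>2, \<epsilon>\<^sub>3, \<epsilon>\<^sub>4, -\<epsilon>\<^sub>4, -\<epsilon>\<^sub>3, -\<epsilon>\<^sub>2, -\<epsilon>\<^sub>1\<close>, the simple roots are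
  \<open>\<epsilon>\<^sub>1 - \<epsilon>\<^sub>2, \<epsilon>\<^sub>2 - \<epsilon>\<^sub>3, \<epsilon>\<^sub>3 - \<epsilon>\<^sub>4, 2\<epsilon>\<^sub>4\<close> and \<open>\<lambda>\<^sub>4 = \<epsilon>\<^sub>1 + \<epsilon>\<^sub>2 + \<epsilon>\<^sub>3 + \<epsilon>\<^sub>4\<close>.\<close>

definition idx_rank :: "idx \<Rightarrow> nat" where
  "idx_rank p =
     (if fst p = 1 then 0 else if fst p = 3 then 2 else if fst p = 4 then 4 else 6) +
     (if snd p = 1 then 0 else 1)"

definition L0_diagonal :: "'a::field mat8 set" where
  "L0_diagonal = {x \<in> L0. \<forall>p q. p \<noteq> q \<longrightarrow> x $ p $ q = 0}"

definition L0_positive :: "'a::field mat8 set" where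
  "L0_positive = {x \<in> L0. \<forall>p q. x $ p $ q \<noteq> 0 \<longrightarrow> idx_rank p < idx_rank q}"

definition lambda4 :: "'a::field mat8 \<Rightarrow> 'a" where
  "lambda4 h = h $ (1, 1) $ (1, 1) + h $ (1, 2) $ (1, 2) + h $ (3, 1) $ (3, 1) + h $ (3, 2) $ (3, 2)"

definition L0_submodule :: "'a::field tensor4 set \<Rightarrow> bool" where
  "L0_submodule W \<longleftrightarrow>
     module.subspace tensor_scale W \<and> W \<subseteq> Ext4 \<and> (\<forall>x\<in>L0. \<forall>w\<in>W. act x w \<in> W)"

text \<open>The irreducible submodule isomorphic to \<open>V(\<lambda>\<^sub>4)\<close> in the kernel of the contraction.\<close>

definition is_L1 :: "'a::field tensor4 set \<Rightarrow> bool" where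
  "is_L1 W \<longleftrightarrow>
     L0_submodule W \<and> W \<noteq> {0} \<and>
     (\<forall>U. L0_submodule U \<and> U \<subseteq> W \<longrightarrow> U = {0} \<or> U = W) \<and>
     (\<exists>v\<in>W. v \<noteq> 0 \<and> (\<forall>x\<in>L0_positive. act x v = 0) \<and>
            (\<forall>h\<in>L0_diagonal. act h v = tensor_scale (lambda4 h) v)) \<and>
     (\<forall>w\<in>W. contraction w = 0)"

definition elt_scale :: "'a::field \<Rightarrow> 'a elt \<Rightarrow> 'a elt" where
  "elt_scale c z = ((\<chi> p q. c * fst z $ p $ q), tensor_scale c (snd z))"

definition L_carrier :: "'a::field tensor4 set \<Rightarrow> 'a elt set" where
  "L_carrier L1 = L0 \<times> L1"

text \<open>\<open>br\<close> is a \<open>Z\<^sub>2\<close>-graded Lie algebra structure of type \<open>E\<^sub>6\<close> on \<open>L\<^sub>0 \<oplus> L\<^sub>1\<close> extending the bracket of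
  \<open>L\<^sub>0\<close> and its action on \<open>L\<^sub>1\<close>.\<close>

definition E6_bracket :: "'a::field tensor4 set \<Rightarrow> ('a elt \<Rightarrow> 'a elt \<Rightarrow> 'a elt) \<Rightarrow> bool" where
  "E6_bracket L1 br \<longleftrightarrow>
     lie_algebra_type_E6 elt_scale (L_carrier L1) br \<and>
     (\<forall>x\<in>L0. \<forall>y\<in>L0. br (x, 0) (y, 0) = (x ** y - y ** x, 0)) \<and>
     (\<forall>x\<in>L0. \<forall>w\<in>L1. br (x, 0) (0, w) = (0, act x w)) \<and>
     (\<forall>w\<in>L1. \<forall>w'\<in>L1. snd (br (0, w) (0, w')) = 0)"

section \<open>The grading \<open>\<Gamma>\<^sub>6\<close>\<close>

definition Theta :: "'a::field elt \<Rightarrow> 'a elt" where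
  "Theta z = (fst z, - snd z)"

definition diamond :: "'a::field mat8 \<Rightarrow> 'a elt \<Rightarrow> 'a elt" where
  "diamond f z = (f ** fst z ** matrix_inv f, ext4_map f (snd z))"

definition block_diag :: "'a::field ^ 2 ^ 2 \<Rightarrow> 'a mat8" where
  "block_diag s = (\<chi> p q. if fst p = fst q then s $ snd p $ snd q else 0)"

definition tau :: "'a::field \<Rightarrow> 'a \<Rightarrow> 'a mat8" where
  "tau \<alpha> \<beta> = (\<chi> p q. if p \<noteq> q then 0
                      else if fst p = 1 then \<alpha> else if fst p = 2 then 1 / \<alpha>
                      else if fst p = 3 then \<beta> else 1 / \<beta>)"

definition bit_sign :: "bit \<Rightarrow> 'a::field" where
  "bit_sign k = (if k = 0 then 1 else - 1)"

type_synonym G6 = "bit \<times> (bit ^ 2) \<times> (int ^ 2)"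

text \<open>The torus is parametrized by \<open>\<tau>'\<^bsub>\<alpha>\<beta>,\<alpha>/\<beta>\<^esub> = \<tau>\<^bsub>\<alpha>,\<beta>\<^esub>\<close>, and \<open>(\<alpha>, \<beta>) \<mapsto> (\<alpha>\<beta>, \<alpha>/\<beta>)\<close> is onto over an
  algebraically closed field.\<close>

definition Gamma6 :: "'a::field tensor4 set \<Rightarrow> G6 \<Rightarrow> 'a elt set" where
  "Gamma6 L1 = (\<lambda>(k0, k, n). {z \<in> L_carrier L1.
     Theta z = elt_scale (bit_sign k0) z \<and>
     diamond (block_diag sigma1) z = elt_scale (bit_sign (k $ 1)) z \<and>
     diamond (block_diag sigma2) z = elt_scale (bit_sign (k $ 2)) z \<and>
     (\<forall>\<alpha> \<beta>. \<alpha> \<noteq> 0 \<and> \<beta> \<noteq> 0 \<longrightarrow>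
        diamond (tau \<alpha> \<beta>) z = elt_scale ((\<alpha> * \<beta>) powi (n $ 1) * (\<alpha> / \<beta>) powi (n $ 2)) z)})"

section \<open>Matrices of automorphisms of \<open>Z\<^sub>2 \<times> Z\<^sub>2\<^sup>2 \<times> Z\<^sup>2\<close>\<close>

text \<open>A matrix in 1 + 2 + 2 blocks is the triple of its rows of blocks. A block with a single row or
  a single column is a vector.\<close>

type_synonym block_matrix =
  "(bit \<times> (bit ^ 2) \<times> (bit ^ 2)) \<times>
   ((bit ^ 2) \<times> (bit ^ 2 ^ 2) \<times> (bit ^ 2 ^ 2)) \<times>
   ((int ^ 2) \<times> (int ^ 2 ^ 2) \<times> (int ^ 2 ^ 2))"

definition matrix_of_aut :: "(G6 \<Rightarrow> G6) \<Rightarrow> block_matrix" where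
  "matrix_of_aut \<alpha> =
     (let u = \<alpha> (1, 0, 0);
          v = (\<lambda>j. \<alpha> (0, axis j 1, 0));
          w = (\<lambda>j. \<alpha> (0, 0, axis j 1))
      in ((fst u, (\<chi> j. fst (v j)), (\<chi> j. fst (w j))),
          (fst (snd u), (\<chi> i j. fst (snd (v j)) $ i), (\<chi> i j. fst (snd (w j)) $ i)),
          (snd (snd u), (\<chi> i j. snd (snd (v j)) $ i), (\<chi> i j. snd (snd (w j)) $ i))))"

definition B_group :: "(int ^ 2 ^ 2) monoid" where
  "B_group = GL_group \<lparr>carrier := generate GL_group {sigma1, sigma2, - mat 1}\<rparr>"

definition weyl_matrices :: "block_matrix set" where
  "weyl_matrices =
     {((1, vector [a, b], vector [c, d]),
       (0, A, vector [vector [e, e], vector [f, f]]),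
       (0, 0, B)) | a b c d e f A B. A \<in> carrier GL_group \<and> B \<in> carrier B_group}"

section \<open>Sanity checks\<close>

lemma vector_space_tensor_scale: "vector_space tensor_scale"
  by unfold_locales (auto simp: tensor_scale_def vec_eq_iff algebra_simps)

lemma vector_space_elt_scale: "vector_space elt_scale"
  by unfold_locales (auto simp: elt_scale_def tensor_scale_def vec_eq_iff algebra_simps)

lemma C_mat_skew: "C_mat $ q $ p = - (C_mat $ p $ q :: 'a::field)"
proof -
  have s: "sigma3 $ j $ i = - (sigma3 $ i $ j :: 'a)" for i j :: 2
    using exhaust_2[of i] exhaust_2[of j] by (auto simp: sigma3_def)
  define S :: "(4 \<times> 4) set" where "S = {(1, 2), (2, 1), (3, 4), (4, 3)}"
  have "(j, i) \<in> S \<longleftrightarrow> (i, j) \<in> S" for i j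
    unfolding S_def by blast
  then show ?thesis
    unfolding C_mat_def S_def[symmetric] by (simp add: s[of "snd q" "snd p"])
qed

lemma bform_skew: "bform v u = - bform u (v :: 'a::field ^ idx)"
proof -
  have "bform v u = (\<Sum>p\<in>UNIV. \<Sum>q\<in>UNIV. v $ q * C_mat $ q $ p * u $ p)"
    unfolding bform_def by (rule sum.swap)
  also have "\<dots> = (\<Sum>p\<in>UNIV. \<Sum>q\<in>UNIV. - (u $ p * C_mat $ p $ q * v $ q))"
  proof (intro sum.cong refl)
    fix p q :: idx
    show "v $ q * C_mat $ q $ p * u $ p = - (u $ p * C_mat $ p $ q * v $ q)"
      by (subst C_mat_skew) simp
  qed
  finally show ?thesis
    by (simp add: bform_def sum_negf)
qed

lemma contract_wedge2:
  "(\<Sum>p\<in>UNIV. \<Sum>q\<in>UNIV. C_mat $ p $ q * wedge2 u v $ p $ q) = 2 * bform u (v :: 'a::field ^ idx)"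
proof -
  have "(\<Sum>p\<in>UNIV. \<Sum>q\<in>UNIV. C_mat $ p $ q * wedge2 u v $ p $ q) = bform u v - bform v u"
    by (simp add: bform_def wedge2_def algebra_simps sum_subtractf)
  then show ?thesis
    by (simp add: bform_skew[of v u])
qed

lemma contraction_wedge4:
  fixes v1 v2 v3 v4 :: "'a::field_char_0 ^ idx"
  shows "contraction (wedge4 v1 v2 v3 v4) = (\<chi> r s.
      bform v1 v2 * wedge2 v3 v4 $ r $ s - bform v1 v3 * wedge2 v2 v4 $ r $ s
    + bform v1 v4 * wedge2 v2 v3 $ r $ s + bform v2 v3 * wedge2 v1 v4 $ r $ s
    - bform v2 v4 * wedge2 v1 v3 $ r $ s + bform v3 v4 * wedge2 v1 v2 $ r $ s)"
proof -
  have lin: "(\<Sum>p\<in>UNIV. \<Sum>q\<in>UNIV. C_mat $ p $ q * (wedge2 u v $ p $ q * x)) = 2 * bform u v * x"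
    for u v :: "'a ^ idx" and x
    using contract_wedge2[of u v] by (simp add: mult.assoc[symmetric] sum_distrib_right[symmetric])
  show ?thesis
    unfolding contraction_def wedge4_def
    by (simp add: vec_eq_iff distrib_left right_diff_distrib sum.distrib sum_subtractf lin field_simps)
qed

end

theory Submission
  imports Defs
begin

text \<open>If \<open>h \<in> L\<close> has a diagonalizable adjoint action with integral eigenvalues, then multiplying the
  \<open>m\<close>-eigenspace by \<open>l\<^sup>m\<close> is an automorphism. Involutions \<open>d \<in> sp\<^sub>8\<close> are of this kind, and for \<open>l\<close> a
  primitive 8th root of unity the resulting automorphism \<open>l\<^bsup>ad d\<^esup>\<close> turns \<open>g\<^sub>i\<^sup>\<diamond>\<close> into \<open>g\<^sub>i\<^sup>\<diamond> d\<^sup>\<diamond>\<close> if \<open>d\<close>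
  anticommutes with \<open>g\<^sub>i\<close>; this yields the parameters \<open>A\<close>, \<open>e\<close>, \<open>f\<close>. Certain \<open>h \<in> L\<^sub>1\<close>, built from the
  highest and lowest weight vectors, are of this kind as well; their automorphisms mix \<open>L\<^sub>0\<close> and \<open>L\<^sub>1\<close> and
  yield \<open>a\<close>, \<open>b\<close>, \<open>c\<close>, \<open>d\<close>. Signed permutations of the blocks yield \<open>B\<close>.

  Modulo this group the components of nontorsion degree reduce to three explicit ones, all of them
  lines, and so do the nonzero brackets between them. In a refinement, or another realization, the
  lines are homogeneous, the brackets force their degrees to come from a homomorphism on the group,
  and the degree of an element of torsion degree is detected by its brackets with the lines since \<open>L\<close>
  is simple. Hence the grading is fine and the group is universal. Finally an automorphism of the
  group that preserves the support \<open>{n = 0} \<union> {\<plusminus>e\<^sub>i} \<union> {\<plusminus>e\<^sub>1 \<plusminus> e\<^sub>2, k \<noteq> 0} \<union> {(1; 0; \<plusminus>2e\<^sub>i)}\<close> has a matrix of the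
  given shape.\<close>

section \<open>Eigenvectors, gradings and torus automorphisms\<close>

text \<open>No formula for the bracket of two elements of L1 is available: it is known only through
  the Jacobi identity, the action of L0, the irreducibility of L1 and the simplicity of L.
  Everything about it is extracted from the single value \<open>B hw lw\<close>, which is forced to
  be a nonzero multiple of \<open>dE\<close>; assertions about all of L1 are proved by exhibiting a
  submodule that contains one nonzero vector. For the same reason conjugations by matrices are
  recognized as automorphisms by matching them with torus automorphisms. The elements of L1 are
  sought as follows. If h in L1 has an integral adjoint action, then T = i^(ad h) satisfies Theta T
  = T^(-1) Theta, since Theta h = -h. If moreover T^2 = (-1)^(ad h) is conjugation by a known matrix
  g, then T shifts the Theta-degree exactly where that conjugation is -1. So an h is needed for g =
  \<open>gW sigma2\<close>, to shift by k_2, and one for g = \<open>dE\<close>, to shift by n_1.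
  Both come from an sl_2 computation in S^4 E, where E is one of three symplectic planes with tensor
  product F^8.\<close>

context vector_space
begin

text \<open>Induction on the number of summands: \<open>T - \<mu> s1\<close> removes the summand
  \<open>s1\<close> and rescales \<open>y s\<close> by a nonzero factor. The operator may depend on
  the pair of indices, because degrees with several coordinates are in general separated only pair
  by pair. \<open>V\<close> is the domain on which the operators are linear.\<close>

lemma eigen_components:
  assumes "finite S" and V: "subspace V" and W: "subspace W"
    and "\<And>s. s \<in> S \<Longrightarrow> y s \<in> V"
    and "\<And>s s'. s \<in> S \<Longrightarrow> s' \<in> S \<Longrightarrow> s \<noteq> s' \<Longrightarrow>
        \<exists>T \<mu>. T ` W \<subseteq> W \<and> (\<forall>u\<in>V. \<forall>v\<in>V. T (u + v) = T u + T v) \<and>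
              (\<forall>c. \<forall>u\<in>V. T (scale c u) = scale c (T u)) \<and>
              (\<forall>r\<in>S. T (y r) = scale (\<mu> r) (y r)) \<and> \<mu> s \<noteq> \<mu> s'"
    and "(\<Sum>s\<in>S. y s) \<in> W" and "s \<in> S"
  shows "y s \<in> W"
  using assms(1,4-)
proof (induction "card S" arbitrary: S y s rule: less_induct)
  case less
  show ?case
  proof (cases "S = {s}")
    case True
    then show ?thesis using less.prems by simp
  next
    case False
    then obtain s1 where s1: "s1 \<in> S" "s1 \<noteq> s" using less.prems by blast
    obtain T \<mu> where T: "T ` W \<subseteq> W" "\<And>u v. u \<in> V \<Longrightarrow> v \<in> V \<Longrightarrow> T (u + v) = T u + T v"
      "\<And>c u. u \<in> V \<Longrightarrow> T (scale c u) = scale c (T u)"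
      "\<And>r. r \<in> S \<Longrightarrow> T (y r) = scale (\<mu> r) (y r)" "\<mu> s \<noteq> \<mu> s1"
      using less.prems(3)[OF less.prems(5) s1(1)] s1(2) by metis
    have T0: "T 0 = 0"
      using T(3)[OF subspace_0[OF V], of 0] by simp
    have Tsum: "T (sum y R) = (\<Sum>r\<in>R. T (y r))" if "R \<subseteq> S" for R
      using finite_subset[OF that less.prems(1)] that
    proof (induction R rule: finite_induct)
      case empty
      then show ?case by (simp add: T0)
    next
      case (insert r R)
      then show ?case using less.prems(2) by (simp add: T(2) subspace_sum[OF V] subset_iff)
    qed
    define y' where "y' r = scale (\<mu> r - \<mu> s1) (y r)" for r
    have "(\<Sum>r\<in>S - {s1}. y' r) = (\<Sum>r\<in>S. y' r)"
      using less.prems(1) s1(1) by (simp add: sum.remove y'_def)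
    also have "\<dots> = (\<Sum>r\<in>S. T (y r)) - scale (\<mu> s1) (\<Sum>r\<in>S. y r)"
      by (simp add: y'_def T(4) scale_left_diff_distrib sum_subtractf scale_sum_right)
    also have "\<dots> = T (\<Sum>r\<in>S. y r) - scale (\<mu> s1) (\<Sum>r\<in>S. y r)"
      by (simp add: Tsum)
    also have "\<dots> \<in> W"
      using T(1) less.prems(4) by (intro subspace_diff[OF W] subspace_scale[OF W]) auto
    finally have sumW: "(\<Sum>r\<in>S - {s1}. y' r) \<in> W" .
    have "y' s \<in> W"
    proof (rule less.hyps[OF _ _ _ _ sumW])
      show "card (S - {s1}) < card S" using s1(1) less.prems(1) by (metis card_Diff1_less)
      show "finite (S - {s1})" using less.prems(1) by simp
      show "y' r \<in> V" if "r \<in> S - {s1}" for r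
        using that less.prems(2) by (auto simp: y'_def intro: subspace_scale[OF V])
      show "s \<in> S - {s1}" using s1 less.prems(5) by auto
      show "\<exists>T \<mu>. T ` W \<subseteq> W \<and> (\<forall>u\<in>V. \<forall>v\<in>V. T (u + v) = T u + T v) \<and>
              (\<forall>c. \<forall>u\<in>V. T (scale c u) = scale c (T u)) \<and>
              (\<forall>r\<in>S - {s1}. T (y' r) = scale (\<mu> r) (y' r)) \<and> \<mu> a \<noteq> \<mu> b"
        if "a \<in> S - {s1}" "b \<in> S - {s1}" "a \<noteq> b" for a b
      proof -
        obtain T \<mu> where T: "T ` W \<subseteq> W" "\<And>u v. u \<in> V \<Longrightarrow> v \<in> V \<Longrightarrow> T (u + v) = T u + T v"
          "\<And>c u. u \<in> V \<Longrightarrow> T (scale c u) = scale c (T u)"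
          "\<And>r. r \<in> S \<Longrightarrow> T (y r) = scale (\<mu> r) (y r)" "\<mu> a \<noteq> \<mu> b"
          using less.prems(3)[of a b] \<open>a \<in> S - {s1}\<close> \<open>b \<in> S - {s1}\<close> \<open>a \<noteq> b\<close> by auto metis
        then have "T (y' r) = scale (\<mu> r) (y' r)" if "r \<in> S" for r
          using that less.prems(2) by (simp add: y'_def mult.commute)
        then show ?thesis using T by blast
      qed
    qed
    then have "scale (inverse (\<mu> s - \<mu> s1)) (y' s) \<in> W" by (rule subspace_scale[OF W])
    then show ?thesis using T(5) by (simp add: y'_def)
  qed
qed

lemma span_Union_sum:
  assumes "\<And>i. subspace (A i)" and "z \<in> span (\<Union>i. A i)"
  obtains S y where "finite S" "\<And>i. y i \<in> A i" "z = sum y S" "\<And>i. i \<notin> S \<Longrightarrow> y i = 0"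
proof -
  have "\<exists>S y. finite S \<and> (\<forall>i. y i \<in> A i) \<and> z = sum y S \<and> (\<forall>i. i \<notin> S \<longrightarrow> y i = 0)"
    using assms(2)
  proof (induction rule: span_induct_alt)
    case base
    then show ?case using assms(1) subspace_0
      by (intro exI[of _ "{}"] exI[of _ "\<lambda>_. 0"]) auto
  next
    case (step c x z)
    then obtain i S y where *: "x \<in> A i" "finite S" "\<forall>i. y i \<in> A i" "z = sum y S"
      "\<forall>i. i \<notin> S \<longrightarrow> y i = 0" by auto
    define y' where "y' = y(i := scale c x + y i)"
    have "sum y (insert i S) = sum y S"
      using * by (cases "i \<in> S") (auto simp: insert_absorb)
    moreover have "sum y' (insert i S - {i}) = sum y (insert i S - {i})"
      by (intro sum.cong) (auto simp: y'_def)
    ultimately have "sum y' (insert i S) = scale c x + z"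
      using *(2,4) by (simp add: sum.remove[of "insert i S" i] y'_def algebra_simps)
    moreover have "\<forall>j. y' j \<in> A j"
      using * by (auto simp: y'_def intro: subspace_add[OF assms(1)] subspace_scale[OF assms(1)])
    ultimately show ?case
      using * by (intro exI[of _ "insert i S"] exI[of _ y']) (auto simp: y'_def)
  qed
  then show ?thesis using that by blast
qed

lemma ex1_decomposition:
  assumes sub: "\<And>i. subspace (A i)" and z: "z \<in> span (\<Union>i. A i)"
    and indep: "\<And>S y i. finite S \<Longrightarrow> (\<And>i. y i \<in> A i) \<Longrightarrow> sum y S = 0 \<Longrightarrow> i \<in> S \<Longrightarrow> y i = 0"
  shows "\<exists>!y. (\<forall>g. y g \<in> A g) \<and> finite {g. y g \<noteq> 0} \<and> z = (\<Sum>g | y g \<noteq> 0. y g)"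
proof -
  obtain S y where y: "finite S" "\<And>i. y i \<in> A i" "z = sum y S" "\<And>i. i \<notin> S \<Longrightarrow> y i = 0"
    using span_Union_sum[OF sub z] by metis
  show ?thesis
  proof (rule ex1I[of _ y])
    have "{g. y g \<noteq> 0} \<subseteq> S" using y(4) by auto
    then show "(\<forall>g. y g \<in> A g) \<and> finite {g. y g \<noteq> 0} \<and> z = (\<Sum>g | y g \<noteq> 0. y g)"
      using y by (auto intro: finite_subset intro!: sum.mono_neutral_right)
  next
    fix x assume x: "(\<forall>g. x g \<in> A g) \<and> finite {g. x g \<noteq> 0} \<and> z = (\<Sum>g | x g \<noteq> 0. x g)"
    let ?R = "S \<union> {g. x g \<noteq> 0}"
    have "sum x ?R = (\<Sum>g | x g \<noteq> 0. x g)"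
      using x y(1) by (intro sum.mono_neutral_right) auto
    moreover have "sum y ?R = sum y S" using x y(1,4) by (intro sum.mono_neutral_right) auto
    ultimately have 0: "(\<Sum>i\<in>?R. x i - y i) = 0" using x y(3) by (simp add: sum_subtractf)
    have "x i - y i = 0" if "i \<in> ?R" for i
      by (rule indep[OF _ _ 0 that]) (use x y in \<open>auto intro: subspace_diff[OF sub]\<close>)
    moreover have "x i - y i = 0" if "i \<notin> ?R" for i using that y(4) by auto
    ultimately show "x = y" by fastforce
  qed
qed

end

section \<open>Calculus in a Lie algebra and in its gradings\<close>

locale lie = vector_space sc for sc :: "'k::field_char_0 \<Rightarrow> 'v::ab_group_add \<Rightarrow> 'v" +
  fixes L :: "'v set" and br :: "'v \<Rightarrow> 'v \<Rightarrow> 'v"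
  assumes lie_algebra: "lie_algebra sc L br"
begin

lemma sub_L: "subspace L"
  and br_L [intro]: "x \<in> L \<Longrightarrow> y \<in> L \<Longrightarrow> br x y \<in> L"
  and br_add_left: "x \<in> L \<Longrightarrow> y \<in> L \<Longrightarrow> z \<in> L \<Longrightarrow> br (x + y) z = br x z + br y z"
  and br_add_right: "x \<in> L \<Longrightarrow> y \<in> L \<Longrightarrow> z \<in> L \<Longrightarrow> br z (x + y) = br z x + br z y"
  and br_sc_left: "x \<in> L \<Longrightarrow> y \<in> L \<Longrightarrow> br (sc c x) y = sc c (br x y)"
  and br_sc_right: "x \<in> L \<Longrightarrow> y \<in> L \<Longrightarrow> br x (sc c y) = sc c (br x y)"
  and br_self: "x \<in> L \<Longrightarrow> br x x = 0"
  and jacobi: "x \<in> L \<Longrightarrow> y \<in> L \<Longrightarrow> z \<in> L \<Longrightarrow> br x (br y z) + br y (br z x) + br z (br x y) = 0"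
  using lie_algebra unfolding lie_algebra_def by auto

lemma L_0 [simp]: "0 \<in> L" and L_add [intro]: "x \<in> L \<Longrightarrow> y \<in> L \<Longrightarrow> x + y \<in> L"
  and L_sc [intro]: "x \<in> L \<Longrightarrow> sc c x \<in> L" and L_diff [intro]: "x \<in> L \<Longrightarrow> y \<in> L \<Longrightarrow> x - y \<in> L"
  and L_neg [intro]: "x \<in> L \<Longrightarrow> - x \<in> L"
  using sub_L by (auto intro: subspace_0 subspace_add subspace_scale subspace_diff subspace_neg)

lemma br_skew: assumes "x \<in> L" "y \<in> L" shows "br y x = - br x y"
proof -
  have "br (x + y) (x + y) = br y x + br x y"
    using assms by (subst br_add_left) (auto simp: br_add_right br_self)
  then have "br y x + br x y = 0" using br_self[OF L_add[OF assms]] by simp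
  then show ?thesis by (simp add: eq_neg_iff_add_eq_0)
qed

lemma br_0_left [simp]: "x \<in> L \<Longrightarrow> br 0 x = 0" and br_0_right [simp]: "x \<in> L \<Longrightarrow> br x 0 = 0"
  using br_sc_left[of 0 x 0] br_sc_right[of x 0 0] by auto

lemma br_neg_left: "x \<in> L \<Longrightarrow> y \<in> L \<Longrightarrow> br (- x) y = - br x y"
  and br_neg_right: "x \<in> L \<Longrightarrow> y \<in> L \<Longrightarrow> br x (- y) = - br x y"
  using br_sc_left[of x y "-1"] br_sc_right[of x y "-1"] by auto

lemma br_diff_right: "x \<in> L \<Longrightarrow> y \<in> L \<Longrightarrow> z \<in> L \<Longrightarrow> br z (x - y) = br z x - br z y"
  using br_add_right[of x "- y" z] by (auto simp: br_neg_right L_neg)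

lemma jacobi':
  assumes "x \<in> L" "y \<in> L" "z \<in> L"
  shows "br x (br y z) = br (br x y) z + br y (br x z)"
proof -
  have "br y (br z x) = - br y (br x z)"
    using assms by (subst br_skew[of x z]) (auto simp: br_neg_right br_L)
  moreover have "br z (br x y) = - br (br x y) z"
    using assms by (subst br_skew[of "br x y" z]) (auto simp: br_L)
  ultimately show ?thesis using jacobi[OF assms] by (simp add: algebra_simps)
qed

definition linear_on_L :: "('v \<Rightarrow> 'v) \<Rightarrow> bool" where
  "linear_on_L f \<longleftrightarrow> (\<forall>x\<in>L. \<forall>y\<in>L. f (x + y) = f x + f y) \<and> (\<forall>c. \<forall>x\<in>L. f (sc c x) = sc c (f x))"

lemma linear_on_L_ad: "h \<in> L \<Longrightarrow> linear_on_L (br h)"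
  by (auto simp: linear_on_L_def br_add_right br_sc_right)

lemma linear_on_L_0: "linear_on_L f \<Longrightarrow> f 0 = 0"
  unfolding linear_on_L_def by (metis L_0 scale_zero_left)

lemma linear_on_L_sum:
  assumes "linear_on_L f" "\<And>s. s \<in> S \<Longrightarrow> y s \<in> L"
  shows "f (sum y S) = (\<Sum>s\<in>S. f (y s))"
  using assms(2)
proof (induction S rule: infinite_finite_induct)
  case (insert s S)
  then show ?case using assms(1) subspace_sum[OF sub_L, of S y] by (simp add: linear_on_L_def)
qed (use assms linear_on_L_0 in auto)

lemma linear_on_L_eqI:
  assumes "linear_on_L f" "linear_on_L g" and "B \<subseteq> L" "L \<subseteq> span B"
    and "\<And>x. x \<in> B \<Longrightarrow> f x = g x" and "z \<in> L"
  shows "f z = g z"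
proof -
  have "span B \<subseteq> {x \<in> L. f x = g x}"
  proof (rule span_minimal)
    show "subspace {x \<in> L. f x = g x}"
      using assms(1,2) linear_on_L_0[OF assms(1)] linear_on_L_0[OF assms(2)]
      by (intro subspaceI) (auto simp: linear_on_L_def)
  qed (use assms sub_L in auto)
  then show ?thesis using assms by auto
qed

lemma lie_autsD:
  assumes "f \<in> lie_auts sc L br"
  shows "linear_on_L f" "x \<in> L \<Longrightarrow> f x \<in> L" "x \<in> L \<Longrightarrow> y \<in> L \<Longrightarrow> f (br x y) = br (f x) (f y)"
    "inj_on f L" "f ` L = L"
  using assms by (auto simp: lie_auts_def Bij_def bij_betw_def linear_on_L_def)

lemma lie_autsI:
  assumes "linear_on_L f" "\<And>x. x \<in> L \<Longrightarrow> f x \<in> L" "\<And>x. x \<in> L \<Longrightarrow> f' x \<in> L"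
    and "\<And>x. x \<in> L \<Longrightarrow> f' (f x) = x" "\<And>x. x \<in> L \<Longrightarrow> f (f' x) = x"
    and "\<And>x y. x \<in> L \<Longrightarrow> y \<in> L \<Longrightarrow> f (br x y) = br (f x) (f y)"
  shows "restrict f L \<in> lie_auts sc L br"
proof -
  have "bij_betw (restrict f L) L L"
    by (intro bij_betwI[where g = f']) (use assms in auto)
  then show ?thesis
    using assms by (auto simp: lie_auts_def Bij_def linear_on_L_def br_L L_add L_sc)
qed

lemma gradingD:
  assumes "grading sc L br A"
  shows "subspace (A g)" "A g \<subseteq> L" "x \<in> A g \<Longrightarrow> y \<in> A h \<Longrightarrow> br x y \<in> A (g + h)"
    "x \<in> L \<Longrightarrow> \<exists>!y. (\<forall>g. y g \<in> A g) \<and> finite {g. y g \<noteq> 0} \<and> x = (\<Sum>g | y g \<noteq> 0. y g)"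
  using assms unfolding grading_def by auto

lemma grading_span:
  assumes "grading sc L br A"
  shows "L \<subseteq> span (\<Union>g. A g)"
proof
  fix x assume "x \<in> L"
  then obtain y where y: "\<And>g. y g \<in> A g" "x = (\<Sum>g | y g \<noteq> 0. y g)"
    using gradingD(4)[OF assms] by metis
  have "y g \<in> span (\<Union>g. A g)" for g using y(1) by (blast intro: span_base)
  then show "x \<in> span (\<Union>g. A g)" unfolding y(2) by (rule span_sum)
qed

lemma grading_indep:
  assumes "grading sc L br A" and "finite S" and y: "\<And>i. i \<in> S \<Longrightarrow> y i \<in> A i" and "sum y S = 0" "s \<in> S"
  shows "y s = 0"
proof -
  let ?P = "\<lambda>y. (\<forall>g. y g \<in> A g) \<and> finite {g. y g \<noteq> 0} \<and> 0 = (\<Sum>g | y g \<noteq> 0. y g)"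
  define x where "x i = (if i \<in> S then y i else 0)" for i
  have ex1: "\<exists>!y. ?P y" by (rule gradingD(4)[OF assms(1) L_0])
  have Px: "?P x"
  proof (intro conjI allI)
    show "x g \<in> A g" for g using y gradingD(1)[OF assms(1)] by (simp add: x_def subspace_0)
    have sub: "{g. x g \<noteq> 0} \<subseteq> S" by (auto simp: x_def)
    then show "finite {g. x g \<noteq> 0}" using assms(2) finite_subset by blast
    have "(\<Sum>g | x g \<noteq> 0. x g) = sum x S" using assms(2) sub by (intro sum.mono_neutral_left) auto
    also have "\<dots> = sum y S" by (simp add: x_def)
    finally show "0 = (\<Sum>g | x g \<noteq> 0. x g)" using assms(4) by simp
  qed
  have "?P (\<lambda>_. 0)" using gradingD(1)[OF assms(1)] by (simp add: subspace_0)
  from trans[OF the1_equality[of ?P x, OF ex1 Px, symmetric] the1_equality[of ?P, OF ex1 this]] have "x = (\<lambda>_. 0)" .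
  then show ?thesis using \<open>s \<in> S\<close> by (metis x_def)
qed

lemma grading_decomp:
  assumes "grading sc L br A" and "z \<in> L"
  obtains S y where "finite S" "\<And>i. y i \<in> A i" "z = sum y S" "\<And>i. i \<notin> S \<Longrightarrow> y i = 0"
proof -
  have "z \<in> span (\<Union>g. A g)" using grading_span[OF assms(1)] assms(2) by (rule subsetD)
  then show ?thesis by (rule span_Union_sum[OF gradingD(1)[OF assms(1)]]) (use that in blast)
qed

text \<open>A character of the grading group respects the bracket because degrees add. The auxiliary
  \<open>F\<close> accepts arbitrary functions on the group, so that the inverse map is
  \<open>F\<close> of the pointwise inverse; \<open>F_sum\<close> evaluates it on any finite sum of
  homogeneous elements of distinct degrees.\<close>

lemma character_aut:
  fixes A :: "'g::ab_group_add \<Rightarrow> 'v set"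
  assumes A: "grading sc L br A" and \<psi>: "\<And>g. \<psi> g \<noteq> 0" "\<And>g h. \<psi> (g + h) = \<psi> g * \<psi> h"
  shows "\<exists>f\<in>lie_auts sc L br. \<forall>g. \<forall>z\<in>A g. f z = sc (\<psi> g) z"
proof -
  define Y where "Y z = (THE y. (\<forall>g. y g \<in> A g) \<and> finite {g. y g \<noteq> 0} \<and> z = (\<Sum>g | y g \<noteq> 0. y g))" for z
  have Y: "(\<forall>g. Y z g \<in> A g) \<and> finite {g. Y z g \<noteq> 0} \<and> z = (\<Sum>g | Y z g \<noteq> 0. Y z g)"
    if "z \<in> L" for z
    unfolding Y_def by (rule theI'[OF gradingD(4)[OF A that]])
  have YL: "Y z g \<in> L" if "z \<in> L" for z g using Y[OF that] gradingD(2)[OF A] by blast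
  define F where "F \<psi> z = (\<Sum>g | Y z g \<noteq> 0. sc (\<psi> g) (Y z g))" for \<psi> :: "'g \<Rightarrow> 'k" and z
  have F_sum: "F \<psi> (sum y S) = (\<Sum>s\<in>S. sc (\<psi> s) (y s))"
    if S: "finite S" and y: "\<And>s. s \<in> S \<Longrightarrow> y s \<in> A s" for \<psi> :: "'g \<Rightarrow> 'k" and S y
  proof -
    define z where "z = sum y S"
    have zL: "z \<in> L" unfolding z_def using y gradingD(2)[OF A] by (intro subspace_sum[OF sub_L]) auto
    define x where "x i = (if i \<in> S then y i else 0)" for i
    let ?R = "S \<union> {g. Y z g \<noteq> 0}"
    have fin: "finite ?R" using Y[OF zL] S by auto
    have "sum x ?R = sum x S" using fin by (intro sum.mono_neutral_right) (auto simp: x_def)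
    then have "sum x ?R = z" by (simp add: x_def z_def)
    moreover have "sum (Y z) ?R = (\<Sum>g | Y z g \<noteq> 0. Y z g)"
      using fin by (intro sum.mono_neutral_right) auto
    then have "sum (Y z) ?R = z" using Y[OF zL] by simp
    ultimately have 0: "(\<Sum>i\<in>?R. x i - Y z i) = 0" by (simp add: sum_subtractf)
    have "x i - Y z i = 0" if "i \<in> ?R" for i
      by (rule grading_indep[OF A fin _ 0 that])
        (use y Y[OF zL] gradingD(1)[OF A] in \<open>auto simp: x_def intro: subspace_diff subspace_0 subspace_neg\<close>)
    then have eq: "x i = Y z i" if "i \<in> ?R" for i using that by fastforce
    have "F \<psi> z = (\<Sum>i\<in>?R. sc (\<psi> i) (Y z i))"
      unfolding F_def using fin by (intro sum.mono_neutral_left) auto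
    also have "\<dots> = (\<Sum>i\<in>?R. sc (\<psi> i) (x i))" using eq by (intro sum.cong) auto
    also have "\<dots> = (\<Sum>i\<in>S. sc (\<psi> i) (x i))"
      using fin by (intro sum.mono_neutral_right) (auto simp: x_def)
    finally show ?thesis by (simp add: x_def z_def)
  qed
  have F_A: "F \<psi> z = sc (\<psi> g) z" if "z \<in> A g" for \<psi> z g
    using F_sum[of "{g}" "\<lambda>_. z" \<psi>] that by simp
  have F_L: "F \<psi> z \<in> L" if "z \<in> L" for \<psi> z
    unfolding F_def using YL[OF that] by (auto intro!: subspace_sum[OF sub_L])
  have lin: "linear_on_L (F \<psi>)" for \<psi>
    unfolding linear_on_L_def
  proof (intro conjI ballI allI)
    fix x y assume xy: "x \<in> L" "y \<in> L"
    obtain S u where u: "finite S" "\<And>i. u i \<in> A i" "x = sum u S" "\<And>i. i \<notin> S \<Longrightarrow> u i = 0"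
      using grading_decomp[OF A xy(1)] by metis
    obtain R v where v: "finite R" "\<And>i. v i \<in> A i" "y = sum v R" "\<And>i. i \<notin> R \<Longrightarrow> v i = 0"
      using grading_decomp[OF A xy(2)] by metis
    have x: "x = sum u (S \<union> R)" and y: "y = sum v (S \<union> R)"
      using u v by (auto intro!: sum.mono_neutral_left)
    have xy': "x + y = (\<Sum>i\<in>S \<union> R. u i + v i)" using x y by (simp add: sum.distrib)
    have "F \<psi> (x + y) = (\<Sum>i\<in>S \<union> R. sc (\<psi> i) (u i + v i))"
      unfolding xy' by (rule F_sum) (use u v in \<open>auto intro: subspace_add[OF gradingD(1)[OF A]]\<close>)
    also have "\<dots> = (\<Sum>i\<in>S \<union> R. sc (\<psi> i) (u i)) + (\<Sum>i\<in>S \<union> R. sc (\<psi> i) (v i))"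
      by (simp add: scale_right_distrib sum.distrib)
    also have "(\<Sum>i\<in>S \<union> R. sc (\<psi> i) (u i)) = F \<psi> x"
      unfolding x by (rule F_sum[symmetric]) (use u v in auto)
    also have "(\<Sum>i\<in>S \<union> R. sc (\<psi> i) (v i)) = F \<psi> y"
      unfolding y by (rule F_sum[symmetric]) (use u v in auto)
    finally show "F \<psi> (x + y) = F \<psi> x + F \<psi> y" .
    show "F \<psi> (sc c x) = sc c (F \<psi> x)" for c
      unfolding u(3) scale_sum_right by (subst F_sum)
        (use u in \<open>auto simp: F_sum scale_sum_right mult.commute intro: subspace_scale[OF gradingD(1)[OF A]]\<close>)
  qed
  have UL: "(\<Union>g. A g) \<subseteq> L" using gradingD(2)[OF A] by auto
  note eqI = linear_on_L_eqI[OF _ _ UL grading_span[OF A]]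
  have inv: "F \<psi>1 (F \<psi>2 z) = z" if "z \<in> L" "\<And>g. \<psi>1 g * \<psi>2 g = 1" for \<psi>1 \<psi>2 z
  proof (rule eqI[of "\<lambda>z. F \<psi>1 (F \<psi>2 z)" "\<lambda>z. z"])
    show "linear_on_L (\<lambda>z. F \<psi>1 (F \<psi>2 z))"
      using lin[of \<psi>1] lin[of \<psi>2] F_L by (auto simp: linear_on_L_def)
    show "F \<psi>1 (F \<psi>2 x) = x" if "x \<in> (\<Union>g. A g)" for x
    proof -
      from that obtain g where g: "x \<in> A g" by auto
      have "sc (\<psi>2 g) x \<in> A g" using g gradingD(1)[OF A] by (simp add: subspace_scale)
      then show ?thesis using \<open>\<And>g. \<psi>1 g * \<psi>2 g = 1\<close> by (simp add: F_A[OF g] F_A)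
    qed
  qed (use that in \<open>auto simp: linear_on_L_def\<close>)
  have br: "F \<psi> (br x y) = br (F \<psi> x) (F \<psi> y)" if xy: "x \<in> L" "y \<in> L" for x y
  proof (rule eqI[of "\<lambda>x. F \<psi> (br x y)" "\<lambda>x. br (F \<psi> x) (F \<psi> y)"])
    show "linear_on_L (\<lambda>x. F \<psi> (br x y))" "linear_on_L (\<lambda>x. br (F \<psi> x) (F \<psi> y))"
      using lin[of \<psi>] xy F_L by (auto simp: linear_on_L_def br_add_left br_sc_left br_L)
    show "F \<psi> (br x y) = br (F \<psi> x) (F \<psi> y)" if "x \<in> (\<Union>g. A g)" for x
    proof (rule eqI[of "\<lambda>y. F \<psi> (br x y)" "\<lambda>y. br (F \<psi> x) (F \<psi> y)"])
      from that obtain g where g: "x \<in> A g" by auto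
      then have xL: "x \<in> L" using UL by auto
      show "linear_on_L (\<lambda>y. F \<psi> (br x y))" "linear_on_L (\<lambda>y. br (F \<psi> x) (F \<psi> y))"
        using lin[of \<psi>] xL F_L by (auto simp: linear_on_L_def br_add_right br_sc_right br_L)
      show "F \<psi> (br x y) = br (F \<psi> x) (F \<psi> y)" if "y \<in> (\<Union>g. A g)" for y
      proof -
        from that obtain h where h: "y \<in> A h" by auto
        then have "y \<in> L" using UL by auto
        then show ?thesis
          using xL by (simp add: F_A[OF gradingD(3)[OF A g h]] F_A[OF g] F_A[OF h] \<psi>(2)
              br_sc_left br_sc_right L_sc)
      qed
    qed (use xy in auto)
  qed (use xy in auto)
  have "restrict (F \<psi>) L \<in> lie_auts sc L br"
    by (rule lie_autsI[where f' = "F (\<lambda>g. inverse (\<psi> g))"]) (use lin F_L inv br \<psi>(1) in auto)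
  moreover have "restrict (F \<psi>) L z = sc (\<psi> g) z" if "z \<in> A g" for z g
    using that F_A[OF that] gradingD(2)[OF A, of g] by auto
  ultimately show ?thesis by blast
qed

section \<open>Elements with a diagonalizable adjoint action and integral eigenvalues\<close>

definition eig :: "'v \<Rightarrow> int \<Rightarrow> 'v set" where
  "eig h m = {z \<in> L. br h z = sc (of_int m) z}"

text \<open>Integral eigenvalues make the powers l^(ad h) meaningful for every nonzero scalar l.
  Asking the eigenspaces to span is enough for a grading by the integers, since eigenspaces are
  independent.\<close>

definition integral :: "'v \<Rightarrow> bool" where
  "integral h \<longleftrightarrow> h \<in> L \<and> L \<subseteq> span (\<Union>m. eig h m)"

lemma eig_L: "x \<in> eig h m \<Longrightarrow> x \<in> L" by (auto simp: eig_def)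

lemma subspace_eig: "h \<in> L \<Longrightarrow> subspace (eig h m)"
  by (rule subspaceI) (auto simp: eig_def br_add_right br_sc_right scale_right_distrib L_add L_sc mult.commute)

lemma eig_br:
  assumes "h \<in> L" "x \<in> eig h m" "y \<in> eig h n"
  shows "br x y \<in> eig h (m + n)"
  using assms jacobi'[of h x y] by (simp add: eig_def br_sc_left br_sc_right scale_left_distrib br_L)

lemma eig_components:
  assumes "h \<in> L" "subspace W" "br h ` W \<subseteq> W"
    and "finite S" "\<And>m. m \<in> S \<Longrightarrow> y m \<in> eig h m" "sum y S \<in> W" "m \<in> S"
  shows "y m \<in> W"
proof (rule eigen_components[OF assms(4) sub_L assms(2) _ _ assms(6,7)])
  show "y s \<in> L" if "s \<in> S" for s using assms(5)[OF that] by (auto simp: eig_def)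
  show "\<exists>T \<mu>. T ` W \<subseteq> W \<and> (\<forall>u\<in>L. \<forall>v\<in>L. T (u + v) = T u + T v) \<and>
      (\<forall>c. \<forall>u\<in>L. T (sc c u) = sc c (T u)) \<and> (\<forall>r\<in>S. T (y r) = sc (\<mu> r) (y r)) \<and> \<mu> s \<noteq> \<mu> s'"
    if "s \<in> S" "s' \<in> S" "s \<noteq> s'" for s s'
    by (rule exI[of _ "br h"], rule exI[of _ of_int])
      (use assms that in \<open>auto simp: br_add_right br_sc_right eig_def\<close>)
qed

lemma integral_grading: "integral h \<Longrightarrow> grading sc L br (eig h)"
  unfolding grading_def
proof (intro conjI allI ballI)
  assume h: "integral h"
  then have hL: "h \<in> L" by (simp add: integral_def)
  show "subspace (eig h g)" for g by (rule subspace_eig[OF hL])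
  show "eig h g \<subseteq> L" for g using eig_L by blast
  show "br x y \<in> eig h (m + n)" if "x \<in> eig h m" "y \<in> eig h n" for m n x y
    using eig_br[OF hL that] .
  show "\<exists>!y. (\<forall>g. y g \<in> eig h g) \<and> finite {g. y g \<noteq> 0} \<and> x = (\<Sum>g | y g \<noteq> 0. y g)" if "x \<in> L" for x
  proof (rule ex1_decomposition)
    show "subspace (eig h g)" for g by (rule subspace_eig[OF hL])
    show "x \<in> span (\<Union>m. eig h m)" using h that by (auto simp: integral_def)
    show "y i = 0" if "finite S" "\<And>i. y i \<in> eig h i" "sum y S = 0" "i \<in> S" for S y i
      using eig_components[OF hL subspace_single_0 _ that(1,2) _ that(4)] that(3) hL by auto
  qed
qed

lemma integral_decomp:
  assumes "integral h" "z \<in> L"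
  obtains S y where "finite S" "\<And>i. y i \<in> eig h i" "z = sum y S"
  using grading_decomp[OF integral_grading[OF assms(1)] assms(2)] by metis

lemma torus_aut:
  assumes "integral h" "l \<noteq> 0"
  shows "\<exists>f\<in>lie_auts sc L br. \<forall>m. \<forall>z\<in>eig h m. f z = sc (l powi m) z"
  by (rule character_aut[OF integral_grading[OF assms(1)]]) (use assms(2) in \<open>auto simp: power_int_add\<close>)

lemma integral_eqI:
  assumes "integral h" "linear_on_L f" "linear_on_L g" "\<And>m x. x \<in> eig h m \<Longrightarrow> f x = g x" "z \<in> L"
  shows "f z = g z"
  by (rule linear_on_L_eqI[OF assms(2,3), of "\<Union>m. eig h m"])
    (use assms(1,4,5) eig_L in \<open>auto simp: integral_def\<close>)

text \<open>\<open>ad h\<close> is a derivation, so its eigenvalues add under the bracket.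
  Integrality of \<open>h\<close> can therefore be tested on generators of the algebra.\<close>

lemma integral_span_subalgebra:
  assumes h: "h \<in> L" and "x \<in> span (\<Union>m. eig h m)" "y \<in> span (\<Union>m. eig h m)"
  shows "br x y \<in> span (\<Union>m. eig h m)"
proof -
  let ?M = "span (\<Union>m. eig h m)"
  have MsubL: "?M \<subseteq> L" by (rule span_minimal) (use eig_L sub_L in auto)
  have 1: "br x y \<in> ?M" if "x \<in> eig h m" "y \<in> ?M" for x y m
  proof -
    have xL: "x \<in> L" using that eig_L by auto
    have "?M \<subseteq> {y \<in> L. br x y \<in> ?M}"
    proof (rule span_minimal)
      show "(\<Union>m. eig h m) \<subseteq> {y \<in> L. br x y \<in> ?M}"
        using eig_br[OF h that(1)] eig_L by (auto intro!: span_base)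
      show "subspace {y \<in> L. br x y \<in> ?M}"
        by (rule subspaceI) (auto simp: xL br_add_right br_sc_right span_zero intro: span_add span_scale)
    qed
    then show ?thesis using that by auto
  qed
  have yL: "y \<in> L" using assms MsubL by auto
  have "?M \<subseteq> {x \<in> L. br x y \<in> ?M}"
  proof (rule span_minimal)
    show "(\<Union>m. eig h m) \<subseteq> {x \<in> L. br x y \<in> ?M}" using 1 assms(3) eig_L by auto
    show "subspace {x \<in> L. br x y \<in> ?M}"
      by (rule subspaceI) (auto simp: yL br_add_left br_sc_left span_zero intro: span_add span_scale)
  qed
  then show ?thesis using assms by auto
qed

text \<open>Simultaneous diagonalization: since \<open>h\<close> and \<open>h'\<close> commute,
  \<open>ad h'\<close> preserves each eigenspace of \<open>ad h\<close>, and the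
  \<open>h'\<close>-components of an eigenvector of \<open>h\<close> stay in its eigenspace.\<close>

lemma commuting_integral_span:
  assumes h: "integral h" and h': "integral h'" and 0: "br h h' = 0"
  shows "L \<subseteq> span (\<Union>m n. eig h m \<inter> eig h' n)"
proof -
  have hL: "h \<in> L" "h' \<in> L" using h h' by (auto simp: integral_def)
  have "z \<in> span (\<Union>m n. eig h m \<inter> eig h' n)" if z: "z \<in> eig h m" for m z
  proof -
    have zL: "z \<in> L" using z by (simp add: eig_def)
    obtain S y where y: "finite S" "\<And>i. y i \<in> eig h' i" "z = sum y S"
      using integral_decomp[OF h' zL] by metis
    have "y i \<in> eig h m" if "i \<in> S" for i
    proof (rule eig_components[OF hL(2) subspace_eig[OF hL(1)] _ y(1,2) _ that])
      show "br h' ` eig h m \<subseteq> eig h m"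
      proof safe
        fix x assume x: "x \<in> eig h m"
        then have "x \<in> L" by (simp add: eig_def)
        then show "br h' x \<in> eig h m"
          using x hL jacobi'[OF hL(1) hL(2) \<open>x \<in> L\<close>] 0 by (auto simp: eig_def br_sc_right)
      qed
    qed (use y z in auto)
    then have "y i \<in> span (\<Union>m n. eig h m \<inter> eig h' n)" if "i \<in> S" for i
      using that y(2)[of i] by (blast intro: span_base)
    then show ?thesis unfolding y(3) by (intro span_sum)
  qed
  then have "span (\<Union>m. eig h m) \<subseteq> span (\<Union>m n. eig h m \<inter> eig h' n)"
    by (intro span_minimal) auto
  then show ?thesis using h by (auto simp: integral_def)
qed

lemma eig_add: "h \<in> L \<Longrightarrow> h' \<in> L \<Longrightarrow> z \<in> eig h m \<Longrightarrow> z \<in> eig h' n \<Longrightarrow> z \<in> eig (h + h') (m + n)"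
  by (auto simp: eig_def br_add_left scale_left_distrib)

lemma integral_add:
  assumes h: "integral h" and h': "integral h'" and 0: "br h h' = 0"
  shows "integral (h + h')"
proof -
  have hL: "h \<in> L" "h' \<in> L" using h h' by (auto simp: integral_def)
  have "(\<Union>m n. eig h m \<inter> eig h' n) \<subseteq> (\<Union>m. eig (h + h') m)" using eig_add[OF hL] by blast
  then have "span (\<Union>m n. eig h m \<inter> eig h' n) \<subseteq> span (\<Union>m. eig (h + h') m)" by (rule span_mono)
  then show ?thesis using commuting_integral_span[OF assms] hL by (auto simp: integral_def)
qed

lemma eig_sc: "h \<in> L \<Longrightarrow> z \<in> eig h m \<Longrightarrow> z \<in> eig (sc (of_int c) h) (c * m)"
  by (auto simp: eig_def br_sc_left)

text \<open>The vectors z + [h, z] / m and z - [h, z] / m are eigenvectors. The Jacobi identity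
  delivers formulas for squares of \<open>ad h\<close>; this lemma turns them into integral
  eigenvalues.\<close>

lemma square_eig_span:
  assumes h: "h \<in> L" and z: "z \<in> L" and 2: "br h (br h z) = sc (of_int m ^ 2) z" and "m \<noteq> 0"
  shows "\<exists>u v. u \<in> eig h m \<and> v \<in> eig h (- m) \<and> z = u + v"
proof (intro exI conjI)
  let ?c = "inverse (2 * of_int m) :: 'k"
  let ?u = "sc (1 / 2) z + sc ?c (br h z)" and ?v = "sc (1 / 2) z - sc ?c (br h z)"
  have "br h ?u = sc (1 / 2) (br h z) + sc (?c * of_int m ^ 2) z"
    "br h ?v = sc (1 / 2) (br h z) - sc (?c * of_int m ^ 2) z"
    using h z 2 by (simp_all add: br_add_right br_diff_right br_sc_right L_sc br_L)
  moreover have "?c * of_int m ^ 2 = of_int m / 2" "of_int m * ?c = 1 / 2"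
    using \<open>m \<noteq> 0\<close> by (simp_all add: power2_eq_square field_simps)
  ultimately show "?u \<in> eig h m" "?v \<in> eig h (- m)"
    using h z by (auto simp: eig_def scale_right_distrib scale_right_diff_distrib br_L L_add L_diff L_sc algebra_simps)
  show "z = ?u + ?v" by (simp flip: scale_left_distrib)
qed

lemma integral_sc:
  assumes "integral h"
  shows "integral (sc (of_int c) h)"
proof -
  have h: "h \<in> L" using assms by (simp add: integral_def)
  have "eig h m \<subseteq> eig (sc (of_int c) h) (c * m)" for m
    using h by (auto simp: eig_def br_sc_left)
  then have "(\<Union>m. eig h m) \<subseteq> (\<Union>m. eig (sc (of_int c) h) m)" by blast
  then have "span (\<Union>m. eig h m) \<subseteq> span (\<Union>m. eig (sc (of_int c) h) m)" by (rule span_mono)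
  then show ?thesis using assms h by (auto simp: integral_def)
qed

lemma eig_image:
  assumes "f \<in> lie_auts sc L br" "h \<in> L" "z \<in> eig h m"
  shows "f z \<in> eig (f h) m"
  using assms lie_autsD[OF assms(1)] by (auto simp: eig_def linear_on_L_def) metis

lemma integral_image:
  assumes f: "f \<in> lie_auts sc L br" and h: "integral h"
  shows "integral (f h)"
proof -
  note fD = lie_autsD[OF f]
  have hL: "h \<in> L" using h by (simp add: integral_def)
  have "z \<in> span (\<Union>m. eig (f h) m)" if z: "z \<in> L" for z
  proof -
    obtain x where x: "x \<in> L" "z = f x" using fD(5) z by auto
    obtain S y where y: "finite S" "\<And>i. y i \<in> eig h i" "x = sum y S"
      using integral_decomp[OF h x(1)] by metis
    have "z = (\<Sum>i\<in>S. f (y i))"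
      unfolding x(2) y(3) by (rule linear_on_L_sum[OF fD(1)]) (use y(2) eig_L in auto)
    moreover have "f (y i) \<in> span (\<Union>m. eig (f h) m)" for i
      using eig_image[OF f hL y(2)] by (blast intro: span_base)
    ultimately show ?thesis by (simp add: span_sum)
  qed
  then show ?thesis using fD(2)[OF hL] by (auto simp: integral_def)
qed

end

section \<open>The Weyl group as a group of automorphisms of the universal group\<close>

context lie
begin

lemma lie_auts_inv:
  assumes "f \<in> lie_auts sc L br"
  shows "restrict (inv_into L f) L \<in> lie_auts sc L br"
proof -
  note fD = lie_autsD[OF assms]
  have 1: "inv_into L f x \<in> L" "f (inv_into L f x) = x" if "x \<in> L" for x
    using that fD(5) by (auto intro: inv_into_into f_inv_into_f)
  have 2: "inv_into L f (f x) = x" if "x \<in> L" for x using fD(4) that by simp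
  have lin: "inv_into L f (x + y) = inv_into L f x + inv_into L f y"
    "inv_into L f (sc c x) = sc c (inv_into L f x)"
    "inv_into L f (br x y) = br (inv_into L f x) (inv_into L f y)" if "x \<in> L" "y \<in> L" for x y c
  proof -
    have "f (inv_into L f x + inv_into L f y) = x + y" "f (sc c (inv_into L f x)) = sc c x"
      "f (br (inv_into L f x) (inv_into L f y)) = br x y"
      using 1 that fD(1,3) by (auto simp: linear_on_L_def)
    then show "inv_into L f (x + y) = inv_into L f x + inv_into L f y"
      "inv_into L f (sc c x) = sc c (inv_into L f x)"
      "inv_into L f (br x y) = br (inv_into L f x) (inv_into L f y)"
      using 1 2 that by (metis L_add, metis L_sc, metis br_L)
  qed
  show ?thesis
    by (rule lie_autsI[where f' = f]) (use 1 2 lin fD(2) in \<open>auto simp: linear_on_L_def\<close>)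
qed

lemma lie_auts_comp:
  assumes "f \<in> lie_auts sc L br" "g \<in> lie_auts sc L br"
  shows "compose L f g \<in> lie_auts sc L br"
  using assms compose_Bij[of f L g] Bij_imp_funcset[of g L]
  by (auto simp: lie_auts_def compose_def L_add L_sc br_L Pi_iff)

lemma lie_auts_id: "(\<lambda>x\<in>L. x) \<in> lie_auts sc L br"
  by (auto simp: lie_auts_def id_Bij L_add L_sc br_L)

lemma subspace_image:
  assumes "f \<in> lie_auts sc L br" "subspace V" "V \<subseteq> L"
  shows "subspace (f ` V)"
proof (rule subspaceI)
  note lin = lie_autsD(1)[OF assms(1)]
  show "0 \<in> f ` V" using linear_on_L_0[OF lin] subspace_0[OF assms(2)] by force
  show "x + y \<in> f ` V" if xy: "x \<in> f ` V" "y \<in> f ` V" for x y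
  proof -
    obtain u v where "u \<in> V" "v \<in> V" "x = f u" "y = f v" using xy by auto
    then show ?thesis using lin assms(2,3)
      by (intro image_eqI[of _ _ "u + v"]) (auto simp: linear_on_L_def subspace_add subset_iff)
  qed
  show "sc c x \<in> f ` V" if x: "x \<in> f ` V" for c x
  proof -
    obtain u where "u \<in> V" "x = f u" using x by auto
    then show ?thesis using lin assms(2,3)
      by (intro image_eqI[of _ _ "sc c u"]) (auto simp: linear_on_L_def subspace_scale subset_iff)
  qed
qed

lemma image_inv_cancel:
  assumes "f \<in> lie_auts sc L br" "V \<subseteq> L"
  shows "f ` restrict (inv_into L f) L ` V = V" "restrict (inv_into L f) L ` f ` V = V"
proof -
  note fD = lie_autsD[OF assms(1)]
  have "f (restrict (inv_into L f) L x) = x" if "x \<in> V" for x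
  proof -
    have "x \<in> L" using that assms(2) by blast
    moreover have "x \<in> f ` L" unfolding fD(5) by fact
    ultimately show ?thesis by (simp only: f_inv_into_f restrict_apply if_True)
  qed
  from image_cong[OF refl[of V] this] show "f ` restrict (inv_into L f) L ` V = V" by (simp only: image_image image_ident)
  have "restrict (inv_into L f) L (f x) = x" if "x \<in> V" for x
    using that assms(2) fD(2,4) by auto
  from image_cong[OF refl[of V] this] show "restrict (inv_into L f) L ` f ` V = V" by (simp only: image_image image_ident)
qed

lemma image_eq_0_iff:
  assumes "f \<in> lie_auts sc L br" "subspace V" "V \<subseteq> L"
  shows "f ` V = {0} \<longleftrightarrow> V = {0}"
proof
  assume 0: "f ` V = {0}"
  have "V = restrict (inv_into L f) L ` f ` V" using image_inv_cancel(2)[OF assms(1,3)] by simp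
  also have "\<dots> = {0}" unfolding 0 using linear_on_L_0[OF lie_autsD(1)[OF lie_auts_inv[OF assms(1)]]] by simp
  finally show "V = {0}" .
qed (use linear_on_L_0[OF lie_autsD(1)[OF assms(1)]] in simp)

lemma grading_image:
  assumes A: "grading sc L br A" and f: "f \<in> lie_auts sc L br"
  shows "grading sc L br (\<lambda>g. f ` A g)"
  unfolding grading_def
proof (intro conjI allI ballI)
  note fD = lie_autsD[OF f] and AL = gradingD(2)[OF A]
  show "subspace (f ` A g)" for g by (rule subspace_image[OF f gradingD(1,2)[OF A]])
  show "f ` A g \<subseteq> L" for g using AL fD(2) by blast
  show "br x y \<in> f ` A (g + h)" if xy: "x \<in> f ` A g" "y \<in> f ` A h" for g h x y
  proof -
    obtain u v where uv: "u \<in> A g" "v \<in> A h" "x = f u" "y = f v" using xy by auto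
    then have "f (br u v) = br x y" using fD(3) AL by blast
    then show ?thesis using gradingD(3)[OF A uv(1,2)] by (metis imageI)
  qed
  show "\<exists>!y. (\<forall>g. y g \<in> f ` A g) \<and> finite {g. y g \<noteq> 0} \<and> x = (\<Sum>g | y g \<noteq> 0. y g)"
    if xL: "x \<in> L" for x
  proof (rule ex1_decomposition)
    show "subspace (f ` A g)" for g by (rule subspace_image[OF f gradingD(1,2)[OF A]])
    obtain u where u: "u \<in> L" "x = f u" using fD(5) xL by auto
    obtain S y where y: "finite S" "\<And>i. y i \<in> A i" "u = sum y S"
      using grading_decomp[OF A u(1)] by metis
    have "x = (\<Sum>i\<in>S. f (y i))" unfolding u(2) y(3)
      by (rule linear_on_L_sum[OF fD(1)]) (use y(2) AL in auto)
    moreover have "f (y i) \<in> span (\<Union>g. f ` A g)" for i using y(2) by (blast intro: span_base)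
    ultimately show "x \<in> span (\<Union>g. f ` A g)" by (simp add: span_sum)
    show "y i = 0" if y: "finite S" "\<And>i. y i \<in> f ` A i" "sum y S = 0" "i \<in> S" for S y i
    proof -
      obtain v where v: "\<And>i. v i \<in> A i" "\<And>i. y i = f (v i)" using y(2) unfolding image_iff by metis
      have vL: "v i \<in> L" for i using v(1) AL by blast
      have "f (sum v S) = sum y S" by (simp add: linear_on_L_sum[OF fD(1) vL] v(2))
      then have "f (sum v S) = f 0" using y(3) linear_on_L_0[OF fD(1)] by simp
      moreover have "sum v S \<in> L" using vL by (intro subspace_sum[OF sub_L]) auto
      ultimately have "sum v S = 0" using fD(4) L_0 by (meson inj_onD)
      then have "v i = 0" using grading_indep[OF A y(1)] v(1) y(4) by metis
      then show ?thesis using v(2) linear_on_L_0[OF fD(1)] by simp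
    qed
  qed
qed

lemma grading_inj:
  assumes A: "grading sc L br A" and "g \<in> supp A" "A g \<subseteq> A h"
  shows "g = h"
proof (rule ccontr)
  assume "g \<noteq> h"
  obtain x where x: "x \<in> A g" "x \<noteq> 0"
    using assms(2) gradingD(1)[OF A, of g] by (auto simp: supp_def dest: subspace_0)
  define y where "y i = (if i = g then x else - x)" for i
  have "y i \<in> A i" if "i \<in> {g, h}" for i
    using that x assms(3) subspace_neg[OF gradingD(1)[OF A, of h]] by (auto simp: y_def)
  moreover have "sum y {g, h} = 0" using \<open>g \<noteq> h\<close> by (simp add: y_def)
  ultimately have "y g = 0" using grading_indep[OF A, of "{g, h}" y g] by blast
  then show False using x by (simp add: y_def)
qed

lemma bij_comps_iff:
  assumes A: "grading sc L br A" and f: "f \<in> lie_auts sc L br"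
  shows "bij_betw (\<lambda>V. f ` V) (comps A) (comps A) \<longleftrightarrow> (\<lambda>V. f ` V) ` comps A = comps A"
proof -
  have "V \<subseteq> L" if "V \<in> comps A" for V using that gradingD(2)[OF A] by (auto simp: comps_def)
  then have "inj_on (\<lambda>V. f ` V) (comps A)"
    using image_inv_cancel(2)[OF f] by (metis inj_onI)
  then show ?thesis by (simp add: bij_betw_def)
qed

lemma comps_image:
  assumes A: "grading sc L br A" and f: "f \<in> lie_auts sc L br"
  shows "supp (\<lambda>g. f ` A g) = supp A" "comps (\<lambda>g. f ` A g) = (\<lambda>V. f ` V) ` comps A"
proof -
  show 1: "supp (\<lambda>g. f ` A g) = supp A"
    using image_eq_0_iff[OF f gradingD(1,2)[OF A]] by (auto simp: supp_def)
  show "comps (\<lambda>g. f ` A g) = (\<lambda>V. f ` V) ` comps A" unfolding comps_def 1 by auto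
qed

lemma subgroup_grading_auts:
  assumes A: "grading sc L br A"
  shows "subgroup (grading_auts sc L br A) (BijGroup L)"
proof (rule group.subgroupI[OF group_BijGroup])
  have Bij: "f \<in> Bij L" if "f \<in> grading_auts sc L br A" for f
    using that by (auto simp: grading_auts_def lie_auts_def)
  then show "grading_auts sc L br A \<subseteq> carrier (BijGroup L)" by (auto simp: BijGroup_def)
  have CL: "V \<subseteq> L" if "V \<in> comps A" for V using that gradingD(2)[OF A] by (auto simp: comps_def)
  have "(\<lambda>V. (\<lambda>x\<in>L. x) ` V) ` comps A = comps A"
  proof -
    have "(\<lambda>x\<in>L. x) ` V = V" if "V \<in> comps A" for V using CL[OF that] by force
    then show ?thesis by simp
  qed
  then have "(\<lambda>x\<in>L. x) \<in> grading_auts sc L br A"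
    by (simp add: grading_auts_def lie_auts_id bij_comps_iff[OF A])
  then show "grading_auts sc L br A \<noteq> {}" by auto
  show "m_inv (BijGroup L) f \<in> grading_auts sc L br A" if f: "f \<in> grading_auts sc L br A" for f
  proof -
    have f': "f \<in> lie_auts sc L br" and comps: "(\<lambda>V. f ` V) ` comps A = comps A"
      using f bij_comps_iff[OF A] by (auto simp: grading_auts_def)
    have "(\<lambda>V. restrict (inv_into L f) L ` V) ` comps A
        = (\<lambda>V. restrict (inv_into L f) L ` V) ` (\<lambda>V. f ` V) ` comps A" by (simp only: comps)
    also have "\<dots> = (\<lambda>V. restrict (inv_into L f) L ` f ` V) ` comps A" by (rule image_image)
    also have "\<dots> = comps A" using image_inv_cancel(2)[OF f' CL] by simp
    finally show ?thesis
      unfolding inv_BijGroup[OF Bij[OF f]] grading_auts_def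
      using lie_auts_inv[OF f'] bij_comps_iff[OF A lie_auts_inv[OF f']] by blast
  qed
  show "f \<otimes>\<^bsub>BijGroup L\<^esub> g \<in> grading_auts sc L br A"
    if f: "f \<in> grading_auts sc L br A" and g: "g \<in> grading_auts sc L br A" for f g
  proof -
    have f': "f \<in> lie_auts sc L br" "(\<lambda>V. f ` V) ` comps A = comps A"
      and g': "g \<in> lie_auts sc L br" "(\<lambda>V. g ` V) ` comps A = comps A"
      using f g bij_comps_iff[OF A] by (auto simp: grading_auts_def)
    have "compose L f g ` V = f ` g ` V" if "V \<in> comps A" for V
      using CL[OF that] by (force simp: compose_def)
    then have "(\<lambda>V. compose L f g ` V) ` comps A = (\<lambda>V. f ` V) ` (\<lambda>V. g ` V) ` comps A"
      by (simp add: image_image)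
    then have "(\<lambda>V. compose L f g ` V) ` comps A = comps A" by (simp only: f' g')
    then show ?thesis
      using lie_auts_comp[OF f'(1) g'(1)] bij_comps_iff[OF A lie_auts_comp[OF f'(1) g'(1)]]
        Bij[OF f] Bij[OF g] by (simp add: grading_auts_def BijGroup_def)
  qed
qed

text \<open>Inclusions suffice because the sum of the components is direct: decompose a preimage of
  an element of \<open>A (\<alpha> s)\<close>, apply \<open>f\<close>, and compare degrees; only the
  summand of degree \<open>s\<close> can contribute.\<close>

lemma grading_autsI:
  fixes A :: "'g::ab_group_add \<Rightarrow> 'v set"
  assumes A: "grading sc L br A" and f: "f \<in> lie_auts sc L br" and "bij \<alpha>"
    and sub: "\<And>s. f ` A s \<subseteq> A (\<alpha> s)"
  shows "f \<in> grading_auts sc L br A" "induces A f \<alpha>"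
proof -
  note fD = lie_autsD[OF f]
  have inj: "\<alpha> s = \<alpha> t \<longleftrightarrow> s = t" for s t using \<open>bij \<alpha>\<close> by (auto simp: bij_def inj_eq)
  have eq: "f ` A s = A (\<alpha> s)" for s
  proof
    show "A (\<alpha> s) \<subseteq> f ` A s"
    proof
      fix z assume z: "z \<in> A (\<alpha> s)"
      then have "z \<in> L" using gradingD(2)[OF A] by blast
      then obtain u where u: "u \<in> L" "z = f u" using fD(5) by auto
      obtain S y where y: "finite S" "\<And>i. y i \<in> A i" "u = sum y S"
        "\<And>i. i \<notin> S \<Longrightarrow> y i = 0"
        using grading_decomp[OF A u(1)] by metis
      have yL: "y i \<in> L" for i using y(2) gradingD(2)[OF A] by blast
      let ?S = "insert s S"
      \<comment> \<open>The image under \<open>f\<close> of the decomposition of \<open>u\<close>,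
        relabelled by \<open>\<alpha>\<close>, with \<open>z\<close> subtracted in degree
        \<open>\<alpha> s\<close>: a homogeneous family with sum 0.\<close>
      define v where "v i = f (y (inv \<alpha> i)) - (if i = \<alpha> s then z else 0)" for i
      have [simp]: "inv \<alpha> (\<alpha> i) = i" for i using \<open>bij \<alpha>\<close> by (simp add: bij_def)
      have "sum v (\<alpha> ` ?S) = (\<Sum>i\<in>?S. f (y i) - (if i = s then z else 0))"
        by (subst sum.reindex) (auto simp: v_def inj inj_on_def)
      also have "\<dots> = f (sum y ?S) - z"
        using y(1) by (simp only: sum_subtractf linear_on_L_sum[OF fD(1) yL] sum.delta finite_insert) simp
      also have "sum y ?S = u" using y by (cases "s \<in> S") (auto simp: insert_absorb)
      finally have "sum v (\<alpha> ` ?S) = 0" using u by simp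
      moreover have "v i \<in> A i" if "i \<in> \<alpha> ` ?S" for i
      proof -
        obtain j where j: "i = \<alpha> j" using \<open>i \<in> \<alpha> ` ?S\<close> by auto
        then have "f (y j) \<in> A i" using sub y(2) by blast
        then show ?thesis
          using j z gradingD(1)[OF A] by (auto simp: v_def inj intro!: subspace_diff)
      qed
      ultimately have "v (\<alpha> s) = 0" using grading_indep[OF A, of "\<alpha> ` ?S" v] y(1) by blast
      then have "z = f (y s)" by (simp add: v_def)
      then show "z \<in> f ` A s" using y(2) by blast
    qed
  qed (rule sub)
  then show "induces A f \<alpha>" by (simp add: induces_def)
  have s: "\<alpha> s \<in> supp A \<longleftrightarrow> s \<in> supp A" for s
    using image_eq_0_iff[OF f gradingD(1,2)[OF A, of s]] eq[of s] by (simp add: supp_def)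
  have "\<alpha> ` supp A = supp A"
  proof
    show "supp A \<subseteq> \<alpha> ` supp A"
    proof
      fix t assume "t \<in> supp A"
      moreover obtain r where "t = \<alpha> r" using bij_is_surj[OF \<open>bij \<alpha>\<close>] by (rule surjE)
      ultimately show "t \<in> \<alpha> ` supp A" using s by simp
    qed
  qed (use s in auto)
  moreover have "(\<lambda>V. f ` V) ` comps A = A ` \<alpha> ` supp A"
    using eq by (auto simp: comps_def image_image)
  ultimately have "(\<lambda>V. f ` V) ` comps A = comps A" by (simp add: comps_def)
  then show "f \<in> grading_auts sc L br A" using f bij_comps_iff[OF A f] by (simp add: grading_auts_def)
qed

end

lemma AutoGroup_plus:
  "carrier (AutoGroup plus_group) = {\<alpha> :: 'g::ab_group_add \<Rightarrow> 'g. Modules.additive \<alpha> \<and> bij \<alpha>}"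
  "\<alpha> \<in> carrier (AutoGroup plus_group) \<Longrightarrow> \<beta> \<in> carrier (AutoGroup plus_group) \<Longrightarrow>
     \<alpha> \<otimes>\<^bsub>AutoGroup plus_group\<^esub> \<beta> = \<alpha> \<circ> \<beta>"
  "\<one>\<^bsub>AutoGroup (plus_group :: 'g monoid)\<^esub> = id"
  by (auto simp: AutoGroup_def auto_def plus_group_def hom_def Modules.additive_def Bij_def
      BijGroup_def compose_def)

lemma group_plus_group: "group (plus_group :: 'g::ab_group_add monoid)"
  by (rule groupI) (auto simp: plus_group_def algebra_simps intro: exI[of _ "- x" for x])

section \<open>From automorphisms of the algebra to automorphisms of the universal group\<close>

locale universal_grading = lie sc L br
  for sc :: "'k::field_char_0 \<Rightarrow> 'v::ab_group_add \<Rightarrow> 'v" and L br +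
  fixes A :: "'g::ab_group_add \<Rightarrow> 'v set"
  assumes universal: "graded_by_universal_group TYPE('g) sc L br A"
begin

lemma A: "grading sc L br A"
  using universal by (simp add: graded_by_universal_group_def)

abbreviation "Aut\<Gamma> \<equiv> grading_auts sc L br A"

lemma AutD: "f \<in> Aut\<Gamma> \<Longrightarrow> f \<in> lie_auts sc L br" by (simp add: grading_auts_def)

text \<open>The universal property is applied to the grading by the preimages of the
  \<open>A s\<close> under \<open>f\<close>, which has the same components as \<open>A\<close>. That
  the preimage of \<open>A (\<alpha> s)\<close> is \<open>A s\<close> says that \<open>f\<close>
  maps \<open>A s\<close> onto \<open>A (\<alpha> s)\<close>; with images in place of preimages one
  would obtain the inverse of \<open>\<alpha>\<close>.\<close>

lemma induced_ex1:
  assumes f: "f \<in> Aut\<Gamma>"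
  shows "\<exists>!\<alpha>. Modules.additive \<alpha> \<and> induces A f \<alpha>"
proof -
  let ?g = "restrict (inv_into L f) L"
  have f': "f \<in> lie_auts sc L br" using f by (rule AutD)
  have fB: "f \<in> Bij L" using f' by (simp add: lie_auts_def)
  have g: "?g \<in> Aut\<Gamma>"
    using subgroup.m_inv_closed[OF subgroup_grading_auts[OF A] f] by (simp add: inv_BijGroup[OF fB])
  have g': "?g \<in> lie_auts sc L br" using g by (rule AutD)
  have "comps (\<lambda>s. ?g ` A s) = comps A"
    using g comps_image(2)[OF A g'] bij_comps_iff[OF A g'] by (simp add: grading_auts_def)
  then have *: "\<exists>!\<phi>. Modules.additive \<phi> \<and> (\<forall>s\<in>supp A. ?g ` A (\<phi> s) = A s)"
    using universal grading_image[OF A g'] unfolding graded_by_universal_group_def by blast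
  have "?g ` A t = A s \<longleftrightarrow> f ` A s = A t" for s t
    using image_inv_cancel[OF f' gradingD(2)[OF A, of s]] image_inv_cancel[OF f' gradingD(2)[OF A, of t]]
    by metis
  then show ?thesis using * by (simp add: induces_def)
qed

definition alpha :: "('v \<Rightarrow> 'v) \<Rightarrow> 'g \<Rightarrow> 'g" where
  "alpha f = (THE \<alpha>. Modules.additive \<alpha> \<and> induces A f \<alpha>)"

lemma alpha: "f \<in> Aut\<Gamma> \<Longrightarrow> Modules.additive (alpha f)" "f \<in> Aut\<Gamma> \<Longrightarrow> induces A f (alpha f)"
  using theI'[OF induced_ex1] unfolding alpha_def by auto

lemma alpha_eqI: "f \<in> Aut\<Gamma> \<Longrightarrow> Modules.additive \<alpha> \<Longrightarrow> induces A f \<alpha> \<Longrightarrow> alpha f = \<alpha>"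
  using alpha[of f] induced_ex1[of f] by blast

lemma induces_supp:
  assumes "f \<in> Aut\<Gamma>" "induces A f \<alpha>" "s \<in> supp A"
  shows "\<alpha> s \<in> supp A"
  using assms image_eq_0_iff[OF AutD[OF assms(1)] gradingD(1,2)[OF A, of s]]
  by (auto simp: induces_def supp_def)

lemma compose_image: "g \<in> Aut\<Gamma> \<Longrightarrow> compose L f g ` A s = f ` g ` A s"
  using gradingD(2)[OF A, of s] by (auto simp: compose_def image_image subset_iff intro!: image_cong)

lemma mult_grading_aut_group:
  assumes "f \<in> Aut\<Gamma>" "g \<in> Aut\<Gamma>"
  shows "f \<otimes>\<^bsub>grading_aut_group sc L br A\<^esub> g = compose L f g"
  using AutD[OF assms(1)] AutD[OF assms(2)] by (simp add: grading_aut_group_def BijGroup_def lie_auts_def)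

lemma group_grading_aut_group: "group (grading_aut_group sc L br A)"
  unfolding grading_aut_group_def
  by (rule subgroup.subgroup_is_group[OF subgroup_grading_auts[OF A] group_BijGroup])

lemma carrier_grading_aut_group: "carrier (grading_aut_group sc L br A) = Aut\<Gamma>"
  by (simp add: grading_aut_group_def)

lemma compose_Aut: "f \<in> Aut\<Gamma> \<Longrightarrow> g \<in> Aut\<Gamma> \<Longrightarrow> compose L f g \<in> Aut\<Gamma>"
  using monoid.m_closed[OF group.is_monoid[OF group_grading_aut_group], of f g]
  by (simp add: mult_grading_aut_group carrier_grading_aut_group)

lemma induces_compose:
  assumes "g \<in> Aut\<Gamma>" "induces A f \<alpha>" "induces A g \<beta>"
  shows "induces A (compose L f g) (\<alpha> \<circ> \<beta>)"
  using assms induces_supp[OF assms(1,3)] by (simp add: induces_def compose_image)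

lemma additive_comp: "Modules.additive \<alpha> \<Longrightarrow> Modules.additive \<beta> \<Longrightarrow> Modules.additive (\<alpha> \<circ> \<beta>)"
  for \<alpha> \<beta> :: "'g \<Rightarrow> 'g"
  by (simp add: Modules.additive_def)

lemma alpha_compose:
  assumes "f \<in> Aut\<Gamma>" "g \<in> Aut\<Gamma>"
  shows "alpha (compose L f g) = alpha f \<circ> alpha g"
  using assms
  by (intro alpha_eqI compose_Aut additive_comp induces_compose alpha) auto

lemma id_Aut: "(\<lambda>x\<in>L. x) \<in> Aut\<Gamma>"
  using subgroup.one_closed[OF subgroup_grading_auts[OF A]] by (simp add: BijGroup_def)

lemma alpha_id: "alpha (\<lambda>x\<in>L. x) = id"
proof (rule alpha_eqI[OF id_Aut])
  show "induces A (\<lambda>x\<in>L. x) id" using gradingD(2)[OF A] by (force simp: induces_def)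
qed (simp add: Modules.additive_def)

lemma alpha_bij:
  assumes f: "f \<in> Aut\<Gamma>"
  shows "bij (alpha f)"
proof -
  let ?g = "restrict (inv_into L f) L"
  have fB: "f \<in> Bij L" using AutD[OF f] by (simp add: lie_auts_def)
  have g: "?g \<in> Aut\<Gamma>"
    using subgroup.m_inv_closed[OF subgroup_grading_auts[OF A] f] by (simp add: inv_BijGroup[OF fB])
  have "alpha ?g \<circ> alpha f = id"
    using alpha_compose[OF g f] alpha_id by (simp add: Bij_compose_restrict_eq[OF fB])
  moreover have "compose L f ?g = (\<lambda>x\<in>L. x)"
    using fB by (auto simp: compose_def Bij_def bij_betw_def f_inv_into_f fun_eq_iff)
  then have "alpha f \<circ> alpha ?g = id" using alpha_compose[OF f g] alpha_id by simp
  ultimately show ?thesis by (rule o_bij)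
qed

lemma induced_auts_eq: "induced_auts sc L br A = alpha ` Aut\<Gamma>"
proof -
  have "alpha f \<in> induced_auts sc L br A" if "f \<in> Aut\<Gamma>" for f
    using that alpha alpha_bij by (auto simp: induced_auts_def AutoGroup_plus)
  moreover have "\<alpha> \<in> alpha ` Aut\<Gamma>" if \<alpha>: "\<alpha> \<in> induced_auts sc L br A" for \<alpha>
  proof -
    obtain f where "f \<in> Aut\<Gamma>" "induces A f \<alpha>" "Modules.additive \<alpha>"
      using \<alpha> by (auto simp: induced_auts_def AutoGroup_plus)
    then show ?thesis using alpha_eqI[of f \<alpha>] by blast
  qed
  ultimately show ?thesis by blast
qed

abbreviation "W_aut \<equiv> AutoGroup plus_group \<lparr>carrier := induced_auts sc L br A\<rparr>"

lemma alpha_group_hom: "group_hom (grading_aut_group sc L br A) (AutoGroup plus_group) alpha"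
proof (rule group_hom.intro)
  show "group_hom_axioms (grading_aut_group sc L br A) (AutoGroup plus_group) alpha"
    using alpha alpha_bij
    by (auto simp: group_hom_axioms_def hom_def carrier_grading_aut_group AutoGroup_plus
        mult_grading_aut_group alpha_compose)
qed (rule group_grading_aut_group group.AutoGroup[OF group_plus_group])+

lemma subgroup_induced_auts: "subgroup (induced_auts sc L br A) (AutoGroup plus_group)"
  using group_hom.img_is_subgroup[OF alpha_group_hom]
  by (simp add: induced_auts_eq carrier_grading_aut_group)

lemma group_W_aut: "group W_aut"
  by (rule subgroup.subgroup_is_group[OF subgroup_induced_auts group.AutoGroup[OF group_plus_group]])

text \<open>The first isomorphism theorem for \<open>alpha\<close>: if \<open>f\<close> fixes every
  component, then the identity is a homomorphism induced by \<open>f\<close>, so uniqueness puts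
  \<open>f\<close> into the kernel.\<close>

lemma weyl_group_iso:
  "\<exists>\<Phi>\<in>iso (weyl_group sc L br A) W_aut.
     \<forall>f\<in>Aut\<Gamma>. induces A f (\<Phi> (grading_stab sc L br A #>\<^bsub>grading_aut_group sc L br A\<^esub> f))"
proof -
  let ?G = "grading_aut_group sc L br A"
  interpret h: group_hom ?G W_aut alpha
  proof (rule group_hom.intro)
    show "group_hom_axioms ?G W_aut alpha"
      using alpha_group_hom
      by (auto simp: group_hom_axioms_def group_hom_def hom_def induced_auts_eq carrier_grading_aut_group)
  qed (rule group_grading_aut_group group_W_aut)+
  have one: "\<one>\<^bsub>W_aut\<^esub> = id" by (simp add: AutoGroup_plus)
  have "alpha f = id \<longleftrightarrow> (\<forall>V\<in>comps A. f ` V = V)" if f: "f \<in> Aut\<Gamma>" for f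
  proof
    assume "alpha f = id"
    then show "\<forall>V\<in>comps A. f ` V = V" using alpha(2)[OF f] by (auto simp: induces_def comps_def)
  next
    assume "\<forall>V\<in>comps A. f ` V = V"
    then show "alpha f = id"
      by (intro alpha_eqI[OF f]) (auto simp: induces_def comps_def Modules.additive_def)
  qed
  then have ker: "kernel ?G W_aut alpha = grading_stab sc L br A"
    by (auto simp: kernel_def grading_stab_def carrier_grading_aut_group one)
  have iso: "(\<lambda>Y. the_elem (alpha ` Y)) \<in> iso (weyl_group sc L br A) W_aut"
    using h.FactGroup_iso_set unfolding ker weyl_group_def
    by (simp add: induced_auts_eq carrier_grading_aut_group)
  have "the_elem (alpha ` (grading_stab sc L br A #>\<^bsub>?G\<^esub> f)) = alpha f" if f: "f \<in> Aut\<Gamma>" for f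
  proof -
    let ?X = "grading_stab sc L br A #>\<^bsub>?G\<^esub> f"
    have "alpha x = alpha f" if x: "x \<in> ?X" for x
    proof -
      obtain k where k: "k \<in> kernel ?G W_aut alpha" "x = k \<otimes>\<^bsub>?G\<^esub> f"
        using x unfolding r_coset_def ker by blast
      then have "k \<in> Aut\<Gamma>" "alpha k = id" by (auto simp: kernel_def carrier_grading_aut_group one)
      then show ?thesis using f k by (simp add: mult_grading_aut_group alpha_compose)
    qed
    then have "alpha ` ?X = (\<lambda>_. alpha f) ` ?X" by (rule image_cong[OF refl])
    moreover have "f \<in> ?X"
      unfolding ker[symmetric]
      using group.rcos_self[OF group_grading_aut_group _ h.subgroup_kernel, of f] f
      by (simp only: carrier_grading_aut_group)
    ultimately have "alpha ` ?X = {alpha f}" unfolding image_constant_conv by force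
    then show ?thesis by simp
  qed
  then show ?thesis using iso alpha(2) by (intro bexI[OF _ iso]) auto
qed

end

section \<open>Matrices acting on tensors\<close>

definition msc :: "'a::field \<Rightarrow> 'a ^ 'n ^ 'm \<Rightarrow> 'a ^ 'n ^ 'm" where
  "msc c x = (\<chi> p q. c * x $ p $ q)"

lemma msc_nth [simp]: "msc c x $ p $ q = c * x $ p $ q"
  by (simp add: msc_def)

lemma msc_mult_left: "msc c x ** y = msc c (x ** (y :: 'a::field ^ 'k ^ 'n))"
  and msc_mult_right: "x ** msc c y = msc c (x ** y)"
  by (simp_all add: vec_eq_iff matrix_matrix_mult_def sum_distrib_left algebra_simps)

lemma msc_msc: "msc a (msc b x) = msc (a * b) x" and msc_1: "msc 1 x = x"
  and msc_0: "msc 0 x = 0" and msc_add: "msc a (x + y) = msc a x + msc a y"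
  and msc_add_left: "msc (a + b) x = msc a x + msc b x"
  and msc_neg: "msc (- a) x = - msc a x" "msc a (- x) = - msc a x"
  and msc_diff: "msc a (x - y) = msc a x - msc a y"
  by (simp_all add: vec_eq_iff algebra_simps)

lemma elt_scale_pair: "elt_scale c (x, w) = (msc c x, tensor_scale c w)"
  by (simp add: elt_scale_def msc_def)

lemma fst_elt_scale: "fst (elt_scale c z) = msc c (fst z)"
  and snd_elt_scale: "snd (elt_scale c z) = tensor_scale c (snd z)"
  by (simp_all add: elt_scale_def msc_def)

lemma tensor_scale_nth [simp]: "tensor_scale c w $ p $ q $ r $ s = c * w $ p $ q $ r $ s"
  by (simp add: tensor_scale_def)

lemma tensor_scale_neg: "tensor_scale (- a) x = - tensor_scale a x"
  by (simp add: vec_eq_iff)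

lemma matrix_neg_left: "(- x) ** y = - (x ** (y :: 'a::field ^ 'k ^ 'n))"
  and matrix_neg_right: "x ** (- y) = - (x ** (y :: 'a::field ^ 'k ^ 'n))"
  by (simp_all add: vec_eq_iff matrix_matrix_mult_def sum_negf)

text \<open>A matrix acting on one of the four tensor positions. Operators on different positions
  commute, the derivation action is the sum of the four and the exterior power their product, so
  identities about tensors become polynomial identities in four commuting operators.\<close>

definition slot1 :: "'a::field mat8 \<Rightarrow> 'a tensor4 \<Rightarrow> 'a tensor4" where
  "slot1 x w = (\<chi> p q r s. \<Sum>t\<in>UNIV. x $ p $ t * w $ t $ q $ r $ s)"

definition slot2 :: "'a::field mat8 \<Rightarrow> 'a tensor4 \<Rightarrow> 'a tensor4" where
  "slot2 x w = (\<chi> p q r s. \<Sum>t\<in>UNIV. x $ q $ t * w $ p $ t $ r $ s)"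

definition slot3 :: "'a::field mat8 \<Rightarrow> 'a tensor4 \<Rightarrow> 'a tensor4" where
  "slot3 x w = (\<chi> p q r s. \<Sum>t\<in>UNIV. x $ r $ t * w $ p $ q $ t $ s)"

definition slot4 :: "'a::field mat8 \<Rightarrow> 'a tensor4 \<Rightarrow> 'a tensor4" where
  "slot4 x w = (\<chi> p q r s. \<Sum>t\<in>UNIV. x $ s $ t * w $ p $ q $ r $ t)"

lemmas slot_defs = slot1_def slot2_def slot3_def slot4_def

lemma act_slots: "act x w = slot1 x w + slot2 x w + slot3 x w + slot4 x w"
  by (simp add: vec_eq_iff act_def slot_defs sum.distrib)

lemma ext4_map_slots: "ext4_map f w = slot1 f (slot2 f (slot3 f (slot4 f w)))"
  by (simp add: vec_eq_iff ext4_map_def slot_defs sum_distrib_left mult.assoc)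

lemma slot_add:
  "slot1 x (v + w) = slot1 x v + slot1 x w" "slot2 x (v + w) = slot2 x v + slot2 x w"
  "slot3 x (v + w) = slot3 x v + slot3 x w" "slot4 x (v + w) = slot4 x v + slot4 x w"
  by (simp_all add: vec_eq_iff slot_defs distrib_left sum.distrib)

lemma slot_scale:
  "slot1 x (tensor_scale c w) = tensor_scale c (slot1 x w)"
  "slot2 x (tensor_scale c w) = tensor_scale c (slot2 x w)"
  "slot3 x (tensor_scale c w) = tensor_scale c (slot3 x w)"
  "slot4 x (tensor_scale c w) = tensor_scale c (slot4 x w)"
  by (simp_all add: vec_eq_iff slot_defs sum_distrib_left algebra_simps)

lemma slot_add_left:
  "slot1 (x + y) w = slot1 x w + slot1 y w" "slot2 (x + y) w = slot2 x w + slot2 y w"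
  "slot3 (x + y) w = slot3 x w + slot3 y w" "slot4 (x + y) w = slot4 x w + slot4 y w"
  by (simp_all add: vec_eq_iff slot_defs distrib_right sum.distrib)

lemma slot_msc:
  "slot1 (msc c x) w = tensor_scale c (slot1 x w)" "slot2 (msc c x) w = tensor_scale c (slot2 x w)"
  "slot3 (msc c x) w = tensor_scale c (slot3 x w)" "slot4 (msc c x) w = tensor_scale c (slot4 x w)"
  by (simp_all add: vec_eq_iff slot_defs sum_distrib_left algebra_simps)

lemma slot_one: "slot1 (mat 1) w = w" "slot2 (mat 1) w = w" "slot3 (mat 1) w = w" "slot4 (mat 1) w = w"
  by (simp_all add: vec_eq_iff slot_defs mat_def if_distrib[of "\<lambda>x. x * _"] cong: if_cong)

lemma slot_mult:
  "slot1 (x ** y) w = slot1 x (slot1 y w)" "slot2 (x ** y) w = slot2 x (slot2 y w)"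
  "slot3 (x ** y) w = slot3 x (slot3 y w)" "slot4 (x ** y) w = slot4 x (slot4 y w)"
proof -
  have *: "(\<Sum>t\<in>UNIV. (\<Sum>u\<in>UNIV. x $ p $ u * y $ u $ t) * g t)
      = (\<Sum>u\<in>UNIV. x $ p $ u * (\<Sum>t\<in>UNIV. y $ u $ t * g t))" for p and g :: "idx \<Rightarrow> 'a"
    unfolding sum_distrib_left sum_distrib_right by (subst sum.swap) (simp add: mult.assoc)
  show "slot1 (x ** y) w = slot1 x (slot1 y w)" "slot2 (x ** y) w = slot2 x (slot2 y w)"
    "slot3 (x ** y) w = slot3 x (slot3 y w)" "slot4 (x ** y) w = slot4 x (slot4 y w)"
    by (simp_all add: vec_eq_iff slot_defs matrix_matrix_mult_def *)
qed

lemma slot_commute: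
  "slot2 x (slot1 y w) = slot1 y (slot2 x w)" "slot3 x (slot1 y w) = slot1 y (slot3 x w)"
  "slot4 x (slot1 y w) = slot1 y (slot4 x w)" "slot3 x (slot2 y w) = slot2 y (slot3 x w)"
  "slot4 x (slot2 y w) = slot2 y (slot4 x w)" "slot4 x (slot3 y w) = slot3 y (slot4 x w)"
proof -
  have *: "(\<Sum>t\<in>UNIV. f t * (\<Sum>u\<in>UNIV. g u * h t u)) = (\<Sum>u\<in>UNIV. g u * (\<Sum>t\<in>UNIV. f t * h t u))"
    for f g :: "idx \<Rightarrow> 'a" and h
    unfolding sum_distrib_left by (subst sum.swap) (simp add: mult.left_commute)
  show "slot2 x (slot1 y w) = slot1 y (slot2 x w)" "slot3 x (slot1 y w) = slot1 y (slot3 x w)"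
    "slot4 x (slot1 y w) = slot1 y (slot4 x w)" "slot3 x (slot2 y w) = slot2 y (slot3 x w)"
    "slot4 x (slot2 y w) = slot2 y (slot4 x w)" "slot4 x (slot3 y w) = slot3 y (slot4 x w)"
    by (simp_all only: vec_eq_iff slot_defs vec_lambda_beta) (intro allI *)+
qed

lemma ext4_map_mult: "ext4_map (f ** g) w = ext4_map f (ext4_map g w)"
  by (simp add: ext4_map_slots slot_mult slot_commute)

lemma ext4_map_msc: "ext4_map (msc c f) w = tensor_scale (c ^ 4) (ext4_map f w)"
  by (simp add: ext4_map_slots slot_msc slot_scale vec_eq_iff power4_eq_xxxx algebra_simps)

lemma ext4_map_one: "ext4_map (mat 1) w = w"
  by (simp add: ext4_map_slots slot_one)

lemma ext4_map_add: "ext4_map f (v + w) = ext4_map f v + ext4_map f w"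
  and ext4_map_scale: "ext4_map f (tensor_scale c w) = tensor_scale c (ext4_map f w)"
  by (simp_all add: ext4_map_slots slot_add slot_scale)

lemma act_add: "act x (v + w) = act x v + act x w"
  and act_scale: "act x (tensor_scale c w) = tensor_scale c (act x w)"
  and act_add_left: "act (x + y) w = act x w + act y w"
  and act_msc: "act (msc c x) w = tensor_scale c (act x w)"
  by (simp_all add: act_slots slot_add slot_scale slot_add_left slot_msc vec_eq_iff algebra_simps)

lemma act_0: "act x 0 = 0" "act 0 w = 0"
  by (simp_all add: act_def vec_eq_iff)

lemma act_neg: "act x (- w) = - act x w"
proof -
  have *: "- v = tensor_scale (- 1) v" for v :: "'a tensor4" by (simp add: vec_eq_iff)
  show ?thesis unfolding *[of w] *[of "act x w"] by (rule act_scale)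
qed

lemma act_commutator: "act x (act y w) = act y (act x w) + act (x ** y - y ** x) w"
proof -
  have neg: "slot1 (x - y) w = slot1 x w - slot1 y w" "slot2 (x - y) w = slot2 x w - slot2 y w"
    "slot3 (x - y) w = slot3 x w - slot3 y w" "slot4 (x - y) w = slot4 x w - slot4 y w"
    for x y :: "'a mat8"
    using slot_add_left[of "x - y" y w] by simp_all
  show ?thesis by (simp add: act_slots slot_add slot_mult slot_commute neg algebra_simps)
qed

text \<open>The second and third elementary symmetric functions e_2, e_3 of the four commuting
  operators given by \<open>d\<close>. In these terms \<open>act d\<close> is e_1 and
  \<open>ext4_map d\<close> is e_4. When \<open>d\<close> is an involution each operator squares to
  1, and multiplication by e_1 closes up on 1, e_1, e_2, e_3, e_4.\<close>

definition slots2 :: "'a::field mat8 \<Rightarrow> 'a tensor4 \<Rightarrow> 'a tensor4" where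
  "slots2 d w = slot1 d (slot2 d w) + slot1 d (slot3 d w) + slot1 d (slot4 d w) +
     slot2 d (slot3 d w) + slot2 d (slot4 d w) + slot3 d (slot4 d w)"

definition slots3 :: "'a::field mat8 \<Rightarrow> 'a tensor4 \<Rightarrow> 'a tensor4" where
  "slots3 d w = slot1 d (slot2 d (slot3 d w)) + slot1 d (slot2 d (slot4 d w)) +
     slot1 d (slot3 d (slot4 d w)) + slot2 d (slot3 d (slot4 d w))"

context
  fixes d :: "'a::field_char_0 mat8"
  assumes dd: "d ** d = mat 1"
begin

lemma slot_involution:
  "slot1 d (slot1 d w) = w" "slot2 d (slot2 d w) = w" "slot3 d (slot3 d w) = w" "slot4 d (slot4 d w) = w"
  by (simp_all add: slot_mult[symmetric] dd slot_one)

lemma act_act: "act d (act d w) = tensor_scale 4 w + tensor_scale 2 (slots2 d w)"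
  by (simp add: act_slots slots2_def slot_add slot_involution slot_commute vec_eq_iff)

lemma act_slots2: "act d (slots2 d w) = tensor_scale 3 (slots3 d w) + tensor_scale 3 (act d w)"
  by (simp add: act_slots slots2_def slots3_def slot_add slot_involution slot_commute vec_eq_iff)

lemma act_slots3: "act d (slots3 d w) = tensor_scale 4 (ext4_map d w) + tensor_scale 2 (slots2 d w)"
  by (simp add: act_slots ext4_map_slots slots2_def slots3_def slot_add slot_involution slot_commute vec_eq_iff)

lemma act_ext4_map: "act d (ext4_map d w) = slots3 d w"
  by (simp add: act_slots ext4_map_slots slots3_def slot_add slot_involution slot_commute vec_eq_iff)

lemma act3: "act d (act d (act d w)) = tensor_scale 10 (act d w) + tensor_scale 6 (slots3 d w)"
  by (subst act_act[of w], simp only: act_add act_scale act_slots2) (simp add: vec_eq_iff)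

lemma act4: "act d (act d (act d (act d w))) =
    tensor_scale 40 w + tensor_scale 32 (slots2 d w) + tensor_scale 24 (ext4_map d w)"
  by (subst act3[of w], simp only: act_add act_scale act_slots3 act_act) (simp add: vec_eq_iff)

text \<open>The polynomial behind it is X (X^2 - 4) (X^2 - 16), whose roots are the possible sums of
  four signs, one for each tensor position.\<close>

lemma act5: "act d (act d (act d (act d (act d w)))) =
    tensor_scale 20 (act d (act d (act d w))) - tensor_scale 64 (act d w)"
  by (subst act4[of w], simp only: act_add act_scale act_slots2 act_ext4_map act3) (simp add: vec_eq_iff)

text \<open>For four commuting operators of square 1 the product e_4 is a polynomial in the sum e_1.
  The exterior power of an involution is thus determined by its derivation action, which is how
  matrices that kill a tensor are seen to fix it.\<close>

lemma ext4_map_involution: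
  "tensor_scale 24 (ext4_map d w) =
     act d (act d (act d (act d w))) - tensor_scale 16 (act d (act d w)) + tensor_scale 24 w"
  by (subst act4[of w], simp only: act_act) (simp add: vec_eq_iff)

lemma ext4_map_linear_combination:
  "ext4_map (msc s (mat 1) + msc t d) w = tensor_scale (s ^ 4) w + tensor_scale (s ^ 3 * t) (act d w) +
     tensor_scale (s ^ 2 * t ^ 2) (slots2 d w) + tensor_scale (s * t ^ 3) (slots3 d w) +
     tensor_scale (t ^ 4) (ext4_map d w)"
  by (simp add: ext4_map_slots act_slots slots2_def slots3_def slot_add_left slot_add slot_msc slot_scale
      slot_one vec_eq_iff power2_eq_square power3_eq_cube power4_eq_xxxx algebra_simps)

text \<open>Heuristically, eigenvalue \<open>m\<close> means sign 1 at (4 + m) / 2 positions and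
  sign -1 at (4 - m) / 2 positions, which contribute factors \<open>s + t\<close> and
  \<open>s - t\<close>. The eigenvector is not decomposed further: all symmetric functions act on it
  by scalars computed from \<open>m\<close>.\<close>

lemma ext4_map_eigenvector:
  assumes w: "act d w = tensor_scale m w" and m: "m \<in> {- 4, - 2, 0, 2, 4}"
  shows "ext4_map (msc s (mat 1) + msc t d) w =
    tensor_scale (if m = 4 then (s + t) ^ 4 else if m = 2 then (s + t) ^ 3 * (s - t)
      else if m = 0 then (s + t) ^ 2 * (s - t) ^ 2 else if m = -2 then (s + t) * (s - t) ^ 3
      else (s - t) ^ 4) w"
proof -
  have s2: "slots2 d w = tensor_scale ((m ^ 2 - 4) / 2) w"
    using act_act[of w] by (simp add: w act_scale vec_eq_iff power2_eq_square field_simps)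
  have s3: "slots3 d w = tensor_scale ((m ^ 3 - 10 * m) / 6) w"
    using act3[of w] by (simp add: w act_scale vec_eq_iff power3_eq_cube field_simps)
  have s4: "ext4_map d w = tensor_scale ((m ^ 4 - 16 * m ^ 2 + 24) / 24) w"
    using ext4_map_involution[of w]
    by (simp add: w act_scale vec_eq_iff power2_eq_square power4_eq_xxxx field_simps)
  let ?c = "s ^ 4 + s ^ 3 * t * m + s ^ 2 * t ^ 2 * ((m ^ 2 - 4) / 2) + s * t ^ 3 * ((m ^ 3 - 10 * m) / 6)
    + t ^ 4 * ((m ^ 4 - 16 * m ^ 2 + 24) / 24)"
  have "ext4_map (msc s (mat 1) + msc t d) w = tensor_scale ?c w"
    unfolding ext4_map_linear_combination w s2 s3 s4 by (simp add: vec_eq_iff distrib_right mult.assoc)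
  moreover have "?c = (if m = 4 then (s + t) ^ 4 else if m = 2 then (s + t) ^ 3 * (s - t)
      else if m = 0 then (s + t) ^ 2 * (s - t) ^ 2 else if m = -2 then (s + t) * (s - t) ^ 3
      else (s - t) ^ 4)"
    using m by (auto simp: power2_eq_square power3_eq_cube power4_eq_xxxx algebra_simps)
  ultimately show ?thesis by (simp only:)
qed

end

section \<open>Kronecker products\<close>

definition kron :: "'a::field ^ 4 ^ 4 \<Rightarrow> 'a ^ 2 ^ 2 \<Rightarrow> 'a mat8" where
  "kron P S = (\<chi> p q. P $ fst p $ fst q * S $ snd p $ snd q)"

lemma kron_nth [simp]: "kron P S $ p $ q = P $ fst p $ fst q * S $ snd p $ snd q"
  by (simp add: kron_def)

lemma sum_idx: "(\<Sum>p\<in>(UNIV :: idx set). f p) = (\<Sum>a\<in>UNIV. \<Sum>b\<in>UNIV. f (a, b))"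
  by (simp add: sum.cartesian_product)

lemma kron_mult: "kron P S ** kron P' S' = kron (P ** P') (S ** S')"
  by (simp add: vec_eq_iff matrix_matrix_mult_def sum_idx sum_product algebra_simps)

lemma kron_one: "kron (mat 1) (mat 1) = mat 1"
  by (auto simp: vec_eq_iff mat_def prod_eq_iff)

lemma kron_transpose: "transpose (kron P S) = kron (transpose P) (transpose S)"
  by (simp add: vec_eq_iff transpose_def)

lemma kron_msc: "kron (msc c P) S = msc c (kron P S)" "kron P (msc c S) = msc c (kron P S)"
  and kron_neg: "kron (- P) S = - kron P S" "kron P (- S) = - kron P S"
  and kron_add: "kron (P + P') S = kron P S + kron P' S" "kron P (S + S') = kron P S + kron P S'"
  and kron_diff: "kron (P - P') S = kron P S - kron P' S"
  by (simp_all add: vec_eq_iff algebra_simps)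

definition eu :: "'n \<Rightarrow> 'n \<Rightarrow> 'a::field ^ 'n ^ 'n" where
  "eu a b = (\<chi> i j. if i = a \<and> j = b then 1 else 0)"

lemma eu_nth [simp]: "eu a b $ i $ j = (if i = a \<and> j = b then 1 else 0)"
  by (simp add: eu_def)

definition Q4 :: "'a::field ^ 4 ^ 4" where
  "Q4 = eu 1 2 + eu 2 1 + eu 3 4 + eu 4 3"

lemma C_mat_kron: "C_mat = kron Q4 sigma3"
  by (auto simp: vec_eq_iff C_mat_def Q4_def sigma3_def forall_4 forall_2)

lemma L0_iff: "x \<in> L0 \<longleftrightarrow> transpose x ** C_mat + C_mat ** x = (0 :: 'a::field mat8)"
proof -
  have b: "bform u v = (\<Sum>p\<in>UNIV. \<Sum>q\<in>UNIV. u $ p * C_mat $ p $ q * v $ q)" for u v :: "'a ^ idx"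
    by (rule bform_def)
  have bx: "bform (x *v u) v = (\<Sum>p\<in>UNIV. \<Sum>q\<in>UNIV. u $ p * (transpose x ** C_mat) $ p $ q * v $ q)" for u v
  proof -
    have "bform (x *v u) v = (\<Sum>r\<in>UNIV. \<Sum>q\<in>UNIV. \<Sum>p\<in>UNIV. u $ p * (x $ r $ p * C_mat $ r $ q) * v $ q)"
      unfolding b matrix_vector_mult_def by (simp add: sum_distrib_right sum_distrib_left algebra_simps)
    also have "\<dots> = (\<Sum>q\<in>UNIV. \<Sum>r\<in>UNIV. \<Sum>p\<in>UNIV. u $ p * (x $ r $ p * C_mat $ r $ q) * v $ q)"
      by (rule sum.swap)
    also have "\<dots> = (\<Sum>q\<in>UNIV. \<Sum>p\<in>UNIV. \<Sum>r\<in>UNIV. u $ p * (x $ r $ p * C_mat $ r $ q) * v $ q)"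
      by (intro sum.cong refl sum.swap)
    also have "\<dots> = (\<Sum>p\<in>UNIV. \<Sum>q\<in>UNIV. \<Sum>r\<in>UNIV. u $ p * (x $ r $ p * C_mat $ r $ q) * v $ q)"
      by (rule sum.swap)
    finally show ?thesis
      by (simp add: matrix_matrix_mult_def transpose_def sum_distrib_left sum_distrib_right)
  qed
  have xb: "bform u (x *v v) = (\<Sum>p\<in>UNIV. \<Sum>q\<in>UNIV. u $ p * (C_mat ** x) $ p $ q * v $ q)" for u v
  proof -
    have "bform u (x *v v) = (\<Sum>p\<in>UNIV. \<Sum>r\<in>UNIV. \<Sum>q\<in>UNIV. u $ p * (C_mat $ p $ r * x $ r $ q) * v $ q)"
      unfolding b matrix_vector_mult_def by (simp add: sum_distrib_left algebra_simps)
    also have "\<dots> = (\<Sum>p\<in>UNIV. \<Sum>q\<in>UNIV. \<Sum>r\<in>UNIV. u $ p * (C_mat $ p $ r * x $ r $ q) * v $ q)"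
      by (intro sum.cong refl sum.swap)
    finally show ?thesis by (simp add: matrix_matrix_mult_def sum_distrib_left sum_distrib_right)
  qed
  let ?M = "transpose x ** C_mat + C_mat ** x"
  have *: "bform (x *v u) v + bform u (x *v v) = (\<Sum>p\<in>UNIV. \<Sum>q\<in>UNIV. u $ p * ?M $ p $ q * v $ q)" for u v
    unfolding bx xb by (simp add: sum.distrib[symmetric] algebra_simps)
  have axis: "(\<Sum>p\<in>UNIV. \<Sum>q\<in>UNIV. axis i 1 $ p * ?M $ p $ q * axis j 1 $ q) = ?M $ i $ j" for i j
    by (simp add: axis_def if_distrib[of "\<lambda>x. x * _"] if_distrib[of "\<lambda>x. _ * x"] cong: if_cong)
  show ?thesis
  proof
    assume "x \<in> L0"
    then have "?M $ i $ j = 0" for i j unfolding axis[of i j, symmetric] *[symmetric] L0_def by blast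
    then show "?M = 0" by (simp add: vec_eq_iff)
  next
    assume "?M = 0"
    then show "x \<in> L0" unfolding L0_def mem_Collect_eq * by simp
  qed
qed

text \<open>The symplectic form is the product of the symmetric form \<open>Q4\<close> and the skew
  form \<open>sigma3\<close>. Accordingly a decomposable matrix lies in sp_8 if its first factor is
  self-adjoint for \<open>Q4\<close> and its second lies in sp_2, or if the first is skew-adjoint
  and the second is the identity; the latter case is \<open>kron_L0_skew\<close>.\<close>

lemma kron_L0_sym:
  assumes "transpose P ** Q4 = Q4 ** P" "transpose S ** sigma3 = - (sigma3 ** S)"
  shows "kron P S \<in> L0"
  by (simp add: L0_iff C_mat_kron kron_transpose kron_mult assms kron_neg)

lemma kron_L0_skew:
  assumes "transpose P ** Q4 = - (Q4 ** P)"
  shows "kron P (mat 1) \<in> L0"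
proof -
  have "transpose (mat 1 :: 'a ^ 2 ^ 2) = mat 1" by (simp add: vec_eq_iff transpose_def mat_def)
  then show ?thesis by (simp add: L0_iff C_mat_kron kron_transpose kron_mult assms kron_neg)
qed

section \<open>Conjugation by symplectic matrices\<close>

lemma matrix_add_rdistrib: "(y + z) ** x = y ** x + z ** (x :: 'a::field ^ 'k ^ 'n)"
  and matrix_diff_ldistrib: "x ** (u - v) = x ** u - x ** (v :: 'a ^ 'j ^ 'k)"
  and matrix_diff_rdistrib: "(y - z) ** x = y ** x - z ** x"
  by (simp_all add: vec_eq_iff matrix_matrix_mult_def distrib_right right_diff_distrib left_diff_distrib
      sum.distrib sum_subtractf)

lemma matrix_inv_eqI:
  fixes f g :: "'a::field ^ 'n ^ 'n"
  assumes "f ** g = mat 1"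
  shows "matrix_inv f = g"
proof -
  have 1: "g ** f = mat 1" using assms by (simp add: matrix_left_right_inverse)
  then have "\<exists>x. f ** x = mat 1 \<and> x ** f = mat 1" using assms by blast
  then have "f ** matrix_inv f = mat 1" unfolding matrix_inv_def by (rule someI2_ex) simp
  then have "g ** (f ** matrix_inv f) = g" by simp
  then show ?thesis by (simp add: matrix_mul_assoc 1)
qed

lemma diamond_eq: "f ** g = mat 1 \<Longrightarrow> diamond f z = (f ** fst z ** g, ext4_map f (snd z))"
  by (simp add: diamond_def matrix_inv_eqI)

lemma diamond_mult:
  assumes "f ** f' = mat 1" "g ** g' = mat 1"
  shows "diamond (f ** g) z = diamond f (diamond g z)"
proof -
  have "(f ** g) ** (g' ** f') = f ** (g ** g') ** f'" by (simp add: matrix_mul_assoc)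
  then have "(f ** g) ** (g' ** f') = mat 1" by (simp add: assms)
  from diamond_eq[OF this, of z] show ?thesis
    by (simp add: diamond_eq[OF assms(1)] diamond_eq[OF assms(2)] ext4_map_mult matrix_mul_assoc)
qed

lemma diamond_msc:
  assumes "f ** f' = mat 1" "c ^ 4 = 1"
  shows "diamond (msc c f) z = diamond f z"
proof -
  have "c \<noteq> 0" using assms(2) by auto
  then have "msc c f ** msc (1 / c) f' = mat 1"
    by (simp add: msc_mult_left msc_mult_right msc_msc assms msc_1)
  from diamond_eq[OF this, of z] show ?thesis using \<open>c \<noteq> 0\<close>
    by (simp add: diamond_eq[OF assms(1)] msc_mult_left msc_mult_right msc_msc msc_1 ext4_map_msc assms
        prod_eq_iff vec_eq_iff)
qed

lemma diamond_uminus: "f ** f' = mat 1 \<Longrightarrow> diamond (- f) z = diamond f z"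
  using diamond_msc[of f f' "- 1" z] by (simp add: msc_neg msc_1)

lemma msc_zero [simp]: "msc c 0 = 0"
  by (simp add: vec_eq_iff)

lemma msc_diff_left: "msc (a - b) x = msc a x - msc b x"
  by (simp add: vec_eq_iff algebra_simps)

lemma sandwich_expand:
  "(msc s (mat 1) + msc t d) ** x ** (msc s (mat 1) + msc u d) =
     msc (s * s) x + msc (s * u) (x ** d) + msc (t * s) (d ** x) + msc (t * u) (d ** x ** d)"
  for x d :: "'a::field mat8"
  by (simp add: matrix_add_ldistrib matrix_add_rdistrib msc_mult_left msc_mult_right msc_msc msc_add)
    (simp add: vec_eq_iff algebra_simps)

text \<open>For an involution \<open>d\<close> this is the matrix acting by \<open>l\<close> on the
  1-eigenspace and by \<open>1 / l\<close> on the (-1)-eigenspace, that is, l^d. Conjugation by it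
  should be l^(ad d).\<close>

definition delta :: "'a::field mat8 \<Rightarrow> 'a \<Rightarrow> 'a mat8" where
  "delta d l = msc ((l + inverse l) / 2) (mat 1) + msc ((l - inverse l) / 2) d"

lemma delta_inverse:
  assumes "d ** d = mat 1" "l \<noteq> (0 :: 'a::field_char_0)"
  shows "delta d l ** delta d (inverse l) = mat 1"
proof -
  have *: "delta d l ** delta d (inverse l) =
    msc (((l + inverse l) / 2) * ((inverse l + l) / 2) + ((l - inverse l) / 2) * ((inverse l - l) / 2)) (mat 1) +
    msc (((l + inverse l) / 2) * ((inverse l - l) / 2) + ((l - inverse l) / 2) * ((inverse l + l) / 2)) d"
    by (simp add: delta_def matrix_add_ldistrib matrix_add_rdistrib msc_mult_left msc_mult_right
        msc_msc msc_add msc_add_left assms(1) algebra_simps)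
  have "((l + inverse l) / 2) * ((inverse l + l) / 2) + ((l - inverse l) / 2) * ((inverse l - l) / 2) = 1"
    "((l + inverse l) / 2) * ((inverse l - l) / 2) + ((l - inverse l) / 2) * ((inverse l + l) / 2) = 0"
    using assms(2) by (simp_all add: field_simps)
  then show ?thesis unfolding * by (simp only: msc_1 msc_0 add_0_right)
qed

lemma ex_imaginary_unit: "\<exists>i :: 'a::{alg_closed_field}. i ^ 2 = - 1"
  by (rule nth_root_exists) simp

section \<open>The bracket of L through its parts L0 and L1\<close>

locale E6 =
  fixes L1 :: "'a::{alg_closed_field, field_char_0} tensor4 set"
    and br :: "'a elt \<Rightarrow> 'a elt \<Rightarrow> 'a elt"
  assumes is_L1: "is_L1 L1" and E6_bracket: "E6_bracket L1 br"
begin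

lemma simple: "simple_lie_algebra elt_scale (L_carrier L1) br"
  using E6_bracket by (simp add: E6_bracket_def lie_algebra_type_E6_def)

sublocale vector_space elt_scale by (rule vector_space_elt_scale)

sublocale lie elt_scale "L_carrier L1" br
  by unfold_locales (use simple in \<open>simp add: simple_lie_algebra_def\<close>)

sublocale ten: vector_space tensor_scale by (rule vector_space_tensor_scale)

abbreviation "L \<equiv> L_carrier L1"

lemma mem_L: "z \<in> L \<longleftrightarrow> fst z \<in> L0 \<and> snd z \<in> L1"
  by (cases z) (auto simp: L_carrier_def)

lemma sub_L1: "ten.subspace L1"
  using is_L1 by (simp add: is_L1_def L0_submodule_def)

lemma L1_0 [simp]: "0 \<in> L1" and L1_add: "v \<in> L1 \<Longrightarrow> w \<in> L1 \<Longrightarrow> v + w \<in> L1"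
  and L1_sc: "w \<in> L1 \<Longrightarrow> tensor_scale c w \<in> L1" and L1_diff: "v \<in> L1 \<Longrightarrow> w \<in> L1 \<Longrightarrow> v - w \<in> L1"
  and L1_neg: "w \<in> L1 \<Longrightarrow> - w \<in> L1"
  using sub_L1 by (auto intro: ten.subspace_0 ten.subspace_add ten.subspace_scale ten.subspace_diff ten.subspace_neg)

lemma L1_act: "x \<in> L0 \<Longrightarrow> w \<in> L1 \<Longrightarrow> act x w \<in> L1"
  and L1_Ext4: "w \<in> L1 \<Longrightarrow> w \<in> Ext4"
  using is_L1 by (auto simp: is_L1_def L0_submodule_def)

lemma L1_irreducible:
  "ten.subspace U \<Longrightarrow> U \<subseteq> L1 \<Longrightarrow> (\<And>x w. x \<in> L0 \<Longrightarrow> w \<in> U \<Longrightarrow> act x w \<in> U) \<Longrightarrow> w \<in> U \<Longrightarrow> w \<noteq> 0 \<Longrightarrow> U = L1"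
proof -
  assume U: "ten.subspace U" "U \<subseteq> L1" "\<And>x w. x \<in> L0 \<Longrightarrow> w \<in> U \<Longrightarrow> act x w \<in> U" "w \<in> U" "w \<noteq> 0"
  have "\<forall>U. L0_submodule U \<and> U \<subseteq> L1 \<longrightarrow> U = {0} \<or> U = L1" using is_L1 by (simp add: is_L1_def)
  moreover have "L0_submodule U" using U L1_Ext4 by (auto simp: L0_submodule_def)
  ultimately show "U = L1" using U by blast
qed

lemma L0_0 [simp]: "(0 :: 'a mat8) \<in> L0" using L_0 by (simp add: mem_L)

lemma in_L0 [simp]: "(x, 0) \<in> L \<longleftrightarrow> x \<in> L0" and in_L1 [simp]: "(0, w) \<in> L \<longleftrightarrow> w \<in> L1"
  by (simp_all add: mem_L)

lemma L0_add: "x \<in> L0 \<Longrightarrow> y \<in> L0 \<Longrightarrow> x + y \<in> L0" for x y :: "'a mat8"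
  using L_add[of "(x, 0)" "(y, 0)"] by simp

lemma L0_sc: "x \<in> L0 \<Longrightarrow> msc c x \<in> L0" for x :: "'a mat8"
  using L_sc[of "(x, 0)" c] by (simp add: elt_scale_pair)

lemma L0_diff: "x \<in> L0 \<Longrightarrow> y \<in> L0 \<Longrightarrow> x - y \<in> L0" for x y :: "'a mat8"
  using L_diff[of "(x, 0)" "(y, 0)"] by simp

lemma br00: "x \<in> L0 \<Longrightarrow> y \<in> L0 \<Longrightarrow> br (x, 0) (y, 0) = (x ** y - y ** x, 0)"
  and br01: "x \<in> L0 \<Longrightarrow> w \<in> L1 \<Longrightarrow> br (x, 0) (0, w) = (0, act x w)"
  using E6_bracket by (auto simp: E6_bracket_def)

lemma br10: "x \<in> L0 \<Longrightarrow> w \<in> L1 \<Longrightarrow> br (0, w) (x, 0) = (0, - act x w)"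
  using br_skew[of "(x, 0)" "(0, w)"] br01 by simp

lemma L0_comm: "x \<in> L0 \<Longrightarrow> y \<in> L0 \<Longrightarrow> x ** y - y ** x \<in> L0" for x y :: "'a mat8"
  using br_L[of "(x, 0)" "(y, 0)"] by (simp add: br00)

definition B :: "'a tensor4 \<Rightarrow> 'a tensor4 \<Rightarrow> 'a mat8" where
  "B v w = fst (br (0, v) (0, w))"

lemma br11: "v \<in> L1 \<Longrightarrow> w \<in> L1 \<Longrightarrow> br (0, v) (0, w) = (B v w, 0)"
  using E6_bracket by (auto simp: E6_bracket_def B_def prod_eq_iff)

lemma B_L0: "v \<in> L1 \<Longrightarrow> w \<in> L1 \<Longrightarrow> B v w \<in> L0"
  using br_L[of "(0, v)" "(0, w)"] by (simp add: br11)

lemma br0: "x \<in> L0 \<Longrightarrow> z \<in> L \<Longrightarrow> br (x, 0) z = (x ** fst z - fst z ** x, act x (snd z))"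
  using br_add_right[of "(fst z, 0)" "(0, snd z)" "(x, 0)"] by (simp add: mem_L br00 br01)

lemma br1: "v \<in> L1 \<Longrightarrow> z \<in> L \<Longrightarrow> br (0, v) z = (B v (snd z), - act (fst z) v)"
  using br_add_right[of "(fst z, 0)" "(0, snd z)" "(0, v)"] by (simp add: mem_L br10 br11)

lemma linear_diamond:
  assumes "f ** g = mat 1"
  shows "linear_on_L (diamond f)"
  by (simp add: linear_on_L_def diamond_eq[OF assms] matrix_add_ldistrib matrix_add_rdistrib ext4_map_add
      fst_elt_scale snd_elt_scale elt_scale_pair msc_mult_left msc_mult_right ext4_map_scale)

section \<open>Involutions of sp_8 and their one-parameter groups\<close>

context
  fixes d :: "'a mat8"
  assumes d: "d \<in> L0" and dd: "d ** d = mat 1"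
begin

lemma dd_left: "d ** (d ** x) = x"
  using matrix_mul_assoc[of d d x] dd by simp

abbreviation "ad_d x \<equiv> d ** x - x ** d"

text \<open>Left and right multiplication by \<open>d\<close> are commuting involutions, so their
  difference has eigenvalues 0, 2, -2 only.\<close>

lemma ad3: "ad_d (ad_d (ad_d x)) = msc 4 (ad_d x)"
proof -
  have 2: "ad_d (ad_d x) = msc 2 (x - d ** x ** d)"
    by (simp add: matrix_diff_ldistrib matrix_diff_rdistrib dd_left matrix_mul_assoc[symmetric] dd)
      (simp add: vec_eq_iff)
  show ?thesis unfolding 2
    by (simp add: matrix_diff_ldistrib matrix_diff_rdistrib dd_left matrix_mul_assoc[symmetric] dd
        msc_mult_left msc_mult_right msc_diff)
      (simp add: vec_eq_iff)
qed

text \<open>The polynomial X^3 - 4 X valid on matrices divides the quintic valid on tensors, so the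
  quintic serves for both parts of L.\<close>

lemma ad_d5:
  assumes z: "z \<in> L"
  shows "br (d, 0) (br (d, 0) (br (d, 0) (br (d, 0) (br (d, 0) z)))) =
    elt_scale 20 (br (d, 0) (br (d, 0) (br (d, 0) z))) - elt_scale 64 (br (d, 0) z)"
proof -
  have L: "(d, 0) \<in> L" using d by simp
  have br: "br (d, 0) y = (ad_d (fst y), act d (snd y))" if "y \<in> L" for y using br0[OF d that] .
  have "fst z \<in> L0" "snd z \<in> L1" using z by (auto simp: mem_L)
  define D where "D y = (ad_d (fst y), act d (snd y))" for y
  have D: "br (d, 0) y = D y" "D y \<in> L" if "y \<in> L" for y
    using br[OF that] br_L[OF L that] by (simp_all add: D_def)
  have "ad_d (ad_d (ad_d (ad_d (ad_d x)))) = msc 20 (ad_d (ad_d (ad_d x))) - msc 64 (ad_d x)" for x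
  proof -
    have "ad_d (ad_d (msc 4 (ad_d x))) = msc 4 (ad_d (ad_d (ad_d x)))"
      by (simp add: msc_mult_left msc_mult_right flip: msc_diff)
    then show ?thesis unfolding ad3[of "ad_d (ad_d x)"] ad3[of x] by (simp add: vec_eq_iff)
  qed
  then have "D (D (D (D (D z)))) = elt_scale 20 (D (D (D z))) - elt_scale 64 (D z)"
    by (simp add: D_def act5[OF dd] elt_scale_pair)
  then show ?thesis using z by (simp add: D)
qed

lemma even_eig_decomposition:
  assumes z: "z \<in> L"
  shows "\<exists>y. (\<forall>m. y m \<in> eig (d, 0) (2 * m)) \<and> z = (\<Sum>m\<in>{- 2, - 1, 0, 1, 2}. y m)"
proof -
  have L: "(d, 0) \<in> L" using d by simp
  define D where "D = br (d, 0)"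
  have DL: "D y \<in> L" if "y \<in> L" for y using br_L[OF L that] by (simp add: D_def)
  have lin: "D (x + y) = D x + D y" "D (x - y) = D x - D y" "D (elt_scale c x) = elt_scale c (D x)"
    if "x \<in> L" "y \<in> L" for x y c
    using that L by (auto simp: D_def br_add_right br_diff_right br_sc_right)
  have 5: "D (D (D (D (D z)))) = elt_scale 20 (D (D (D z))) - elt_scale 64 (D z)"
    using ad_d5[OF z] by (simp add: D_def)
  note zL = z DL[OF z] DL[OF DL[OF z]] DL[OF DL[OF DL[OF z]]] DL[OF DL[OF DL[OF DL[OF z]]]]
  let ?z1 = "D z" and ?z2 = "D (D z)" and ?z3 = "D (D (D z))" and ?z4 = "D (D (D (D z)))"
  \<comment> \<open>\<open>P a0 a1 a2 a3 a4\<close> is the polynomial with these coefficients in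
    \<open>D\<close>, applied to \<open>z\<close>; \<open>DP\<close> is multiplication by X modulo
    the quintic.\<close>
  define P where "P a0 a1 a2 a3 a4 = elt_scale a0 z + elt_scale a1 ?z1 + elt_scale a2 ?z2 +
    elt_scale a3 ?z3 + elt_scale a4 ?z4" for a0 a1 a2 a3 a4
  have PL: "P a0 a1 a2 a3 a4 \<in> L" for a0 a1 a2 a3 a4
    unfolding P_def using zL by (intro L_add L_sc)
  have DP: "D (P a0 a1 a2 a3 a4) = P 0 (a0 - 64 * a4) a1 (a2 + 20 * a4) a3" for a0 a1 a2 a3 a4
  proof -
    have "D (P a0 a1 a2 a3 a4) = elt_scale a0 ?z1 + elt_scale a1 ?z2 + elt_scale a2 ?z3 +
        elt_scale a3 ?z4 + elt_scale a4 (elt_scale 20 ?z3 - elt_scale 64 ?z1)"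
      unfolding P_def 5[symmetric] using zL by (simp add: lin L_add L_sc)
    also have "\<dots> = P 0 (a0 - 64 * a4) a1 (a2 + 20 * a4) a3"
      by (simp add: P_def algebra_simps)
    finally show ?thesis .
  qed
  have scP: "elt_scale c (P a0 a1 a2 a3 a4) = P (c * a0) (c * a1) (c * a2) (c * a3) (c * a4)" for c a0 a1 a2 a3 a4
    by (simp add: P_def algebra_simps)
  \<comment> \<open>Lagrange interpolation at the roots 0, 2, -2, 4, -4. For instance 0 gives (X^2 -
    4) (X^2 - 16) / 64 and 4 gives X (X + 4) (X^2 - 4) / 384; \<open>y m\<close> belongs to the root
    \<open>2 * m\<close>.\<close>
  define y :: "int \<Rightarrow> 'a elt" where "y m =
     (if m = 0 then P 1 0 (- 20 / 64) 0 (1 / 64)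
      else if m = 1 then P 0 (32 / 96) (16 / 96) (- 2 / 96) (- 1 / 96)
      else if m = - 1 then P 0 (- 32 / 96) (16 / 96) (2 / 96) (- 1 / 96)
      else if m = 2 then P 0 (- 16 / 384) (- 4 / 384) (4 / 384) (1 / 384)
      else if m = - 2 then P 0 (16 / 384) (- 4 / 384) (- 4 / 384) (1 / 384) else 0)" for m
  have "y m \<in> eig (d, 0) (2 * m)" for m
    unfolding eig_def mem_Collect_eq D_def[symmetric]
    using PL linear_on_L_0[OF linear_on_L_ad[OF L], folded D_def] by (auto simp: y_def DP scP)
  moreover have "(\<Sum>m\<in>{- 2, - 1, 0, 1, 2}. y m) = z"
    by (simp add: y_def) (simp add: P_def algebra_simps flip: scale_left_distrib)
  ultimately show ?thesis by metis
qed

lemma integral_d: "integral (d, 0)"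
  unfolding integral_def
proof (intro conjI subsetI)
  fix z assume "z \<in> L"
  then obtain y where y: "\<And>m. y m \<in> eig (d, 0) (2 * m)" "z = (\<Sum>m\<in>{- 2, - 1, 0, 1, 2}. y m)"
    using even_eig_decomposition by metis
  have "y m \<in> span (\<Union>m. eig (d, 0) m)" for m using y(1)[of m] by (blast intro: span_base)
  then show "z \<in> span (\<Union>m. eig (d, 0) m)" unfolding y(2) by (intro span_sum)
qed (use d in simp)

lemma eig_d_cases:
  assumes z: "z \<in> eig (d, 0) m" and "z \<noteq> 0"
  shows "m \<in> {- 4, - 2, 0, 2, 4}"
proof -
  have zL: "z \<in> L" and D: "br (d, 0) z = elt_scale (of_int m) z" using z by (auto simp: eig_def)
  have Dc: "br (d, 0) (elt_scale c z) = elt_scale (c * of_int m) z" for c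
    using br_sc_right[of "(d, 0)" z c] d zL D by simp
  have "elt_scale (of_int m ^ 5 - 20 * of_int m ^ 3 + 64 * of_int m) z = 0"
    using ad_d5[OF zL] by (simp add: D Dc algebra_simps power3_eq_cube eval_nat_numeral)
  then have "(of_int m :: 'a) ^ 5 - 20 * of_int m ^ 3 + 64 * of_int m = 0" using \<open>z \<noteq> 0\<close> by simp
  then have "of_int (m ^ 5 - 20 * m ^ 3 + 64 * m) = (0 :: 'a)" by simp
  then have "m ^ 5 - 20 * m ^ 3 + 64 * m = 0" by (simp only: of_int_eq_0_iff)
  then have "m * ((m - 2) * (m + 2) * ((m - 4) * (m + 4))) = 0"
    by (simp add: algebra_simps power3_eq_cube eval_nat_numeral)
  then show ?thesis by (auto simp: eq_neg_iff_add_eq_0)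
qed

lemma eig_d_L0:
  assumes "(x, 0) \<in> eig (d, 0) m" "x \<noteq> 0"
  shows "m \<in> {- 2, 0, 2}"
proof -
  have D: "ad_d x = msc (of_int m) x"
    using assms(1) br0[OF d, of "(x, 0)"] by (simp add: eig_def elt_scale_pair)
  have "msc 4 (ad_d x) = msc (of_int (m ^ 3)) x"
    using ad3[of x] by (simp add: D msc_mult_left msc_mult_right msc_msc power3_eq_cube flip: msc_diff)
  then have "msc (of_int (m ^ 3 - 4 * m)) x = 0"
    by (auto simp: D msc_msc vec_eq_iff left_diff_distrib mult.commute)
  then have "of_int (m ^ 3 - 4 * m) = (0 :: 'a)" using assms(2) by (auto simp: vec_eq_iff)
  moreover have "m \<in> {- 4, - 2, 0, 2, 4}"
    by (rule eig_d_cases[OF assms(1)]) (use assms(2) in \<open>simp add: prod_eq_iff\<close>)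
  ultimately show ?thesis by (auto simp: power3_eq_cube)
qed

text \<open>Conjugation by l^d is l^(ad d). On tensors this is \<open>ext4_map_eigenvector\<close>
  with \<open>s + t = l\<close> and \<open>s - t = 1 / l\<close>; on matrices the eigenvalues are 0
  and \<plusminus>2, and \<open>x\<close> commutes or anticommutes with \<open>d\<close>
  accordingly.\<close>

lemma diamond_delta_eig:
  assumes z: "z \<in> eig (d, 0) m" and l: "l \<noteq> 0"
  shows "diamond (delta d l) z = elt_scale (l powi m) z"
proof (cases "z = 0")
  case True
  then show ?thesis
    using linear_on_L_0[OF linear_diamond[OF delta_inverse[OF dd l]]] by simp
next
  case False
  let ?s = "(l + inverse l) / 2" and ?t = "(l - inverse l) / 2"
  define x w where "x = fst z" and "w = snd z"
  have m: "m \<in> {- 4, - 2, 0, 2, 4}" by (rule eig_d_cases[OF z False])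
  have D: "ad_d x = msc (of_int m) x" "act d w = tensor_scale (of_int m) w"
    using z br0[OF d, of z] by (auto simp: eig_def x_def w_def prod_eq_iff elt_scale_def msc_def)
  have st: "?s + ?t = l" "?s - ?t = inverse l" by (simp_all add: field_simps)
  have pow: "l powi 4 = l ^ 4" "l powi 2 = l ^ 2" "l powi (- 2) = inverse l ^ 2" "l powi (- 4) = inverse l ^ 4"
    by (simp_all add: power_int_def)
  have m': "of_int m \<in> {- 4, - 2, 0, 2, 4 :: 'a}" using m by auto
  have "ext4_map (delta d l) w = tensor_scale (l powi m) w"
  proof -
    have inv: "l * l * (inverse l * inverse l) = 1" using l by (simp add: field_simps)
    consider "m = 4" | "m = 2" | "m = 0" | "m = - 2" | "m = - 4" using m by auto
    then show ?thesis
      unfolding delta_def ext4_map_eigenvector[OF dd D(2) m'] st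
      by cases (use l in \<open>simp_all add: power_int_def power2_eq_square power3_eq_cube inv\<close>)
  qed
  moreover have "delta d l ** x ** delta d (inverse l) = msc (l powi m) x"
  proof (cases "x = 0")
    case False
    have xL: "x \<in> L0" using z by (simp add: eig_def mem_L x_def)
    have "(x, 0) \<in> eig (d, 0) m" by (simp add: eig_def xL br0[OF d] D(1) elt_scale_pair act_0)
    then have "m \<in> {- 2, 0, 2}" using eig_d_L0 False by blast
    let ?s = "(l + inverse l) / 2" and ?t = "(l - inverse l) / 2"
    have delta': "delta d (inverse l) = msc ?s (mat 1) + msc (- ?t) d"
    proof -
      have "(inverse l - l) / 2 = - ?t" by (metis minus_diff_eq minus_divide_left)
      then show ?thesis
        unfolding delta_def inverse_inverse_eq by (simp only: add.commute[of "inverse l" l])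
    qed
    have expand: "delta d l ** x ** delta d (inverse l) =
        msc (?s * ?s) x + msc (?s * ?t) (ad_d x) - msc (?t * ?t) (d ** x ** d)"
      unfolding delta' unfolding delta_def sandwich_expand by (simp add: vec_eq_iff algebra_simps)
    have left: "x - d ** x ** d = msc (of_int m) (d ** x)" and right: "d ** x ** d - x = msc (of_int m) (x ** d)"
      using arg_cong[OF D(1), of "\<lambda>y. d ** y"] arg_cong[OF D(1), of "\<lambda>y. y ** d"]
      by (simp_all add: matrix_diff_ldistrib matrix_diff_rdistrib dd_left msc_mult_left msc_mult_right)
        (simp_all add: matrix_mul_assoc[symmetric] dd)
    show ?thesis
    proof (cases "m = 0")
      case True
      then have "d ** x ** d = x" using left by (simp add: msc_0)
      moreover have "?s * ?s - ?t * ?t = 1" using l by (simp add: field_simps)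
      then have "msc (?s * ?s) x - msc (?t * ?t) x = x" by (simp only: msc_diff_left[symmetric] msc_1)
      ultimately show ?thesis unfolding expand D(1) using True by (simp add: msc_0 msc_1 msc_msc)
    next
      case False
      then have me: "m = 2 \<or> m = - 2" using \<open>m \<in> {- 2, 0, 2}\<close> by auto
      \<comment> \<open>Multiplying \<open>d ** x - x ** d = m x\<close> by \<open>d\<close> from
        the left and from the right and adding shows that \<open>x\<close> anticommutes with
        \<open>d\<close> when \<open>m\<close> is not 0.\<close>
      have "msc (of_int m) (d ** x + x ** d) = 0" unfolding msc_add left[symmetric] right[symmetric] by simp
      then have "x ** d = - (d ** x)" using False by (simp add: vec_eq_iff eq_neg_iff_add_eq_0 add.commute)
      then have dx: "d ** x = msc (of_int m / 2) x" using D(1) by (simp add: vec_eq_iff field_simps)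
      have "msc (of_int m) (d ** x) = msc 2 x" unfolding dx msc_msc using me by auto
      then have e: "x - d ** x ** d = msc 2 x" using left by simp
      have "d ** x ** d = x - (x - d ** x ** d)" by simp
      also have "\<dots> = x - msc 2 x" unfolding e ..
      finally have "d ** x ** d = x - msc 2 x" .
      then have "d ** x ** d = - x" by (simp add: vec_eq_iff)
      then show ?thesis unfolding expand D(1)
        using me l by (auto simp: vec_eq_iff power_int_def power2_eq_square field_simps)
    qed
  qed simp
  ultimately show ?thesis
    unfolding diamond_eq[OF delta_inverse[OF dd l]] by (simp add: x_def w_def elt_scale_def msc_def)
qed

text \<open>Compatibility with the bracket of two elements of L1 cannot be computed directly; it is
  inherited from the torus automorphism l^(ad d), with which the conjugation agrees on
  eigenvectors.\<close>

lemma diamond_delta_aut: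
  assumes "l \<noteq> 0"
  shows "restrict (diamond (delta d l)) L \<in> lie_auts elt_scale L br"
proof -
  obtain f where f: "f \<in> lie_auts elt_scale L br" "\<And>m z. z \<in> eig (d, 0) m \<Longrightarrow> f z = elt_scale (l powi m) z"
    using torus_aut[OF integral_d assms] by metis
  have "f z = diamond (delta d l) z" if "z \<in> L" for z
    by (rule integral_eqI[OF integral_d lie_autsD(1)[OF f(1)] linear_diamond[OF delta_inverse[OF dd assms]] _ that])
      (simp add: f(2) diamond_delta_eig[OF _ assms])
  then have "restrict (diamond (delta d l)) L = restrict f L" by (intro restrict_ext) simp
  also have "\<dots> = f" using f(1) by (auto simp: lie_auts_def Bij_def extensional_restrict)
  finally show ?thesis using f(1) by simp
qed

text \<open>For a square root \<open>i\<close> of -1 one has \<open>delta d i = i d\<close>, and the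
  scalar disappears in \<open>diamond\<close> because \<open>i^4 = 1\<close>. So an involution of
  sp_8 lies itself on the one-parameter group that it generates, and its conjugation is an
  automorphism of L.\<close>

lemma diamond_delta_imaginary:
  assumes "i ^ 2 = (- 1 :: 'a)"
  shows "diamond (delta d i) z = diamond d z" "i \<noteq> 0"
proof -
  show "i \<noteq> 0" using assms by auto
  then have "inverse i = - i" using assms by (simp add: field_simps power2_eq_square)
  then have "delta d i = msc i d" by (simp add: delta_def msc_0)
  moreover have "i ^ 4 = 1" using assms by (metis mult.assoc mult_minus_left mult_1 minus_minus power4_eq_xxxx power2_eq_square)
  ultimately show "diamond (delta d i) z = diamond d z" using diamond_msc[OF dd] by simp
qed

lemma diamond_aut: "restrict (diamond d) L \<in> lie_auts elt_scale L br"
proof -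
  obtain i :: 'a where i: "i ^ 2 = - 1" using ex_imaginary_unit by blast
  show ?thesis using diamond_delta_aut[OF diamond_delta_imaginary(2)[OF i]]
    by (simp add: diamond_delta_imaginary(1)[OF i] cong: restrict_cong)
qed

lemma diamond_eig:
  assumes "z \<in> eig (d, 0) (2 * m)"
  shows "diamond d z = elt_scale ((- 1) powi m) z"
proof -
  obtain i :: 'a where i: "i ^ 2 = - 1" using ex_imaginary_unit by blast
  have "i powi (2 * m) = (i powi 2) powi m" by (rule power_int_mult)
  also have "i powi 2 = - 1" using i by (simp add: power_int_def)
  finally have "i powi (2 * m) = (- 1) powi m" .
  then show ?thesis
    using diamond_delta_eig[OF assms diamond_delta_imaginary(2)[OF i]] diamond_delta_imaginary(1)[OF i]
    by simp
qed

end

end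

section \<open>Special elements of the symplectic algebra\<close>

text \<open>\<open>F\<^sup>8\<close> is the tensor product of three symplectic planes \<open>E\<close>, \<open>E'\<close>, \<open>W\<close>: the blocks 1, 2, 3, 4
  are \<open>e\<^sub>1 e'\<^sub>1, e\<^sub>2 e'\<^sub>2, e\<^sub>1 e'\<^sub>2, - e\<^sub>2 e'\<^sub>1\<close> and \<open>W\<close> is the position in a block. With this in mind, \<open>dE\<close>,
  \<open>dE'\<close>, \<open>gW \<sigma>\<^sub>2\<close> are the diagonal involutions and \<open>sE\<close>, \<open>sE'\<close>, \<open>gW \<sigma>\<^sub>1\<close> the swaps of the basis in
  one factor, and \<open>sEW\<close> exchanges \<open>E\<close> with \<open>W\<close> (after applying \<open>dE'\<close>, which puts it into \<open>sp\<^sub>8\<close>).\<close>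

definition dg :: "'a::field \<Rightarrow> 'a \<Rightarrow> 'a \<Rightarrow> 'a \<Rightarrow> 'a ^ 4 ^ 4" where
  "dg a b c d = (\<chi> i j. if i = j then (if i = 1 then a else if i = 2 then b else if i = 3 then c else d) else 0)"

definition pE :: "'a::field ^ 4 ^ 4" where "pE = dg 1 (- 1) 1 (- 1)"
definition pE' :: "'a::field ^ 4 ^ 4" where "pE' = dg 1 (- 1) (- 1) 1"
definition qE :: "'a::field ^ 4 ^ 4" where "qE = eu 2 3 + eu 3 2 - eu 4 1 - eu 1 4"
definition qE' :: "'a::field ^ 4 ^ 4" where "qE' = eu 1 3 + eu 3 1 - eu 2 4 - eu 4 2"

definition dE :: "'a::field mat8" where "dE = kron pE (mat 1)"
definition dE' :: "'a::field mat8" where "dE' = kron pE' (mat 1)"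
definition sE :: "'a::field mat8" where "sE = kron qE (mat 1)"
definition sE' :: "'a::field mat8" where "sE' = kron qE' (mat 1)"
definition gW :: "'a::field ^ 2 ^ 2 \<Rightarrow> 'a mat8" where "gW s = kron (mat 1) s"

definition EW_perm :: "idx \<Rightarrow> idx" where
  "EW_perm p = (if p = (1, 2) then (4, 1) else if p = (4, 1) then (1, 2) else if p = (2, 1) then (3, 2)
     else if p = (3, 2) then (2, 1) else p)"

definition EW_sign :: "idx \<Rightarrow> 'a::field" where
  "EW_sign p = (if p \<in> {(1, 1), (4, 2)} then 1 else - 1)"

definition sEW :: "'a::field mat8" where
  "sEW = (\<chi> p q. if q = EW_perm p then EW_sign p else 0)"

lemma block_diag_gW: "block_diag s = gW s"
  by (auto simp: vec_eq_iff block_diag_def gW_def mat_def)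

lemma tau_kron: "tau \<alpha> \<beta> = kron (dg \<alpha> (1 / \<alpha>) \<beta> (1 / \<beta>)) (mat 1)"
  by (auto simp: vec_eq_iff tau_def dg_def mat_def prod_eq_iff)

lemma forall_idx: "(\<forall>p :: idx. P p) \<longleftrightarrow> (\<forall>a b. P (a, b))" by simp

lemmas mat4_simps = vec_eq_iff forall_4 matrix_matrix_mult_def sum_4 transpose_def dg_def Q4_def mat_def
lemmas mat2_simps = vec_eq_iff forall_2 matrix_matrix_mult_def sum_2 transpose_def mat_def
  sigma1_def sigma2_def sigma3_def

lemma dg_mult: "dg a b c d ** dg a' b' c' d' = dg (a * a') (b * b') (c * c') (d * d')"
  by (simp add: mat4_simps)

lemma dg_one: "dg 1 1 1 1 = mat 1"
  by (simp add: mat4_simps)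

lemma pq_products:
  "pE ** pE = mat 1" "pE' ** pE' = mat 1" "qE ** qE = mat 1" "qE' ** qE' = mat 1"
  "pE ** pE' = pE' ** pE" "pE ** qE = - (qE ** pE)" "pE' ** qE = qE ** pE'" "pE' ** qE' = - (qE' ** pE')"
  "pE ** qE' = qE' ** pE" "qE ** qE' = qE' ** qE"
  by (simp_all add: mat4_simps pE_def pE'_def qE_def qE'_def)

lemma sigma_products:
  "sigma1 ** sigma1 = mat 1" "sigma2 ** sigma2 = mat 1" "sigma3 ** sigma3 = - mat 1"
  "sigma2 ** sigma1 = - (sigma1 ** sigma2)" "sigma1 ** sigma2 = sigma3"
  "sigma1 ** sigma3 = sigma2" "sigma3 ** sigma1 = - sigma2" "sigma2 ** sigma3 = - sigma1" "sigma3 ** sigma2 = sigma1"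
  by (simp_all add: mat2_simps)

lemma sigma_sp:
  "transpose sigma1 ** sigma3 = - (sigma3 ** sigma1)" "transpose sigma2 ** sigma3 = - (sigma3 ** sigma2)"
  "transpose sigma3 ** sigma3 = - (sigma3 ** sigma3)"
  by (simp_all add: mat2_simps)

lemma special_L0:
  "dE \<in> L0" "dE' \<in> L0" "sE \<in> L0" "sE' \<in> L0" "gW sigma1 \<in> L0" "gW sigma2 \<in> L0" "gW sigma3 \<in> L0"
  unfolding dE_def dE'_def sE_def sE'_def gW_def
  by (intro kron_L0_skew kron_L0_sym sigma_sp; simp add: mat4_simps pE_def pE'_def qE_def qE'_def)+

lemma special_squares:
  "dE ** dE = mat 1" "dE' ** dE' = mat 1" "sE ** sE = mat 1" "sE' ** sE' = mat 1"
  "gW sigma1 ** gW sigma1 = mat 1" "gW sigma2 ** gW sigma2 = mat 1"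
  unfolding dE_def dE'_def sE_def sE'_def gW_def kron_mult
  by (simp_all add: pq_products sigma_products kron_one)

lemma special_commute:
  "dE ** dE' = dE' ** dE" "dE ** sE = - (sE ** dE)" "dE' ** sE = sE ** dE'" "dE' ** sE' = - (sE' ** dE')"
  "dE ** sE' = sE' ** dE" "sE ** sE' = sE' ** sE"
  "dE ** gW s = gW s ** dE" "dE' ** gW s = gW s ** dE'" "sE ** gW s = gW s ** sE" "sE' ** gW s = gW s ** sE'"
  unfolding dE_def dE'_def sE_def sE'_def gW_def kron_mult
  by (simp_all add: pq_products kron_neg)

lemma EW_perm_EW_perm: "EW_perm (EW_perm p) = p" and EW_sign_EW_perm: "EW_sign (EW_perm p) = EW_sign p"
  by (auto simp: EW_perm_def EW_sign_def)

lemma EW_sign_square: "EW_sign p * EW_sign p = (1 :: 'a::field)"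
  by (simp add: EW_sign_def)

lemma sEW_mult_left: "(sEW ** x) $ p $ q = EW_sign p * x $ (EW_perm p) $ q"
  by (simp add: sEW_def matrix_matrix_mult_def if_distrib[of "\<lambda>x. x * _"] cong: if_cong)

lemma sEW_mult_right: "(x ** sEW) $ p $ q = x $ p $ (EW_perm q) * EW_sign q"
proof -
  have "(q = EW_perm t) = (t = EW_perm q)" for t using EW_perm_EW_perm by metis
  then show ?thesis
    by (simp add: sEW_def matrix_matrix_mult_def if_distrib[of "\<lambda>x. _ * x"] EW_sign_EW_perm cong: if_cong)
qed

lemma sEW_square: "sEW ** sEW = (mat 1 :: 'a::field mat8)"
proof -
  have "(sEW ** sEW :: 'a mat8) $ p $ q = mat 1 $ p $ q" for p q :: idx
    unfolding sEW_mult_left by (auto simp: sEW_def EW_perm_EW_perm EW_sign_EW_perm EW_sign_square mat_def)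
  then show ?thesis by (simp add: vec_eq_iff)
qed

lemma sEW_transpose: "transpose sEW = sEW"
proof -
  have "(q = EW_perm p) = (p = EW_perm q)" for p q using EW_perm_EW_perm by metis
  then show ?thesis by (auto simp: vec_eq_iff transpose_def sEW_def EW_sign_EW_perm)
qed

lemma sEW_L0: "sEW \<in> L0"
  unfolding L0_iff sEW_transpose
  by (simp only: vec_eq_iff forall_idx forall_4 forall_2 vector_add_component sEW_mult_left sEW_mult_right)
    (simp add: C_mat_kron Q4_def sigma3_def EW_perm_def EW_sign_def)

lemma sEW_conj: "gW sigma2 ** sEW = sEW ** dE" "gW sigma1 ** sEW = sEW ** sE" "dE' ** sEW = sEW ** dE'"
  "dE ** sEW = sEW ** gW sigma2"
  unfolding vec_eq_iff sEW_mult_left sEW_mult_right forall_idx forall_4 forall_2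
  by (simp_all add: gW_def sigma2_def sigma1_def dE_def dE'_def sE_def pE_def pE'_def qE_def dg_def
      EW_perm_def EW_sign_def mat_def)

section \<open>Highest weight vectors\<close>

lemma sum_diagonal:
  assumes "\<And>q. q \<noteq> p \<Longrightarrow> x $ p $ q = 0"
  shows "(\<Sum>t\<in>UNIV. x $ p $ t * g t) = x $ p $ p * (g p :: 'a::field)"
  by (subst sum.remove[of _ p]) (use assms in auto)

lemma diagonal_mult:
  fixes d :: "'a::field mat8"
  assumes "\<And>p q. p \<noteq> q \<Longrightarrow> d $ p $ q = 0"
  shows "(d ** x) $ p $ q = d $ p $ p * x $ p $ q" "(x ** d) $ p $ q = x $ p $ q * d $ q $ q"
  unfolding matrix_matrix_mult_def vec_lambda_beta
  by (simp_all add: sum_diagonal assms) (subst sum.remove[of _ q]; simp add: assms)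

lemma act_diagonal:
  assumes "\<And>p q. p \<noteq> q \<Longrightarrow> x $ p $ q = 0"
  shows "act x w $ p $ q $ r $ s = (x $ p $ p + x $ q $ q + x $ r $ r + x $ s $ s) * w $ p $ q $ r $ s"
  using assms by (simp add: act_slots slot_defs sum_diagonal distrib_right)

lemma Ext4_swap:
  assumes "w \<in> Ext4"
  shows "w $ q $ p $ r $ s = - w $ p $ q $ r $ s" "w $ p $ r $ q $ s = - w $ p $ q $ r $ s"
    "w $ p $ q $ s $ r = - w $ p $ q $ r $ s"
  using assms unfolding Ext4_def by blast+

lemma Ext4_repeat:
  fixes w :: "'a::field_char_0 tensor4"
  assumes w: "w \<in> Ext4"
  shows "w $ p $ p $ r $ s = 0" "w $ r $ p $ p $ s = 0" "w $ r $ s $ p $ p = 0"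
    "w $ p $ r $ p $ s = 0" "w $ r $ p $ s $ p = 0" "w $ p $ r $ s $ p = 0"
proof -
  have *: "a = 0" if "a = - a" for a :: 'a
  proof -
    have "a + a = a + - a" by (rule arg_cong[OF that])
    then have "2 * a = 0" unfolding mult_2 by (simp only: add.right_inverse)
    then show ?thesis by simp
  qed
  show 1: "w $ p $ p $ r $ s = 0" "w $ r $ p $ p $ s = 0" "w $ r $ s $ p $ p = 0" for p r s
    using Ext4_swap[OF w] * by blast+
  show "w $ p $ r $ p $ s = 0" using Ext4_swap(1)[OF w, of p r p s] 1 by simp
  show 2: "w $ r $ p $ s $ p = 0" for r s using Ext4_swap(3)[OF w, of r p s p] 1 by simp
  show "w $ p $ r $ s $ p = 0" using Ext4_swap(1)[OF w, of p r s p] 2 by simp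
qed

text \<open>The four indices are those of blocks 1 and 3, on which \<open>dE\<close> is 1; they span
  a Lagrangian subspace. Up to sign this is the one coefficient that an alternating tensor of
  \<open>dE\<close>-weight 4 can have.\<close>

definition top_coeff :: "'a::field tensor4 \<Rightarrow> 'a" where
  "top_coeff w = w $ (1, 1) $ (1, 2) $ (3, 1) $ (3, 2)"

lemma dE_nth: "dE $ p $ q = (if p = q then (if fst p \<in> {1, 3} then 1 else - 1) else (0 :: 'a::field))"
proof -
  have "(dg 1 (- 1) 1 (- 1) :: 'a ^ 4 ^ 4) $ i $ j = (if i = j then (if i \<in> {1, 3} then 1 else - 1) else 0)" for i j :: 4
    using exhaust_4[of i] by (auto simp: dg_def)
  then show ?thesis by (auto simp: dE_def pE_def mat_def prod_eq_iff)
qed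

lemma weight4_support:
  fixes w :: "'a::field_char_0 tensor4"
  assumes "act dE w = tensor_scale 4 w" and "\<not> (fst p \<in> {1, 3} \<and> fst q \<in> {1, 3} \<and> fst r \<in> {1, 3} \<and> fst s \<in> {1, 3})"
  shows "w $ p $ q $ r $ s = 0"
proof -
  have "(dE $ p $ p + dE $ q $ q + dE $ r $ r + dE $ s $ s) * w $ p $ q $ r $ s = 4 * w $ p $ q $ r $ s"
    using act_diagonal[of dE w p q r s] assms(1) by (simp add: dE_nth)
  then have "((if fst p \<in> {1, 3} then 1 else - 1) + (if fst q \<in> {1, 3} then 1 else - 1) +
      (if fst r \<in> {1, 3} then 1 else - 1) + (if fst s \<in> {1, 3} then 1 else - 1) - 4) * w $ p $ q $ r $ s = 0"
    unfolding dE_nth by (simp add: left_diff_distrib)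
  moreover have "(if fst p \<in> {1, 3} then 1 else - 1) + (if fst q \<in> {1, 3} then 1 else - 1) +
      (if fst r \<in> {1, 3} then 1 else - 1) + (if fst s \<in> {1, 3} then 1 else - 1) - 4 \<noteq> (0 :: 'a)"
    using assms(2) by (auto split: if_splits)
  ultimately show ?thesis by (simp only: mult_eq_0_iff) blast
qed

text \<open>Weight 4 forces all four indices into blocks 1 and 3, and alternation then leaves the
  permutations of a single coefficient.\<close>

lemma weight4_eq_0:
  fixes w :: "'a::field_char_0 tensor4"
  assumes w: "w \<in> Ext4" "act dE w = tensor_scale 4 w" and 0: "top_coeff w = 0"
  shows "w = 0"
proof -
  let ?B = "{(1, 1), (1, 2), (3, 1), (3, 2)} :: idx set"
  \<comment> \<open>The pairs in decreasing order. Restricted to them, the sign rules can be used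
    for rewriting: they sort the indices instead of looping.\<close>
  let ?pairs = "{((1, 2), (1, 1)), ((3, 1), (1, 1)), ((3, 2), (1, 1)), ((3, 1), (1, 2)), ((3, 2), (1, 2)), ((3, 2), (3, 1))} :: (idx \<times> idx) set"
  have sorts: "\<forall>(q, p)\<in>?pairs. \<forall>r s. w $ q $ p $ r $ s = - w $ p $ q $ r $ s"
    "\<forall>(q, p)\<in>?pairs. \<forall>r s. w $ r $ q $ p $ s = - w $ r $ p $ q $ s"
    "\<forall>(q, p)\<in>?pairs. \<forall>r s. w $ r $ s $ q $ p = - w $ r $ s $ p $ q"
    using Ext4_swap[OF w(1)] by fast+
  have B: "\<forall>p\<in>?B. \<forall>q\<in>?B. \<forall>r\<in>?B. \<forall>s\<in>?B. w $ p $ q $ r $ s = 0"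
    using sorts[simplified] 0 unfolding top_coeff_def
    by (simp add: Ext4_repeat[OF w(1)])
  have inB: "p \<in> ?B" if "fst p \<in> {1, 3}" for p :: idx
    using that exhaust_2[of "snd p"] by (cases p) auto
  have "w $ p $ q $ r $ s = 0" for p q r s
    using weight4_support[OF w(2), of p q r s] B inB by blast
  then show ?thesis by (simp add: vec_eq_iff)
qed

lemma weight4_line:
  fixes v w :: "'a::field_char_0 tensor4"
  assumes v: "v \<in> Ext4" "act dE v = tensor_scale 4 v" "v \<noteq> 0" and w: "w \<in> Ext4" "act dE w = tensor_scale 4 w"
  shows "w = tensor_scale (top_coeff w / top_coeff v) v"
proof -
  let ?c = "top_coeff w / top_coeff v"
  have n: "top_coeff v \<noteq> 0" using weight4_eq_0[OF v(1,2)] v(3) by blast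
  let ?u = "w + tensor_scale (- ?c) v"
  have "?u \<in> Ext4"
    unfolding Ext4_def
  proof (intro CollectI allI conjI)
    fix p q r s
    show "?u $ q $ p $ r $ s = - ?u $ p $ q $ r $ s"
      by (simp add: Ext4_swap(1)[OF v(1), where q=q and p=p and r=r and s=s]
          Ext4_swap(1)[OF w(1), where q=q and p=p and r=r and s=s])
    show "?u $ p $ r $ q $ s = - ?u $ p $ q $ r $ s"
      by (simp add: Ext4_swap(2)[OF v(1), where q=q and p=p and r=r and s=s]
          Ext4_swap(2)[OF w(1), where q=q and p=p and r=r and s=s])
    show "?u $ p $ q $ s $ r = - ?u $ p $ q $ r $ s"
      by (simp add: Ext4_swap(3)[OF v(1), where q=q and p=p and r=r and s=s]
          Ext4_swap(3)[OF w(1), where q=q and p=p and r=r and s=s])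
  qed
  moreover have "act dE ?u = tensor_scale 4 ?u"
    by (simp add: act_add act_scale v(2) w(2)) (simp add: vec_eq_iff algebra_simps)
  moreover have "top_coeff ?u = 0" using n by (simp add: top_coeff_def)
  ultimately have "?u = 0" by (rule weight4_eq_0)
  then show ?thesis by (simp add: vec_eq_iff eq_neg_iff_add_eq_0 add_eq_0_iff)
qed

text \<open>An off-diagonal entry of \<open>x\<close> either repeats an index, where the alternating
  tensor vanishes, or leaves blocks 1 and 3, where a tensor of weight 4 vanishes. What remains is
  the trace of \<open>x\<close> on the Lagrangian subspace.\<close>

lemma act_weight4:
  fixes v :: "'a::field_char_0 tensor4"
  assumes v: "v \<in> Ext4" "act dE v = tensor_scale 4 v"
  shows "top_coeff (act x v) =
    (x $ (1, 1) $ (1, 1) + x $ (1, 2) $ (1, 2) + x $ (3, 1) $ (3, 1) + x $ (3, 2) $ (3, 2)) * top_coeff v"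
  unfolding top_coeff_def
  by (simp only: act_slots slot_defs vector_add_component vec_lambda_beta sum_idx sum_4 sum_2)
    (simp add: weight4_support[OF v(2)] Ext4_repeat[OF v(1)] distrib_right)

lemma ext4_map_act:
  assumes "f ** g = mat 1"
  shows "ext4_map f (act x w) = act (f ** x ** g) (ext4_map f w)"
proof -
  have gf: "g ** f = mat 1" using assms by (simp add: matrix_left_right_inverse)
  have "f ** x = (f ** x ** g) ** f" by (simp add: matrix_mul_assoc[symmetric] gf)
  then have *: "slot1 f (slot1 x v) = slot1 (f ** x ** g) (slot1 f v)"
    "slot2 f (slot2 x v) = slot2 (f ** x ** g) (slot2 f v)"
    "slot3 f (slot3 x v) = slot3 (f ** x ** g) (slot3 f v)"
    "slot4 f (slot4 x v) = slot4 (f ** x ** g) (slot4 f v)" for v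
    unfolding slot_mult[symmetric] by simp_all
  show ?thesis
    by (simp add: ext4_map_slots act_slots slot_add slot_commute *)
qed

section \<open>An element of \<open>L\<^sub>1\<close> with integral adjoint action\<close>

context E6
begin

lemma special_L [simp]:
  "(dE, 0) \<in> L" "(dE', 0) \<in> L" "(sE, 0) \<in> L" "(sE', 0) \<in> L" "(gW sigma1, 0) \<in> L" "(gW sigma2, 0) \<in> L"
  by (simp_all add: special_L0)

lemma eig_dE_L1: "(0, w) \<in> eig (dE, 0) m \<longleftrightarrow> w \<in> L1 \<and> act dE w = tensor_scale (of_int m) w"
  by (auto simp: eig_def br0[OF special_L0(1)] elt_scale_pair)

lemma eig_dE_L0: "(x, 0) \<in> eig (dE, 0) m \<longleftrightarrow> x \<in> L0 \<and> dE ** x - x ** dE = msc (of_int m) x"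
  by (auto simp: eig_def br0[OF special_L0(1)] elt_scale_pair act_0)

text \<open>The highest weight vector. Only the value 4 of its weight at \<open>dE\<close> is
  retained, since this eigenvalue already has a one-dimensional eigenspace by
  \<open>weight4_line\<close>.\<close>

definition hw :: "'a tensor4" where
  "hw = (SOME v. v \<in> L1 \<and> v \<noteq> 0 \<and> act dE v = tensor_scale 4 v)"

lemma hw: "hw \<in> L1" "hw \<noteq> 0" "act dE hw = tensor_scale 4 hw"
proof -
  obtain v where v: "v \<in> L1" "v \<noteq> 0" "\<And>h. h \<in> L0_diagonal \<Longrightarrow> act h v = tensor_scale (lambda4 h) v"
    using is_L1 unfolding is_L1_def by blast
  have "(dE :: 'a mat8) \<in> L0_diagonal" using special_L0(1) by (simp add: L0_diagonal_def dE_nth)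
  from v(3)[OF this] have "act dE v = tensor_scale 4 v" by (simp add: lambda4_def dE_nth)
  then have "\<exists>v. v \<in> L1 \<and> v \<noteq> 0 \<and> act dE v = tensor_scale 4 v" using v by blast
  from someI_ex[OF this] show "hw \<in> L1" "hw \<noteq> 0" "act dE hw = tensor_scale 4 hw"
    unfolding hw_def by auto
qed

text \<open>\<open>sE\<close> conjugates \<open>dE\<close> into its negative, so this is a lowest
  weight vector.\<close>

definition lw :: "'a tensor4" where "lw = ext4_map sE hw"

lemma aut_snd: "restrict (diamond f) L \<in> lie_auts elt_scale L br \<Longrightarrow> w \<in> L1 \<Longrightarrow> ext4_map f w \<in> L1"
  using lie_autsD(2)[of "restrict (diamond f) L" "(0, w)"] by (simp add: diamond_def mem_L)

lemma aut_fst: "restrict (diamond f) L \<in> lie_auts elt_scale L br \<Longrightarrow> x \<in> L0 \<Longrightarrow> f ** g = mat 1 \<Longrightarrow> f ** x ** g \<in> L0"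
  using lie_autsD(2)[of "restrict (diamond f) L" "(x, 0)"] by (simp add: diamond_eq mem_L)

lemma sE_aut: "restrict (diamond sE) L \<in> lie_auts elt_scale L br"
  by (rule diamond_aut[OF special_L0(3) special_squares(3)])

lemma sE_dE_sE: "sE ** dE ** sE = - (dE :: 'a mat8)"
proof -
  have "sE ** dE = - (dE ** (sE :: 'a mat8))" by (simp add: special_commute)
  then show ?thesis
    by (simp add: matrix_neg_left) (simp add: matrix_mul_assoc[symmetric] special_squares)
qed

lemma lw: "lw \<in> L1" "act dE lw = tensor_scale (- 4) lw" "ext4_map sE lw = hw"
proof -
  show "lw \<in> L1" unfolding lw_def by (rule aut_snd[OF sE_aut hw(1)])
  show "ext4_map sE lw = hw"
    unfolding lw_def by (simp add: ext4_map_mult[symmetric] special_squares ext4_map_one)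
  have "act (- dE) lw = tensor_scale 4 lw"
    using ext4_map_act[OF special_squares(3), of dE hw] unfolding sE_dE_sE hw(3) ext4_map_scale lw_def by simp
  then show "act dE lw = tensor_scale (- 4) lw"
    using act_msc[of "- 1" dE lw] by (auto simp: msc_neg msc_1 vec_eq_iff)
qed

lemma hw_line: "w \<in> L1 \<Longrightarrow> act dE w = tensor_scale 4 w \<Longrightarrow> \<exists>c. w = tensor_scale c hw"
  using weight4_line[OF L1_Ext4[OF hw(1)] hw(3,2) L1_Ext4] by blast

lemma lw_line:
  assumes "w \<in> L1" "act dE w = tensor_scale (- 4) w"
  shows "\<exists>c. w = tensor_scale c lw"
proof -
  have "act (- dE) (ext4_map sE w) = tensor_scale (- 4) (ext4_map sE w)"
    using ext4_map_act[OF special_squares(3), of dE w] unfolding sE_dE_sE assms(2) ext4_map_scale by simp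
  then have "act dE (ext4_map sE w) = tensor_scale 4 (ext4_map sE w)"
    using act_msc[of "- 1" dE "ext4_map sE w"] by (auto simp: msc_neg msc_1 vec_eq_iff)
  then obtain c where "ext4_map sE w = tensor_scale c hw" using hw_line aut_snd[OF sE_aut assms(1)] by blast
  then have "ext4_map sE (ext4_map sE w) = tensor_scale c lw" by (simp add: ext4_map_scale lw_def)
  then show ?thesis by (auto simp: ext4_map_mult[symmetric] special_squares ext4_map_one)
qed

text \<open>The trace on the Lagrangian subspace of blocks 1 and 3. The centralizer of
  \<open>dE\<close> in sp_8 is gl_4, and \<open>nu\<close> is the character by which it acts on
  \<open>hw\<close>.\<close>

definition nu :: "'a mat8 \<Rightarrow> 'a" where
  "nu x = x $ (1, 1) $ (1, 1) + x $ (1, 2) $ (1, 2) + x $ (3, 1) $ (3, 1) + x $ (3, 2) $ (3, 2)"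

lemma act_hw:
  assumes "x \<in> L0" "dE ** x = x ** dE"
  shows "act x hw = tensor_scale (nu x) hw"
proof -
  have "act dE (act x hw) = tensor_scale 4 (act x hw)"
    using act_commutator[of dE x hw] assms by (simp add: hw(3) act_scale act_0)
  then obtain c where c: "act x hw = tensor_scale c hw" using hw_line L1_act[OF assms(1) hw(1)] by blast
  have "nu x * top_coeff hw = top_coeff (act x hw)"
    unfolding nu_def by (rule act_weight4[OF L1_Ext4[OF hw(1)] hw(3), symmetric])
  also have "\<dots> = c * top_coeff hw" unfolding c by (simp add: top_coeff_def)
  finally have "nu x * top_coeff hw = c * top_coeff hw" .
  moreover have "top_coeff hw \<noteq> 0" using weight4_eq_0[OF L1_Ext4[OF hw(1)] hw(3)] hw(2) by blast
  ultimately have "nu x = c" by (metis mult_right_cancel)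
  then show ?thesis using c by simp
qed

lemma L0_diagonal_entries:
  fixes x :: "'a mat8"
  assumes "x \<in> L0"
  shows "x $ (2, 2) $ (2, 2) = - x $ (1, 1) $ (1, 1)" "x $ (2, 1) $ (2, 1) = - x $ (1, 2) $ (1, 2)"
    "x $ (4, 2) $ (4, 2) = - x $ (3, 1) $ (3, 1)" "x $ (4, 1) $ (4, 1) = - x $ (3, 2) $ (3, 2)"
proof -
  have *: "(transpose x ** C_mat + C_mat ** x) $ p $ q = 0" for p q
    using assms by (simp add: L0_iff)
  show "x $ (2, 2) $ (2, 2) = - x $ (1, 1) $ (1, 1)" "x $ (2, 1) $ (2, 1) = - x $ (1, 2) $ (1, 2)"
    "x $ (4, 2) $ (4, 2) = - x $ (3, 1) $ (3, 1)" "x $ (4, 1) $ (4, 1) = - x $ (3, 2) $ (3, 2)"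
    using *[of "(1, 1)" "(2, 2)"] *[of "(1, 2)" "(2, 1)"] *[of "(3, 1)" "(4, 2)"] *[of "(3, 2)" "(4, 1)"]
    unfolding vector_add_component matrix_matrix_mult_def vec_lambda_beta sum_idx sum_4 sum_2 C_mat_kron kron_nth
    by (simp_all add: Q4_def sigma3_def transpose_def eq_neg_iff_add_eq_0 add.commute)
qed

lemma act_lw:
  assumes "x \<in> L0" "dE ** x = x ** dE"
  shows "act x lw = tensor_scale (- nu x) lw"
proof -
  let ?y = "sE ** x ** sE"
  have y: "?y \<in> L0" by (rule aut_fst[OF sE_aut assms(1) special_squares(3)])
  have "dE ** ?y = ?y ** dE"
  proof -
    have "dE ** ?y = (dE ** sE) ** x ** sE" by (simp only: matrix_mul_assoc)
    also have "\<dots> = - (sE ** (dE ** x) ** sE)"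
      unfolding special_commute(2) matrix_neg_left by (simp only: matrix_mul_assoc)
    also have "\<dots> = - (sE ** x ** (dE ** sE))" unfolding assms(2) by (simp only: matrix_mul_assoc)
    also have "\<dots> = ?y ** dE" unfolding special_commute(2) matrix_neg_right by (simp add: matrix_mul_assoc)
    finally show ?thesis .
  qed
  then have "act ?y hw = tensor_scale (nu ?y) hw" using act_hw y by blast
  moreover have "sE ** ?y ** sE = x"
    by (simp add: matrix_mul_assoc special_squares) (simp add: matrix_mul_assoc[symmetric] special_squares)
  ultimately have "act x lw = tensor_scale (nu ?y) lw"
    using ext4_map_act[OF special_squares(3), of ?y hw] by (simp add: lw_def ext4_map_scale)
  moreover have "nu ?y = - nu x"
  proof -
    \<comment> \<open>Conjugation by \<open>sE\<close> exchanges block 1 with 4 and 3 with 2; the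
      diagonal of a symplectic matrix on blocks 2 and 4 is, up to order, the negative of that on
      blocks 1 and 3.\<close>
    have diag: "?y $ (1, i) $ (1, i) = x $ (4, i) $ (4, i)" "?y $ (3, i) $ (3, i) = x $ (2, i) $ (2, i)" for i
      unfolding matrix_matrix_mult_def vec_lambda_beta sum_idx sum_4 sum_2 sE_def kron_nth
      using exhaust_2[of i] by (auto simp: qE_def mat_def)
    show ?thesis unfolding nu_def diag L0_diagonal_entries[OF assms(1)] by simp
  qed
  ultimately show ?thesis by simp
qed

text \<open>The diagonal entries \<open>1, 2, 3, 4, -1, -2, -3, -4\<close> of \<open>regular_diag\<close> are distinct, so that it
  only commutes with diagonal matrices.\<close>

definition regular_diag :: "'a mat8" where
  "regular_diag = (\<chi> p q. if p = q then (if p = (1, 1) then 1 else if p = (1, 2) then 2 else if p = (3, 1) then 3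
     else if p = (3, 2) then 4 else if p = (2, 2) then - 1 else if p = (2, 1) then - 2
     else if p = (4, 2) then - 3 else - 4) else 0)"

lemma regular_diag: "regular_diag \<in> L0" "dE ** regular_diag = regular_diag ** dE"
proof -
  have off: "regular_diag $ p $ q = 0" if "p \<noteq> q" for p q using that by (simp add: regular_diag_def)
  have left: "(regular_diag ** z) $ p $ q = regular_diag $ p $ p * z $ p $ q"
    and right: "(z ** regular_diag) $ p $ q = z $ p $ q * regular_diag $ q $ q" for p q and z :: "'a mat8"
    by (rule diagonal_mult[of regular_diag]; erule off)+
  have tr: "transpose regular_diag = regular_diag" by (simp add: vec_eq_iff transpose_def regular_diag_def)
  show "regular_diag \<in> L0"
    unfolding L0_iff tr by (simp only: vec_eq_iff forall_idx forall_4 forall_2 vector_add_component left right)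
      (simp add: C_mat_kron Q4_def sigma3_def regular_diag_def)
  show "dE ** regular_diag = regular_diag ** dE"
  proof -
    have off': "dE $ p $ q = (0 :: 'a)" if "p \<noteq> q" for p q using that by (simp add: dE_nth)
    have "(dE ** regular_diag) $ p $ q = (regular_diag ** dE) $ p $ q" for p q
      unfolding right left using off' by (cases "p = q") (simp_all add: off)
    then show ?thesis unfolding vec_eq_iff by blast
  qed
qed

text \<open>The centre of gl_4 is a line. Commuting with \<open>regular_diag\<close> makes
  \<open>y\<close> diagonal; commuting with \<open>gW sigma1\<close> and \<open>sE'\<close>, which
  permute the four coordinates of the Lagrangian transitively up to sign, makes the diagonal
  constant there, and the symplectic relations give the rest.\<close>

lemma commuting_scalar:
  fixes y :: "'a mat8"
  assumes y: "y \<in> L0" "dE ** y = y ** dE" and c: "\<And>x. x \<in> L0 \<Longrightarrow> dE ** x = x ** dE \<Longrightarrow> x ** y = y ** x"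
  shows "\<exists>c. y = msc c dE"
proof -
  have off: "regular_diag $ p $ q = 0" if "p \<noteq> q" for p q using that by (simp add: regular_diag_def)
  have left: "(regular_diag ** z) $ p $ q = regular_diag $ p $ p * z $ p $ q"
    and right: "(z ** regular_diag) $ p $ q = z $ p $ q * regular_diag $ q $ q" for p q and z :: "'a mat8"
    by (rule diagonal_mult[of regular_diag]; erule off)+
  have "regular_diag $ p $ p * y $ p $ q = y $ p $ q * regular_diag $ q $ q" for p q
    using c[OF regular_diag] by (simp flip: left right)
  then have "(regular_diag $ p $ p - regular_diag $ q $ q) * y $ p $ q = 0" for p q
    by (simp add: left_diff_distrib mult.commute)
  moreover have "regular_diag $ p $ p \<noteq> regular_diag $ q $ q" if "p \<noteq> q" for p q
  proof -
    have "\<forall>p q. p \<noteq> q \<longrightarrow> regular_diag $ p $ p \<noteq> regular_diag $ q $ q"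
      by (simp only: forall_idx forall_4 forall_2) (simp add: regular_diag_def)
    then show ?thesis using that by blast
  qed
  ultimately have diag: "y $ p $ q = 0" if "p \<noteq> q" for p q using that by (metis eq_iff_diff_eq_0 mult_eq_0_iff)
  have off_dE: "dE $ p $ q = (0 :: 'a)" if "p \<noteq> q" for p q using that by (simp add: dE_nth)
  have "gW sigma1 ** y = y ** gW sigma1" "sE' ** y = y ** sE'"
    using c special_L0 special_commute by blast+
  then have e: "(gW sigma1 ** y) $ p $ q = (y ** gW sigma1) $ p $ q" "(sE' ** y) $ p $ q = (y ** sE') $ p $ q" for p q
    by simp_all
  have "y $ (1, 2) $ (1, 2) = y $ (1, 1) $ (1, 1)" "y $ (3, 2) $ (3, 2) = y $ (3, 1) $ (3, 1)"
    "y $ (3, 1) $ (3, 1) = y $ (1, 1) $ (1, 1)"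
    using e(1)[of "(1, 1)" "(1, 2)"] e(1)[of "(3, 1)" "(3, 2)"] e(2)[of "(1, 1)" "(3, 1)"]
    unfolding matrix_matrix_mult_def vec_lambda_beta sum_idx sum_4 sum_2 gW_def sE'_def kron_nth
    by (simp_all add: mat_def sigma1_def qE'_def diag)
  then have "\<forall>p. y $ p $ p = y $ (1, 1) $ (1, 1) * dE $ p $ p"
    unfolding forall_idx forall_4 forall_2 by (simp add: L0_diagonal_entries[OF y(1)] dE_nth)
  then have D: "y $ p $ p = y $ (1, 1) $ (1, 1) * dE $ p $ p" for p by (rule spec)
  have "y $ p $ q = msc (y $ (1, 1) $ (1, 1)) dE $ p $ q" for p q
  proof (cases "p = q")
    case True
    then show ?thesis unfolding True msc_nth by (simp only: D[of q])
  next
    case False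
    then show ?thesis unfolding msc_nth diag[OF False] off_dE[OF False] by simp
  qed
  then have "y = msc (y $ (1, 1) $ (1, 1)) dE" unfolding vec_eq_iff by blast
  then show ?thesis ..
qed

section \<open>The bracket of the two extreme weight vectors\<close>

lemma B_hw_lw: "\<exists>c. B hw lw = msc c dE"
proof (rule commuting_scalar)
  have hL: "(0, hw) \<in> L" "(0, lw) \<in> L" using hw lw by simp_all
  have inv: "br (x, 0) (B hw lw, 0) = br (0, act x hw) (0, lw) + br (0, hw) (0, act x lw)" if "x \<in> L0" for x
    using jacobi'[of "(x, 0)" "(0, hw)" "(0, lw)"] that hw lw by (simp add: br01 br11)
  show y: "B hw lw \<in> L0" by (rule B_L0[OF hw(1) lw(1)])
  have comm: "x ** B hw lw = B hw lw ** x" if x: "x \<in> L0" "dE ** x = x ** dE" for x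
  proof -
    have "br (0, tensor_scale (nu x) hw) (0, lw) = elt_scale (nu x) (br (0, hw) (0, lw))"
      "br (0, hw) (0, tensor_scale (- nu x) lw) = elt_scale (- nu x) (br (0, hw) (0, lw))"
      using br_sc_left[OF hL, of "nu x"] br_sc_right[OF hL, of "- nu x"] by (simp_all add: elt_scale_pair)
    then have "br (x, 0) (B hw lw, 0) = 0"
      using inv[OF x(1)] by (simp add: act_hw[OF x] act_lw[OF x])
    then show ?thesis using x(1) y by (simp add: br00 prod_eq_iff)
  qed
  show "x ** B hw lw = B hw lw ** x" if x: "x \<in> L0" "dE ** x = x ** dE" for x using comm[OF that] .
  show "dE ** B hw lw = B hw lw ** dE" by (rule comm) (simp_all add: special_L0)
qed

text \<open>A matrix of weight -2 maps blocks 1 and 3 into blocks 2 and 4. Each of its entries,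
  times \<open>top_coeff hw\<close>, is a coefficient of \<open>act x hw\<close> in which one of the
  four indices has been replaced.\<close>

lemma weight2_injective:
  assumes x: "(x, 0) \<in> eig (dE, 0) (- 2)" and 0: "act x hw = 0"
  shows "x = 0"
proof -
  have xL: "x \<in> L0" and D: "dE ** x - x ** dE = msc (- 2) x" using x by (simp_all add: eig_dE_L0)
  have off: "dE $ p $ q = (0 :: 'a)" if "p \<noteq> q" for p q using that by (simp add: dE_nth)
  have left: "(dE ** z) $ p $ q = dE $ p $ p * z $ p $ q"
    and right: "(z ** dE) $ p $ q = z $ p $ q * dE $ q $ q" for p q and z :: "'a mat8"
    by (rule diagonal_mult[of dE]; erule off)+
  have "(dE ** x - x ** dE) $ p $ q = msc (- 2) x $ p $ q" for p q by (simp only: D)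
  then have "(dE $ p $ p - dE $ q $ q + 2) * x $ p $ q = 0" for p q
    by (simp add: left right algebra_simps)
  moreover have "dE $ p $ p - dE $ q $ q + 2 \<noteq> (0 :: 'a)" if "fst p \<in> {1, 3} \<or> fst q \<notin> {1, 3}" for p q
    using that by (auto simp: dE_nth)
  ultimately have z: "x $ p $ q = 0" if "fst p \<in> {1, 3} \<or> fst q \<notin> {1, 3}" for p q
    using that mult_eq_0_iff by blast
  define k where "k = top_coeff hw"
  have k: "k \<noteq> 0" using weight4_eq_0[OF L1_Ext4[OF hw(1)] hw(3)] hw(2) by (auto simp: k_def)
  have "x $ p $ (1, 1) = 0" "x $ p $ (1, 2) = 0" "x $ p $ (3, 1) = 0" "x $ p $ (3, 2) = 0"
    if p: "fst p \<notin> {1, 3}" for p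
  proof -
    note rules = weight4_support[OF hw(3)] Ext4_repeat[OF L1_Ext4[OF hw(1)]] z
    have e: "act x hw $ a $ b $ c $ d = 0" for a b c d by (simp add: 0)
    have "x $ p $ (1, 1) * k = 0" "x $ p $ (1, 2) * k = 0" "x $ p $ (3, 1) * k = 0" "x $ p $ (3, 2) * k = 0"
      using e[of p "(1, 2)" "(3, 1)" "(3, 2)"] e[of "(1, 1)" p "(3, 1)" "(3, 2)"]
        e[of "(1, 1)" "(1, 2)" p "(3, 2)"] e[of "(1, 1)" "(1, 2)" "(3, 1)" p] p
      unfolding act_slots slot_defs vector_add_component vec_lambda_beta sum_idx sum_4 sum_2 k_def top_coeff_def
      by (simp_all add: rules)
    then show "x $ p $ (1, 1) = 0" "x $ p $ (1, 2) = 0" "x $ p $ (3, 1) = 0" "x $ p $ (3, 2) = 0"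
      using k by auto
  qed
  moreover have "q \<in> {(1, 1), (1, 2), (3, 1), (3, 2)}" if "fst q \<in> {1, 3}" for q :: idx
    using that exhaust_2[of "snd q"] by (cases q) auto
  ultimately have "x $ p $ q = 0" for p q
    using z[of p q] by blast
  then show ?thesis by (simp add: vec_eq_iff)
qed

lemma ext4_map_0: "ext4_map f 0 = 0" for f :: "'a mat8"
  using ext4_map_scale[of f 0 0] by simp

declare special_L0 [simp]

lemmas dE_cases = eig_d_cases[OF special_L0(1) special_squares(1)]
lemmas dE_L0_cases = eig_d_L0[OF special_L0(1) special_squares(1)]
lemmas dE_decomposition = even_eig_decomposition[OF special_L0(1) special_squares(1)]

lemma eig_dE_parts:
  assumes "z \<in> eig (dE, 0) m"
  shows "(fst z, 0) \<in> eig (dE, 0) m" "(0, snd z) \<in> eig (dE, 0) m"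
proof -
  have "z \<in> L" "br (dE, 0) z = elt_scale (of_int m) z" using assms by (auto simp: eig_def)
  then show "(fst z, 0) \<in> eig (dE, 0) m" "(0, snd z) \<in> eig (dE, 0) m"
    unfolding eig_dE_L0 eig_dE_L1
    by (auto simp: br0[OF special_L0(1)] mem_L prod_eq_iff fst_elt_scale snd_elt_scale)
qed

lemma fst_sum: "fst (sum f S) = (\<Sum>i\<in>S. fst (f i))" and snd_sum: "snd (sum f S) = (\<Sum>i\<in>S. snd (f i))"
  for f :: "'i \<Rightarrow> 'a elt"
  by (induction S rule: infinite_finite_induct) auto

lemma dE_decomposition_L1:
  assumes "w \<in> L1"
  obtains u where "\<And>m. (0, u m) \<in> eig (dE, 0) (2 * m)" "w = (\<Sum>m\<in>{- 2, - 1, 0, 1, 2}. u m)"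
proof -
  obtain y where y: "\<And>m. y m \<in> eig (dE, 0) (2 * m)" "(0, w) = (\<Sum>m\<in>{- 2, - 1, 0, 1, 2}. y m)"
    using dE_decomposition[of "(0, w)"] assms by auto
  show ?thesis
  proof (rule that[of "\<lambda>m. snd (y m)"])
    show "w = (\<Sum>m\<in>{- 2, - 1, 0, 1, 2}. snd (y m))"
      using arg_cong[OF y(2), of snd] by (simp only: snd_sum snd_conv)
  qed (rule eig_dE_parts(2)[OF y(1)])
qed

lemma dE_decomposition_L0:
  assumes "x \<in> L0"
  obtains u where "\<And>m. (u m, 0) \<in> eig (dE, 0) (2 * m)" "x = (\<Sum>m\<in>{- 1, 0, 1}. u m)"
proof -
  obtain y where y: "\<And>m. y m \<in> eig (dE, 0) (2 * m)" "(x, 0) = (\<Sum>m\<in>{- 2, - 1, 0, 1, 2}. y m)"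
    using dE_decomposition[of "(x, 0)"] assms by auto
  show ?thesis
  proof (rule that[of "\<lambda>m. fst (y m)"])
    show y': "(fst (y m), 0) \<in> eig (dE, 0) (2 * m)" for m by (rule eig_dE_parts(1)[OF y(1)])
    have "fst (y 2) = 0" "fst (y (- 2)) = 0"
      using dE_L0_cases[OF y'[of 2]] dE_L0_cases[OF y'[of "- 2"]] by auto
    moreover have "x = (\<Sum>m\<in>{- 2, - 1, 0, 1, 2}. fst (y m))"
      using arg_cong[OF y(2), of fst] by (simp only: fst_sum fst_conv)
    ultimately show "x = (\<Sum>m\<in>{- 1, 0, 1}. fst (y m))" by simp
  qed
qed

text \<open>Otherwise L1 would be an ideal, neither zero nor everything, against simplicity.\<close>

lemma B_nonzero: "\<exists>v\<in>L1. \<exists>w\<in>L1. B v w \<noteq> 0"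
proof (rule ccontr)
  assume "\<not> ?thesis"
  then have 0: "B v w = 0" if "v \<in> L1" "w \<in> L1" for v w using that by blast
  let ?I = "{(0, w) | w. w \<in> L1} :: 'a elt set"
  have simp: "I = {0} \<or> I = L" if "subspace I" "I \<subseteq> L" "\<And>x y. x \<in> L \<Longrightarrow> y \<in> I \<Longrightarrow> br x y \<in> I" for I
    using simple that unfolding simple_lie_algebra_def by blast
  have "?I = {0} \<or> ?I = L"
  proof (rule simp)
    show "subspace ?I"
      by (rule subspaceI) (auto simp: zero_prod_def elt_scale_pair L1_add L1_sc)
    show "?I \<subseteq> L" by (auto simp: mem_L)
    show "br z y \<in> ?I" if zy: "z \<in> L" "y \<in> ?I" for z y
    proof -
      obtain w where w: "w \<in> L1" "y = (0, w)" using zy by auto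
      have z: "fst z \<in> L0" "snd z \<in> L1" using zy by (auto simp: mem_L)
      have "br z y = br (fst z, 0) (0, w) + br (0, snd z) (0, w)"
        using br_add_left[of "(fst z, 0)" "(0, snd z)" "(0, w)"] z w by simp
      then have "br z y = (0, act (fst z) w)" using z w 0 by (simp add: br01 br11)
      then show ?thesis using L1_act[OF z(1) w(1)] by blast
    qed
  qed
  moreover have "?I \<noteq> {0}" using hw by (auto simp: zero_prod_def)
  moreover have "dE \<noteq> (0 :: 'a mat8)"
  proof
    assume "dE = (0 :: 'a mat8)"
    then have "dE $ (1, 1) $ (1, 1) = (0 :: 'a)" by simp
    then show False by (simp add: dE_nth)
  qed
  then have "(dE, 0) \<notin> ?I" by auto
  ultimately show False by auto
qed

text \<open>If \<open>[hw, lw]\<close> vanished, then \<open>hw\<close> would commute with all of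
  L1: by weights only vectors of weight -4 and -2 need attention, and both cases reduce to the
  assumption. The elements of L1 commuting with L1 form a submodule, so the bracket on L1 would
  vanish, which \<open>B_nonzero\<close> excludes.\<close>

lemma B_hw_lw_nonzero: "\<exists>c. c \<noteq> 0 \<and> B hw lw = msc c dE"
proof -
  obtain c where c: "B hw lw = msc c dE" using B_hw_lw by blast
  have "c \<noteq> 0"
  proof
    assume "c = 0"
    then have hl: "B hw lw = 0" using c by (simp add: msc_0)
    have hL: "(0, hw) \<in> L" "(0, lw) \<in> L" using hw lw by simp_all
    have he: "(0, hw) \<in> eig (dE, 0) 4" "(0, lw) \<in> eig (dE, 0) (- 4)" using hw lw by (simp_all add: eig_dE_L1)
    have lh: "br (0, lw) (0, hw) = 0" using br_skew[OF hL] hl hw lw by (simp add: br11 zero_prod_def)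
    have B0: "B hw u = 0" if u: "(0, u) \<in> eig (dE, 0) (2 * m)" for u m
    proof (rule ccontr)
      assume n: "B hw u \<noteq> 0"
      have uL: "u \<in> L1" using u by (simp add: eig_dE_L1)
      have "(B hw u, 0) \<in> eig (dE, 0) (4 + 2 * m)"
        using eig_br[OF special_L(1) he(1) u] by (simp add: br11 hw uL)
      from dE_L0_cases[OF this n] have "m \<in> {- 3, - 2, - 1}" by auto
      moreover have "u \<noteq> 0" using n uL hw(1) br_0_right[OF hL(1)] by (auto simp: B_def zero_prod_def)
      then have "m \<in> {- 2, - 1, 0, 1, 2}" using dE_cases[OF u] by (auto simp: zero_prod_def)
      ultimately consider "m = - 2" | "m = - 1" by auto
      then show False
      proof cases
        case 1
        then obtain k where "u = tensor_scale k lw" using lw_line[OF uL] u by (auto simp: eig_dE_L1)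
        then have "br (0, hw) (0, u) = 0"
          using br_sc_right[OF hL, of k] hl hw lw by (simp add: elt_scale_pair br11) (simp add: zero_prod_def)
        then show False using n by (simp add: B_def)
      next
        case 2
        \<comment> \<open>In weight -2, \<open>[lw, u]\<close> would have weight -6 and so is 0;
          together with \<open>[lw, hw] = 0\<close> the Jacobi identity shows that \<open>?y\<close>
          kills \<open>lw\<close>. Conjugation by \<open>sE\<close> turns this into the situation of
          \<open>weight2_injective\<close>.\<close>
        let ?y = "B hw u"
        have y: "?y \<in> L0" "(?y, 0) \<in> eig (dE, 0) 2"
          using eig_br[OF special_L(1) he(1) u] B_L0[OF hw(1) uL] 2 by (simp_all add: br11 hw uL)
        have "br (0, lw) (0, u) \<in> eig (dE, 0) (- 6)" using eig_br[OF special_L(1) he(2) u] 2 by simp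
        then have lu: "br (0, lw) (0, u) = 0"
          using dE_cases[of "br (0, lw) (0, u)" "- 6"] by auto
        have "br (0, lw) (br (0, hw) (0, u)) = 0"
          using jacobi'[OF hL(2,1), of "(0, u)"] uL lh lu hL by simp
        then have "act ?y lw = 0"
          using hw uL lw y by (simp add: br11 br10 zero_prod_def)
        then have 0: "act (sE ** ?y ** sE) hw = 0"
          using ext4_map_act[OF special_squares(3), of ?y lw] by (simp add: lw(3) ext4_map_0)
        have "(sE ** ?y ** sE, 0) \<in> eig (- dE, 0) 2"
          using eig_image[OF sE_aut special_L(1) y(2)] y
          by (simp add: diamond_eq[OF special_squares(3)] sE_dE_sE ext4_map_0)
        then have "(sE ** ?y ** sE, 0) \<in> eig (dE, 0) (- 2)"
          using br_neg_left[OF special_L(1)] by (auto simp: eig_def) (metis add.inverse_inverse scale_minus_left)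
        from weight2_injective[OF this 0] have "sE ** (sE ** ?y ** sE) ** sE = 0" by simp
        then have "?y = 0"
          by (simp add: matrix_mul_assoc special_squares) (simp add: matrix_mul_assoc[symmetric] special_squares)
        then show False using n by simp
      qed
    qed
    have hw0: "br (0, hw) (0, w) = 0" if w: "w \<in> L1" for w
    proof -
      obtain u where u: "\<And>m. (0, u m) \<in> eig (dE, 0) (2 * m)" "w = (\<Sum>m\<in>{- 2, - 1, 0, 1, 2}. u m)"
        using dE_decomposition_L1[OF w] by blast
      have uL: "u m \<in> L1" for m using u(1) by (simp add: eig_dE_L1)
      have "(0, w) = (\<Sum>m\<in>{- 2, - 1, 0, 1, 2}. (0, u m))" unfolding u(2) by (simp add: prod_eq_iff)
      moreover have "br (0, hw) (0, u m) = 0" for m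
        using B0[OF u(1)] by (simp add: br11 hw uL zero_prod_def)
      ultimately show ?thesis
        using linear_on_L_sum[OF linear_on_L_ad[OF hL(1)], of "{- 2, - 1, 0, 1, 2}" "\<lambda>m. (0, u m)"] uL by simp
    qed
    let ?U = "{v \<in> L1. \<forall>w\<in>L1. br (0, v) (0, w) = 0}"
    have "?U = L1"
    proof (rule L1_irreducible[of _ hw])
      show "ten.subspace ?U"
      proof (rule ten.subspaceI)
        show "0 \<in> ?U" using br_0_left by (simp add: zero_prod_def)
        show "v + v' \<in> ?U" if "v \<in> ?U" "v' \<in> ?U" for v v'
        proof -
          have "br (0, v + v') (0, w) = br (0, v) (0, w) + br (0, v') (0, w)" if "w \<in> L1" for w
            using br_add_left[of "(0, v)" "(0, v')" "(0, w)"] that \<open>v \<in> ?U\<close> \<open>v' \<in> ?U\<close> by simp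
          then show ?thesis using that by (simp add: L1_add)
        qed
        show "tensor_scale k v \<in> ?U" if "v \<in> ?U" for k v
        proof -
          have "br (0, tensor_scale k v) (0, w) = elt_scale k (br (0, v) (0, w))" if "w \<in> L1" for w
            using br_sc_left[of "(0, v)" "(0, w)" k] that \<open>v \<in> ?U\<close> by (simp add: elt_scale_pair)
          then show ?thesis using that by (simp add: L1_sc)
        qed
      qed
      show "act x v \<in> ?U" if x: "x \<in> L0" and v: "v \<in> ?U" for x v
      proof -
        have "br (0, act x v) (0, w) = 0" if w: "w \<in> L1" for w
          using jacobi'[of "(x, 0)" "(0, v)" "(0, w)"] x v w L1_act[OF x w] br_0_right[of "(x, 0)"]
          by (simp add: br01)
        then show ?thesis using x v by (simp add: L1_act)
      qed
      show "hw \<in> ?U" using hw0 hw(1) by simp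
    qed (use hw in auto)
    then have "v \<in> ?U" if "v \<in> L1" for v using that by (rule ssubst)
    then have "B v w = 0" if "v \<in> L1" "w \<in> L1" for v w using that by (simp add: B_def)
    then show False using B_nonzero by blast
  qed
  then show ?thesis using c by blast
qed

text \<open>Normalizes \<open>hE\<close>: with this square root \<open>ad hE\<close> squares to 1 on
  matrices of weight \<plusminus>2 and to 4 on \<open>dE\<close>, so that its eigenvalues come out
  integral.\<close>

definition scale_factor :: 'a where
  "scale_factor = (SOME m. m \<noteq> 0 \<and> B hw lw = msc (m ^ 2 / 2) dE)"

lemma scale_factor: "scale_factor \<noteq> 0" "B hw lw = msc (scale_factor ^ 2 / 2) dE"
proof -
  obtain c where c: "c \<noteq> 0" "B hw lw = msc c dE" using B_hw_lw_nonzero by blast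
  obtain m :: 'a where "m ^ 2 = 2 * c" using nth_root_exists[of 2 "2 * c"] by auto
  then have "m \<noteq> 0 \<and> B hw lw = msc (m ^ 2 / 2) dE" using c by auto
  then have "\<exists>m. m \<noteq> 0 \<and> B hw lw = msc (m ^ 2 / 2) dE" by blast
  from someI_ex[OF this] show "scale_factor \<noteq> 0" "B hw lw = msc (scale_factor ^ 2 / 2) dE"
    unfolding scale_factor_def by auto
qed

section \<open>The element \<open>hE\<close> and its adjoint action\<close>

definition hE :: "'a tensor4" where
  "hE = tensor_scale (1 / scale_factor) (hw + lw)"

lemma hE_L1: "hE \<in> L1"
  unfolding hE_def by (intro L1_sc L1_add hw lw)

lemma hE_nonzero: "hE \<noteq> 0"
proof
  assume "hE = 0"
  then have 0: "hw + lw = 0" using scale_factor(1) by (simp add: hE_def)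
  then have "act dE (hw + lw) = 0" by (simp add: act_0)
  then have "hw - lw = 0" by (simp add: act_add hw(3) lw(2) vec_eq_iff)
  moreover have "hw + hw = (hw + lw) + (hw - lw)" by simp
  ultimately have "hw + hw = 0" using 0 by (simp only: add_0_right)
  then have "tensor_scale 2 hw = 0" by (simp add: vec_eq_iff)
  then show False using hw(2) by simp
qed

lemma act_hE:
  assumes "x \<in> L0" "dE ** x = x ** dE" "nu x = 0"
  shows "act x hE = 0"
  using act_hw[OF assms(1,2)] act_lw[OF assms(1,2)] assms(3) by (simp add: hE_def act_scale act_add)

lemma sE_hE: "ext4_map sE hE = hE"
  by (simp add: hE_def ext4_map_scale ext4_map_add lw(3) lw_def[symmetric] add.commute)

text \<open>For a matrix of weight 2 the bracket with \<open>hw\<close> vanishes, and the Jacobi identity computes the square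
  of the adjoint action of \<open>hw + lw\<close>; the weight -6 of \<open>[lw, [lw, x]]\<close> does not occur.\<close>

lemma ad_hE_square_weight:
  assumes x: "(x, 0) \<in> eig (dE, 0) (2 * e)" "e = 1 \<or> e = - 1"
  shows "br (0, hE) (br (0, hE) (x, 0)) = (x, 0)"
proof -
  let ?c = "scale_factor ^ 2 / 2"
  have xL: "x \<in> L0" using x by (simp add: eig_dE_L0)
  have L: "(0, hw) \<in> L" "(0, lw) \<in> L" "(x, 0) \<in> L" using hw lw xL by simp_all
  have he: "(0, hw) \<in> eig (dE, 0) 4" "(0, lw) \<in> eig (dE, 0) (- 4)" using hw lw by (simp_all add: eig_dE_L1)
  have dx: "br (dE, 0) (x, 0) = elt_scale (of_int (2 * e)) (x, 0)" using x by (simp add: eig_def)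
  have hl: "br (0, hw) (0, lw) = elt_scale ?c (dE, 0)"
    using scale_factor(2) hw lw by (simp add: br11 elt_scale_pair)
  have lh: "br (0, lw) (0, hw) = elt_scale (- ?c) (dE, 0)" using br_skew[OF L(1,2)] hl by simp
  let ?h = "(0, hw + lw) :: 'a elt"
  have h: "?h = (0, hw) + (0, lw)" by simp
  have hx: "br ?h z = br (0, hw) z + br (0, lw) z" if "z \<in> L" for z
    unfolding h using L that by (simp add: br_add_left del: add_Pair)
  have eigs: "br (0, hw) (x, 0) \<in> eig (dE, 0) (4 + 2 * e)" "br (0, lw) (x, 0) \<in> eig (dE, 0) (- 4 + 2 * e)"
    using eig_br[OF special_L(1) he(1) x(1)] eig_br[OF special_L(1) he(2) x(1)] by auto
  then have eigs2: "br (0, hw) (br (0, hw) (x, 0)) \<in> eig (dE, 0) (4 + (4 + 2 * e))"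
    "br (0, lw) (br (0, lw) (x, 0)) \<in> eig (dE, 0) (- 4 + (- 4 + 2 * e))"
    using eig_br[OF special_L(1) he(1)] eig_br[OF special_L(1) he(2)] by blast+
  have "br ?h (br ?h (x, 0)) = elt_scale (scale_factor ^ 2) (x, 0)"
    using x(2)
  proof
    assume e: "e = 1"
    have 0: "br (0, hw) (x, 0) = 0" using eigs(1) dE_cases[of _ 6] e by fastforce
    have 1: "br (0, lw) (br (0, lw) (x, 0)) = 0" using eigs2(2) dE_cases[of _ "- 6"] e by fastforce
    have "br ?h (br ?h (x, 0)) = br (0, hw) (br (0, lw) (x, 0))"
      using L by (simp add: hx 0 1 br_L)
    also have "\<dots> = br (br (0, hw) (0, lw)) (x, 0)"
      using jacobi'[OF L] 0 L by simp
    also have "\<dots> = elt_scale (scale_factor ^ 2) (x, 0)"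
      unfolding hl using L e by (simp add: br_sc_left dx)
    finally show ?thesis .
  next
    assume e: "e = - 1"
    have 0: "br (0, lw) (x, 0) = 0" using eigs(2) dE_cases[of _ "- 6"] e by fastforce
    have 1: "br (0, hw) (br (0, hw) (x, 0)) = 0" using eigs2(1) dE_cases[of _ "6"] e by fastforce
    have "br ?h (br ?h (x, 0)) = br (0, lw) (br (0, hw) (x, 0))"
      using L by (simp add: hx 0 1 br_L)
    also have "\<dots> = br (br (0, lw) (0, hw)) (x, 0)"
      using jacobi'[OF L(2,1,3)] 0 L by simp
    also have "\<dots> = elt_scale (scale_factor ^ 2) (x, 0)"
      unfolding lh using L e by (simp add: br_neg_left br_sc_left dx L_sc)
    finally show ?thesis .
  qed
  moreover have "(0, hE) = elt_scale (1 / scale_factor) ?h" by (simp add: hE_def elt_scale_pair)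
  moreover have "?h \<in> L" using hw lw by (simp add: L1_add)
  ultimately show ?thesis using L scale_factor(1)
    by (simp add: br_sc_left br_sc_right br_L L_sc power2_eq_square)
qed

text \<open>Conjugation by \<open>dE\<close> is 1 on weight 0 and -1 on weights \<plusminus>2, so a
  matrix that it negates has no part of weight 0. This is wanted for \<open>sE\<close>, which is not
  homogeneous.\<close>

lemma ad_hE_square_skew:
  assumes x: "x \<in> L0" "dE ** x ** dE = - x"
  shows "br (0, hE) (br (0, hE) (x, 0)) = (x, 0)"
proof -
  obtain u where u: "\<And>m. (u m, 0) \<in> eig (dE, 0) (2 * m)" "x = (\<Sum>m\<in>{- 1, 0, 1}. u m)"
    using dE_decomposition_L0[OF x(1)] by blast
  have uL: "u m \<in> L0" and du: "dE ** u m - u m ** dE = msc (of_int (2 * m)) (u m)" for m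
    using u(1)[of m] by (simp_all add: eig_dE_L0)
  note dia = diamond_eig[OF special_L0(1) special_squares(1) u(1)]
  have c: "dE ** u m ** dE = msc ((- 1) powi m) (u m)" for m
    using dia[of m] by (simp add: diamond_eq[OF special_squares(1)] elt_scale_pair)
  have "dE ** x ** dE = - u (- 1) + u 0 - u 1"
    unfolding u(2) by (simp add: matrix_add_ldistrib matrix_add_rdistrib c msc_1 msc_neg power_int_def)
  then have "x + dE ** x ** dE = (u (- 1) + u 0 + u 1) + (- u (- 1) + u 0 - u 1)" using u(2) by simp
  also have "\<dots> = u 0 + u 0" by (simp only: algebra_simps) simp
  finally have "u 0 + u 0 = 0" using x(2) by simp
  then have "msc 2 (u 0) = 0" by (simp add: vec_eq_iff)
  then have "u 0 = 0" by (simp add: vec_eq_iff)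
  then have x': "(x, 0 :: 'a tensor4) = (u (- 1), 0) + (u 1, 0)" using u(2) by simp
  have "(0, hE) \<in> L" using hE_L1 by simp
  then show ?thesis
    unfolding x' using ad_hE_square_weight[of "u (- 1)" "- 1"] ad_hE_square_weight[of "u 1" 1] u(1)[of 1] u(1)[of "- 1"] uL
    by (simp add: br_add_right br_L del: add_Pair)
qed

lemma ad_hE_dE: "br (0, hE) (br (0, hE) (dE, 0)) = elt_scale 4 (dE, 0)"
proof -
  have L: "(0, hw) \<in> L" "(0, lw) \<in> L" using hw lw by simp_all
  let ?h = "(0, hw + lw) :: 'a elt" and ?k = "(0, hw - lw) :: 'a elt"
  have hL: "?h \<in> L" "?k \<in> L" using hw lw by (simp_all add: L1_add L1_diff)
  have "br ?h (dE, 0) = elt_scale (- 4) ?k"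
    using hL by (simp add: br10 special_L0 L1_add hw lw act_add hw(3) lw(2) elt_scale_pair ten.scale_right_diff_distrib)
  moreover have "br ?h ?k = elt_scale (- (scale_factor ^ 2)) (dE, 0)"
  proof -
    have "br ?h ?k = br ((0, hw) + (0, lw)) ((0, hw) - (0, lw))" by simp
    also have "\<dots> = br (0, lw) (0, hw) - br (0, hw) (0, lw)"
      using L by (simp add: br_add_left br_diff_right br_self L_diff del: add_Pair diff_Pair)
    also have "\<dots> = - elt_scale 2 (br (0, hw) (0, lw))"
      using br_skew[OF L] by (simp add: prod_eq_iff vec_eq_iff elt_scale_def)
    also have "\<dots> = elt_scale (- (scale_factor ^ 2)) (dE, 0)"
      using scale_factor(2) hw lw by (simp add: br11 elt_scale_pair msc_msc msc_neg)
    finally show ?thesis .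
  qed
  ultimately have "br ?h (br ?h (dE, 0)) = elt_scale (4 * scale_factor ^ 2) (dE, 0)"
    using hL by (simp add: br_sc_right br_neg_right L_sc)
  moreover have "(0, hE) = elt_scale (1 / scale_factor) ?h" by (simp add: hE_def elt_scale_pair)
  ultimately show ?thesis using hL scale_factor(1)
    by (simp add: br_sc_left br_sc_right br_L L_sc power2_eq_square)
qed

lemma nu_dE: "nu dE = 4" by (simp add: nu_def dE_nth)

text \<open>The decomposition of gl_4 into its centre and sl_4. As \<open>nu dE = 4\<close>,
  subtracting \<open>nu x / 4\<close> times \<open>dE\<close> leaves trace 0, and such matrices kill
  both \<open>hw\<close> and \<open>lw\<close>.\<close>

lemma L0_weight_zero_split:
  assumes "x \<in> L0" "dE ** x = x ** dE"
  shows "(x, 0) = elt_scale (nu x / 4) (dE, 0) + (x - msc (nu x / 4) dE, 0 :: 'a tensor4)"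
    "br (0, hE) (x - msc (nu x / 4) dE, 0) = 0" "x - msc (nu x / 4) dE \<in> L0"
proof -
  let ?y = "x - msc (nu x / 4) dE"
  show "(x, 0) = elt_scale (nu x / 4) (dE, 0) + (?y, 0)" by (simp add: elt_scale_pair)
  show y: "?y \<in> L0" by (intro L0_diff L0_sc assms special_L0)
  have "nu ?y = nu x - nu x / 4 * nu dE" by (simp add: nu_def algebra_simps add_divide_distrib)
  then have "nu ?y = 0" by (simp add: nu_dE)
  moreover have "dE ** ?y = ?y ** dE"
    by (simp add: matrix_diff_ldistrib matrix_diff_rdistrib msc_mult_left msc_mult_right assms(2))
  ultimately show "br (0, hE) (?y, 0) = 0"
    using act_hE[OF y] y hE_L1 by (simp add: br10 zero_prod_def)
qed

lemma L0_hE_eigenvectors: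
  assumes "x \<in> L0"
  shows "(x, 0) \<in> span (\<Union>m. eig (0, hE) m)"
proof -
  let ?M = "span (\<Union>m. eig (0, hE) m)"
  have hL: "(0, hE) \<in> L" using hE_L1 by simp
  have in_M: "z \<in> ?M" if "z \<in> eig (0, hE) m" for z m using that by (blast intro: span_base)
  obtain u where u: "\<And>m. (u m, 0) \<in> eig (dE, 0) (2 * m)" "x = (\<Sum>m\<in>{- 1, 0, 1}. u m)"
    using dE_decomposition_L0[OF assms] by blast
  have uL: "u m \<in> L0" for m using u(1)[of m] by (simp add: eig_dE_L0)
  have "(u m, 0) \<in> ?M" if m: "m \<in> {- 1, 1}" for m
  proof -
    have "br (0, hE) (br (0, hE) (u m, 0)) = elt_scale (of_int 1 ^ 2) (u m, 0)"
      using ad_hE_square_weight[OF u(1)] m by auto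
    from square_eig_span[OF hL in_L0[THEN iffD2, OF uL] this] obtain a b
      where "a \<in> eig (0, hE) 1" "b \<in> eig (0, hE) (- 1)" "(u m, 0) = a + b" by auto
    then show ?thesis using in_M by (metis span_add)
  qed
  moreover have "(u 0, 0) \<in> ?M"
  proof -
    have c: "dE ** u 0 = u 0 ** dE" using u(1)[of 0] by (simp add: eig_dE_L0 msc_0)
    note split = L0_weight_zero_split[OF uL c]
    have "br (0, hE) (br (0, hE) (dE, 0)) = elt_scale (of_int 2 ^ 2) (dE, 0)"
      using ad_hE_dE by simp
    from square_eig_span[OF hL special_L(1) this] obtain a b
      where "a \<in> eig (0, hE) 2" "b \<in> eig (0, hE) (- 2)" "(dE, 0) = a + b" by (metis zero_neq_numeral)
    then have "(dE, 0) \<in> ?M" using in_M by (metis span_add)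
    moreover have "(u 0 - msc (nu (u 0) / 4) dE, 0) \<in> eig (0, hE) 0"
      using split(2,3) by (simp add: eig_def)
    ultimately show ?thesis using in_M split(1) by (metis span_add span_scale)
  qed
  moreover have "(x, 0 :: 'a tensor4) = (u (- 1), 0) + (u 0, 0) + (u 1, 0)" using u(2) by simp
  ultimately show ?thesis by (metis span_add insertI1 insertI2)
qed

text \<open>L0 is spanned by eigenvectors of \<open>ad hE\<close>, and \<open>hE\<close> itself has
  eigenvalue 0. As the span of the eigenvectors is a subalgebra, its part in L1 is a submodule
  containing \<open>hE\<close>, hence all of L1.\<close>

lemma integral_hE: "integral (0, hE)"
proof -
  let ?M = "span (\<Union>m. eig (0, hE) m)"
  have hL: "(0, hE) \<in> L" using hE_L1 by simp
  have MsubL: "z \<in> L" if "z \<in> ?M" for z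
    using span_minimal[OF _ sub_L, of "\<Union>m. eig (0, hE) m"] eig_L that by blast
  let ?U = "{w \<in> L1. (0, w) \<in> ?M}"
  have "?U = L1"
  proof (rule L1_irreducible[of _ hE])
    show "ten.subspace ?U"
    proof (rule ten.subspaceI)
      show "0 \<in> ?U" using span_zero by (simp add: zero_prod_def)
      show "v + w \<in> ?U" if "v \<in> ?U" "w \<in> ?U" for v w
        using that span_add[of "(0, v)" _ "(0, w)"] by (simp add: L1_add)
      show "tensor_scale c v \<in> ?U" if "v \<in> ?U" for c v
        using that span_scale[of "(0, v)" _ c] by (simp add: L1_sc elt_scale_pair)
    qed
    show "act x w \<in> ?U" if "x \<in> L0" "w \<in> ?U" for x w
      using integral_span_subalgebra[OF hL L0_hE_eigenvectors[OF that(1)], of "(0, w)"] that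
      by (simp add: br01 L1_act)
    have "(0, hE) \<in> eig (0, hE) 0" using hL by (simp add: eig_def br_self)
    then show "hE \<in> ?U" using hE_L1 by (blast intro: span_base)
  qed (use hE_nonzero in auto)
  have "z \<in> ?M" if z: "z \<in> L" for z
  proof -
    have "(fst z, 0) \<in> ?M" "(0, snd z) \<in> ?M"
      using z L0_hE_eigenvectors \<open>?U = L1\<close> by (auto simp: mem_L)
    then have "(fst z, 0) + (0, snd z) \<in> ?M" by (rule span_add)
    then show ?thesis by simp
  qed
  then show ?thesis using hL by (auto simp: integral_def)
qed

text \<open>It expresses that (-1)^(ad h) is conjugation by \<open>g\<close>. Then i^(ad h) is a
  square root of this conjugation.\<close>

definition parity :: "'a elt \<Rightarrow> 'a mat8 \<Rightarrow> bool" where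
  "parity h g \<longleftrightarrow> integral h \<and> (\<forall>m. \<forall>z\<in>eig h m. diamond g z = elt_scale ((- 1) powi m) z)"

lemma parityI:
  assumes h: "integral h" and f: "f \<in> lie_auts elt_scale L br"
    and "\<And>m z. z \<in> eig h m \<Longrightarrow> f z = elt_scale ((- 1) powi m) z"
    and "\<And>z. z \<in> L \<Longrightarrow> f z = diamond g z"
  shows "parity h g"
  using assms eig_L by (auto simp: parity_def)

lemma hE_L: "(0, hE) \<in> L" using hE_L1 by simp

text \<open>On L0 the eigenvalues of \<open>ad hE\<close> are \<plusminus>1 in weights \<plusminus>2
  and 0, \<plusminus>2 in weight 0, so (-1)^(ad hE) has there the signs of the conjugation by
  \<open>dE\<close>. Both maps are automorphisms fixing \<open>hE\<close>, and agreement spreads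
  over L1 by irreducibility.\<close>

lemma parity_hE: "parity (0, hE) dE"
proof -
  obtain f where f: "f \<in> lie_auts elt_scale L br"
    "\<And>m z. z \<in> eig (0, hE) m \<Longrightarrow> f z = elt_scale ((- 1) powi m) z"
    using torus_aut[OF integral_hE, of "- 1"] by auto
  note fD = lie_autsD[OF f(1)]
  note dia = diamond_eig[OF special_L0(1) special_squares(1)]
  have lin: "linear_on_L (diamond dE)" by (rule linear_diamond[OF special_squares(1)])
  have gD: "diamond dE (br x y) = br (diamond dE x) (diamond dE y)" "diamond dE x \<in> L" if "x \<in> L" "y \<in> L" for x y
    using lie_autsD(2,3)[OF diamond_aut[OF special_L0(1) special_squares(1)]] that by (auto simp: br_L)
  have L0: "f (x, 0) = diamond dE (x, 0)" if x: "x \<in> L0" for x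
  proof -
    obtain u where u: "\<And>m. (u m, 0) \<in> eig (dE, 0) (2 * m)" "x = (\<Sum>m\<in>{- 1, 0, 1}. u m)"
      using dE_decomposition_L0[OF x] by blast
    have uL: "u m \<in> L0" for m using u(1)[of m] by (simp add: eig_dE_L0)
    have odd: "f (u m, 0) = diamond dE (u m, 0)" if m: "m = 1 \<or> m = - 1" for m
    proof -
      have "br (0, hE) (br (0, hE) (u m, 0)) = elt_scale (of_int 1 ^ 2) (u m, 0)"
        using ad_hE_square_weight[OF u(1) m] by simp
      from square_eig_span[OF hE_L in_L0[THEN iffD2, OF uL] this] obtain a b
        where ab: "a \<in> eig (0, hE) 1" "b \<in> eig (0, hE) (- 1)" "(u m, 0) = a + b" by auto
      have "f (u m, 0) = f a + f b" unfolding ab(3) using fD(1) ab eig_L by (auto simp: linear_on_L_def)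
      also have "\<dots> = - (u m, 0)" unfolding ab(3) using f(2)[OF ab(1)] f(2)[OF ab(2)] by simp
      also have "\<dots> = diamond dE (u m, 0)" unfolding dia[OF u(1)] using m by auto
      finally show ?thesis .
    qed
    have even: "f (u 0, 0) = diamond dE (u 0, 0)"
    proof -
      have c: "dE ** u 0 = u 0 ** dE" using u(1)[of 0] by (simp add: eig_dE_L0 msc_0)
      note split = L0_weight_zero_split[OF uL c]
      have "br (0, hE) (br (0, hE) (dE, 0)) = elt_scale (of_int 2 ^ 2) (dE, 0)" using ad_hE_dE by simp
      from square_eig_span[OF hE_L special_L(1) this] obtain a b
        where ab: "a \<in> eig (0, hE) 2" "b \<in> eig (0, hE) (- 2)" "(dE, 0) = a + b" by (metis zero_neq_numeral)
      have "f (dE, 0) = f a + f b" unfolding ab(3) using fD(1) ab eig_L by (auto simp: linear_on_L_def)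
      also have "\<dots> = (dE, 0)" unfolding ab(3) using f(2)[OF ab(1)] f(2)[OF ab(2)] by (simp add: power_int_def)
      finally have "f (elt_scale (nu (u 0) / 4) (dE, 0)) = elt_scale (nu (u 0) / 4) (dE, 0)"
        using fD(1) by (simp add: linear_on_L_def)
      moreover have "(u 0 - msc (nu (u 0) / 4) dE, 0) \<in> eig (0, hE) 0"
        using split(2,3) by (simp add: eig_def)
      from f(2)[OF this] have "f (u 0 - msc (nu (u 0) / 4) dE, 0) = (u 0 - msc (nu (u 0) / 4) dE, 0)" by simp
      moreover have "f (elt_scale (nu (u 0) / 4) (dE, 0) + (u 0 - msc (nu (u 0) / 4) dE, 0)) =
          f (elt_scale (nu (u 0) / 4) (dE, 0)) + f (u 0 - msc (nu (u 0) / 4) dE, 0)"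
        using fD(1) L_sc[OF special_L(1)] in_L0[THEN iffD2, OF split(3)] by (simp only: linear_on_L_def)
      ultimately have "f (u 0, 0) = (u 0, 0)" using split(1) by simp
      then show ?thesis using dia[OF u(1)[of 0]] by simp
    qed
    have x': "(x, 0 :: 'a tensor4) = (u (- 1), 0) + (u 0, 0) + (u 1, 0)" using u(2) by simp
    have split: "g (x, 0 :: 'a tensor4) = g (u (- 1), 0) + g (u 0, 0) + g (u 1, 0)" if "linear_on_L g" for g
      unfolding x' using that uL L_add[of "(u (- 1), 0)" "(u 0, 0)"] by (simp add: linear_on_L_def del: add_Pair)
    show ?thesis unfolding split[OF fD(1)] split[OF lin] using odd even by simp
  qed
  let ?U = "{w \<in> L1. f (0, w) = diamond dE (0, w)}"
  have U: "?U = L1"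
  proof (rule L1_irreducible[of _ hE])
    have add: "g (0, v + w) = g (0, v) + g (0, w :: 'a tensor4)" "g (0, tensor_scale c v) = elt_scale c (g (0, v))"
      if "linear_on_L g" "v \<in> L1" "w \<in> L1" for g :: "'a elt \<Rightarrow> 'a elt" and v w c
    proof -
      have "g ((0, v) + (0, w)) = g (0, v) + g (0, w)" "g (elt_scale c (0, v)) = elt_scale c (g (0, v))"
        using that by (simp_all add: linear_on_L_def del: add_Pair)
      then show "g (0, v + w) = g (0, v) + g (0, w)" "g (0, tensor_scale c v) = elt_scale c (g (0, v))"
        by (simp_all add: elt_scale_pair)
    qed
    show "ten.subspace ?U"
      using linear_on_L_0[OF fD(1)] linear_on_L_0[OF lin]
      by (intro ten.subspaceI) (auto simp: add[OF fD(1)] add[OF lin] L1_add L1_sc zero_prod_def)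
    show "act x w \<in> ?U" if x: "x \<in> L0" and w: "w \<in> ?U" for x w
    proof -
      have "(0, act x w) = br (x, 0) (0, w)" using x w by (simp add: br01)
      then have "f (0, act x w) = diamond dE (0, act x w)"
        using fD(3)[of "(x, 0)" "(0, w)"] gD(1)[of "(x, 0)" "(0, w)"] x w L0[OF x] by simp
      then show ?thesis using x w L1_act by simp
    qed
    have hE0: "(0, hE) \<in> eig (0, hE) 0" using hE_L by (simp add: eig_def br_self)
    have "act dE hw = tensor_scale (of_int 4) hw" "act dE lw = tensor_scale (of_int (- 4)) lw"
      using hw lw by simp_all
    then have "(0, hw) \<in> eig (dE, 0) (2 * 2)" "(0, lw) \<in> eig (dE, 0) (2 * - 2)"
      using hw(1) lw(1) unfolding eig_dE_L1 by simp_all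
    then have "ext4_map dE hw = hw" "ext4_map dE lw = lw"
      using dia[of "(0, hw)" 2] dia[of "(0, lw)" "- 2"]
      by (simp_all add: diamond_eq[OF special_squares(1)] power_int_def)
    then have "diamond dE (0, hE) = (0, hE)"
      by (simp add: diamond_eq[OF special_squares(1)] hE_def ext4_map_scale ext4_map_add)
    then show "hE \<in> ?U" using f(2)[OF hE0] hE_L1 by simp
  qed (use hE_nonzero in auto)
  have "f z = diamond dE z" if z: "z \<in> L" for z
  proof -
    have z': "fst z \<in> L0" "snd z \<in> L1" using z by (simp_all add: mem_L)
    have "snd z \<in> ?U" unfolding U by (rule z'(2))
    then have "f (0, snd z) = diamond dE (0, snd z)" by simp
    moreover have "g z = g (fst z, 0) + g (0, snd z)" if "linear_on_L g" for g :: "'a elt \<Rightarrow> 'a elt"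
    proof -
      have "g ((fst z, 0) + (0, snd z)) = g (fst z, 0) + g (0, snd z)"
        using that z' by (simp add: linear_on_L_def del: add_Pair)
      then show ?thesis by simp
    qed
    ultimately show ?thesis using L0[OF z'(1)] fD(1) lin by metis
  qed
  from parityI[OF integral_hE f(1) f(2) this] show ?thesis by blast
qed

text \<open>An automorphism \<open>f\<close> transports (-1)^(ad h) to (-1)^(ad f(h)) by
  conjugation.\<close>

lemma parity_image:
  assumes p: "parity h g" and f: "restrict (diamond f) L \<in> lie_auts elt_scale L br"
    and inv: "f ** f' = mat 1" "g ** k = mat 1" "g' ** k' = mat 1" and g': "g' ** f = f ** g"
  shows "parity (diamond f h) g'"
proof -
  let ?F = "restrict (diamond f) L"
  have h: "integral h" "h \<in> L" using p by (auto simp: parity_def integral_def)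
  have "integral (?F h)" by (rule integral_image[OF f h(1)])
  moreover have "diamond g' z = elt_scale ((- 1) powi m) z" if z: "z \<in> eig (?F h) m" for z m
  proof -
    note FD = lie_autsD[OF f]
    have zL: "z \<in> L" using z by (rule eig_L)
    then have "z \<in> ?F ` L" unfolding FD(5) .
    then obtain y where y: "y \<in> L" "z = ?F y" by blast
    have "?F (br h y) = ?F (elt_scale (of_int m) y)"
      using z y h FD(1,3) unfolding eig_def linear_on_L_def by auto
    then have "br h y = elt_scale (of_int m) y" using FD(4) y h by (meson inj_onD br_L L_sc)
    then have "y \<in> eig h m" using y by (simp add: eig_def)
    then have "diamond g y = elt_scale ((- 1) powi m) y" using p by (simp add: parity_def)
    moreover have "diamond g' (diamond f y) = diamond f (diamond g y)"
      using diamond_mult[OF inv(3,1)] diamond_mult[OF inv(1,2)] g' by metis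
    ultimately show ?thesis
      using y linear_diamond[OF inv(1)] by (simp add: linear_on_L_def)
  qed
  ultimately show ?thesis using h by (simp add: parity_def)
qed

lemma invariant_ext4_map:
  fixes d :: "'a mat8"
  assumes "d ** d = mat 1" "act d w = 0"
  shows "ext4_map d w = w"
  using ext4_map_involution[OF assms(1), of w] by (simp add: assms(2) act_0 vec_eq_iff)

lemma dE_hE: "ext4_map dE hE = hE"
proof -
  have "(0, hE) \<in> eig (0, hE) 0" using hE_L by (simp add: eig_def br_self)
  then have "diamond dE (0, hE) = (0, hE)" using parity_hE by (auto simp: parity_def)
  then show ?thesis by (simp add: diamond_eq[OF special_squares(1)])
qed

lemma nu_special: "nu dE' = 0" "nu (gW sigma1) = 0" "nu (gW sigma2) = 0"
  by (simp_all add: nu_def dE'_def pE'_def dg_def gW_def mat_def sigma1_def sigma2_def)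

lemma act_special_hE: "act dE' hE = 0" "act (gW sigma1) hE = 0" "act (gW sigma2) hE = 0"
  by (intro act_hE special_L0 special_commute nu_special)+

text \<open>The analogue of \<open>hE\<close> for the plane W. The exchange of planes turns
  \<open>dE\<close> into \<open>gW sigma2\<close>, so its parity is the second of the given
  involutions; as the planes E and E' are not involved, it has weight 0 for \<open>dE\<close> and
  \<open>dE'\<close>.\<close>

definition hW :: "'a tensor4" where "hW = ext4_map sEW hE"

lemma sEW_aut: "restrict (diamond sEW) L \<in> lie_auts elt_scale L br"
  by (rule diamond_aut[OF sEW_L0 sEW_square])

lemma parity_hW: "parity (0, hW) (gW sigma2)"
  using parity_image[OF parity_hE sEW_aut sEW_square special_squares(1) special_squares(6) sEW_conj(1)]
  by (simp add: hW_def diamond_eq[OF sEW_square])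

lemma conj_eq: "x ** f = f ** y \<Longrightarrow> f ** f' = mat 1 \<Longrightarrow> f ** y ** f' = x" for x y f :: "'a mat8"
  using matrix_mul_assoc[of x f f'] by simp

lemma hW: "hW \<in> L1" "act dE hW = 0" "act dE' hW = 0" "ext4_map (gW sigma1) hW = hW" "ext4_map (gW sigma2) hW = hW"
proof -
  show "hW \<in> L1" unfolding hW_def by (rule aut_snd[OF sEW_aut hE_L1])
  have "act (sEW ** x ** sEW) hW = 0" if "act x hE = 0" for x
    using ext4_map_act[OF sEW_square, of x hE] that by (simp add: hW_def ext4_map_0)
  from this[OF act_special_hE(3)] this[OF act_special_hE(1)] show "act dE hW = 0" "act dE' hW = 0"
    by (simp_all add: conj_eq[OF sEW_conj(4) sEW_square] conj_eq[OF sEW_conj(3) sEW_square])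
  show "ext4_map (gW sigma1) hW = hW" "ext4_map (gW sigma2) hW = hW"
    unfolding hW_def ext4_map_mult[symmetric] sEW_conj by (simp_all add: ext4_map_mult sE_hE dE_hE)
qed

text \<open>In terms of \<open>S\<^sup>4 E\<close>, \<open>hE\<close> is \<open>e\<^sub>1\<^sup>4 + e\<^sub>2\<^sup>4\<close> and \<open>h2\<close> is a multiple of \<open>e\<^sub>1\<^sup>2 e\<^sub>2\<^sup>2\<close>, which has weight 0. It is
  a combination of \<open>hE\<close> with its image under a rotation of \<open>E\<close>.\<close>

definition h2 :: "'a tensor4" where
  "h2 = tensor_scale (1 / 4) (act sE (act sE hE)) - hE"

lemma act_diff: "act x (v - w) = act x v - act x w" for x :: "'a mat8"
  using act_add[of x "v - w" w] by simp

text \<open>\<open>hE\<close> is fixed by the exterior power of \<open>sE\<close>, which is -1 on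
  the eigenvalues \<plusminus>2 of \<open>act sE\<close>; so only the eigenvalues 0 and
  \<plusminus>4 occur in it. The computation writes a multiple of \<open>hE\<close> as a polynomial
  in \<open>act sE\<close> applied to \<open>hw\<close> and reduces modulo the quintic.\<close>

lemma sE3_hE: "act sE (act sE (act sE hE)) = tensor_scale 16 (act sE hE)"
proof -
  let ?a = "act sE"
  note five = act5[OF special_squares(3), of hw]
  have u: "tensor_scale (24 * scale_factor) hE = ?a (?a (?a (?a hw))) - tensor_scale 16 (?a (?a hw)) + tensor_scale 48 hw"
    using ext4_map_involution[OF special_squares(3), of hw] scale_factor(1)
    by (simp add: hE_def lw_def[symmetric] vec_eq_iff algebra_simps)
  define k where "k = 24 * scale_factor"
  have sub: "?a (v - w) = ?a v - ?a w" for v w using act_add[of sE v "- w"] by (simp add: act_neg)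
  have 1: "?a (tensor_scale k hE) = tensor_scale 4 (?a (?a (?a hw))) - tensor_scale 16 (?a hw)"
    unfolding k_def u by (simp add: sub act_add act_scale five vec_eq_iff)
  have "?a (?a (?a (tensor_scale k hE))) = tensor_scale 16 (?a (tensor_scale k hE))"
    unfolding 1 by (simp add: sub act_add act_scale five vec_eq_iff)
  then have "tensor_scale k (?a (?a (?a hE))) = tensor_scale k (tensor_scale 16 (?a hE))"
    by (simp only: act_scale ten.scale_left_commute)
  moreover have "k \<noteq> 0" using scale_factor(1) by (simp add: k_def)
  ultimately show ?thesis by (metis ten.scale_left_imp_eq)
qed

text \<open>An sl_2 computation: \<open>sE + dE ** sE\<close> and \<open>sE - dE ** sE\<close> have
  weights 2 and -2, so they kill \<open>hw\<close> and \<open>lw\<close> respectively, weights 6 and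
  -6 being absent from L1. This makes the combination defining \<open>h2\<close> have weight
  0.\<close>

lemma dE_sE_sE_hE: "act dE (act sE (act sE hE)) = tensor_scale 4 (act dE hE)"
proof -
  let ?H = "act dE" and ?a = "act sE" and ?b = "act (dE ** sE)"
  have sd: "sE ** dE = - (dE ** (sE :: 'a mat8))" by (simp add: special_commute)
  have y: "dE ** (sE :: 'a mat8) \<in> L0"
    using L0_sc[OF L0_comm[OF special_L0(1,3)], of "1 / 2"] by (simp add: sd msc_add) (simp add: msc_def vec_eq_iff)
  have act2: "act (msc 2 x) w = tensor_scale 2 (act x w)" for x and w :: "'a tensor4" by (simp add: act_msc)
  have c1: "dE ** sE - sE ** dE = msc 2 (dE ** (sE :: 'a mat8))"
    by (simp add: sd vec_eq_iff)
  have c2: "sE ** (dE ** sE) - (dE ** sE) ** sE = msc (- 2) (dE :: 'a mat8)"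
    by (simp add: matrix_mul_assoc sd matrix_neg_left)
      (simp add: matrix_mul_assoc[symmetric] special_squares vec_eq_iff)
  have Ha: "?H (?a w) = ?a (?H w) + tensor_scale 2 (?b w)" for w :: "'a tensor4"
    using act_commutator[of dE sE w] by (simp add: c1 act2)
  have ab: "?b (?a w) = ?a (?b w) + tensor_scale 2 (?H w)" for w :: "'a tensor4"
    using act_commutator[of sE "dE ** sE" w] by (simp add: c2 act_msc vec_eq_iff)
  have Haa: "?H (?a (?a w)) = ?a (?a (?H w)) + tensor_scale 4 (?a (?b w)) + tensor_scale 4 (?H w)" for w :: "'a tensor4"
    by (simp add: Ha act_add act_scale ab vec_eq_iff)
  have e1: "dE ** (dE ** sE) = (sE :: 'a mat8)" by (simp add: matrix_mul_assoc special_squares)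
  have e2: "dE ** sE ** dE = - (sE :: 'a mat8)"
    by (simp add: matrix_mul_assoc[symmetric] sd matrix_neg_right e1)
  note e = e1 e2
  have X: "?a hw + ?b hw = 0"
  proof -
    have "(sE + dE ** sE, 0) \<in> eig (dE, 0) 2"
      unfolding eig_dE_L0 using y
      by (simp add: L0_add matrix_add_ldistrib matrix_add_rdistrib e sd) (simp add: vec_eq_iff)
    from eig_br[OF special_L(1) this, of "(0, hw)" 4] have "(0, act (sE + dE ** sE) hw) \<in> eig (dE, 0) 6"
      using hw y by (simp add: br01 L0_add eig_dE_L1)
    then have "act (sE + dE ** sE) hw = 0" using dE_cases[of "(0, act (sE + dE ** sE) hw)" 6] by (auto simp: zero_prod_def)
    then show ?thesis by (simp add: act_add_left)
  qed
  have F: "?a lw - ?b lw = 0"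
  proof -
    have "(sE - dE ** sE, 0) \<in> eig (dE, 0) (- 2)"
      unfolding eig_dE_L0 using y
      by (simp add: L0_diff matrix_diff_ldistrib matrix_diff_rdistrib e sd) (simp add: vec_eq_iff)
    from eig_br[OF special_L(1) this, of "(0, lw)" "- 4"] have "(0, act (sE - dE ** sE) lw) \<in> eig (dE, 0) (- 6)"
      using lw y by (simp add: br01 L0_diff eig_dE_L1)
    then have 0: "act (sE - dE ** sE) lw = 0"
      using dE_cases[of "(0, act (sE - dE ** sE) lw)" "- 6"] by (auto simp: zero_prod_def)
    have "act sE lw = act (sE - dE ** sE) lw + ?b lw" using act_add_left[of "sE - dE ** sE" "dE ** sE" lw] by simp
    then show ?thesis using 0 by simp
  qed
  have "?a (?b hw) = - ?a (?a hw)"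
    using X act_neg[of sE "?a hw"] by (simp add: add_eq_0_iff)
  moreover have "?a (?b lw) = ?a (?a lw)" using F by simp
  ultimately have "?H (?a (?a (hw + lw))) = tensor_scale 4 (?H (hw + lw))"
    by (simp add: act_add Haa hw(3) lw(2) act_scale act_neg vec_eq_iff)
  then show ?thesis by (simp add: hE_def act_scale mult.commute)
qed

lemma h2_L1: "h2 \<in> L1"
  unfolding h2_def by (intro L1_diff L1_sc L1_act hE_L1 special_L0)

lemma commuting_act: "x ** y = y ** x \<Longrightarrow> act x (act y w) = act y (act x w)" for x y :: "'a mat8"
  using act_commutator[of x y w] by (simp add: act_0)

lemma h2_invariant: "act dE h2 = 0" "act dE' h2 = 0" "ext4_map (gW sigma1) h2 = h2" "ext4_map (gW sigma2) h2 = h2"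
proof -
  show "act dE h2 = 0" by (simp add: h2_def act_diff act_scale dE_sE_sE_hE)
  have *: "act x h2 = 0" if "act x hE = 0" "x ** sE = sE ** x" for x
    using that by (simp add: h2_def act_diff act_scale commuting_act act_0)
  show "act dE' h2 = 0" by (rule *[OF act_special_hE(1) special_commute(3)])
  show "ext4_map (gW sigma1) h2 = h2" "ext4_map (gW sigma2) h2 = h2"
    by (intro invariant_ext4_map special_squares * act_special_hE special_commute(9)[symmetric])+
qed

text \<open>Apply \<open>ad sE\<close> to the formula \<open>[hE, [hE, sE]] = sE\<close>: the right
  side is killed, and on the left the Jacobi identity leaves, up to sign, the bracket of
  \<open>hE\<close> with \<open>act sE (act sE hE)\<close>.\<close>

lemma br_hE_h2: "br (0, hE) (0, h2) = 0"
proof -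
  let ?a = "act sE"
  have aL: "?a hE \<in> L1" "?a (?a hE) \<in> L1" by (intro L1_act hE_L1 special_L0)+
  have "sE ** dE = - (dE ** (sE :: 'a mat8))" by (simp add: special_commute)
  then have "dE ** sE ** dE = - (sE :: 'a mat8)"
    by (simp add: matrix_mul_assoc[symmetric] matrix_neg_right) (simp add: matrix_mul_assoc special_squares)
  from ad_hE_square_skew[OF special_L0(3) this] have "br (0, hE) (0, - ?a hE) = (sE, 0)"
    by (simp add: br10 hE_L1)
  then have "- br (0, hE) (0, ?a hE) = (sE, 0)"
    using br_neg_right[of "(0, hE)" "(0, ?a hE)"] hE_L1 aL by simp
  then have 1: "br (0, hE) (0, ?a hE) = - (sE, 0)" by (simp only: minus_equation_iff)
  have "br (sE, 0) (br (0, hE) (0, ?a hE)) = br (0, ?a hE) (0, ?a hE) + br (0, hE) (0, ?a (?a hE))"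
    using jacobi'[of "(sE, 0)" "(0, hE)" "(0, ?a hE)"] hE_L1 aL by (simp add: br01)
  then have "br (0, hE) (0, ?a (?a hE)) = 0"
    using aL br_neg_right[of "(sE, 0)" "(sE, 0)"] by (simp add: 1 br_self)
  moreover have "(0, h2) = elt_scale (1 / 4) (0, ?a (?a hE)) - (0, hE)" by (simp add: h2_def elt_scale_pair)
  ultimately show ?thesis
    using aL hE_L1 by (simp add: br_diff_right br_sc_right br_self L_sc del: diff_Pair)
qed

text \<open>Rotating \<open>hE\<close> by \<open>delta sE l\<close> gives a second integral element
  \<open>hb\<close>, commuting with \<open>hE\<close>, and \<open>h2 = hE - 2 hb\<close>. On a
  common eigenvector with eigenvalues \<open>m\<close> and \<open>n\<close> the element
  \<open>h2\<close> acts by \<open>m - 2 n\<close>, which has the parity of \<open>m\<close>; so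
  \<open>h2\<close> inherits the parity of \<open>hE\<close>.\<close>

lemma parity_h2: "parity (0, h2) dE"
proof -
  obtain i :: 'a where i: "i ^ 2 = - 1" using ex_imaginary_unit by blast
  obtain l where l: "l ^ 2 = i" using nth_root_exists[of 2 i] by auto
  have l4: "l ^ 4 = - 1" using i l by (metis mult_2 numeral_Bit0 power_add power2_eq_square)
  have l0: "l \<noteq> 0" using l4 by auto
  let ?s = "(l + inverse l) / 2" and ?t = "(l - inverse l) / 2"
  have inv: "inverse l = - (l ^ 3)"
    using l4 l0 by (simp add: field_simps eval_nat_numeral)
  have s2: "?s ^ 2 = 1 / 2" and t2: "?t ^ 2 = - 1 / 2" and st: "?s * ?t = l ^ 2 / 2"
  proof -
    have 6: "l ^ 6 = - (l ^ 2)" using l4 power_add[of l 4 2] by simp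
    have "?s ^ 2 = (l ^ 2 - 2 * l ^ 4 + l ^ 6) / 4" "?t ^ 2 = (l ^ 2 + 2 * l ^ 4 + l ^ 6) / 4"
      "?s * ?t = (l ^ 2 - l ^ 6) / 4"
      unfolding inv by (simp_all add: field_simps eval_nat_numeral)
    then show "?s ^ 2 = 1 / 2" "?t ^ 2 = - 1 / 2" "?s * ?t = l ^ 2 / 2" by (simp_all add: 6 l4)
  qed
  let ?g = "delta sE l"
  define hb where "hb = ext4_map ?g hE"
  have hb: "hb = hE - tensor_scale (1 / 8) (act sE (act sE hE))"
  proof -
    \<comment> \<open>For a primitive 8th root of unity the coefficients of \<open>act sE hE\<close>
      and of \<open>slots3 sE hE\<close> are opposite. These two vectors coincide, so the terms of
      odd degree in \<open>sE\<close> cancel.\<close>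
    have c: "?s ^ 4 = 1 / 4" "?t ^ 4 = 1 / 4" "?s ^ 2 * ?t ^ 2 = - 1 / 4" "?s ^ 3 * ?t = l ^ 2 / 4" "?s * ?t ^ 3 = - (l ^ 2 / 4)"
    proof -
      have "?s ^ 4 = (?s ^ 2) ^ 2" "?t ^ 4 = (?t ^ 2) ^ 2" "?s ^ 3 * ?t = ?s ^ 2 * (?s * ?t)" "?s * ?t ^ 3 = ?t ^ 2 * (?s * ?t)"
        by (simp_all only: power2_eq_square power3_eq_cube power4_eq_xxxx ac_simps)
      then show "?s ^ 4 = 1 / 4" "?t ^ 4 = 1 / 4" "?s ^ 2 * ?t ^ 2 = - 1 / 4" "?s ^ 3 * ?t = l ^ 2 / 4" "?s * ?t ^ 3 = - (l ^ 2 / 4)"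
        unfolding s2 t2 st by (simp_all add: power2_eq_square)
    qed
    have sl2: "slots2 sE hE = tensor_scale (1 / 2) (act sE (act sE hE)) - tensor_scale 2 hE"
      by (simp add: act_act[OF special_squares(3)] vec_eq_iff add_divide_distrib)
    have sl3: "slots3 sE hE = act sE hE"
      using act3[OF special_squares(3), of hE] by (simp add: sE3_hE vec_eq_iff)
    show ?thesis
      unfolding hb_def delta_def ext4_map_linear_combination[OF special_squares(3)] c sl2 sl3 sE_hE
      by (simp add: vec_eq_iff field_simps)
  qed
  have F: "restrict (diamond ?g) L \<in> lie_auts elt_scale L br"
    by (rule diamond_delta_aut[OF special_L0(3) special_squares(3) l0])
  have hbL: "hb \<in> L1" unfolding hb_def by (rule aut_snd[OF F hE_L1])
  have int_hb: "integral (0, hb)"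
    using integral_image[OF F integral_hE] hE_L by (simp add: hb_def diamond_eq[OF delta_inverse[OF special_squares(3) l0]])
  have h2: "(0, h2) = (0, hE) + elt_scale (of_int (- 2)) (0, hb)"
    by (simp add: h2_def hb elt_scale_pair vec_eq_iff field_simps)
  have "(0, hb) = elt_scale (- 1 / 2) ((0, h2) - (0, hE))"
    by (simp add: h2_def hb elt_scale_pair vec_eq_iff field_simps)
  then have comm: "br (0, hE) (0, hb) = 0"
    using br_hE_h2 h2_L1 hE_L1
    by (simp add: br_neg_right br_sc_right br_diff_right br_self L_diff L_sc del: diff_Pair)
  have "br (0, hE) (elt_scale (of_int (- 2)) (0, hb)) = 0"
    using comm br_sc_right[OF hE_L, of "(0, hb)" "of_int (- 2)"] hbL by simp
  from integral_add[OF integral_hE integral_sc[OF int_hb] this] have int: "integral (0, h2)" unfolding h2 .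
  obtain f where f: "f \<in> lie_auts elt_scale L br"
    "\<And>m z. z \<in> eig (0, h2) m \<Longrightarrow> f z = elt_scale ((- 1) powi m) z"
    using torus_aut[OF int, of "- 1"] by auto
  show ?thesis
  proof (rule parityI[OF int f])
    fix z assume z: "z \<in> L"
    show "f z = diamond dE z"
    proof (rule linear_on_L_eqI[OF lie_autsD(1)[OF f(1)] linear_diamond[OF special_squares(1)] _
          commuting_integral_span[OF integral_hE int_hb comm] _ z])
      show "(\<Union>m n. eig (0, hE) m \<inter> eig (0, hb) n) \<subseteq> L" using eig_L by blast
      fix x assume "x \<in> (\<Union>m n. eig (0, hE) m \<inter> eig (0, hb) n)"
      then obtain m n where x: "x \<in> eig (0, hE) m" "x \<in> eig (0, hb) n" by blast
      have hbL': "(0, hb) \<in> L" using hbL by simp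
      have "x \<in> eig (0, h2) (m + - 2 * n)"
        unfolding h2 by (rule eig_add[OF hE_L L_sc[OF hbL'] x(1) eig_sc[OF hbL' x(2)]])
      from f(2)[OF this] have "f x = elt_scale ((- 1) powi m) x" by (simp add: power_int_add power_int_mult power_int_minus_left)
      also have "\<dots> = diamond dE x" using parity_hE x(1) by (simp add: parity_def)
      finally show "f x = diamond dE x" .
    qed
  qed
qed

end

section \<open>The grading \<open>\<Gamma>\<^sub>6\<close>\<close>

lemma bit_sign_add: "bit_sign (a + b) = bit_sign a * (bit_sign b :: 'a::field)"
  by (cases a; cases b) (simp_all add: bit_sign_def)

lemma bit_sign_square [simp]: "bit_sign a * bit_sign a = (1 :: 'a::field)"
  by (simp add: bit_sign_def)

lemma bit_sign_neq: "a \<noteq> b \<Longrightarrow> bit_sign a \<noteq> (bit_sign b :: 'a::field_char_0)"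
  by (cases a; cases b) (simp_all add: bit_sign_def)

lemma bit_sign_of_int: "bit_sign (of_int n) = (- 1 :: 'a::field) powi n"
proof (cases "even n")
  case True
  then obtain m where "n = 2 * m" by (elim evenE)
  then show ?thesis by (simp add: bit_sign_def power_int_mult)
next
  case False
  then obtain m where "n = 2 * m + 1" by (elim oddE)
  then show ?thesis by (simp add: bit_sign_def power_int_add power_int_mult)
qed

lemma powi_inj:
  assumes "(4 :: 'a::field_char_0) powi m = 4 powi n"
  shows "m = n"
proof -
  have *: "d = 0" if "(4 :: 'a) ^ d = 1" for d :: nat
  proof -
    have "(of_nat (4 ^ d) :: 'a) = of_nat 1" using that by simp
    then have "(4 :: nat) ^ d = 1" by (simp only: of_nat_eq_iff)
    then show ?thesis by simp
  qed
  have "m - n = 0" if "(4 :: 'a) powi m = 4 powi n" "n \<le> m" for m n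
  proof -
    have "(4 :: 'a) powi (m - n) = 1" using that(1) by (simp add: power_int_diff)
    then have "(4 :: 'a) ^ nat (m - n) = 1" using that(2) by (simp add: power_int_def)
    then show ?thesis using * that(2) by fastforce
  qed
  then show ?thesis using assms by (metis eq_iff_diff_eq_0 linorder_linear)
qed

section \<open>The grading by eigenvectors and the automorphisms i^(ad w)\<close>

context E6
begin

abbreviation "Gam \<equiv> Gamma6 L1"
abbreviation "G1 \<equiv> gW sigma1 :: 'a mat8"
abbreviation "G2 \<equiv> gW sigma2 :: 'a mat8"

text \<open>The infinitely many torus conditions are replaced by two eigenvalue conditions in the
  Lie algebra: the torus consists of products of \<open>delta dE\<close> and
  \<open>delta dE'\<close>, and its weights are half the eigenvalues of \<open>ad dE\<close> and
  \<open>ad dE'\<close>. The two descriptions are identified in \<open>Gam_eq\<close>.\<close>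

definition GA :: "G6 \<Rightarrow> 'a elt set" where
  "GA = (\<lambda>(k0, k, n). {z. Theta z = elt_scale (bit_sign k0) z \<and>
     diamond G1 z = elt_scale (bit_sign (k $ 1)) z \<and> diamond G2 z = elt_scale (bit_sign (k $ 2)) z \<and>
     z \<in> eig (dE, 0) (2 * n $ 1) \<and> z \<in> eig (dE', 0) (2 * n $ 2)})"

lemma Theta_lin: "linear_on_L Theta"
  by (auto simp: linear_on_L_def Theta_def elt_scale_def vec_eq_iff prod_eq_iff)

lemma Theta_L: "z \<in> L \<Longrightarrow> Theta z \<in> L"
  by (simp add: Theta_def mem_L L1_neg)

lemma Theta_Theta: "Theta (Theta z) = (z :: 'a elt)"
  by (simp add: Theta_def)

lemma Theta_br:
  assumes x: "x \<in> L" and y: "y \<in> L"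
  shows "Theta (br x y) = br (Theta x) (Theta y)"
proof -
  have L: "fst x \<in> L0" "snd x \<in> L1" "fst y \<in> L0" "snd y \<in> L1" using x y by (simp_all add: mem_L)
  have br: "br (a, v) z = br (a, 0) z + br (0, v) z" if "a \<in> L0" "v \<in> L1" "z \<in> L" for a v z
    using br_add_left[of "(a, 0)" "(0, v)" z] that by simp
  have Bneg: "B (- v) (- w) = B v w" if "v \<in> L1" "w \<in> L1" for v w
    using br_neg_left[of "(0, v)" "- (0, w)"] br_neg_right[of "(0, v)" "(0, w)"] that by (simp add: B_def L1_neg)
  have "br x y = (fst x ** fst y - fst y ** fst x + B (snd x) (snd y), act (fst x) (snd y) - act (fst y) (snd x))"
    using br[of "fst x" "snd x" y] L y by (simp add: br0 br1)
  moreover have "br (Theta x) (Theta y) = (fst x ** fst y - fst y ** fst x + B (snd x) (snd y), - act (fst x) (snd y) + act (fst y) (snd x))"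
    using br[of "fst x" "- snd x" "Theta y"] L Theta_L[OF y]
    by (simp add: br0 br1 L1_neg) (simp add: Theta_def Bneg act_neg)
  ultimately show ?thesis by (simp add: Theta_def)
qed

lemma G_aut: "restrict (diamond G1) L \<in> lie_auts elt_scale L br" "restrict (diamond G2) L \<in> lie_auts elt_scale L br"
  by (intro diamond_aut special_L0 special_squares)+

lemma G_lin: "linear_on_L (diamond G1)" "linear_on_L (diamond G2)"
  by (rule linear_diamond[OF special_squares(5)], rule linear_diamond[OF special_squares(6)])

lemma G_br: "x \<in> L \<Longrightarrow> y \<in> L \<Longrightarrow> diamond G1 (br x y) = br (diamond G1 x) (diamond G1 y)"
  "x \<in> L \<Longrightarrow> y \<in> L \<Longrightarrow> diamond G2 (br x y) = br (diamond G2 x) (diamond G2 y)"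
  using lie_autsD(3)[OF G_aut(1)] lie_autsD(3)[OF G_aut(2)] by (simp_all add: br_L)

lemma G_L: "x \<in> L \<Longrightarrow> diamond G1 x \<in> L" "x \<in> L \<Longrightarrow> diamond G2 x \<in> L"
  using lie_autsD(2)[OF G_aut(1)] lie_autsD(2)[OF G_aut(2)] by simp_all

lemma G_G: "diamond G1 (diamond G1 z) = z" "diamond G2 (diamond G2 z) = z"
  by (simp_all add: diamond_mult[OF special_squares(5,5), symmetric] diamond_mult[OF special_squares(6,6), symmetric]
      special_squares diamond_eq[OF matrix_mul_lid] ext4_map_one)

lemma gW_mult: "gW s ** gW t = gW (s ** t)"
  by (simp add: gW_def kron_mult)

lemma G1_G2: "diamond G2 (diamond G1 z) = diamond G1 (diamond G2 z)"
proof -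
  have "G2 ** G1 = - (G1 ** G2)" unfolding gW_mult sigma_products(4) by (simp add: gW_def kron_neg)
  moreover have "(G1 ** G2) ** (G2 ** G1) = mat 1"
  proof -
    have "(G1 ** G2) ** (G2 ** G1) = G1 ** (G2 ** G2) ** G1" by (simp only: matrix_mul_assoc)
    then show ?thesis by (simp add: special_squares)
  qed
  ultimately show ?thesis
    using diamond_uminus diamond_mult[OF special_squares(5,6)] diamond_mult[OF special_squares(6,5)] by metis
qed

lemma Theta_diamond: "f ** f' = mat 1 \<Longrightarrow> Theta (diamond f z) = diamond f (Theta z)" for f :: "'a mat8"
proof -
  assume f: "f ** f' = mat 1"
  have neg: "ext4_map f (- w) = - ext4_map f w" for w
    using ext4_map_scale[of f "- 1" w] by (simp add: tensor_scale_neg)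
  show "Theta (diamond f z) = diamond f (Theta z)" by (simp add: Theta_def diamond_eq[OF f] neg)
qed

lemma commute_eig:
  assumes "T \<in> {Theta, diamond G1, diamond G2}" "d \<in> {dE, dE'}" "z \<in> eig (d, 0) m"
  shows "T z \<in> eig (d, 0) m"
proof -
  have zL: "z \<in> L" and D: "br (d, 0) z = elt_scale (of_int m) z" using assms(3) by (auto simp: eig_def)
  have dL: "(d, 0) \<in> L" using assms(2) by auto
  have "diamond G1 (d, 0) = (d, 0)" "diamond G2 (d, 0) = (d, 0)" "Theta (d, 0) = (d, 0)"
    using assms(2) conj_eq[OF special_commute(7) special_squares(5)] conj_eq[OF special_commute(7) special_squares(6)]
      conj_eq[OF special_commute(8) special_squares(5)] conj_eq[OF special_commute(8) special_squares(6)]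
    by (auto simp: diamond_eq[OF special_squares(5)] diamond_eq[OF special_squares(6)] ext4_map_0 Theta_def)
  then have Td: "T (d, 0) = (d, 0)" using assms(1) by auto
  have T: "T (br (d, 0) z) = br (T (d, 0)) (T z)" "T (elt_scale (of_int m) z) = elt_scale (of_int m) (T z)" "T z \<in> L"
    using assms(1) G_br[OF dL zL] Theta_br[OF dL zL] G_lin Theta_lin G_L[OF zL] Theta_L[OF zL] zL
    by (auto simp: linear_on_L_def)
  show ?thesis using T D Td by (simp add: eig_def)
qed

lemma involution_split:
  assumes W: "subspace W" "W \<subseteq> L" "\<And>z. z \<in> W \<Longrightarrow> T z \<in> W" and T: "linear_on_L T" "\<And>z. T (T z) = z"
    and z: "z \<in> W"
  obtains u where "\<And>k. u k \<in> W" "\<And>k. T (u k) = elt_scale (bit_sign k) (u k)" "z = u 0 + u 1"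
proof (rule that[of "\<lambda>k. elt_scale (1 / 2) (z + elt_scale (bit_sign k) (T z))"])
  have L: "z \<in> L" "T z \<in> L" using W z by blast+
  show "elt_scale (1 / 2) (z + elt_scale (bit_sign k) (T z)) \<in> W" for k
    using W z by (intro subspace_scale subspace_add)
  show "T (elt_scale (1 / 2) (z + elt_scale (bit_sign k) (T z))) =
      elt_scale (bit_sign k) (elt_scale (1 / 2) (z + elt_scale (bit_sign k) (T z)))" for k
  proof -
    have "T (elt_scale (1 / 2) (z + elt_scale (bit_sign k) (T z))) = elt_scale (1 / 2) (T z + elt_scale (bit_sign k) z)"
      using T L by (simp add: linear_on_L_def L_add L_sc)
    also have "\<dots> = elt_scale (bit_sign k) (elt_scale (1 / 2) (z + elt_scale (bit_sign k) (T z)))"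
      by (simp add: scale_right_distrib mult.commute mult.left_commute)
    finally show ?thesis .
  qed
  show "z = elt_scale (1 / 2) (z + elt_scale (bit_sign 0) (T z)) + elt_scale (1 / 2) (z + elt_scale (bit_sign 1) (T z))"
    by (simp add: bit_sign_def scale_right_distrib scale_right_diff_distrib flip: scale_left_distrib)
qed

lemma subspace_T_eig:
  assumes "subspace W" "W \<subseteq> L" "linear_on_L T"
  shows "subspace {z \<in> W. T z = elt_scale c z}"
proof (rule subspaceI)
  show "0 \<in> {z \<in> W. T z = elt_scale c z}" using linear_on_L_0[OF assms(3)] subspace_0[OF assms(1)] by simp
  show "x + y \<in> {z \<in> W. T z = elt_scale c z}"
    if xy: "x \<in> {z \<in> W. T z = elt_scale c z}" "y \<in> {z \<in> W. T z = elt_scale c z}" for x y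
  proof -
    have "x \<in> L" "y \<in> L" using xy assms(2) by blast+
    then have "T (x + y) = T x + T y" using assms(3) unfolding linear_on_L_def by blast
    then show ?thesis using xy subspace_add[OF assms(1)] by (simp add: scale_right_distrib)
  qed
  show "elt_scale a x \<in> {z \<in> W. T z = elt_scale c z}" if x: "x \<in> {z \<in> W. T z = elt_scale c z}" for a x
  proof -
    have "x \<in> L" using x assms(2) by blast
    then have "T (elt_scale a x) = elt_scale a (T x)" using assms(3) unfolding linear_on_L_def by blast
    then show ?thesis using x subspace_scale[OF assms(1)] by (simp add: mult.commute)
  qed
qed

lemma subspace_GA: "subspace (GA s)"
proof (cases s)
  case (fields k0 k n)
  have "subspace (eig (dE, 0) m \<inter> eig (dE', 0) m')" for m m'
    by (intro subspace_inter subspace_eig) simp_all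
  then have 1: "subspace {z \<in> eig (dE, 0) m \<inter> eig (dE', 0) m'. T z = elt_scale c z}"
    if "linear_on_L T" for m m' T c
    by (rule subspace_T_eig) (use eig_L that in auto)
  have "GA s = {z \<in> eig (dE, 0) (2 * n $ 1) \<inter> eig (dE', 0) (2 * n $ 2). Theta z = elt_scale (bit_sign k0) z} \<inter>
      {z \<in> eig (dE, 0) (2 * n $ 1) \<inter> eig (dE', 0) (2 * n $ 2). diamond G1 z = elt_scale (bit_sign (k $ 1)) z} \<inter>
      {z \<in> eig (dE, 0) (2 * n $ 1) \<inter> eig (dE', 0) (2 * n $ 2). diamond G2 z = elt_scale (bit_sign (k $ 2)) z}"
    unfolding GA_def fields by auto
  then show ?thesis using 1 Theta_lin G_lin by (simp add: subspace_inter)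
qed

lemma GA_L: "z \<in> GA s \<Longrightarrow> z \<in> L"
  by (cases s) (auto simp: GA_def eig_def)

text \<open>Split by \<open>dE\<close>, then by \<open>dE'\<close> inside the eigenspaces of
  \<open>dE\<close>, then by three involutions. The matrices \<open>G1\<close> and \<open>G2\<close>
  anticommute, but their conjugations commute, the sign having no effect.\<close>

lemma GA_span: "L \<subseteq> span (\<Union>s. GA s)"
proof
  fix z assume z: "z \<in> L"
  have 1: "x \<in> span (\<Union>s. GA s)" if x: "x \<in> eig (dE, 0) (2 * m)" "x \<in> eig (dE', 0) (2 * n)" for x m n
  proof -
    let ?W = "eig (dE, 0) (2 * m) \<inter> eig (dE', 0) (2 * n)"
    have sW: "subspace ?W" by (intro subspace_inter subspace_eig) simp_all
    have WL: "?W \<subseteq> L" using eig_L by auto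
    have TW: "T y \<in> ?W" if "T \<in> {Theta, diamond G1, diamond G2}" "y \<in> ?W" for T y
      using commute_eig[OF that(1)] that(2) by auto
    have comm: "diamond G1 (Theta y) = Theta (diamond G1 y)" "diamond G2 (Theta y) = Theta (diamond G2 y)" for y
      using Theta_diamond[OF special_squares(5)] Theta_diamond[OF special_squares(6)] by auto
    obtain u where u: "\<And>k. u k \<in> ?W" "\<And>k. Theta (u k) = elt_scale (bit_sign k) (u k)" "x = u 0 + u 1"
      by (rule involution_split[OF sW WL TW[of Theta] Theta_lin Theta_Theta, of x]) (use x in auto)
    have "u k0 \<in> span (\<Union>s. GA s)" for k0
    proof -
      let ?W1 = "{y \<in> ?W. Theta y = elt_scale (bit_sign k0) y}"
      have s1: "subspace ?W1" by (rule subspace_T_eig[OF sW WL Theta_lin])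
      have T1: "T y \<in> ?W1" if "T \<in> {diamond G1, diamond G2}" "y \<in> ?W1" for T y
        using that TW[of T y] comm G_lin WL by (auto simp: linear_on_L_def simp flip: comm)
      obtain v where v: "\<And>k. v k \<in> ?W1" "\<And>k. diamond G1 (v k) = elt_scale (bit_sign k) (v k)" "u k0 = v 0 + v 1"
        by (rule involution_split[OF s1 _ T1[of "diamond G1"] G_lin(1) G_G(1), of "u k0"]) (use u WL in auto)
      have "v k1 \<in> span (\<Union>s. GA s)" for k1
      proof -
        let ?W2 = "{y \<in> ?W1. diamond G1 y = elt_scale (bit_sign k1) y}"
        have W1L: "?W1 \<subseteq> L" using WL by auto
        have s2: "subspace ?W2" by (rule subspace_T_eig[OF s1 W1L G_lin(1)])
        have T2: "diamond G2 y \<in> ?W2" if y: "y \<in> ?W2" for y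
        proof -
          have "diamond G1 (diamond G2 y) = diamond G2 (elt_scale (bit_sign k1) y)"
            using y by (simp flip: G1_G2)
          also have "\<dots> = elt_scale (bit_sign k1) (diamond G2 y)"
            using y W1L G_lin(2) by (auto simp: linear_on_L_def)
          finally show ?thesis using T1[of "diamond G2" y] y by simp
        qed
        obtain w where w: "\<And>k. w k \<in> ?W2" "\<And>k. diamond G2 (w k) = elt_scale (bit_sign k) (w k)" "v k1 = w 0 + w 1"
          by (rule involution_split[OF s2 _ T2 G_lin(2) G_G(2), of "v k1"]) (use v W1L in auto)
        have "w k2 \<in> GA (k0, vector [k1, k2], vector [m, n])" for k2
          using w(1,2)[of k2] by (simp add: GA_def)
        then have "w k2 \<in> span (\<Union>s. GA s)" for k2 by (blast intro: span_base)
        then show ?thesis unfolding w(3) by (intro span_add)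
      qed
      then show ?thesis unfolding v(3) by (intro span_add)
    qed
    then show ?thesis unfolding u(3) by (intro span_add)
  qed
  have 2: "x \<in> span (\<Union>s. GA s)" if x: "x \<in> eig (dE, 0) (2 * m)" for x m
  proof -
    have xL: "x \<in> L" using x by (rule eig_L)
    obtain y where y: "\<And>n. y n \<in> eig (dE', 0) (2 * n)" "x = (\<Sum>n\<in>{- 2, - 1, 0, 1, 2}. y n)"
      using even_eig_decomposition[OF special_L0(2) special_squares(2) xL] by blast
    have "y n \<in> span (\<Union>s. GA s)" if n: "n \<in> {- 2, - 1, 0, 1, 2}" for n
    proof -
      \<comment> \<open>\<open>eig_components\<close> labels summands by their eigenvalues, here the
        even numbers \<open>2 * n\<close>; hence the relabelling by \<open>j div 2\<close>.\<close>
      let ?S = "(\<lambda>n. 2 * n) ` {- 2, - 1, 0, 1, 2 :: int}"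
      have "y (2 * n div 2) \<in> eig (dE, 0) (2 * m)"
      proof (rule eig_components[of "(dE', 0)" "eig (dE, 0) (2 * m)" ?S "\<lambda>j. y (j div 2)"])
        show "br (dE', 0) ` eig (dE, 0) (2 * m) \<subseteq> eig (dE, 0) (2 * m)"
        proof (rule image_subsetI)
          fix v assume v: "v \<in> eig (dE, 0) (2 * m)"
          have "(dE', 0) \<in> eig (dE, 0) 0" by (simp add: eig_dE_L0 special_commute msc_0)
          from eig_br[OF special_L(1) this v] show "br (dE', 0) v \<in> eig (dE, 0) (2 * m)" by simp
        qed
        show "y (j div 2) \<in> eig (dE', 0) j" if "j \<in> ?S" for j
        proof -
          from that obtain l where "j = 2 * l" by blast
          then show ?thesis using y(1)[of l] by simp
        qed
        have "(\<Sum>j\<in>?S. y (j div 2)) = x" unfolding y(2) by (subst sum.reindex) (auto simp: inj_on_def)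
        then show "(\<Sum>j\<in>?S. y (j div 2)) \<in> eig (dE, 0) (2 * m)" using x by simp
        show "2 * n \<in> ?S" using n by blast
        show "subspace (eig (dE, 0) (2 * m))" by (intro subspace_eig) simp
      qed simp_all
      then show ?thesis using 1 y(1)[of n] by simp
    qed
    then show ?thesis unfolding y(2) by (intro span_sum)
  qed
  obtain y where y: "\<And>m. y m \<in> eig (dE, 0) (2 * m)" "z = (\<Sum>m\<in>{- 2, - 1, 0, 1, 2}. y m)"
    using dE_decomposition[OF z] by blast
  show "z \<in> span (\<Union>s. GA s)" unfolding y(2) using 2 y(1) by (intro span_sum) blast
qed

lemma delta_dE: "l \<noteq> 0 \<Longrightarrow> delta dE l = kron (dg l (1 / l) l (1 / l)) (mat 1)"
  and delta_dE': "l \<noteq> 0 \<Longrightarrow> delta dE' l = kron (dg l (1 / l) (1 / l) l) (mat 1)" for l :: 'a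
  by (simp_all add: delta_def dE_def dE'_def kron_one[symmetric] kron_msc(1)[symmetric] kron_add(1)[symmetric]
      flip: dg_one)
    (rule arg_cong[of _ _ "\<lambda>P. kron P _"], simp add: mat4_simps pE_def pE'_def field_simps)+

text \<open>\<open>tau \<alpha> \<beta>\<close> is the product of \<open>delta dE l\<close> and
  \<open>delta dE' u\<close> with \<open>l^2 = \<alpha> \<beta>\<close> and
  \<open>u^2 = \<alpha> / \<beta>\<close>. The roots enter the result with even exponents.\<close>

lemma diamond_tau:
  assumes z: "z \<in> eig (dE, 0) (2 * m)" "z \<in> eig (dE', 0) (2 * n)" and ab: "\<alpha> \<noteq> 0" "\<beta> \<noteq> 0"
  shows "diamond (tau \<alpha> \<beta>) z = elt_scale ((\<alpha> * \<beta>) powi m * (\<alpha> / \<beta>) powi n) z"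
proof -
  obtain l where l: "l ^ 2 = \<alpha> * \<beta>" using nth_root_exists[of 2 "\<alpha> * \<beta>"] by auto
  have l0: "l \<noteq> 0" using l ab by auto
  define u where "u = \<alpha> / l"
  have u0: "u \<noteq> 0" using ab l0 by (simp add: u_def)
  have u2: "u ^ 2 = \<alpha> / \<beta>" using l ab by (simp add: u_def power_divide) (simp add: power2_eq_square)
  have lu: "l * u = \<alpha>" "l / u = \<beta>" using l l0 ab by (simp_all add: u_def power2_eq_square field_simps)
  have tau: "tau \<alpha> \<beta> = delta dE l ** delta dE' u"
    unfolding delta_dE[OF l0] delta_dE'[OF u0] kron_mult dg_mult tau_kron matrix_mul_lid
    using lu l0 u0 by (simp add: lu[symmetric])
  have pow: "x powi (2 * j) = (x ^ 2) powi j" for x :: 'a and j by (simp add: power_int_mult)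
  have "diamond (tau \<alpha> \<beta>) z = diamond (delta dE l) (diamond (delta dE' u) z)"
    unfolding tau by (rule diamond_mult[OF delta_inverse[OF special_squares(1) l0] delta_inverse[OF special_squares(2) u0]])
  also have "\<dots> = diamond (delta dE l) (elt_scale ((\<alpha> / \<beta>) powi n) z)"
    unfolding diamond_delta_eig[OF special_L0(2) special_squares(2) z(2) u0] pow u2 ..
  also have "\<dots> = elt_scale ((\<alpha> / \<beta>) powi n) (diamond (delta dE l) z)"
    using linear_diamond[OF delta_inverse[OF special_squares(1) l0]] eig_L[OF z(1)] by (simp add: linear_on_L_def)
  also have "\<dots> = elt_scale ((\<alpha> * \<beta>) powi m * (\<alpha> / \<beta>) powi n) z"
    unfolding diamond_delta_eig[OF special_L0(1) special_squares(1) z(1) l0] pow l by (simp add: mult.commute)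
  finally show ?thesis .
qed

lemma mem_Gam: "z \<in> Gam (k0, k, n) \<longleftrightarrow> z \<in> L \<and> Theta z = elt_scale (bit_sign k0) z \<and>
     diamond G1 z = elt_scale (bit_sign (k $ 1)) z \<and> diamond G2 z = elt_scale (bit_sign (k $ 2)) z \<and>
     (\<forall>\<alpha> \<beta>. \<alpha> \<noteq> 0 \<and> \<beta> \<noteq> 0 \<longrightarrow>
        diamond (tau \<alpha> \<beta>) z = elt_scale ((\<alpha> * \<beta>) powi (n $ 1) * (\<alpha> / \<beta>) powi (n $ 2)) z)"
  by (simp add: Gamma6_def block_diag_gW)

lemma GA_Gam: "GA s \<subseteq> Gam s"
proof (cases s)
  case (fields k0 k n)
  show ?thesis unfolding fields
  proof
    fix z assume z: "z \<in> GA (k0, k, n)"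
    then have e: "z \<in> eig (dE, 0) (2 * n $ 1)" "z \<in> eig (dE', 0) (2 * n $ 2)" by (simp_all add: GA_def)
    show "z \<in> Gam (k0, k, n)"
      unfolding mem_Gam using z GA_L[OF z] diamond_tau[OF e] by (simp add: GA_def)
  qed
qed

lemma tau_inverse: "\<alpha> \<noteq> 0 \<Longrightarrow> \<beta> \<noteq> 0 \<Longrightarrow> tau \<alpha> \<beta> ** tau (1 / \<alpha>) (1 / \<beta>) = (mat 1 :: 'a mat8)"
  by (simp add: tau_kron kron_mult dg_mult kron_one dg_one)

text \<open>Each coordinate of a degree is detected by one operator. The elements
  \<open>tau 2 2\<close> and \<open>tau 2 (1 / 2)\<close> isolate the two free coordinates: one of
  the factors in the torus condition becomes 1 and the other a power of 4, which determines its
  exponent in characteristic 0.\<close>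

lemma Gam_indep:
  assumes S: "finite S" and y: "\<And>s. s \<in> S \<Longrightarrow> y s \<in> Gam s" and 0: "sum y S = 0" and "s \<in> S"
  shows "y s = 0"
proof -
  have yL: "y s \<in> L" if "s \<in> S" for s using y[OF that] by (cases s) (simp add: mem_Gam)
  have "y s \<in> {0}"
  proof (rule eigen_components[OF S sub_L subspace_single_0 yL _ _ \<open>s \<in> S\<close>])
    show "sum y S \<in> {0}" using 0 by simp
    fix s s' assume ss: "s \<in> S" "s' \<in> S" "s \<noteq> s'"
    have lin: "\<exists>T \<mu>. T ` {0} \<subseteq> {0} \<and> (\<forall>u\<in>L. \<forall>v\<in>L. T (u + v) = T u + T v) \<and>
        (\<forall>c. \<forall>u\<in>L. T (elt_scale c u) = elt_scale c (T u)) \<and> (\<forall>r\<in>S. T (y r) = elt_scale (\<mu> r) (y r)) \<and> \<mu> s \<noteq> \<mu> s'"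
      if "linear_on_L T" "\<And>r. r \<in> S \<Longrightarrow> T (y r) = elt_scale (\<mu> r) (y r)" "\<mu> s \<noteq> \<mu> s'" for T \<mu>
      using that linear_on_L_0[OF that(1)] by (intro exI[of _ T] exI[of _ \<mu>]) (auto simp: linear_on_L_def)
    obtain k0 k n k0' k' n' where s: "s = (k0, k, n)" "s' = (k0', k', n')" by (cases s; cases s') blast
    have yr: "Theta (y r) = elt_scale (bit_sign (fst r)) (y r)"
      "diamond G1 (y r) = elt_scale (bit_sign (fst (snd r) $ 1)) (y r)"
      "diamond G2 (y r) = elt_scale (bit_sign (fst (snd r) $ 2)) (y r)"
      "diamond (tau 2 2) (y r) = elt_scale (4 powi (snd (snd r) $ 1)) (y r)"
      "diamond (tau 2 (1 / 2)) (y r) = elt_scale (4 powi (snd (snd r) $ 2)) (y r)" if "r \<in> S" for r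
    proof -
      obtain a b c where r: "r = (a, b, c)" by (cases r)
      have m: "y r \<in> L \<and> Theta (y r) = elt_scale (bit_sign a) (y r) \<and>
        diamond G1 (y r) = elt_scale (bit_sign (b $ 1)) (y r) \<and> diamond G2 (y r) = elt_scale (bit_sign (b $ 2)) (y r) \<and>
        (\<forall>\<alpha> \<beta>. \<alpha> \<noteq> 0 \<and> \<beta> \<noteq> 0 \<longrightarrow>
          diamond (tau \<alpha> \<beta>) (y r) = elt_scale ((\<alpha> * \<beta>) powi (c $ 1) * (\<alpha> / \<beta>) powi (c $ 2)) (y r))"
        using y[OF that] unfolding mem_Gam[symmetric] r by simp
      then show "Theta (y r) = elt_scale (bit_sign (fst r)) (y r)"
        "diamond G1 (y r) = elt_scale (bit_sign (fst (snd r) $ 1)) (y r)"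
        "diamond G2 (y r) = elt_scale (bit_sign (fst (snd r) $ 2)) (y r)" by (simp_all add: r)
      have "diamond (tau 2 2) (y r) = elt_scale ((2 * 2) powi (c $ 1) * (2 / 2) powi (c $ 2)) (y r)"
        "diamond (tau 2 (1 / 2)) (y r) = elt_scale ((2 * (1 / 2)) powi (c $ 1) * (2 / (1 / 2)) powi (c $ 2)) (y r)"
        using m by simp_all
      then show "diamond (tau 2 2) (y r) = elt_scale (4 powi (snd (snd r) $ 1)) (y r)"
        "diamond (tau 2 (1 / 2)) (y r) = elt_scale (4 powi (snd (snd r) $ 2)) (y r)" by (simp_all add: r)
    qed
    consider "k0 \<noteq> k0'" | "k $ 1 \<noteq> k' $ 1" | "k $ 2 \<noteq> k' $ 2" | "n $ 1 \<noteq> n' $ 1" | "n $ 2 \<noteq> n' $ 2"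
      using ss(3) unfolding s by (auto simp: vec_eq_iff forall_2)
    then show "\<exists>T \<mu>. T ` {0} \<subseteq> {0} \<and> (\<forall>u\<in>L. \<forall>v\<in>L. T (u + v) = T u + T v) \<and>
        (\<forall>c. \<forall>u\<in>L. T (elt_scale c u) = elt_scale c (T u)) \<and> (\<forall>r\<in>S. T (y r) = elt_scale (\<mu> r) (y r)) \<and> \<mu> s \<noteq> \<mu> s'"
    proof cases
      case 1
      then show ?thesis by (intro lin[OF Theta_lin yr(1)]) (auto simp: s dest: bit_sign_neq)
    next
      case 2
      then show ?thesis by (intro lin[OF G_lin(1) yr(2)]) (auto simp: s dest: bit_sign_neq)
    next
      case 3
      then show ?thesis by (intro lin[OF G_lin(2) yr(3)]) (auto simp: s dest: bit_sign_neq)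
    next
      case 4
      then show ?thesis
        by (intro lin[OF linear_diamond[OF tau_inverse[of 2 2]] yr(4)]) (auto simp: s dest: powi_inj)
    next
      case 5
      then show ?thesis
        by (intro lin[OF linear_diamond[OF tau_inverse[of 2 "1 / 2"]] yr(5)]) (auto simp: s dest: powi_inj)
    qed
  qed
  then show ?thesis by simp
qed

text \<open>The subspaces \<open>GA s\<close> span L and are contained in the independent subspaces
  \<open>Gam s\<close>, so no \<open>Gam s\<close> can be larger.\<close>

lemma Gam_eq: "Gam = GA"
proof
  fix s
  have "z \<in> GA s" if z: "z \<in> Gam s" for z
  proof -
    have zL: "z \<in> L" using z by (cases s) (simp add: mem_Gam)
    obtain S y where y: "finite S" "\<And>i. y i \<in> GA i" "z = sum y S" "\<And>i. i \<notin> S \<Longrightarrow> y i = 0"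
      using span_Union_sum[of GA, OF subspace_GA subsetD[OF GA_span zL]] by metis
    let ?S = "insert s S"
    have sumy: "sum y ?S = z" using y by (cases "s \<in> S") (auto simp: insert_absorb)
    define x where "x i = y i - (if i = s then z else 0)" for i
    have sub: "subspace (Gam s)"
    proof (cases s)
      case (fields k0 k n)
      show ?thesis unfolding fields
        by (rule subspaceI)
          (use linear_on_L_0 Theta_lin G_lin linear_diamond[OF tau_inverse] in
            \<open>auto simp: mem_Gam linear_on_L_def scale_right_distrib mult.commute L_add L_sc\<close>)
    qed
    have "sum x ?S = 0" using y(1) by (simp add: x_def sum_subtractf sumy del: sum.insert)
    moreover have "x i \<in> Gam i" if "i \<in> ?S" for i
      using y(2)[of i] GA_Gam[of i] z sub by (auto simp: x_def intro: subspace_diff)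
    ultimately have "x s = 0" using Gam_indep[of ?S x s] y(1) by blast
    then show ?thesis using y(2)[of s] by (simp add: x_def)
  qed
  then show "Gam s = GA s" using GA_Gam by blast
qed

lemma Gam_grading: "grading elt_scale L br Gam"
  unfolding grading_def
proof (intro conjI allI ballI)
  show "subspace (Gam s)" for s unfolding Gam_eq by (rule subspace_GA)
  show "Gam s \<subseteq> L" for s unfolding Gam_eq using GA_L by blast
  show "\<exists>!y. (\<forall>g. y g \<in> Gam g) \<and> finite {g. y g \<noteq> 0} \<and> x = (\<Sum>g | y g \<noteq> 0. y g)" if "x \<in> L" for x
  proof (rule ex1_decomposition)
    show "subspace (Gam s)" for s unfolding Gam_eq by (rule subspace_GA)
    show "x \<in> span (\<Union>s. Gam s)" unfolding Gam_eq using GA_span that by blast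
  qed (rule Gam_indep)
  show "br x y \<in> Gam (s + t)" if x: "x \<in> Gam s" and y: "y \<in> Gam t" for s t x y
  proof -
    obtain k0 k n k0' k' n' where s: "s = (k0, k, n)" "t = (k0', k', n')" by (cases s; cases t) blast
    have xy: "x \<in> L" "y \<in> L" using x y GA_L unfolding Gam_eq by blast+
    have x': "x \<in> GA (k0, k, n)" and y': "y \<in> GA (k0', k', n')" using x y by (simp_all add: Gam_eq s)
    have "br x y \<in> eig (dE, 0) (2 * n $ 1 + 2 * n' $ 1)" "br x y \<in> eig (dE', 0) (2 * n $ 2 + 2 * n' $ 2)"
      using x' y' by (auto simp: GA_def intro!: eig_br)
    moreover have sc: "br (elt_scale a x) (elt_scale b y) = elt_scale (a * b) (br x y)" for a b
      using xy by (simp add: br_sc_left br_sc_right L_sc)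
    moreover have "Theta (br x y) = elt_scale (bit_sign (k0 + k0')) (br x y)"
      "diamond G1 (br x y) = elt_scale (bit_sign (k $ 1 + k' $ 1)) (br x y)"
      "diamond G2 (br x y) = elt_scale (bit_sign (k $ 2 + k' $ 2)) (br x y)"
      unfolding Theta_br[OF xy] G_br[OF xy] bit_sign_add using x' y' by (simp_all add: GA_def sc)
    ultimately show ?thesis
      unfolding Gam_eq s GA_def
      by (simp only: add_Pair prod.case mem_Collect_eq vector_add_component distrib_left)
  qed
qed

text \<open>Here \<open>f\<close> is i^(ad w) and \<open>f'\<close> its inverse. Since
  \<open>G1\<close>, \<open>G2\<close> fix \<open>w\<close> and \<open>dE\<close>,
  \<open>dE'\<close> commute with it, \<open>f\<close> preserves the degrees k and n. As
  \<open>f^2\<close> is conjugation by \<open>g\<close>, on a component \<open>f\<close> is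
  \<open>f'\<close> times the sign of \<open>g\<close>; and \<open>Theta f = f' Theta\<close>, so
  the Theta-degree changes by exactly this sign.\<close>

lemma shift_aut:
  assumes w: "w \<in> L1" "act dE w = 0" "act dE' w = 0" "ext4_map G1 w = w" "ext4_map G2 w = w"
    and p: "parity (0, w) g" and par: "\<And>k0 k n z. z \<in> GA (k0, k, n) \<Longrightarrow> diamond g z = elt_scale (bit_sign (par k n)) z"
  shows "\<exists>f\<in>lie_auts elt_scale L br. \<forall>k0 k n. f ` Gam (k0, k, n) \<subseteq> Gam (k0 + par k n, k, n)"
proof -
  obtain i :: 'a where i: "i ^ 2 = - 1" using ex_imaginary_unit by blast
  have ii: "i * i = - 1" using i by (simp add: power2_eq_square)
  have i0: "i \<noteq> 0" using i by auto
  have int: "integral (0, w)" using p by (simp add: parity_def)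
  have hL: "(0, w) \<in> L" using w by simp
  obtain f where f: "f \<in> lie_auts elt_scale L br" "\<And>m z. z \<in> eig (0, w) m \<Longrightarrow> f z = elt_scale (i powi m) z"
    using torus_aut[OF int i0] by metis
  obtain f' where f': "f' \<in> lie_auts elt_scale L br" "\<And>m z. z \<in> eig (0, w) m \<Longrightarrow> f' z = elt_scale (i powi (- m)) z"
    using torus_aut[OF int, of "inverse i"] i0 by (auto simp: power_int_minus power_int_inverse)
  note fD = lie_autsD[OF f(1)] and f'D = lie_autsD[OF f'(1)]
  have comp: "linear_on_L (\<lambda>z. a (b z))" if "linear_on_L a" "linear_on_L b" "\<And>z. z \<in> L \<Longrightarrow> b z \<in> L" for a b
    using that by (auto simp: linear_on_L_def)
  have sc: "T (elt_scale c z) = elt_scale c (T z)" if "linear_on_L T" "z \<in> L" for T c z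
    using that by (simp add: linear_on_L_def)
  have eL: "z \<in> L" if "z \<in> eig (0, w) m" for z m using that by (rule eig_L)
  have fG: "f (diamond G z) = diamond G (f z)" if G: "G = G1 \<or> G = G2" and z: "z \<in> L" for G z
  proof (rule integral_eqI[OF int _ _ _ z])
    have lin: "linear_on_L (diamond G)" and GL: "\<And>z. z \<in> L \<Longrightarrow> diamond G z \<in> L" using G G_lin G_L by auto
    show "linear_on_L (\<lambda>z. f (diamond G z))" "linear_on_L (\<lambda>z. diamond G (f z))"
      by (rule comp[OF fD(1) lin GL] comp[OF lin fD(1,2)], assumption)+
    fix m x assume x: "x \<in> eig (0, w) m"
    have "restrict (diamond G) L \<in> lie_auts elt_scale L br" using G G_aut by auto
    from eig_image[OF this hL x] have "diamond G x \<in> eig (diamond G (0, w)) m" using eL[OF x] hL by simp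
    moreover have "diamond G (0, w) = (0, w)"
      using G w by (auto simp: diamond_eq[OF special_squares(5)] diamond_eq[OF special_squares(6)])
    ultimately have "diamond G x \<in> eig (0, w) m" by simp
    then show "f (diamond G x) = diamond G (f x)" using f(2) x sc[OF lin eL[OF x]] by simp
  qed
  have fTheta: "Theta (f z) = f' (Theta z)" if z: "z \<in> L" for z
  proof (rule integral_eqI[OF int _ _ _ z])
    show "linear_on_L (\<lambda>z. Theta (f z))" "linear_on_L (\<lambda>z. f' (Theta z))"
      by (rule comp[OF Theta_lin fD(1,2)] comp[OF f'D(1) Theta_lin Theta_L], assumption)+
    fix m x assume x: "x \<in> eig (0, w) m"
    have xL: "x \<in> L" by (rule eL[OF x])
    have "Theta (br (0, w) x) = br (Theta (0, w)) (Theta x)" by (rule Theta_br[OF hL xL])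
    moreover have "Theta (0, w) = - (0, w)" by (simp add: Theta_def)
    ultimately have "br (0, w) (Theta x) = - Theta (br (0, w) x)" using br_neg_left[OF hL Theta_L[OF xL]] by simp
    also have "br (0, w) x = elt_scale (of_int m) x" using x by (simp add: eig_def)
    finally have "Theta x \<in> eig (0, w) (- m)" using Theta_L[OF xL] sc[OF Theta_lin xL] by (simp add: eig_def)
    from f'(2)[OF this] show "Theta (f x) = f' (Theta x)" using f(2)[OF x] sc[OF Theta_lin xL] by simp
  qed
  have f'f: "f' (f z) = z" and ff: "f (f z) = diamond g z" if z: "z \<in> L" for z
  proof -
    have "x = f' (f x)" "f (f x) = diamond g x" if x: "x \<in> eig (0, w) m" for x m
    proof -
      have xL: "x \<in> L" by (rule eL[OF x])
      show "x = f' (f x)" using f(2)[OF x] f'(2)[OF x] sc[OF f'D(1) xL] i0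
        by (simp flip: power_int_add)
      have "f (f x) = elt_scale (i powi m * i powi m) x" using f(2)[OF x] sc[OF fD(1) xL] by simp
      also have "i powi m * i powi m = (- 1) powi m" by (simp add: ii flip: power_int_mult_distrib)
      finally show "f (f x) = diamond g x" using p x by (simp add: parity_def)
    qed
    note * = this
    show "f' (f z) = z"
    proof (rule integral_eqI[OF int comp[OF f'D(1) fD(1,2)] _ _ z])
      show "linear_on_L (\<lambda>z. z)" by (simp add: linear_on_L_def)
    qed (simp_all add: *(1)[symmetric])
    have "linear_on_L (diamond g)"
      by (simp add: linear_on_L_def diamond_def matrix_add_ldistrib matrix_add_rdistrib ext4_map_add
          fst_elt_scale snd_elt_scale elt_scale_pair msc_mult_left msc_mult_right ext4_map_scale)
    show "f (f z) = diamond g z"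
    proof (rule integral_eqI[OF int comp[OF fD(1) fD(1,2)] _ _ z])
      show "linear_on_L (diamond g)" by fact
    qed (simp_all add: *(2))
  qed
  have fd: "f z \<in> eig (d, 0) m" if d: "d = dE \<or> d = dE'" and z: "z \<in> eig (d, 0) m" for d z m
  proof -
    have dL: "(d, 0) \<in> L" using d by auto
    have "(d, 0) \<in> eig (0, w) 0" using d w by (auto simp: eig_def br10 zero_prod_def)
    from f(2)[OF this] have "f (d, 0) = (d, 0)" by simp
    with eig_image[OF f(1) dL z] show ?thesis by simp
  qed
  have "f z \<in> GA (k0 + par k n, k, n)" if z: "z \<in> GA (k0, k, n)" for z k0 k n
  proof -
    have zL: "z \<in> L" using z by (rule GA_L)
    have z': "Theta z = elt_scale (bit_sign k0) z" "diamond G1 z = elt_scale (bit_sign (k $ 1)) z"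
      "diamond G2 z = elt_scale (bit_sign (k $ 2)) z" "z \<in> eig (dE, 0) (2 * n $ 1)" "z \<in> eig (dE', 0) (2 * n $ 2)"
      using z by (simp_all add: GA_def)
    have "f z = f' (f (f z))" using f'f[OF fD(2)[OF zL]] by simp
    also have "\<dots> = elt_scale (bit_sign (par k n)) (f' z)" using ff[OF zL] par[OF z] sc[OF f'D(1) zL] by simp
    finally have fz: "f z = elt_scale (bit_sign (par k n)) (f' z)" .
    have "Theta (f z) = elt_scale (bit_sign k0) (f' z)" using fTheta[OF zL] z'(1) sc[OF f'D(1) zL] by simp
    also have "\<dots> = elt_scale (bit_sign (k0 + par k n)) (f z)"
      unfolding fz bit_sign_add by (simp add: mult.assoc)
    finally show ?thesis
      using z' fd(1)[OF _ z'(4)] fd(1)[OF _ z'(5)] fG[of G1, OF _ zL, symmetric] fG[of G2, OF _ zL, symmetric] sc[OF fD(1) zL]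
      by (simp add: GA_def)
  qed
  then show ?thesis using f(1) unfolding Gam_eq by blast
qed

end

section \<open>Automorphisms of \<open>Z\<^sub>2 \<times> Z\<^sub>2\<^sup>2 \<times> Z\<^sup>2\<close>\<close>

declare add_bit_eq_xor [simp del] mult_bit_eq_and [simp del]

definition dot :: "bit ^ 2 \<Rightarrow> bit ^ 2 \<Rightarrow> bit" where
  "dot p k = p $ 1 * k $ 1 + p $ 2 * k $ 2"

definition red :: "int ^ 2 \<Rightarrow> bit ^ 2" where
  "red n = (\<chi> i. of_int (n $ i))"

definition parity_sum :: "int ^ 2 \<Rightarrow> bit" where
  "parity_sum n = of_int (n $ 1) + of_int (n $ 2)"

text \<open>In the notation of the matrices, \<open>p\<close> is (a b), \<open>q\<close> is (c d),
  and \<open>v\<close> is the column with entries e, f. Because this column is repeated,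
  \<open>n\<close> acts on it through the parity of n_1 + n_2.\<close>

definition gaut :: "bit ^ 2 \<Rightarrow> bit ^ 2 \<Rightarrow> bit ^ 2 \<Rightarrow> bit ^ 2 ^ 2 \<Rightarrow> int ^ 2 ^ 2 \<Rightarrow> G6 \<Rightarrow> G6" where
  "gaut p q v A B = (\<lambda>(k0, k, n). (k0 + dot p k + dot q (red n), A *v k + parity_sum n *s v, B *v n))"

lemma vec2_eq_iff: "x = y \<longleftrightarrow> x $ 1 = y $ 1 \<and> x $ 2 = (y $ 2 :: 'a)" for x y :: "'a ^ 2"
  by (simp add: vec_eq_iff forall_2)

lemmas gaut_simps = gaut_def dot_def red_def parity_sum_def vec2_eq_iff matrix_vector_mult_def
  matrix_matrix_mult_def sum_2 mat_def

lemma bit_add_self [simp]: "(a :: bit) + a = 0"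
  by (cases a) simp_all

lemma bit_add_self_left [simp]: "(a :: bit) + (a + b) = b"
  by (cases a; cases b) simp_all

lemma dot_add: "dot p (x + y) = dot p x + dot p y" and red_add: "red (m + n) = red m + red n"
  and parity_sum_add: "parity_sum (m + n) = parity_sum m + parity_sum n"
  by (simp_all only: dot_def red_def parity_sum_def vector_add_component of_int_add distrib_left ac_simps
      vec2_eq_iff vec_lambda_beta)

lemma additive_gaut: "Modules.additive (gaut p q v A B)"
proof (rule Modules.additive.intro)
  fix s t :: G6
  obtain k0 k n k0' k' n' where st: "s = (k0, k, n)" "t = (k0', k', n')" by (cases s; cases t) blast
  show "gaut p q v A B (s + t) = gaut p q v A B s + gaut p q v A B t"
    unfolding st gaut_def add_Pair prod.case dot_add red_add parity_sum_add matrix_vector_right_distrib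
      vector_sadd_rdistrib by (simp only: ac_simps)
qed

lemma gaut_id: "gaut 0 0 0 (mat 1) (mat 1) = id"
  by (auto simp: gaut_simps fun_eq_iff)

definition B_set :: "(int ^ 2 ^ 2) set" where
  "B_set = generate GL_group {sigma1, sigma2, - mat 1}"

lemma carrier_B_group: "carrier B_group = B_set"
  by (simp add: B_group_def B_set_def)

definition signed_perm :: "(int ^ 2 ^ 2) set" where
  "signed_perm = {B. \<exists>x y. (x = 1 \<or> x = - 1) \<and> (y = 1 \<or> y = - 1) \<and>
     (B = vector [vector [x, 0], vector [0, y]] \<or> B = vector [vector [0, x], vector [y, 0]])}"

lemma group_GL: "group (GL_group :: ('a::semiring_1 ^ 'n ^ 'n) monoid)"
proof (rule groupI)
  show "\<exists>y\<in>carrier GL_group. y \<otimes>\<^bsub>GL_group\<^esub> x = \<one>\<^bsub>GL_group\<^esub>" if "x \<in> carrier GL_group"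
    for x :: "'a ^ 'n ^ 'n"
    using that by (auto simp: GL_group_def invertible_def)
next
  fix x y :: "'a ^ 'n ^ 'n" assume "x \<in> carrier GL_group" "y \<in> carrier GL_group"
  then obtain x' y' where inv: "x ** x' = mat 1" "x' ** x = mat 1" "y ** y' = mat 1" "y' ** y = mat 1"
    by (auto simp: GL_group_def invertible_def)
  have "(x ** y) ** (y' ** x') = x ** (y ** y') ** x'" "(y' ** x') ** (x ** y) = y' ** (x' ** x) ** y"
    by (simp_all only: matrix_mul_assoc)
  then have "(x ** y) ** (y' ** x') = mat 1" "(y' ** x') ** (x ** y) = mat 1" by (simp_all add: inv)
  then show "x \<otimes>\<^bsub>GL_group\<^esub> y \<in> carrier GL_group" unfolding GL_group_def invertible_def by auto
next
  show "\<one>\<^bsub>GL_group\<^esub> \<in> carrier (GL_group :: ('a ^ 'n ^ 'n) monoid)"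
    unfolding GL_group_def invertible_def by (simp add: exI[of _ "mat 1"])
qed (simp_all add: GL_group_def matrix_mul_assoc)

lemma B_gens: "{sigma1, sigma2, - mat 1} \<subseteq> carrier (GL_group :: (int ^ 2 ^ 2) monoid)"
proof -
  have "sigma1 ** sigma1 = (mat 1 :: int ^ 2 ^ 2)" "sigma2 ** sigma2 = (mat 1 :: int ^ 2 ^ 2)"
    "(- mat 1) ** (- mat 1) = (mat 1 :: int ^ 2 ^ 2)"
    by (simp_all add: mat2_simps)
  then show ?thesis unfolding GL_group_def invertible_def by auto
qed

lemma mult_GL: "x \<otimes>\<^bsub>GL_group\<^esub> y = x ** y" and one_GL: "\<one>\<^bsub>GL_group\<^esub> = mat 1"
  by (simp_all add: GL_group_def)

lemma signed_perm_mult: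
  assumes "x \<in> signed_perm" "y \<in> signed_perm"
  shows "x ** y \<in> signed_perm"
proof -
  have "(vector [vector [a, 0], vector [0, b]] :: int ^ 2 ^ 2) ** (vector [vector [c, 0], vector [0, d]] :: int ^ 2 ^ 2) =
      (vector [vector [a * c, 0], vector [0, b * d]] :: int ^ 2 ^ 2)"
    "(vector [vector [a, 0], vector [0, b]] :: int ^ 2 ^ 2) ** (vector [vector [0, c], vector [d, 0]] :: int ^ 2 ^ 2) =
      (vector [vector [0, a * c], vector [b * d, 0]] :: int ^ 2 ^ 2)"
    "(vector [vector [0, a], vector [b, 0]] :: int ^ 2 ^ 2) ** (vector [vector [c, 0], vector [0, d]] :: int ^ 2 ^ 2) =
      (vector [vector [0, a * d], vector [b * c, 0]] :: int ^ 2 ^ 2)"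
    "(vector [vector [0, a], vector [b, 0]] :: int ^ 2 ^ 2) ** (vector [vector [0, c], vector [d, 0]] :: int ^ 2 ^ 2) =
      (vector [vector [a * d, 0], vector [0, b * c]] :: int ^ 2 ^ 2)" for a b c d :: int
    by (simp_all add: mat2_simps)
  note mult = this
  have sg: "a * c = 1 \<or> a * c = - 1" if "a = 1 \<or> a = - 1" "c = 1 \<or> c = - 1" for a c :: int using that by auto
  obtain a b where ab: "a = 1 \<or> a = - 1" "b = 1 \<or> b = - 1"
    "x = vector [vector [a, 0], vector [0, b]] \<or> x = vector [vector [0, a], vector [b, 0]]"
    using assms(1) unfolding signed_perm_def by blast
  obtain c d where cd: "c = 1 \<or> c = - 1" "d = 1 \<or> d = - 1"
    "y = vector [vector [c, 0], vector [0, d]] \<or> y = vector [vector [0, c], vector [d, 0]]"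
    using assms(2) unfolding signed_perm_def by blast
  note sg = sg[OF ab(1) cd(1)] sg[OF ab(1) cd(2)] sg[OF ab(2) cd(1)] sg[OF ab(2) cd(2)]
  show ?thesis
    using ab(3) cd(3)
  proof (elim disjE; simp only: mult signed_perm_def mem_Collect_eq)
  qed (use sg in blast)+
qed

lemma B_set_eq: "B_set = signed_perm"
proof
  interpret GL: group "GL_group :: (int ^ 2 ^ 2) monoid" by (rule group_GL)
  have gens: "{sigma1, sigma2, - mat 1} \<subseteq> signed_perm"
    unfolding signed_perm_def by (auto simp: mat2_simps)
  have "mat 1 \<in> signed_perm" by (auto simp: signed_perm_def mat2_simps)
  have inv: "m_inv GL_group x \<in> signed_perm" if "x \<in> {sigma1, sigma2, - mat 1}" for x
  proof -
    have "x ** x = mat 1" using that by (auto simp: mat2_simps)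
    then have "m_inv GL_group x = x"
      using that B_gens by (intro GL.inv_equality) (auto simp: mult_GL one_GL)
    then show ?thesis using that gens by auto
  qed
  show "B_set \<subseteq> signed_perm"
  proof
    fix x assume "x \<in> B_set"
    then show "x \<in> signed_perm" unfolding B_set_def
    proof (induction rule: generate.induct)
      case (eng h1 h2)
      then show ?case by (simp add: mult_GL signed_perm_mult)
    qed (use gens inv \<open>mat 1 \<in> signed_perm\<close> in \<open>auto simp: one_GL\<close>)
  qed
  have mult: "x ** y \<in> B_set" if "x \<in> B_set" "y \<in> B_set" for x y
    using generate.eng[of x GL_group "{sigma1, sigma2, - mat 1}" y] that by (simp add: B_set_def mult_GL)
  have s: "sigma1 \<in> B_set" "sigma2 \<in> B_set" "- mat 1 \<in> B_set" "mat 1 \<in> B_set"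
    unfolding B_set_def using generate.incl[of _ "{sigma1, sigma2, - mat 1}" "GL_group :: (int ^ 2 ^ 2) monoid"]
      generate.one[of "GL_group :: (int ^ 2 ^ 2) monoid"] by (auto simp: one_GL)
  have diag: "vector [vector [x, 0], vector [0, y]] \<in> B_set" if "x = 1 \<or> x = - 1" "y = 1 \<or> y = - 1" for x y
  proof -
    have "vector [vector [1, 0], vector [0, 1]] = (mat 1 :: int ^ 2 ^ 2)"
      "vector [vector [1, 0], vector [0, - 1]] = (sigma2 :: int ^ 2 ^ 2)"
      "vector [vector [- 1, 0], vector [0, 1]] = (- mat 1) ** (sigma2 :: int ^ 2 ^ 2)"
      "vector [vector [- 1, 0], vector [0, - 1]] = (- mat 1 :: int ^ 2 ^ 2)"
      by (simp_all add: mat2_simps)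
    then show ?thesis using that s mult[OF s(3,2)] by auto
  qed
  show "signed_perm \<subseteq> B_set"
  proof
    fix B assume "B \<in> signed_perm"
    then obtain x y :: int where xy: "x = 1 \<or> x = - 1" "y = 1 \<or> y = - 1"
      "B = vector [vector [x, 0], vector [0, y]] \<or> B = vector [vector [0, x], vector [y, 0]]"
      by (auto simp: signed_perm_def)
    moreover have "vector [vector [0, x], vector [y, 0]] = (vector [vector [x, 0], vector [0, y]] :: int ^ 2 ^ 2) ** sigma1"
      by (simp add: mat2_simps)
    ultimately show "B \<in> B_set" using diag[OF xy(1,2)] mult[OF diag[OF xy(1,2)] s(1)] by metis
  qed
qed

lemma one_B_set: "mat 1 \<in> B_set" and sigma_B_set: "sigma1 \<in> B_set" "sigma2 \<in> B_set"
  unfolding B_set_eq signed_perm_def by (auto simp: mat2_simps)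

text \<open>Signs disappear modulo 2 and permutations keep the sum. Hence \<open>v\<close> and
  \<open>B\<close> do not interact in products, which later makes the affine part and the signed
  permutations commute.\<close>

lemma parity_sum_B:
  assumes "B \<in> B_set"
  shows "parity_sum (B *v n) = parity_sum n"
proof -
  obtain x y :: int where xy: "x = 1 \<or> x = - 1" "y = 1 \<or> y = - 1"
    "B = vector [vector [x, 0], vector [0, y]] \<or> B = vector [vector [0, x], vector [y, 0]]"
    using assms unfolding B_set_eq signed_perm_def by blast
  then have "of_int x = (1 :: bit)" "of_int y = (1 :: bit)" by auto
  then show ?thesis
    using xy(3) by (elim disjE) (simp_all add: parity_sum_def matrix_vector_mult_def sum_2 add.commute)
qed

definition redM :: "int ^ 2 ^ 2 \<Rightarrow> bit ^ 2 ^ 2" where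
  "redM B = (\<chi> i j. of_int (B $ i $ j))"

definition ones :: "bit ^ 2" where "ones = vector [1, 1]"

text \<open>The term with \<open>ones\<close> arises when \<open>p\<close> is applied to the
  translation \<open>parity_sum n *s v'\<close>: this is a multiple of n_1 + n_2, that is, of the
  pairing of \<open>n\<close> modulo 2 with (1, 1).\<close>

lemma gaut_comp:
  assumes "B' \<in> B_set"
  shows "gaut p q v A B \<circ> gaut p' q' v' A' B' =
    gaut (p' + p v* A') (q' + dot p v' *s ones + q v* redM B') (A *v v' + v) (A ** A') (B ** B')"
proof
  fix s :: G6
  obtain k0 k n where s: "s = (k0, k, n)" by (cases s)
  have "B *v (B' *v n) = (B ** B') *v n" by (simp add: matrix_vector_mul_assoc)
  moreover have "A *v (A' *v k + parity_sum n *s v') + parity_sum n *s v =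
      (A ** A') *v k + parity_sum n *s (A *v v' + v)"
    by (simp add: vec2_eq_iff matrix_vector_mult_def matrix_matrix_mult_def sum_2 algebra_simps)
  moreover have "k0 + dot p' k + dot q' (red n) + dot p (A' *v k + parity_sum n *s v') + dot q (red (B' *v n)) =
      k0 + dot (p' + p v* A') k + dot (q' + dot p v' *s ones + q v* redM B') (red n)"
    by (simp add: dot_def red_def redM_def ones_def parity_sum_def matrix_vector_mult_def vector_matrix_mult_def
        sum_2 algebra_simps)
  ultimately show "(gaut p q v A B \<circ> gaut p' q' v' A' B') s =
      gaut (p' + p v* A') (q' + dot p v' *s ones + q v* redM B') (A *v v' + v) (A ** A') (B ** B') s"
    unfolding s gaut_def comp_def prod.case parity_sum_B[OF assms] by simp
qed

lemma gaut_inj: "gaut p q v A B = gaut p' q' v' A' B' \<longleftrightarrow> p = p' \<and> q = q' \<and> v = v' \<and> A = A' \<and> B = B'"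
proof
  assume e: "gaut p q v A B = gaut p' q' v' A' B'"
  have "gaut p q v A B (0, k, n) = gaut p' q' v' A' B' (0, k, n)" for k n by (simp add: e)
  from this[of "vector [1, 0]" 0] this[of "vector [0, 1]" 0] this[of 0 "vector [1, 0]"] this[of 0 "vector [0, 1]"]
  show "p = p' \<and> q = q' \<and> v = v' \<and> A = A' \<and> B = B'"
    by (simp add: gaut_simps)
qed simp

lemma GL2_bit_cases:
  assumes "A \<in> carrier (GL_group :: (bit ^ 2 ^ 2) monoid)"
  shows "A $ 1 $ 1 * A $ 2 $ 2 + A $ 1 $ 2 * A $ 2 $ 1 = 1"
proof -
  have "det A \<noteq> 0" using assms by (simp add: GL_group_def invertible_det_nz)
  then show ?thesis unfolding det_2
    by (cases "A $ 1 $ 1"; cases "A $ 1 $ 2"; cases "A $ 2 $ 1"; cases "A $ 2 $ 2") simp_all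
qed

text \<open>The generators are the ones produced by explicit automorphisms of L. The missing
  coordinate of \<open>p\<close> comes from conjugating by the exchange of coordinates in the
  \<open>A\<close> part, that of \<open>q\<close> from conjugating by \<open>sigma1\<close> in the
  \<open>B\<close> part, and the translations \<open>v\<close> from comparing two generators with
  the same linear part.\<close>

lemma gaut_generated:
  fixes R :: "(G6 \<Rightarrow> G6) set"
  assumes comp: "\<And>\<alpha> \<beta>. \<alpha> \<in> R \<Longrightarrow> \<beta> \<in> R \<Longrightarrow> \<alpha> \<circ> \<beta> \<in> R"
    and gens: "gaut 0 0 0 (vector [vector [1, 1], vector [0, 1]]) (mat 1) \<in> R"
      "gaut 0 0 0 (vector [vector [1, 0], vector [1, 1]]) (mat 1) \<in> R"
      "gaut 0 0 (vector [1, 0]) (vector [vector [1, 1], vector [0, 1]]) (mat 1) \<in> R"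
      "gaut 0 0 (vector [0, 1]) (vector [vector [1, 0], vector [1, 1]]) (mat 1) \<in> R"
      "gaut 0 0 0 (mat 1) sigma1 \<in> R" "gaut 0 0 0 (mat 1) sigma2 \<in> R"
      "gaut (vector [0, 1]) 0 0 (mat 1) (mat 1) \<in> R" "gaut 0 (vector [1, 0]) 0 (mat 1) (mat 1) \<in> R"
    and A: "A \<in> carrier GL_group" and B: "B \<in> B_set"
  shows "gaut p q v A B \<in> R"
proof -
  let ?U = "vector [vector [1, 1], vector [0, 1]] :: bit ^ 2 ^ 2"
  let ?D = "vector [vector [1, 0], vector [1, 1]] :: bit ^ 2 ^ 2"
  note m1 = one_B_set
  have z: "dot 0 v = 0" "0 *s x = 0" "0 v* M = 0" "M *v 0 = 0" for v x :: "bit ^ 2" and M :: "bit ^ 2 ^ 2"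
    by (simp_all add: dot_def vec2_eq_iff vector_matrix_mult_def matrix_vector_mult_def)
  have one: "p v* mat 1 = p" "redM (mat 1) = mat 1" "mat 1 *v p = p" for p :: "bit ^ 2"
    by (simp_all add: vec2_eq_iff vector_matrix_mult_def redM_def mat_def matrix_vector_mult_def sum_2)
  note c = gaut_comp[OF m1, simplified one matrix_mul_rid z add_0_left add_0_right]
  have AR: "gaut 0 0 0 (A ** A') (mat 1) \<in> R"
    if "gaut 0 0 0 A (mat 1) \<in> R" "gaut 0 0 0 A' (mat 1) \<in> R" for A A'
    using comp[OF that] by (simp add: gaut_comp[OF m1] z)
  have UU: "?U ** ?U = mat 1" and DD: "?D ** ?D = mat 1" by (simp_all add: mat2_simps)
  have id: "gaut 0 0 0 (mat 1) (mat 1) \<in> R" using AR[OF gens(1,1)] UU by simp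
  have Ain: "gaut 0 0 0 A (mat 1) \<in> R" if "A \<in> carrier GL_group" for A
  proof -
    \<comment> \<open>The six elements of GL_2 over the field with two elements, as words in the two
      transvections.\<close>
    have "A = mat 1 \<or> A = ?U \<or> A = ?D \<or> A = ?U ** ?D \<or> A = ?D ** ?U \<or> A = ?U ** (?D ** ?U)"
      using GL2_bit_cases[OF that]
      by (cases "A $ 1 $ 1"; cases "A $ 1 $ 2"; cases "A $ 2 $ 1"; cases "A $ 2 $ 2") (simp_all add: mat2_simps)
    then show ?thesis using id gens(1,2) AR by metis
  qed
  have vadd: "gaut 0 0 (v + v') (mat 1) (mat 1) \<in> R"
    if "gaut 0 0 v (mat 1) (mat 1) \<in> R" "gaut 0 0 v' (mat 1) (mat 1) \<in> R" for v v'
    using comp[OF that] by (simp add: gaut_comp[OF m1] z add.commute)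
  have v10: "gaut 0 0 (vector [1, 0]) (mat 1) (mat 1) \<in> R"
    using comp[OF gens(3,1)] by (simp add: gaut_comp[OF m1] z UU)
  have v01: "gaut 0 0 (vector [0, 1]) (mat 1) (mat 1) \<in> R"
    using comp[OF gens(4,2)] by (simp add: gaut_comp[OF m1] z DD)
  have bit2: "x = 0 \<or> x = vector [1, 0] \<or> x = vector [0, 1] \<or> x = vector [1, 0] + vector [0, 1]" for x :: "bit ^ 2"
    by (cases "x $ 1"; cases "x $ 2") (simp_all add: vec2_eq_iff)
  have vin: "gaut 0 0 v (mat 1) (mat 1) \<in> R" for v
    using bit2[of v] id v10 v01 vadd[OF v10 v01] by auto
  have padd: "gaut (p + p') 0 0 (mat 1) (mat 1) \<in> R"
    if "gaut p 0 0 (mat 1) (mat 1) \<in> R" "gaut p' 0 0 (mat 1) (mat 1) \<in> R" for p p'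
    using comp[OF that] by (simp add: gaut_comp[OF m1] z one dot_def add.commute)
  have p10: "gaut (vector [1, 0]) 0 0 (mat 1) (mat 1) \<in> R"
  proof -
    let ?S = "sigma1 :: bit ^ 2 ^ 2"
    have SS: "?S ** ?S = mat 1" by (simp add: mat2_simps)
    then have "?S \<in> carrier GL_group" unfolding GL_group_def invertible_def by auto
    then have S: "gaut 0 0 0 ?S (mat 1) \<in> R" by (rule Ain)
    have "gaut (vector [0, 1] v* ?S) 0 0 ?S (mat 1) \<in> R"
      using comp[OF gens(7) S] by (simp add: gaut_comp[OF m1] z dot_def)
    from comp[OF S this] have "gaut (vector [0, 1] v* ?S) 0 0 (mat 1) (mat 1) \<in> R"
      by (simp add: gaut_comp[OF m1] z SS)
    moreover have "vector [0, 1] v* ?S = vector [1, 0]"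
      by (simp add: vec2_eq_iff vector_matrix_mult_def sum_2 sigma1_def)
    ultimately show ?thesis by simp
  qed
  have pin: "gaut p 0 0 (mat 1) (mat 1) \<in> R" for p
    using bit2[of p] id p10 gens(7) padd[OF p10 gens(7)] by auto
  have qadd: "gaut 0 (q + q') 0 (mat 1) (mat 1) \<in> R"
    if "gaut 0 q 0 (mat 1) (mat 1) \<in> R" "gaut 0 q' 0 (mat 1) (mat 1) \<in> R" for q q'
    using comp[OF that] by (simp add: gaut_comp[OF m1] z one add.commute)
  have q01: "gaut 0 (vector [0, 1]) 0 (mat 1) (mat 1) \<in> R"
  proof -
    have 1: "vector [1, 0] v* redM sigma1 = vector [0, 1]"
      by (simp add: vec2_eq_iff vector_matrix_mult_def sum_2 sigma1_def redM_def)
    have SS: "sigma1 ** sigma1 = (mat 1 :: int ^ 2 ^ 2)" by (simp add: mat2_simps)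
    have "gaut 0 (vector [0, 1]) 0 (mat 1) sigma1 \<in> R"
      using comp[OF gens(8,5)] by (simp add: gaut_comp[OF sigma_B_set(1)] z 1)
    from comp[OF gens(5) this] show ?thesis by (simp add: gaut_comp[OF sigma_B_set(1)] z SS)
  qed
  have qin: "gaut 0 q 0 (mat 1) (mat 1) \<in> R" for q
    using bit2[of q] id q01 gens(8) qadd[OF gens(8) q01] by auto
  have Bmul: "gaut 0 0 0 (mat 1) (B ** B') \<in> R"
    if "gaut 0 0 0 (mat 1) B \<in> R" "gaut 0 0 0 (mat 1) B' \<in> R" "B' \<in> B_set" for B B'
    using comp[OF that(1,2)] by (simp add: gaut_comp[OF that(3)] z)
  have Bin: "gaut 0 0 0 (mat 1) B \<in> R"
  proof -
    obtain x y :: int where xy: "x = 1 \<or> x = - 1" "y = 1 \<or> y = - 1"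
      "B = vector [vector [x, 0], vector [0, y]] \<or> B = vector [vector [0, x], vector [y, 0]]"
      using B by (auto simp: B_set_eq signed_perm_def)
    let ?s = "sigma1 :: int ^ 2 ^ 2" and ?t = "sigma2 :: int ^ 2 ^ 2"
    have "B = mat 1 \<or> B = ?t \<or> B = ?s \<or> B = ?t ** ?s \<or> B = ?s ** ?t \<or> B = ?s ** (?t ** ?s) \<or>
        B = ?t ** (?s ** ?t) \<or> B = (?s ** ?t) ** (?s ** ?t)"
      using xy by (auto simp: mat2_simps)
    moreover have Bs: "?s \<in> B_set" "?t \<in> B_set" "?t ** ?s \<in> B_set" "?s ** ?t \<in> B_set"
      using sigma_B_set signed_perm_mult unfolding B_set_eq by blast+
    note g = gens(5,6)
    have ts: "gaut 0 0 0 (mat 1) (?t ** ?s) \<in> R" by (rule Bmul[OF g(2,1) Bs(1)])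
    have st: "gaut 0 0 0 (mat 1) (?s ** ?t) \<in> R" by (rule Bmul[OF g Bs(2)])
    ultimately show ?thesis
      using id g ts st Bmul[OF g(1) ts Bs(3)] Bmul[OF g(2) st Bs(4)] Bmul[OF st st Bs(4)] by metis
  qed
  have "gaut p q 0 (mat 1) (mat 1) \<in> R"
    using comp[OF qin pin] by (simp add: gaut_comp[OF m1] z one)
  note pq = this
  have "gaut 0 0 0 A B \<in> R" using comp[OF Ain[OF A] Bin] by (simp add: gaut_comp[OF B] z)
  from comp[OF vin this] have "gaut 0 0 v A B \<in> R" by (simp add: gaut_comp[OF B] z)
  from comp[OF this pq] show ?thesis by (simp add: gaut_comp[OF m1] z)
qed

lemma gaut_inverse:
  assumes "A \<in> carrier GL_group" "B \<in> B_set"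
  shows "bij (gaut p q v A B)"
proof -
  interpret GL: group "GL_group :: (int ^ 2 ^ 2) monoid" by (rule group_GL)
  have right: "\<exists>p' q' v' A' B'. A' \<in> carrier GL_group \<and> B' \<in> B_set \<and>
      gaut p q v A B \<circ> gaut p' q' v' A' B' = id"
    if A: "A \<in> carrier GL_group" and B: "B \<in> B_set" for p q v A B
  proof -
    obtain A' where A': "A ** A' = mat 1" "A' ** A = mat 1" using A by (auto simp: GL_group_def invertible_def)
    have sub: "subgroup B_set GL_group" unfolding B_set_def by (rule GL.generate_is_subgroup[OF B_gens])
    have B': "m_inv GL_group B \<in> B_set" by (rule subgroup.m_inv_closed[OF sub B])
    have "B ** m_inv GL_group B = mat 1"
      using GL.r_inv[of B] subgroup.mem_carrier[OF sub B] by (simp add: mult_GL one_GL)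
    moreover have "A *v (A' *v v) = v" by (simp add: matrix_vector_mul_assoc A')
    moreover have self: "x + x = 0" "x + y + x + y = 0" for x y :: "bit ^ 2" by (simp_all add: vec2_eq_iff ac_simps)
    ultimately have "gaut p q v A B \<circ> gaut (p v* A') (dot p (A' *v v) *s ones + q v* redM (m_inv GL_group B)) (A' *v v) A' (m_inv GL_group B) = id"
      unfolding gaut_comp[OF B'] gaut_id[symmetric] A'(1) by (simp only: self)
    moreover have "A' \<in> carrier GL_group" using A' by (auto simp: GL_group_def invertible_def)
    ultimately show ?thesis using B' by blast
  qed
  obtain p' q' v' A' B' where r: "A' \<in> carrier GL_group" "B' \<in> B_set"
    "gaut p q v A B \<circ> gaut p' q' v' A' B' = id" using right[OF assms] by blast
  obtain \<gamma> where \<gamma>: "gaut p' q' v' A' B' \<circ> \<gamma> = id" using right[OF r(1,2)] by blast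
  have "gaut p q v A B \<circ> (gaut p' q' v' A' B' \<circ> \<gamma>) = \<gamma>" unfolding comp_assoc[symmetric] r(3) by simp
  then have "gaut p q v A B = \<gamma>" using \<gamma> by simp
  then show ?thesis using o_bij[of "gaut p' q' v' A' B'" "gaut p q v A B"] r(3) \<gamma> by simp
qed

section \<open>Automorphisms of L that realize the matrices\<close>

context E6
begin

definition realized :: "(G6 \<Rightarrow> G6) set" where
  "realized = {\<alpha>. \<exists>f\<in>lie_auts elt_scale L br. \<forall>s. f ` Gam s \<subseteq> Gam (\<alpha> s)}"

lemma realized_comp:
  assumes "\<alpha> \<in> realized" "\<beta> \<in> realized"
  shows "\<alpha> \<circ> \<beta> \<in> realized"
proof -
  obtain f g where f: "f \<in> lie_auts elt_scale L br" "\<And>s. f ` Gam s \<subseteq> Gam (\<alpha> s)"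
    and g: "g \<in> lie_auts elt_scale L br" "\<And>s. g ` Gam s \<subseteq> Gam (\<beta> s)"
    using assms by (auto simp: realized_def)
  have "compose L f g z \<in> Gam (\<alpha> (\<beta> s))" if z: "z \<in> Gam s" for z s
  proof -
    have "g z \<in> Gam (\<beta> s)" using g(2)[of s] z by blast
    then have "f (g z) \<in> Gam (\<alpha> (\<beta> s))" using f(2)[of "\<beta> s"] by blast
    then show ?thesis using gradingD(2)[OF Gam_grading, of s] z by (auto simp: compose_def)
  qed
  then show ?thesis unfolding realized_def using lie_auts_comp[OF f(1) g(1)] by (auto intro!: bexI[of _ "compose L f g"])
qed

lemma realized_diamondI:
  assumes f: "restrict (diamond f) L \<in> lie_auts elt_scale L br"
    and "\<And>z k0 k n. z \<in> GA (k0, k, n) \<Longrightarrow> diamond f z \<in> GA (\<alpha> (k0, k, n))"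
  shows "\<alpha> \<in> realized"
proof -
  have "restrict (diamond f) L ` Gam s \<subseteq> Gam (\<alpha> s)" for s
    using assms(2) GA_L by (cases s) (auto simp: Gam_eq)
  then show ?thesis unfolding realized_def mem_Collect_eq using f by blast
qed

lemma diamond_eig_conj:
  assumes f: "restrict (diamond f) L \<in> lie_auts elt_scale L br" "f ** f' = mat 1"
    and d: "d \<in> L0" "f ** d ** f' = d'" and z: "z \<in> eig (d, 0) m"
  shows "diamond f z \<in> eig (d', 0) m"
  using eig_image[OF f(1) _ z] d eig_L[OF z] by (simp add: diamond_eq[OF f(2)] ext4_map_0)

lemma diamond_commute:
  assumes "g ** f = f ** g'" "f ** f' = mat 1" "g ** h = mat 1" "g' ** h' = mat 1"
  shows "diamond g (diamond f z) = diamond f (diamond g' z)"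
  using diamond_mult[OF assms(3,2)] diamond_mult[OF assms(2,4)] assms(1) by metis

lemma diamond_sc: "f ** f' = mat 1 \<Longrightarrow> z \<in> L \<Longrightarrow> diamond f (elt_scale c z) = elt_scale c (diamond f z)" for f :: "'a mat8"
  using linear_diamond[of f f'] by (simp add: linear_on_L_def)

lemma delta_commute: "g ** d = d ** g \<Longrightarrow> g ** delta d l = delta d l ** g" for g d :: "'a mat8"
  by (simp add: delta_def matrix_add_ldistrib matrix_add_rdistrib msc_mult_left msc_mult_right)

text \<open>Conjugating an anticommuting involution \<open>g\<close> by the square root \<open>delta d l\<close>, where \<open>l\<close> is a primitive
  8th root of unity, multiplies it by \<open>d\<close>, up to a scalar.\<close>

lemma delta_anticommute:
  assumes gd: "g ** d = - (d ** g)" and dd: "d ** d = mat 1" and gg: "g ** g = mat 1"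
    and l: "l ^ 2 = i" "i ^ 2 = (- 1 :: 'a)"
  shows "diamond g (diamond (delta d l) z) = diamond (delta d l) (diamond d (diamond g z))"
proof -
  let ?s = "(l + inverse l) / 2" and ?t = "(l - inverse l) / 2"
  have i0: "i \<noteq> 0" using l(2) by auto
  have l0: "l \<noteq> 0" using l(1) i0 by auto
  have ll: "l * l = i" and ii: "i * i = - 1" using l by (simp_all add: power2_eq_square)
  have inv: "inverse l = - (i * l)" using ll ii l0 by (simp add: field_simps)
  have iil: "i * (i * l) = - l" using ii by (simp add: mult.assoc[symmetric])
  have it: "?t = i * ?s" unfolding inv by (simp add: iil algebra_simps)
  then have si: "- (i * ?t) = ?s" by (simp only: it mult.assoc[symmetric] ii mult_minus1 minus_minus)
  have d_dg: "d ** (d ** g) = g" by (simp add: matrix_mul_assoc dd)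
  have "g ** delta d l = msc ?s g - msc ?t (d ** g)"
    by (simp add: delta_def matrix_add_ldistrib msc_mult_right gd msc_neg)
  moreover have "delta d l ** msc (- i) (d ** g) = msc (?s * - i) (d ** g) + msc (?t * - i) g"
    by (simp only: delta_def matrix_add_rdistrib msc_mult_left msc_mult_right d_dg matrix_mul_lid msc_add msc_msc mult.commute)
  moreover have neg: "x * - i = - (i * x)" for x by simp
  have "?t * - i = ?s" by (rule trans[OF neg si])
  moreover have "?s * - i = - ?t" by (simp only: neg it)
  ultimately have "g ** delta d l = delta d l ** msc (- i) (d ** g)" by (simp only: msc_neg) simp
  moreover have dg: "(d ** g) ** (g ** d) = mat 1"
  proof -
    have "(d ** g) ** (g ** d) = d ** (g ** g) ** d" by (simp only: matrix_mul_assoc)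
    then show ?thesis by (simp add: gg dd)
  qed
  moreover have "msc (- i) (d ** g) ** msc (- inverse i) (g ** d) = mat 1"
    using i0 by (simp add: msc_mult_left msc_mult_right msc_msc dg msc_1)
  ultimately have "diamond g (diamond (delta d l) z) = diamond (delta d l) (diamond (msc (- i) (d ** g)) z)"
    by (intro diamond_commute[OF _ delta_inverse[OF dd l0] gg])
  moreover have "(- i) ^ 4 = 1" using ii by (simp add: power4_eq_xxxx mult.assoc)
  ultimately show ?thesis by (simp add: diamond_msc[OF dg] diamond_mult[OF dd gg])
qed

text \<open>Conjugation by l^d, with l a primitive 8th root of unity, preserves the component's
  other degrees and adds to k_j the degree \<open>x k n\<close> of \<open>d\<close> whenever
  \<open>d\<close> anticommutes with the j-th involution. The cases for \<open>c1\<close> and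
  \<open>c2\<close> record which of the two anticommute.\<close>

lemma rotation_realized:
  assumes d: "d \<in> L0" "d ** d = mat 1" "dE ** d = d ** dE" "dE' ** d = d ** dE'"
    and g: "G1 ** d = (if c1 then - (d ** G1) else d ** G1)" "G2 ** d = (if c2 then - (d ** G2) else d ** G2)"
    and x: "\<And>z k0 k n. z \<in> GA (k0, k, n) \<Longrightarrow> diamond d z = elt_scale (bit_sign (x k n)) z"
  shows "(\<lambda>(k0, k, n). (k0, vector [k $ 1 + (if c1 then x k n else 0), k $ 2 + (if c2 then x k n else 0)], n)) \<in> realized"
proof -
  obtain i :: 'a where i: "i ^ 2 = - 1" using ex_imaginary_unit by blast
  obtain l where l: "l ^ 2 = i" using nth_root_exists[of 2 i] by auto
  have l0: "l \<noteq> 0" using l i by auto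
  let ?f = "delta d l" and ?f' = "delta d (inverse l)"
  note ff = delta_inverse[OF d(2) l0]
  have aut: "restrict (diamond ?f) L \<in> lie_auts elt_scale L br" by (rule diamond_delta_aut[OF d(1,2) l0])
  show ?thesis
  proof (rule realized_diamondI[OF aut])
    fix z k0 k n assume z: "z \<in> GA (k0, k, n)"
    have zL: "z \<in> L" using z by (rule GA_L)
    have z': "Theta z = elt_scale (bit_sign k0) z" "diamond G1 z = elt_scale (bit_sign (k $ 1)) z"
      "diamond G2 z = elt_scale (bit_sign (k $ 2)) z" "z \<in> eig (dE, 0) (2 * n $ 1)" "z \<in> eig (dE', 0) (2 * n $ 2)"
      using z by (simp_all add: GA_def)
    note sc = diamond_sc[OF ff zL]
    have "Theta (diamond ?f z) = elt_scale (bit_sign k0) (diamond ?f z)"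
      using Theta_diamond[OF ff, of z] z' sc by simp
    moreover have "diamond ?f z \<in> eig (dE, 0) (2 * n $ 1)"
      by (rule diamond_eig_conj[OF aut ff special_L0(1) conj_eq[OF delta_commute[OF d(3)] ff] z'(4)])
    moreover have "diamond ?f z \<in> eig (dE', 0) (2 * n $ 2)"
      by (rule diamond_eig_conj[OF aut ff special_L0(2) conj_eq[OF delta_commute[OF d(4)] ff] z'(5)])
    moreover have "diamond G (diamond ?f z) = elt_scale (bit_sign (k $ j + (if c then x k n else 0))) (diamond ?f z)"
      if G: "G ** d = (if c then - (d ** G) else d ** G)" "G ** G = mat 1" "diamond G z = elt_scale (bit_sign (k $ j)) z" for G c j
    proof (cases c)
      case True
      then have a: "G ** d = - (d ** G)" using G(1) by simp
      have "diamond G (diamond ?f z) = diamond ?f (diamond d (diamond G z))"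
        by (rule delta_anticommute[OF a d(2) G(2) l i])
      also have "\<dots> = elt_scale (bit_sign (k $ j) * bit_sign (x k n)) (diamond ?f z)"
        unfolding G(3) diamond_sc[OF d(2) zL] x[OF z] by (simp add: sc)
      finally show ?thesis unfolding bit_sign_add[symmetric] using True by simp
    next
      case False
      then have a: "G ** ?f = ?f ** G" using G(1) by (simp add: delta_commute)
      show ?thesis using diamond_commute[OF a ff G(2) G(2), of z] False by (simp add: G(3) sc)
    qed
    note this[OF g(1) special_squares(5) z'(2)] this[OF g(2) special_squares(6) z'(3)]
    ultimately show "diamond ?f z \<in> GA (case (k0, k, n) of (k0, k, n) \<Rightarrow>
        (k0, vector [k $ 1 + (if c1 then x k n else 0), k $ 2 + (if c2 then x k n else 0)], n))"
      by (simp add: GA_def)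
  qed
qed

text \<open>This is \<open>gW s\<close> multiplied by the torus element \<open>tau 1 (- 1)\<close>,
  on which characters take the value (-1)^(n_1 + n_2). Its degree on a component therefore involves
  the parity of n, which is how the parameters e and f arise.\<close>

definition dS :: "'a ^ 2 ^ 2 \<Rightarrow> 'a mat8" where "dS s = kron (dg 1 1 (- 1) (- 1)) s"

lemma dS: "dS sigma1 \<in> L0" "dS sigma2 \<in> L0" "dS sigma1 ** dS sigma1 = mat 1" "dS sigma2 ** dS sigma2 = mat 1"
  "dE ** dS s = dS s ** dE" "dE' ** dS s = dS s ** dE'"
  "gW s ** dS t = kron (dg 1 1 (- 1) (- 1)) (s ** t)" "dS s ** gW t = kron (dg 1 1 (- 1) (- 1)) (s ** t)"
  "gW s ** tau 1 (- 1) = dS s"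
proof -
  show "dS sigma1 \<in> L0" "dS sigma2 \<in> L0"
    unfolding dS_def by (rule kron_L0_sym[OF _ sigma_sp(1)] kron_L0_sym[OF _ sigma_sp(2)], simp add: mat4_simps)+
  show "dS sigma1 ** dS sigma1 = mat 1" "dS sigma2 ** dS sigma2 = mat 1"
    by (simp_all add: dS_def kron_mult dg_mult sigma_products kron_one dg_one)
  show "dE ** dS s = dS s ** dE" "dE' ** dS s = dS s ** dE'"
    by (simp_all add: dS_def dE_def dE'_def kron_mult pE_def pE'_def dg_mult)
  show "gW s ** dS t = kron (dg 1 1 (- 1) (- 1)) (s ** t)" "dS s ** gW t = kron (dg 1 1 (- 1) (- 1)) (s ** t)"
    by (simp_all add: dS_def gW_def kron_mult)
  show "gW s ** tau 1 (- 1) = dS s"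
    by (simp add: dS_def gW_def tau_kron kron_mult)
qed

lemma diamond_dS:
  assumes "z \<in> GA (k0, k, n)" "s = sigma1 \<and> j = 1 \<or> s = sigma2 \<and> j = 2"
  shows "diamond (dS s) z = elt_scale (bit_sign (k $ j + parity_sum n)) z"
proof -
  have zL: "z \<in> L" using assms(1) by (rule GA_L)
  have z': "diamond (gW s) z = elt_scale (bit_sign (k $ j)) z" "z \<in> eig (dE, 0) (2 * n $ 1)" "z \<in> eig (dE', 0) (2 * n $ 2)"
    using assms by (auto simp: GA_def)
  have ss: "gW s ** gW s = mat 1" using assms(2) special_squares by auto
  have "diamond (tau 1 (- 1)) z = elt_scale ((1 * - 1) powi (n $ 1) * (1 / - 1) powi (n $ 2)) z"
    by (rule diamond_tau[OF z'(2,3)]) simp_all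
  also have "(1 * - 1) powi (n $ 1) * (1 / - 1) powi (n $ 2) = (bit_sign (parity_sum n) :: 'a)"
    unfolding parity_sum_def bit_sign_add bit_sign_of_int by simp
  finally have t: "diamond (tau 1 (- 1)) z = elt_scale (bit_sign (parity_sum n)) z" .
  have "diamond (dS s) z = diamond (gW s) (diamond (tau 1 (- 1)) z)"
    unfolding dS(9)[symmetric] by (rule diamond_mult[OF ss tau_inverse]) simp_all
  then show ?thesis unfolding t diamond_sc[OF ss zL] z'(1) bit_sign_add by (simp add: mult.commute)
qed

text \<open>A permutation of blocks that is self-adjoint for \<open>Q4\<close> becomes an element of
  sp_8 after tensoring with \<open>sigma2\<close>. This factor anticommutes with
  \<open>sigma1\<close>, but conjugation does not see the sign, so the torsion degrees are
  unchanged.\<close>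

lemma swap_realized:
  assumes P: "kron P sigma2 \<in> L0" "P ** P = mat 1"
    and eig: "\<And>n z. z \<in> eig (dE, 0) (2 * n $ 1) \<Longrightarrow> z \<in> eig (dE', 0) (2 * n $ 2) \<Longrightarrow>
        diamond (kron P sigma2) z \<in> eig (dE, 0) (2 * (M *v n) $ 1) \<and> diamond (kron P sigma2) z \<in> eig (dE', 0) (2 * (M *v n) $ 2)"
  shows "gaut 0 0 0 (mat 1) M \<in> realized"
proof -
  let ?f = "kron P sigma2"
  have ff: "?f ** ?f = mat 1" by (simp add: kron_mult P(2) sigma_products kron_one)
  have aut: "restrict (diamond ?f) L \<in> lie_auts elt_scale L br" by (rule diamond_aut[OF P(1) ff])
  have g1: "G1 ** ?f = ?f ** (- G1)" and g2: "G2 ** ?f = ?f ** G2"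
    by (simp_all add: gW_def kron_mult sigma_products kron_neg matrix_neg_right)
  have gg: "(- G1) ** (- G1) = mat 1" by (simp add: matrix_neg_left matrix_neg_right special_squares)
  show ?thesis
  proof (rule realized_diamondI[OF aut])
    fix z k0 k n assume z: "z \<in> GA (k0, k, n)"
    have zL: "z \<in> L" using z by (rule GA_L)
    have z': "Theta z = elt_scale (bit_sign k0) z" "diamond G1 z = elt_scale (bit_sign (k $ 1)) z"
      "diamond G2 z = elt_scale (bit_sign (k $ 2)) z" "z \<in> eig (dE, 0) (2 * n $ 1)" "z \<in> eig (dE', 0) (2 * n $ 2)"
      using z by (simp_all add: GA_def)
    have "Theta (diamond ?f z) = elt_scale (bit_sign k0) (diamond ?f z)"
      "diamond G1 (diamond ?f z) = elt_scale (bit_sign (k $ 1)) (diamond ?f z)"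
      "diamond G2 (diamond ?f z) = elt_scale (bit_sign (k $ 2)) (diamond ?f z)"
      using Theta_diamond[OF ff, of z] diamond_commute[OF g1 ff special_squares(5) gg, of z]
        diamond_commute[OF g2 ff special_squares(6,6), of z] z' diamond_sc[OF ff zL]
        diamond_uminus[OF special_squares(5), of z] by simp_all
    then show "diamond ?f z \<in> GA (gaut 0 0 0 (mat 1) M (k0, k, n))"
      using eig[OF z'(4,5)] by (simp add: GA_def gaut_def dot_def)
  qed
qed

lemma eig_neg: "z \<in> eig (- d, 0) m \<Longrightarrow> (d, 0) \<in> L \<Longrightarrow> z \<in> eig (d, 0) (- m)"
  using br_neg_left[of "(d, 0)" z] by (auto simp: eig_def)

lemma gaut_realized:
  assumes A: "A \<in> carrier GL_group" and M: "M \<in> B_set"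
  shows "gaut p q v A M \<in> realized"
proof (rule gaut_generated[OF realized_comp _ _ _ _ _ _ _ _ A M])
  have anti: "G1 ** G2 = - (G2 ** G1)" "G2 ** G1 = - (G1 ** G2)"
    unfolding gW_mult sigma_products by (simp_all add: gW_def kron_neg)
  have eqI: "\<alpha> \<in> realized" if "\<beta> \<in> realized" "\<And>k0 k n. \<alpha> (k0, k, n) = \<beta> (k0, k, n)" for \<alpha> \<beta>
  proof -
    have "\<alpha> = \<beta>" using that(2) by (auto simp: fun_eq_iff)
    then show ?thesis using that(1) by simp
  qed
  have "(\<lambda>(k0, k, n). (k0, vector [k $ 1 + (if True then k $ 2 else 0), k $ 2 + (if False then k $ 2 else 0)], n)) \<in> realized"
    by (rule rotation_realized[of G2]) (simp_all add: special_L0 special_squares special_commute anti(1) GA_def)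
  then show "gaut 0 0 0 (vector [vector [1, 1], vector [0, 1]]) (mat 1) \<in> realized"
    by (rule eqI) (simp add: gaut_simps)
  have "(\<lambda>(k0, k, n). (k0, vector [k $ 1 + (if False then k $ 1 else 0), k $ 2 + (if True then k $ 1 else 0)], n)) \<in> realized"
    by (rule rotation_realized[of G1]) (simp_all add: special_L0 special_squares special_commute anti(2) GA_def)
  then show "gaut 0 0 0 (vector [vector [1, 0], vector [1, 1]]) (mat 1) \<in> realized"
    by (rule eqI) (simp add: gaut_simps add.commute)
  have "(\<lambda>(k0, k, n). (k0, vector [k $ 1 + (if True then k $ 2 + parity_sum n else 0),
      k $ 2 + (if False then k $ 2 + parity_sum n else 0)], n)) \<in> realized"
    by (rule rotation_realized[of "dS sigma2"]) (simp_all add: dS sigma_products kron_neg diamond_dS)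
  then show "gaut 0 0 (vector [1, 0]) (vector [vector [1, 1], vector [0, 1]]) (mat 1) \<in> realized"
    by (rule eqI) (simp add: gaut_simps add.assoc)
  have "(\<lambda>(k0, k, n). (k0, vector [k $ 1 + (if False then k $ 1 + parity_sum n else 0),
      k $ 2 + (if True then k $ 1 + parity_sum n else 0)], n)) \<in> realized"
    by (rule rotation_realized[of "dS sigma1"]) (simp_all add: dS sigma_products kron_neg diamond_dS)
  then show "gaut 0 0 (vector [0, 1]) (vector [vector [1, 0], vector [1, 1]]) (mat 1) \<in> realized"
    by (rule eqI) (simp add: gaut_simps add.assoc add.commute add.left_commute)
  show "gaut (vector [0, 1]) 0 0 (mat 1) (mat 1) \<in> realized"
  proof -
    obtain f where f: "f \<in> lie_auts elt_scale L br" "\<And>k0 k n. f ` Gam (k0, k, n) \<subseteq> Gam (k0 + k $ 2, k, n)"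
      using shift_aut[OF hW parity_hW, of "\<lambda>k n. k $ 2"] by (auto simp: GA_def)
    have "gaut (vector [0, 1]) 0 0 (mat 1) (mat 1) (k0, k, n) = (k0 + k $ 2, k, n)" for k0 k n
      by (simp add: gaut_simps)
    then have "f ` Gam s \<subseteq> Gam (gaut (vector [0, 1]) 0 0 (mat 1) (mat 1) s)" for s
      using f(2) by (cases s) simp
    then show ?thesis using f(1) by (auto simp: realized_def)
  qed
  show "gaut 0 (vector [1, 0]) 0 (mat 1) (mat 1) \<in> realized"
  proof -
    have par: "diamond dE z = elt_scale (bit_sign (of_int (n $ 1))) z" if "z \<in> GA (k0, k, n)" for z k0 k n
      using that diamond_eig[OF special_L0(1) special_squares(1)] unfolding bit_sign_of_int by (simp add: GA_def)
    have "\<exists>f\<in>lie_auts elt_scale L br. \<forall>k0 k n. f ` Gam (k0, k, n) \<subseteq> Gam (k0 + of_int (n $ 1), k, n)"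
      by (rule shift_aut[OF h2_L1 h2_invariant parity_h2]) (rule par)
    then obtain f where f: "f \<in> lie_auts elt_scale L br" "\<And>k0 k n. f ` Gam (k0, k, n) \<subseteq> Gam (k0 + of_int (n $ 1), k, n)"
      by blast
    have "gaut 0 (vector [1, 0]) 0 (mat 1) (mat 1) (k0, k, n) = (k0 + of_int (n $ 1), k, n)" for k0 k n
      by (simp add: gaut_simps)
    then have "f ` Gam s \<subseteq> Gam (gaut 0 (vector [1, 0]) 0 (mat 1) (mat 1) s)" for s
      using f(2) by (cases s) simp
    then show ?thesis using f(1) by (auto simp: realized_def)
  qed
  show "gaut 0 0 0 (mat 1) sigma1 \<in> realized"
  \<comment> \<open>Exchanging blocks 3 and 4 exchanges \<open>dE\<close> with \<open>dE'\<close>,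
    hence n_1 with n_2.\<close>
  proof (rule swap_realized[of "eu 1 1 + eu 2 2 + eu 3 4 + eu 4 3"])
    let ?P = "eu 1 1 + eu 2 2 + eu 3 4 + eu 4 3 :: 'a ^ 4 ^ 4"
    show PL: "kron ?P sigma2 \<in> L0" by (rule kron_L0_sym[OF _ sigma_sp(2)]) (simp add: mat4_simps)
    show PP: "?P ** ?P = mat 1" by (simp add: mat4_simps)
    have ff: "kron ?P sigma2 ** kron ?P sigma2 = mat 1" by (simp add: kron_mult PP sigma_products kron_one)
    note aut = diamond_aut[OF PL ff]
    have c: "kron ?P sigma2 ** dE ** kron ?P sigma2 = dE'" "kron ?P sigma2 ** dE' ** kron ?P sigma2 = dE"
      by (simp_all add: dE_def dE'_def kron_mult sigma_products)
        (simp_all add: mat4_simps pE_def pE'_def arg_cong[of _ _ "\<lambda>P. kron P (mat 1)"])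
    show "diamond (kron ?P sigma2) z \<in> eig (dE, 0) (2 * (sigma1 *v n) $ 1) \<and>
        diamond (kron ?P sigma2) z \<in> eig (dE', 0) (2 * (sigma1 *v n) $ 2)"
      if z: "z \<in> eig (dE, 0) (2 * n $ 1)" "z \<in> eig (dE', 0) (2 * n $ 2)" for n z
      using diamond_eig_conj[OF aut ff special_L0(1) c(1) z(1)] diamond_eig_conj[OF aut ff special_L0(2) c(2) z(2)]
      by (simp add: matrix_vector_mult_def sum_2 sigma1_def)
  qed
  show "gaut 0 0 0 (mat 1) sigma2 \<in> realized"
  \<comment> \<open>Exchanging 1 with 3 and 2 with 4 fixes \<open>dE\<close> and negates
    \<open>dE'\<close>, hence n_2.\<close>
  proof (rule swap_realized[of "eu 1 3 + eu 3 1 + eu 2 4 + eu 4 2"])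
    let ?P = "eu 1 3 + eu 3 1 + eu 2 4 + eu 4 2 :: 'a ^ 4 ^ 4"
    show PL: "kron ?P sigma2 \<in> L0" by (rule kron_L0_sym[OF _ sigma_sp(2)]) (simp add: mat4_simps)
    show PP: "?P ** ?P = mat 1" by (simp add: mat4_simps)
    have ff: "kron ?P sigma2 ** kron ?P sigma2 = mat 1" by (simp add: kron_mult PP sigma_products kron_one)
    note aut = diamond_aut[OF PL ff]
    have c: "kron ?P sigma2 ** dE ** kron ?P sigma2 = dE" "kron ?P sigma2 ** dE' ** kron ?P sigma2 = - dE'"
      by (simp_all add: dE_def dE'_def kron_mult sigma_products flip: kron_neg)
        (simp_all add: mat4_simps pE_def pE'_def arg_cong[of _ _ "\<lambda>P. kron P (mat 1)"])
    show "diamond (kron ?P sigma2) z \<in> eig (dE, 0) (2 * (sigma2 *v n) $ 1) \<and>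
        diamond (kron ?P sigma2) z \<in> eig (dE', 0) (2 * (sigma2 *v n) $ 2)"
      if z: "z \<in> eig (dE, 0) (2 * n $ 1)" "z \<in> eig (dE', 0) (2 * n $ 2)" for n z
      using diamond_eig_conj[OF aut ff special_L0(1) c(1) z(1)]
        eig_neg[OF diamond_eig_conj[OF aut ff special_L0(2) c(2) z(2)]]
      by (simp add: matrix_vector_mult_def sum_2 sigma2_def)
  qed
qed (assumption+)

lemma gaut_induced:
  assumes "A \<in> carrier GL_group" "M \<in> B_set"
  shows "\<exists>f\<in>grading_auts elt_scale L br Gam. induces Gam f (gaut p q v A M)"
    "gaut p q v A M \<in> induced_auts elt_scale L br Gam"
proof -
  obtain f where f: "f \<in> lie_auts elt_scale L br" "\<And>s. f ` Gam s \<subseteq> Gam (gaut p q v A M s)"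
    using gaut_realized[OF assms] unfolding realized_def by blast
  note * = grading_autsI[OF Gam_grading f(1) gaut_inverse[OF assms] f(2)]
  then show "\<exists>f\<in>grading_auts elt_scale L br Gam. induces Gam f (gaut p q v A M)" by blast
  then show "gaut p q v A M \<in> induced_auts elt_scale L br Gam"
    using additive_gaut gaut_inverse[OF assms] by (auto simp: induced_auts_def AutoGroup_plus)
qed

end

section \<open>The support and the components outside the torsion\<close>

abbreviation dg2 :: "int \<Rightarrow> int \<Rightarrow> int ^ 2 ^ 2" where "dg2 x y \<equiv> vector [vector [x, 0], vector [0, y]]"

lemma mv2: "(vector [vector [a, b], vector [c, d]] :: 'x ^ 2 ^ 2) *v n = vector [a * n $ 1 + b * n $ 2, c * n $ 1 + d * n $ 2]"
  for n :: "'x::comm_semiring_1 ^ 2"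
  by (simp add: vec2_eq_iff matrix_vector_mult_def sum_2)

lemma one_GL_carrier: "mat 1 \<in> carrier (GL_group :: (bit ^ 2 ^ 2) monoid)"
  by (simp add: GL_group_def invertible_def)

section \<open>Transport of components by the realized automorphisms\<close>

context E6
begin

text \<open>\<open>induces\<close> speaks about the support only. Off the support both sides are
  zero, because \<open>f\<close> permutes the nonzero components and the group automorphism is
  injective. With this, dimension and nonvanishing of brackets need checking on orbit
  representatives only.\<close>

lemma gaut_Gam:
  assumes "A \<in> carrier GL_group" "M \<in> B_set"
  obtains f where "f \<in> lie_auts elt_scale L br" "\<And>s. f ` Gam s = Gam (gaut p q v A M s)"
proof -
  let ?\<alpha> = "gaut p q v A M"
  obtain f where f: "f \<in> grading_auts elt_scale L br Gam" "induces Gam f ?\<alpha>"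
    using gaut_induced(1)[OF assms] by blast
  have aut: "f \<in> lie_auts elt_scale L br" using f(1) by (simp add: grading_auts_def)
  have in_supp: "f ` Gam s = Gam (?\<alpha> s)" if "s \<in> supp Gam" for s
    using f(2) that unfolding induces_def by blast
  have "f ` Gam s = Gam (?\<alpha> s)" for s
  proof (cases "s \<in> supp Gam")
    case False
    then have 0: "Gam s = {0}" by (simp add: supp_def)
    have "?\<alpha> s \<notin> supp Gam"
    proof
      assume \<alpha>s: "?\<alpha> s \<in> supp Gam"
      have "(\<lambda>V. f ` V) ` comps Gam = comps Gam" using f(1) by (simp add: grading_auts_def bij_betw_def)
      then have "Gam (?\<alpha> s) \<in> (\<lambda>V. f ` V) ` comps Gam" using \<alpha>s by (simp add: comps_def)
      then obtain t where t: "t \<in> supp Gam" "Gam (?\<alpha> s) = f ` Gam t" by (auto simp: comps_def)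
      then have "Gam (?\<alpha> s) = Gam (?\<alpha> t)" using in_supp by simp
      then have "?\<alpha> s = ?\<alpha> t" using grading_inj[OF Gam_grading \<alpha>s] by simp
      then have "s = t" using gaut_inverse[OF assms] by (simp add: bij_def inj_eq)
      then show False using t(1) False by simp
    qed
    then show ?thesis using linear_on_L_0[OF lie_autsD(1)[OF aut]] by (simp add: 0 supp_def)
  qed (rule in_supp)
  then show ?thesis using that aut by blast
qed

lemma gaut_supp:
  assumes "A \<in> carrier GL_group" "M \<in> B_set"
  shows "gaut p q v A M s \<in> supp Gam \<longleftrightarrow> s \<in> supp Gam"
proof -
  obtain f where f: "f \<in> lie_auts elt_scale L br" "\<And>s. f ` Gam s = Gam (gaut p q v A M s)"
    using gaut_Gam[OF assms] by blast
  show ?thesis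
    using image_eq_0_iff[OF f(1) gradingD(1,2)[OF Gam_grading], of s] unfolding f(2) supp_def by simp
qed

definition nz :: "G6 \<Rightarrow> G6 \<Rightarrow> bool" where
  "nz s t \<longleftrightarrow> (\<exists>x\<in>Gam s. \<exists>y\<in>Gam t. br x y \<noteq> 0)"

lemma nz_gaut:
  assumes AM: "A \<in> carrier GL_group" "M \<in> B_set" and "nz s t"
  shows "nz (gaut p q v A M s) (gaut p q v A M t)"
proof -
  obtain f where f: "f \<in> lie_auts elt_scale L br" "\<And>s. f ` Gam s = Gam (gaut p q v A M s)"
    using gaut_Gam[OF AM] by blast
  obtain x y where xy: "x \<in> Gam s" "y \<in> Gam t" "br x y \<noteq> 0" using assms(3) by (auto simp: nz_def)
  have L: "x \<in> L" "y \<in> L" using gradingD(2)[OF Gam_grading] xy by blast+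
  have "f (br x y) \<noteq> f 0"
    using inj_onD[OF lie_autsD(4)[OF f(1)] _ br_L[OF L] L_0] xy(3) by blast
  then have "br (f x) (f y) \<noteq> 0" using linear_on_L_0[OF lie_autsD(1)[OF f(1)]] lie_autsD(3)[OF f(1) L] by simp
  then show ?thesis unfolding nz_def using xy f(2)[of s] f(2)[of t] by blast
qed

definition line :: "'a elt set \<Rightarrow> bool" where
  "line V \<longleftrightarrow> (\<forall>x\<in>V. \<forall>y\<in>V. y \<noteq> 0 \<longrightarrow> (\<exists>c. x = elt_scale c y))"

lemma line_gaut:
  assumes AM: "A \<in> carrier GL_group" "M \<in> B_set" and s: "line (Gam s)"
  shows "line (Gam (gaut p q v A M s))"
proof -
  obtain f where f: "f \<in> lie_auts elt_scale L br" "\<And>s. f ` Gam s = Gam (gaut p q v A M s)"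
    using gaut_Gam[OF AM] by blast
  note lin = lie_autsD(1)[OF f(1)]
  show ?thesis unfolding line_def f(2)[symmetric]
  proof (intro ballI impI, elim imageE)
    fix x y x' y' assume "x = f x'" "x' \<in> Gam s" "y = f y'" "y' \<in> Gam s" "y \<noteq> 0"
    moreover from this have "y' \<noteq> 0" using linear_on_L_0[OF lin] by auto
    moreover have "y' \<in> L" using gradingD(2)[OF Gam_grading, of s] \<open>y' \<in> Gam s\<close> by blast
    moreover from calculation obtain c where "x' = elt_scale c y'" using s by (auto simp: line_def)
    ultimately show "\<exists>c. x = elt_scale c y" using lin by (auto simp: linear_on_L_def)
  qed
qed

lemma lineI: "(\<And>x. x \<in> V \<Longrightarrow> \<exists>c. x = elt_scale c u) \<Longrightarrow> line V"
proof (unfold line_def, intro ballI impI)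
  fix x y assume u: "\<And>x. x \<in> V \<Longrightarrow> \<exists>c. x = elt_scale c u" and xy: "x \<in> V" "y \<in> V" "y \<noteq> 0"
  then obtain c d where cd: "x = elt_scale c u" "y = elt_scale d u" by blast
  then have "d \<noteq> 0" using xy(3) by auto
  then have "x = elt_scale (c / d) y" by (simp add: cd)
  then show "\<exists>c. x = elt_scale c y" ..
qed

section \<open>Explicit representatives of the components\<close>

abbreviation wE :: "4 \<Rightarrow> int" where "wE a \<equiv> (if a \<in> {1, 3} then 1 else - 1)"
abbreviation wE' :: "4 \<Rightarrow> int" where "wE' a \<equiv> (if a \<in> {1, 4} then 1 else - 1)"

lemma dE'_nth: "dE' $ p $ q = (if p = q then (if fst p \<in> {1, 4} then 1 else - 1) else (0 :: 'a))"
proof -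
  have "(dg 1 (- 1) (- 1) 1 :: 'a ^ 4 ^ 4) $ i $ j = (if i = j then (if i \<in> {1, 4} then 1 else - 1) else 0)" for i j :: 4
    using exhaust_4[of i] by (auto simp: dg_def)
  then show ?thesis by (auto simp: dE'_def pE'_def mat_def prod_eq_iff)
qed

lemma G2_nth: "G2 $ p $ q = (if p = q then (if snd p = 1 then 1 else - 1) else (0 :: 'a))"
proof -
  have "(sigma2 :: 'a ^ 2 ^ 2) $ i $ j = (if i = j then (if i = 1 then 1 else - 1) else 0)" for i j :: 2
    using exhaust_2[of i] exhaust_2[of j] by (auto simp: sigma2_def)
  then show ?thesis by (auto simp: gW_def mat_def prod_eq_iff)
qed

abbreviation flip2 :: "2 \<Rightarrow> 2" where "flip2 b \<equiv> (if b = 1 then 2 else 1)"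

lemma G1_conj: "(G1 ** x ** G1) $ (a, b) $ (a', b') = x $ (a, flip2 b) $ (a', flip2 b')" for x :: "'a mat8"
proof -
  have "\<forall>b d :: 2. sigma1 $ b $ d = (if d = flip2 b then 1 else 0 :: 'a)"
    unfolding forall_2 by (simp add: sigma1_def)
  then have s: "(G1 :: 'a mat8) $ (a, b) $ (c, d) = (if (c, d) = (a, flip2 b) then 1 else 0)" for a c b d
    by (simp add: gW_def mat_def)
  have "\<forall>b d :: 2. d = flip2 b \<longleftrightarrow> b = flip2 d" unfolding forall_2 by simp
  then have s': "(G1 :: 'a mat8) $ (c, d) $ (a, b) = (if (c, d) = (a, flip2 b) then 1 else 0)" for a c b d
    unfolding s by auto
  have 1: "(G1 ** x) $ (a, b) $ q = x $ (a, flip2 b) $ q" for x :: "'a mat8" and a b q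
  proof -
    have "(G1 ** x) $ (a, b) $ q = (\<Sum>r\<in>UNIV. if r = (a, flip2 b) then x $ r $ q else 0)"
      unfolding matrix_matrix_mult_def vec_lambda_beta
    proof (rule sum.cong[OF refl])
      fix r :: idx
      show "G1 $ (a, b) $ r * x $ r $ q = (if r = (a, flip2 b) then x $ r $ q else 0)"
        by (cases r) (simp only: s, simp)
    qed
    then show ?thesis by simp
  qed
  have 2: "(x ** G1) $ q $ (a, b) = x $ q $ (a, flip2 b)" for x :: "'a mat8" and a b q
  proof -
    have "(x ** G1) $ q $ (a, b) = (\<Sum>r\<in>UNIV. if r = (a, flip2 b) then x $ q $ r else 0)"
      unfolding matrix_matrix_mult_def vec_lambda_beta
    proof (rule sum.cong[OF refl])
      fix r :: idx
      show "x $ q $ r * G1 $ r $ (a, b) = (if r = (a, flip2 b) then x $ q $ r else 0)"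
        by (cases r) (simp only: s', simp)
    qed
    then show ?thesis by simp
  qed
  show ?thesis unfolding 2 1 ..
qed

text \<open>\<open>dE\<close>, \<open>dE'\<close> and \<open>G2\<close> are diagonal, so they decide
  which matrix entries may be nonzero; \<open>G1\<close> permutes the entries and so relates those
  that remain.\<close>

lemma GA_even_entries:
  assumes z: "z \<in> GA (0, k, n)"
  shows "snd z = 0" "fst z \<in> L0"
    "fst z $ (a, b) $ (a', b') \<noteq> 0 \<Longrightarrow> 2 * n $ 1 = wE a - wE a' \<and> 2 * n $ 2 = wE' a - wE' a' \<and> (b = b' \<longleftrightarrow> k $ 2 = 0)"
    "fst z $ (a, flip2 b) $ (a', flip2 b') = bit_sign (k $ 1) * fst z $ (a, b) $ (a', b')"
proof -
  have zL: "z \<in> L" using z by (rule GA_L)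
  have z': "Theta z = z" "diamond G1 z = elt_scale (bit_sign (k $ 1)) z"
      "diamond G2 z = elt_scale (bit_sign (k $ 2)) z" "z \<in> eig (dE, 0) (2 * n $ 1)" "z \<in> eig (dE', 0) (2 * n $ 2)"
    using z by (simp_all add: GA_def bit_sign_def)
  have "- snd z = snd z" using z'(1) by (simp add: Theta_def prod_eq_iff)
  then show "snd z = 0" by (simp add: vec_eq_iff)
  show "fst z \<in> L0" using zL by (simp add: mem_L)
  let ?x = "fst z"
  have G1x: "G1 ** ?x ** G1 = msc (bit_sign (k $ 1)) ?x" and G2x: "G2 ** ?x ** G2 = msc (bit_sign (k $ 2)) ?x"
    using arg_cong[OF z'(2), of fst] arg_cong[OF z'(3), of fst]
    by (simp_all add: diamond_eq[OF special_squares(5)] diamond_eq[OF special_squares(6)] fst_elt_scale)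
  show "?x $ (a, flip2 b) $ (a', flip2 b') = bit_sign (k $ 1) * ?x $ (a, b) $ (a', b')"
    using G1_conj[of ?x a b a' b'] by (simp add: G1x)
  have Ex: "d ** ?x - ?x ** d = msc (of_int m) ?x" if "d \<in> L0" "z \<in> eig (d, 0) m" for d m
    using that zL by (simp add: eig_def br0) (simp add: prod_eq_iff fst_elt_scale)
  have dg: "(of_int w - of_int w') * x = of_int m * x \<Longrightarrow> x \<noteq> 0 \<Longrightarrow> m = w - w'" for w w' m :: int and x :: 'a
    by (simp flip: of_int_diff)
  assume nz: "?x $ (a, b) $ (a', b') \<noteq> 0"
  have dEn: "dE $ (a, b) $ (a, b) = (of_int (wE a) :: 'a)" "dE' $ (a, b) $ (a, b) = (of_int (wE' a) :: 'a)" for a b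
    by (simp_all add: dE_nth dE'_nth)
  have mE: "(dE ** x) $ p $ q = dE $ p $ p * x $ p $ q" "(x ** dE) $ p $ q = x $ p $ q * dE $ q $ q" for x :: "'a mat8" and p q
    by (rule diagonal_mult, simp add: dE_nth)+
  have mE': "(dE' ** x) $ p $ q = dE' $ p $ p * x $ p $ q" "(x ** dE') $ p $ q = x $ p $ q * dE' $ q $ q" for x :: "'a mat8" and p q
    by (rule diagonal_mult, simp add: dE'_nth)+
  have mG: "(G2 ** x) $ p $ q = G2 $ p $ p * x $ p $ q" "(x ** G2) $ p $ q = x $ p $ q * G2 $ q $ q" for x :: "'a mat8" and p q
    by (rule diagonal_mult, simp add: G2_nth)+
  have "(of_int (wE a) - of_int (wE a')) * ?x $ (a, b) $ (a', b') = of_int (2 * n $ 1) * ?x $ (a, b) $ (a', b')"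
    using arg_cong[OF Ex[OF special_L0(1) z'(4)], of "\<lambda>x. x $ (a, b) $ (a', b')"]
    unfolding vector_minus_component mE dEn msc_nth by (simp only: left_diff_distrib right_diff_distrib mult.commute)
  from dg[OF this nz] have 1: "2 * n $ 1 = wE a - wE a'" .
  have "(of_int (wE' a) - of_int (wE' a')) * ?x $ (a, b) $ (a', b') = of_int (2 * n $ 2) * ?x $ (a, b) $ (a', b')"
    using arg_cong[OF Ex[OF special_L0(2) z'(5)], of "\<lambda>x. x $ (a, b) $ (a', b')"]
    unfolding vector_minus_component mE' dEn msc_nth by (simp only: left_diff_distrib right_diff_distrib mult.commute)
  from dg[OF this nz] have 2: "2 * n $ 2 = wE' a - wE' a'" .
  have "(if b = 1 then 1 else - 1) * (if b' = 1 then 1 else - 1) * ?x $ (a, b) $ (a', b') = bit_sign (k $ 2) * ?x $ (a, b) $ (a', b')"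
    using arg_cong[OF G2x, of "\<lambda>x. x $ (a, b) $ (a', b')"]
    unfolding mG G2_nth msc_nth by (simp add: ac_simps)
  then have "(if b = 1 then 1 else - 1) * (if b' = 1 then 1 else - 1) = (bit_sign (k $ 2) :: 'a)" using nz by (simp only: mult_cancel_right) simp
  then have 3: "b = b' \<longleftrightarrow> k $ 2 = 0"
    using exhaust_2[of b] exhaust_2[of b'] by (auto simp: bit_sign_def split: if_splits)
  show "2 * n $ 1 = wE a - wE a' \<and> 2 * n $ 2 = wE' a - wE' a' \<and> (b = b' \<longleftrightarrow> k $ 2 = 0)" using 1 2 3 by blast
qed

lemma L0_entries:
  fixes x :: "'a mat8"
  assumes "x \<in> L0"
  shows "x $ (1, 1) $ (4, 1) = - x $ (3, 2) $ (2, 2)" "x $ (1, 1) $ (2, 1) = - x $ (1, 2) $ (2, 2)"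
proof -
  have *: "(transpose x ** C_mat + C_mat ** x) $ p $ q = 0" for p q
    using assms by (simp add: L0_iff)
  show "x $ (1, 1) $ (4, 1) = - x $ (3, 2) $ (2, 2)"
    using *[of "(4, 1)" "(2, 2)"]
    unfolding vector_add_component matrix_matrix_mult_def vec_lambda_beta sum_idx sum_4 sum_2 C_mat_kron kron_nth
    by (simp add: Q4_def sigma3_def transpose_def) (metis minus_minus)?
  show "x $ (1, 1) $ (2, 1) = - x $ (1, 2) $ (2, 2)"
    using *[of "(2, 1)" "(2, 2)"]
    unfolding vector_add_component matrix_matrix_mult_def vec_lambda_beta sum_idx sum_4 sum_2 C_mat_kron kron_nth
    by (simp add: Q4_def sigma3_def transpose_def) (metis minus_minus)?
qed

lemma kron_GA:
  assumes x: "kron P S \<in> L0"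
    and s: "sigma1 ** S ** sigma1 = msc (bit_sign (k $ 1)) S" "sigma2 ** S ** sigma2 = msc (bit_sign (k $ 2)) S"
    and p: "pE ** P - P ** pE = msc (of_int (2 * n $ 1)) P" "pE' ** P - P ** pE' = msc (of_int (2 * n $ 2)) P"
  shows "(kron P S, 0) \<in> Gam (0, k, n)"
proof -
  have "diamond G1 (kron P S, 0) = elt_scale (bit_sign (k $ 1)) (kron P S, 0)"
    "diamond G2 (kron P S, 0) = elt_scale (bit_sign (k $ 2)) (kron P S, 0)"
    unfolding diamond_eq[OF special_squares(5)] diamond_eq[OF special_squares(6)]
    by (simp_all add: ext4_map_0 elt_scale_pair gW_def kron_mult s kron_msc ten.scale_zero_right)
  moreover have "(kron P S, 0) \<in> eig (dE, 0) (2 * n $ 1)" "(kron P S, 0) \<in> eig (dE', 0) (2 * n $ 2)"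
    using x by (simp_all add: eig_def br00 elt_scale_pair ten.scale_zero_right)
      (simp_all add: dE_def dE'_def kron_mult p kron_msc flip: kron_diff)
  ultimately show ?thesis by (simp add: Gam_eq GA_def Theta_def bit_sign_def)
qed

text \<open>Representatives over e_1 and e_1 + e_2. The vectors over -e_1 and e_2 are the partners
  in the brackets shown to be nonzero below.\<close>

lemma base_unit: "(kron (eu 1 4 - eu 3 2) (mat 1), 0) \<in> Gam (0, 0, vector [1, 0])"
  and base_unit_neg: "(kron (eu 4 1 - eu 2 3) (mat 1), 0) \<in> Gam (0, 0, vector [- 1, 0])"
  and base_unit': "(kron (eu 1 3 + eu 4 2) sigma2, 0) \<in> Gam (0, vector [1, 0], vector [0, 1])"
  and base_corner: "(kron (eu 1 2) sigma2, 0) \<in> Gam (0, vector [1, 0], vector [1, 1])"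
  by (rule kron_GA; (rule kron_L0_skew | rule kron_L0_sym[OF _ sigma_sp(2)])?;
      simp add: bit_sign_def mat2_simps; simp add: mat4_simps pE_def pE'_def)+

lemma base_torsion: "(gW sigma2, 0) \<in> Gam (0, vector [1, 0], 0)" "(dE, 0) \<in> Gam (0, 0, 0)"
proof -
  show "(gW sigma2, 0) \<in> Gam (0, vector [1, 0], 0)" unfolding gW_def
  proof (rule kron_GA)
    show "kron (mat 1) sigma2 \<in> (L0 :: 'a mat8 set)" using special_L0(6) by (simp add: gW_def)
    show "sigma1 ** sigma2 ** sigma1 = msc (bit_sign ((vector [1, 0] :: bit ^ 2) $ 1)) (sigma2 :: 'a ^ 2 ^ 2)"
      "sigma2 ** sigma2 ** sigma2 = msc (bit_sign ((vector [1, 0] :: bit ^ 2) $ 2)) (sigma2 :: 'a ^ 2 ^ 2)"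
      by (simp_all add: bit_sign_def mat2_simps)
  qed (simp_all add: msc_0)
  show "(dE, 0) \<in> Gam (0, 0, 0)" unfolding dE_def
  proof (rule kron_GA)
    show "kron pE (mat 1) \<in> (L0 :: 'a mat8 set)" using special_L0(1) by (simp add: dE_def)
  qed (simp_all add: msc_0 bit_sign_def msc_1 sigma_products pq_products)
qed

lemma odd_GA:
  assumes w: "w \<in> L1" "act dE w = tensor_scale (of_int (2 * n $ 1)) w" "act dE' w = tensor_scale (of_int (2 * n $ 2)) w"
    "ext4_map G1 w = w" "ext4_map G2 w = w"
  shows "(0, w) \<in> Gam (1, 0, n)"
  using assms by (simp add: Gam_eq GA_def Theta_def bit_sign_def diamond_eq[OF special_squares(5)]
      diamond_eq[OF special_squares(6)] eig_def br01 elt_scale_pair tensor_scale_neg)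

lemma act_special_hw: "act dE' hw = 0" "ext4_map G1 hw = hw" "ext4_map G2 hw = hw"
proof -
  have 0: "act d hw = 0" if "d \<in> L0" "dE ** d = d ** dE" "nu d = 0" for d
    using act_hw[OF that(1,2)] that(3) by simp
  show "act dE' hw = 0" by (rule 0) (simp_all add: special_commute nu_special)
  show "ext4_map G1 hw = hw" by (rule invariant_ext4_map[OF special_squares(5) 0]) (simp_all add: special_commute nu_special)
  show "ext4_map G2 hw = hw" by (rule invariant_ext4_map[OF special_squares(6) 0]) (simp_all add: special_commute nu_special)
qed

lemma base_double: "(0, hw) \<in> Gam (1, 0, vector [2, 0])"
  by (rule odd_GA) (simp_all add: hw act_special_hw)

lemma base_odd: "(0, hW) \<in> Gam (1, 0, 0)"
  by (rule odd_GA) (simp_all add: hW)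

lemma hW_nonzero: "hW \<noteq> 0"
proof
  assume "hW = 0"
  then have "ext4_map sEW hW = 0" by (simp add: ext4_map_0)
  then show False unfolding hW_def by (simp add: ext4_map_mult[symmetric] sEW_square ext4_map_one hE_nonzero)
qed

text \<open>\<open>n $ 1 = 2\<close> means \<open>dE\<close>-weight 4, which does not occur on
  matrices and has the line of \<open>hw\<close> as its eigenspace in L1; the other degrees are
  those of \<open>hw\<close>.\<close>

lemma double_component:
  assumes z: "z \<in> Gam (k0, k, n)" "z \<noteq> 0" and n: "n $ 1 = 2"
  shows "k0 = 1 \<and> k = 0 \<and> n $ 2 = 0 \<and> (\<exists>c. z = elt_scale c (0, hw))"
proof -
  have z': "Theta z = elt_scale (bit_sign k0) z" "diamond G1 z = elt_scale (bit_sign (k $ 1)) z"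
      "diamond G2 z = elt_scale (bit_sign (k $ 2)) z" "z \<in> eig (dE, 0) 4" "z \<in> eig (dE', 0) (2 * n $ 2)"
    using z(1) n by (simp_all add: Gam_eq GA_def)
  have "fst z = 0" using dE_L0_cases[OF eig_dE_parts(1)[OF z'(4)]] by auto
  moreover obtain c where c: "snd z = tensor_scale c hw"
    using hw_line[of "snd z"] eig_dE_parts(2)[OF z'(4)] by (auto simp: eig_dE_L1)
  ultimately have zc: "z = elt_scale c (0, hw)" by (simp add: prod_eq_iff elt_scale_pair)
  then have c0: "c \<noteq> 0" using z(2) by auto
  have hwL: "(0, hw) \<in> L" using hw by simp
  have eq: "a = b" if "elt_scale a z = elt_scale b z" for a b using that z(2) by (simp add: scale_right_imp_eq)
  have "Theta z = elt_scale (bit_sign 1) z" unfolding zc by (simp add: Theta_def elt_scale_pair bit_sign_def tensor_scale_neg)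
  then have k0: "k0 = 1" using z'(1) eq bit_sign_neq[of k0 1] by metis
  have "diamond G1 z = elt_scale (bit_sign 0) z" "diamond G2 z = elt_scale (bit_sign 0) z" unfolding zc
    by (simp_all add: diamond_eq[OF special_squares(5)] diamond_eq[OF special_squares(6)] elt_scale_pair bit_sign_def
        ext4_map_scale act_special_hw)
  then have "k $ 1 = 0" "k $ 2 = 0" using z'(2,3) eq bit_sign_neq[of _ 0] by metis+
  moreover have "br (dE', 0) z = elt_scale 0 z"
    unfolding zc by (simp add: br_sc_right[OF special_L(2) hwL] br01[OF special_L0(2) hw(1)] act_special_hw flip: zero_prod_def)
  then have "of_int (2 * n $ 2) = (0 :: 'a)" using z'(5) eq by (simp only: eig_def mem_Collect_eq)
  ultimately show ?thesis using k0 zc by (auto simp: vec2_eq_iff)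
qed

lemma unit_line: "line (Gam (0, 0, vector [1, 0]))"
proof (rule lineI)
  fix z assume z: "z \<in> Gam (0, 0, vector [1, 0])"
  let ?x = "fst z"
  note e = GA_even_entries[OF z[unfolded Gam_eq]]
  have 0: "?x $ (a, b) $ (a', b') = 0" if "\<not> (1 = wE a \<and> - 1 = wE a' \<and> wE' a = wE' a' \<and> b = b')" for a b a' b'
    using e(3)[of a b a' b'] that by (cases "?x $ (a, b) $ (a', b') = 0") (auto split: if_splits)
  have t: "?x $ (a, 2) $ (a', 2) = ?x $ (a, 1) $ (a', 1)" for a a'
    using e(4)[of a 1 a' 1] by (simp add: bit_sign_def)
  have r: "?x $ (3, 1) $ (2, 1) = - ?x $ (1, 1) $ (4, 1)" using L0_entries(1)[OF e(2)] t[of 3 2] by simp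
  have "?x = msc (?x $ (1, 1) $ (4, 1)) (kron (eu 1 4 - eu 3 2) (mat 1))"
    unfolding vec_eq_iff forall_idx forall_4 forall_2 by (simp add: 0 t r mat_def)
  then show "\<exists>c. z = elt_scale c (kron (eu 1 4 - eu 3 2) (mat 1), 0)"
    using e(1) by (intro exI[of _ "?x $ (1, 1) $ (4, 1)"]) (simp add: prod_eq_iff elt_scale_pair ten.scale_zero_right)
qed

text \<open>Over (1, 1) with k_2 = 0 only the diagonal 2 by 2 block from block 2 to block 1
  survives. Its two entries are opposite by the symplectic relation and agree up to the sign of
  \<open>G1\<close>; for k = 0 they are also equal, so the component vanishes. This is the origin of
  the condition k \<noteq> 0 over the corners.\<close>

lemma corner_line: "line (Gam (0, vector [1, 0], vector [1, 1]))" and corner_0: "Gam (0, 0, vector [1, 1]) = {0}"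
proof -
  have 0: "fst z $ (a, b) $ (a', b') = 0"
    if "z \<in> GA (0, k, vector [1, 1])" "k $ 2 = 0" "\<not> (1 = wE a \<and> - 1 = wE a' \<and> 1 = wE' a \<and> - 1 = wE' a' \<and> b = b')" for z k a b a' b'
    using GA_even_entries(3)[OF that(1), of a b a' b'] that(2,3)
    by (cases "fst z $ (a, b) $ (a', b') = 0") (auto split: if_splits)
  show "line (Gam (0, vector [1, 0], vector [1, 1]))"
  proof (rule lineI)
    fix z assume z: "z \<in> Gam (0, vector [1, 0], vector [1, 1])"
    let ?x = "fst z"
    note z' = z[unfolded Gam_eq]
    note e = GA_even_entries[OF z']
    have t: "?x $ (a, 2) $ (a', 2) = - ?x $ (a, 1) $ (a', 1)" for a a'
      using e(4)[of a 1 a' 1] by (simp add: bit_sign_def)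
    have "?x = msc (?x $ (1, 1) $ (2, 1)) (kron (eu 1 2) sigma2)"
      unfolding vec_eq_iff forall_idx forall_4 forall_2 by (simp add: 0[OF z'] t sigma2_def)
    then show "\<exists>c. z = elt_scale c (kron (eu 1 2) sigma2, 0)"
      using e(1) by (intro exI[of _ "?x $ (1, 1) $ (2, 1)"]) (simp add: prod_eq_iff elt_scale_pair ten.scale_zero_right)
  qed
  have "z = 0" if z: "z \<in> Gam (0, 0, vector [1, 1])" for z
  proof -
    let ?x = "fst z"
    note z' = z[unfolded Gam_eq]
    note e = GA_even_entries[OF z']
    have t: "?x $ (a, 2) $ (a', 2) = ?x $ (a, 1) $ (a', 1)" for a a'
      using e(4)[of a 1 a' 1] by (simp add: bit_sign_def)
    have r: "?x $ (1, 1) $ (2, 1) = 0" using L0_entries(2)[OF e(2)] t[of 1 2] by simp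
    have "?x = 0" unfolding vec_eq_iff forall_idx forall_4 forall_2 by (simp add: 0[OF z'] t r)
    then show ?thesis using e(1) by (simp add: prod_eq_iff)
  qed
  then show "Gam (0, 0, vector [1, 1]) = {0}" using subspace_0[OF gradingD(1)[OF Gam_grading]] by blast
qed

section \<open>The shape of the support\<close>

definition unit_vec :: "int ^ 2 \<Rightarrow> bool" where "unit_vec n \<longleftrightarrow> \<bar>n $ 1\<bar> + \<bar>n $ 2\<bar> = 1"
definition corner :: "int ^ 2 \<Rightarrow> bool" where "corner n \<longleftrightarrow> \<bar>n $ 1\<bar> = 1 \<and> \<bar>n $ 2\<bar> = 1"
definition double :: "int ^ 2 \<Rightarrow> bool" where "double n \<longleftrightarrow> \<bar>n $ 1\<bar> + \<bar>n $ 2\<bar> = 2 \<and> \<not> corner n"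

lemma diag_B_set: "\<bar>x\<bar> = 1 \<Longrightarrow> \<bar>y\<bar> = 1 \<Longrightarrow> vector [vector [x, 0], vector [0, y]] \<in> B_set"
  and antidiag_B_set: "\<bar>x\<bar> = 1 \<Longrightarrow> \<bar>y\<bar> = 1 \<Longrightarrow> vector [vector [0, x], vector [y, 0]] \<in> B_set"
proof -
  assume "\<bar>x\<bar> = 1" "\<bar>y\<bar> = 1"
  then have "x = 1 \<or> x = - 1" "y = 1 \<or> y = - 1" by linarith+
  then show "vector [vector [x, 0], vector [0, y]] \<in> B_set" "vector [vector [0, x], vector [y, 0]] \<in> B_set"
    unfolding B_set_eq signed_perm_def by blast+
qed

lemma obtain_unit:
  assumes "unit_vec n"
  obtains M where "M \<in> B_set" "M *v vector [1, 0] = n" "M *v vector [2, 0] = n + n"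
proof (cases "n $ 1 = 0")
  case True
  then have "\<bar>n $ 2\<bar> = 1" using assms by (simp add: unit_vec_def)
  then show ?thesis using True
    by (intro that[OF antidiag_B_set[of 1 "n $ 2"]]) (simp_all only: mv2, simp_all add: vec2_eq_iff)
next
  case False
  then have "\<bar>n $ 1\<bar> = 1" "n $ 2 = 0" using assms by (simp_all add: unit_vec_def)
  then show ?thesis
    by (intro that[OF diag_B_set[of "n $ 1" 1]]) (simp_all only: mv2, simp_all add: vec2_eq_iff)
qed

lemma obtain_double:
  assumes "double n"
  obtains M where "M \<in> B_set" "M *v vector [2, 0] = n"
proof -
  have "n $ 1 = 0 \<and> (n $ 2 = 2 \<or> n $ 2 = - 2) \<or> n $ 2 = 0 \<and> (n $ 1 = 2 \<or> n $ 1 = - 2)"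
    using assms unfolding double_def corner_def by arith
  then have "unit_vec (vector [n $ 1 div 2, n $ 2 div 2])"
    "vector [n $ 1 div 2, n $ 2 div 2] + vector [n $ 1 div 2, n $ 2 div 2] = n"
    by (elim disjE conjE; simp add: unit_vec_def vec2_eq_iff)+
  then show ?thesis using that obtain_unit by metis
qed

lemma obtain_GL2:
  assumes "k \<noteq> (0 :: bit ^ 2)"
  obtains A where "A \<in> carrier GL_group" "A *v vector [1, 0] = k"
\<comment> \<open>The second column is chosen so that the determinant is k_1 + k_2 + k_1 k_2, which
  is 1 modulo 2 unless k = 0.\<close>
proof (rule that[of "vector [vector [k $ 1, 1 + k $ 1], vector [k $ 2, k $ 1]]"])
  show "(vector [vector [k $ 1, 1 + k $ 1], vector [k $ 2, k $ 1]] :: bit ^ 2 ^ 2) \<in> carrier GL_group"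
    using assms by (cases "k $ 1"; cases "k $ 2") (simp_all add: GL_group_def invertible_det_nz det_2 vec2_eq_iff)
qed (simp add: mv2 vec2_eq_iff)

lemma corner_vector: "corner n \<Longrightarrow> n = vector [n $ 1, n $ 2]" by (simp add: vec2_eq_iff)

text \<open>Eigenvalues of \<open>dE\<close> and \<open>dE'\<close> bound both coordinates of
  \<open>n\<close> by 2 in absolute value. Signed permutations move a coordinate \<plusminus>2 to
  the first place with sign 1, where \<open>double_component\<close> applies, and a corner to (1,
  1). Conversely each listed degree is the image of a representative under a realized
  automorphism.\<close>

lemma supp_Gam:
  "(k0, k, n) \<in> supp Gam \<longleftrightarrow> n = 0 \<or> unit_vec n \<or> corner n \<and> k \<noteq> 0 \<or> double n \<and> k0 = 1 \<and> k = 0"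
proof
  assume s: "(k0, k, n) \<in> supp Gam"
  then obtain z where z: "z \<in> Gam (k0, k, n)" "z \<noteq> 0"
    using subspace_0[OF gradingD(1)[OF Gam_grading, of "(k0, k, n)"]] by (auto simp: supp_def)
  then have "z \<in> eig (dE, 0) (2 * n $ 1)" "z \<in> eig (dE', 0) (2 * n $ 2)" by (simp_all add: Gam_eq GA_def)
  then have b: "\<bar>n $ 1\<bar> \<le> 2" "\<bar>n $ 2\<bar> \<le> 2"
    using dE_cases[OF _ z(2)] eig_d_cases[OF special_L0(2) special_squares(2) _ z(2)] by fastforce+
  have two: "k0 = 1 \<and> k = 0 \<and> m $ 2 = 0" if "(k0, k, m) \<in> supp Gam" "m $ 1 = 2" for m
    using that double_component subspace_0[OF gradingD(1)[OF Gam_grading, of "(k0, k, m)"]] by (auto simp: supp_def)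
  have M: "(k0, k, M *v n) \<in> supp Gam" if "M \<in> B_set" for M
    using gaut_supp[OF one_GL_carrier that, of 0 0 0 "(k0, k, n)"] s by (simp add: gaut_def dot_def)
  consider "\<bar>n $ 1\<bar> = 2" | "\<bar>n $ 2\<bar> = 2" | "\<bar>n $ 1\<bar> \<le> 1 \<and> \<bar>n $ 2\<bar> \<le> 1" using b by linarith
  then show "n = 0 \<or> unit_vec n \<or> corner n \<and> k \<noteq> 0 \<or> double n \<and> k0 = 1 \<and> k = 0"
  proof cases
    case 1
    then have "k0 = 1 \<and> k = 0 \<and> n $ 2 = 0"
      using two[OF M[OF diag_B_set[of "sgn (n $ 1)" 1]]] by (simp add: mv2 sgn_if abs_if split: if_splits)
    then show ?thesis using 1 by (simp add: double_def corner_def)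
  next
    case 2
    then have "k0 = 1 \<and> k = 0 \<and> n $ 1 = 0"
      using two[OF M[OF antidiag_B_set[of "sgn (n $ 2)" 1]]] by (simp add: mv2 sgn_if abs_if split: if_splits)
    then show ?thesis using 2 by (simp add: double_def corner_def)
  next
    case 3
    have "k \<noteq> 0" if c: "corner n"
    proof
      assume k: "k = 0"
      have "n $ 1 * n $ 1 = 1" "n $ 2 * n $ 2 = 1" using c by (auto simp: corner_def abs_if split: if_splits)
      then have n: "dg2 (n $ 1) (n $ 2) *v n = vector [1, 1]" by (simp add: mv2)
      have "dg2 (n $ 1) (n $ 2) \<in> B_set" using c by (intro diag_B_set) (auto simp: corner_def)
      \<comment> \<open>The choice \<open>q = (k0, 0)\<close> adds k0 to the Theta-degree, since n_1
        is odd, and so brings it to 0, the case treated in \<open>corner_0\<close>.\<close>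
      from gaut_supp[OF one_GL_carrier this, of 0 "vector [k0, 0]" 0 "(k0, k, n)"] s
      have "(k0 + k0 * of_int (n $ 1), 0, vector [1, 1]) \<in> supp Gam"
        by (simp add: gaut_def dot_def red_def k n)
      moreover have "of_int (n $ 1) = (1 :: bit)" using c by (auto simp: corner_def abs_if split: if_splits)
      ultimately show False using corner_0 by (simp add: supp_def)
    qed
    moreover have "\<bar>n $ 1\<bar> = 0 \<or> \<bar>n $ 1\<bar> = 1" "\<bar>n $ 2\<bar> = 0 \<or> \<bar>n $ 2\<bar> = 1" using 3 by linarith+
    ultimately show ?thesis by (elim disjE) (simp_all add: unit_vec_def corner_def vec2_eq_iff)
  qed
next
  have suppI: "s \<in> supp Gam" if "z \<in> Gam s" "z \<noteq> 0" for s z using that by (auto simp: supp_def)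
  have x0: "(x, 0) \<noteq> (0 :: 'a elt)" if "x $ p $ q \<noteq> 0" for x :: "'a mat8" and p q using that by (auto simp: zero_prod_def)
  assume "n = 0 \<or> unit_vec n \<or> corner n \<and> k \<noteq> 0 \<or> double n \<and> k0 = 1 \<and> k = 0"
  then consider "n = 0" "k = 0" | "n = 0" "k \<noteq> 0" | "unit_vec n" | "corner n" "k \<noteq> 0" | "double n" "k0 = 1" "k = 0" by blast
  then show "(k0, k, n) \<in> supp Gam"
  proof cases
    case 1
    have "(0, 0, 0) \<in> supp Gam" by (rule suppI[OF base_torsion(2) x0[of dE "(1, 1)" "(1, 1)"]]) (simp add: dE_nth)
    moreover have "(1, 0, 0) \<in> supp Gam" by (rule suppI[OF base_odd]) (simp add: hW_nonzero zero_prod_def)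
    ultimately show ?thesis using 1 by (cases k0) auto
  next
    case 2
    obtain A where A: "A \<in> carrier GL_group" "A *v vector [1, 0] = k" using obtain_GL2[OF 2(2)] .
    have "(0, vector [1, 0], 0) \<in> supp Gam"
      by (rule suppI[OF base_torsion(1) x0[of G2 "(1, 1)" "(1, 1)"]]) (simp add: G2_nth)
    then show ?thesis using gaut_supp[OF A(1) one_B_set, of "vector [k0, 0]" 0 0 "(0, vector [1, 0], 0)"] 2 A(2)
      by (simp add: gaut_def dot_def red_def parity_sum_def)
  next
    case 3
    obtain M where M: "M \<in> B_set" "M *v vector [1, 0] = n" using obtain_unit[OF 3] .
    have "(0, 0, vector [1, 0]) \<in> supp Gam"
      by (rule suppI[OF base_unit x0[of _ "(1, 1)" "(4, 1)"]]) (simp add: mat_def)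
    then show ?thesis using gaut_supp[OF one_GL_carrier M(1), of 0 "vector [k0, 0]" k "(0, 0, vector [1, 0])"] M(2)
      by (simp add: gaut_def dot_def red_def parity_sum_def)
  next
    case 4
    obtain A where A: "A \<in> carrier GL_group" "A *v vector [1, 0] = k" using obtain_GL2[OF 4(2)] .
    have "dg2 (n $ 1) (n $ 2) \<in> B_set" using 4(1) by (intro diag_B_set) (auto simp: corner_def)
    moreover have "dg2 (n $ 1) (n $ 2) *v vector [1, 1] = n" by (simp add: mv2 vec2_eq_iff)
    moreover have "(0, vector [1, 0], vector [1, 1]) \<in> supp Gam"
      by (rule suppI[OF base_corner x0[of _ "(1, 1)" "(2, 1)"]]) (simp add: sigma2_def)
    ultimately show ?thesis
      using gaut_supp[OF A(1), of "dg2 (n $ 1) (n $ 2)" 0 "vector [k0, 0]" 0 "(0, vector [1, 0], vector [1, 1])"] A(2)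
      by (simp add: gaut_def dot_def red_def)
  next
    case 5
    obtain M where M: "M \<in> B_set" "M *v vector [2, 0] = n" using obtain_double[OF 5(1)] .
    have "(1, 0, vector [2, 0]) \<in> supp Gam" by (rule suppI[OF base_double]) (simp add: hw zero_prod_def)
    then show ?thesis using gaut_supp[OF one_GL_carrier M(1), of 0 0 0 "(1, 0, vector [2, 0])"] M(2) 5
      by (simp add: gaut_def dot_def red_def parity_sum_def)
  qed
qed

lemma Gam_line:
  assumes "n \<noteq> 0"
  shows "line (Gam (k0, k, n))"
proof (cases "(k0, k, n) \<in> supp Gam")
  case False
  then show ?thesis by (simp add: supp_def line_def)
next
  case True
  then consider "unit_vec n" | "corner n" "k \<noteq> 0" | "double n" "k0 = 1" "k = 0" using assms supp_Gam by blast
  then show ?thesis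
  proof cases
    case 1
    obtain M where M: "M \<in> B_set" "M *v vector [1, 0] = n" using obtain_unit[OF 1] .
    show ?thesis using line_gaut[OF one_GL_carrier M(1) unit_line, of 0 "vector [k0, 0]" k] M(2)
      by (simp add: gaut_def dot_def red_def parity_sum_def)
  next
    case 2
    obtain A where A: "A \<in> carrier GL_group" "A *v vector [1, 0] = k" using obtain_GL2[OF 2(2)] .
    have "dg2 (n $ 1) (n $ 2) \<in> B_set" using 2(1) by (intro diag_B_set) (auto simp: corner_def)
    from line_gaut[OF A(1) this corner_line, of 0 "vector [k0, 0]" 0]
    show ?thesis using A(2) by (simp add: gaut_def dot_def red_def mv2) (simp flip: corner_vector[OF 2(1)])
  next
    case 3
    have "line (Gam (1, 0, vector [2, 0]))"
    proof (rule lineI[of _ "(0, hw)"])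
      fix z assume "z \<in> Gam (1, 0, vector [2, 0])"
      then show "\<exists>c. z = elt_scale c (0, hw)" using double_component[of z 1 0 "vector [2, 0]"]
        by (cases "z = 0") (auto intro: exI[of _ 0])
    qed
    moreover obtain M where M: "M \<in> B_set" "M *v vector [2, 0] = n" using obtain_double[OF 3(1)] .
    ultimately show ?thesis using line_gaut[OF one_GL_carrier M(1), of "(1, 0, vector [2, 0])" 0 0 0] 3 M(2)
      by (simp add: gaut_def dot_def red_def parity_sum_def)
  qed
qed

section \<open>Nonzero brackets between lines\<close>

lemma nzI: "(x, 0) \<in> Gam s \<Longrightarrow> (y, 0) \<in> Gam t \<Longrightarrow> (x ** y - y ** x) $ p $ q \<noteq> 0 \<Longrightarrow> nz s t"
proof -
  assume xy: "(x, 0) \<in> Gam s" "(y, 0) \<in> Gam t" "(x ** y - y ** x) $ p $ q \<noteq> 0"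
  then have "(x, 0) \<in> L" "(y, 0) \<in> L" using gradingD(2)[OF Gam_grading] by blast+
  then have "br (x, 0) (y, 0) = (x ** y - y ** x, 0)" by (simp add: br00)
  moreover have "(x ** y - y ** x, 0) \<noteq> (0 :: 'a elt)" using xy(3) by (auto simp: zero_prod_def)
  ultimately show "nz s t" unfolding nz_def using xy(1,2) by metis
qed

text \<open>The torsion parts must differ because the bracket lies over a corner, where the torsion
  part cannot be 0. Conversely \<open>A\<close> adjusts the difference of the two torsion parts, the
  translation \<open>v = k\<close> their position, and \<open>q\<close> the two
  Theta-degrees.\<close>

lemma nz_unit:
  assumes "k \<noteq> k'" "\<bar>s1\<bar> = 1" "\<bar>s2\<bar> = 1"
  shows "nz (k0, k, vector [s1, 0]) (k0', k', vector [0, s2])"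
proof -
  have "(kron (eu 1 4 - eu 3 2) (mat 1) ** kron (eu 1 3 + eu 4 2) sigma2 -
      kron (eu 1 3 + eu 4 2) sigma2 ** kron (eu 1 4 - eu 3 2) (mat 1)) $ (1, 1) $ (2, 1) = (2 :: 'a)"
    unfolding kron_mult by (simp add: matrix_matrix_mult_def sum_4 sum_2 sigma2_def mat_def)
  then have base: "nz (0, 0, vector [1, 0]) (0, vector [1, 0], vector [0, 1])"
    by (intro nzI[OF base_unit base_unit', of "(1, 1)" "(2, 1)"]) simp
  have "k + k' \<noteq> 0" using assms(1) by (cases "k $ 1"; cases "k $ 2"; cases "k' $ 1"; cases "k' $ 2") (auto simp: vec2_eq_iff)
  then obtain A where A: "A \<in> carrier GL_group" "A *v vector [1, 0] = k + k'" by (rule obtain_GL2)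
  have "k + k' + k = k'" by (simp add: vec2_eq_iff ac_simps)
  then show ?thesis
    using nz_gaut[OF A(1) diag_B_set[OF assms(2,3)] base, of 0 "vector [k0, k0']" k] A(2)
    by (simp add: gaut_def dot_def red_def parity_sum_def mv2)
qed

lemma two_bit2: "2 * k = (0 :: bit ^ 2)"
  by (simp only: mult_2) (simp add: vec2_eq_iff)

lemma nz_corner:
  assumes "k \<noteq> 0"
  shows "nz (k0, k, vector [1, 1]) (k0', k', vector [- 1, 0])" "nz (k0, k, vector [1, 1]) (k0', k', vector [0, - 1])"
proof -
  have "(kron (eu 1 2) sigma2 ** kron (eu 4 1 - eu 2 3) (mat 1) -
      kron (eu 4 1 - eu 2 3) (mat 1) ** kron (eu 1 2) sigma2) $ (1, 1) $ (3, 1) = (- 1 :: 'a)"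
    unfolding kron_mult by (simp add: matrix_matrix_mult_def sum_4 sum_2 sigma2_def mat_def)
  then have base: "nz (0, vector [1, 0], vector [1, 1]) (0, 0, vector [- 1, 0])"
    by (intro nzI[OF base_corner base_unit_neg, of "(1, 1)" "(3, 1)"]) simp
  obtain A where A: "A \<in> carrier GL_group" "A *v vector [1, 0] = k" using obtain_GL2[OF assms] .
  show "nz (k0, k, vector [1, 1]) (k0', k', vector [- 1, 0])"
    \<comment> \<open>The pairing of \<open>q\<close> with (1, 1) is k0 and with (-1, 0) is k0'; the
      translation k' has no effect on the corner, where n_1 + n_2 is even.\<close>
    using nz_gaut[OF A(1) one_B_set base, of 0 "vector [k0', k0 + k0']" k'] A(2)
    by (simp add: gaut_def dot_def red_def parity_sum_def two_bit2 add.commute[of k0])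
  show "nz (k0, k, vector [1, 1]) (k0', k', vector [0, - 1])"
    using nz_gaut[OF A(1) sigma_B_set(1) base, of 0 "vector [k0', k0 + k0']" k'] A(2)
    by (simp add: gaut_def dot_def red_def parity_sum_def sigma1_def mv2 two_bit2 add.commute[of k0])
qed

lemma nz_double:
  assumes "\<bar>s\<bar> = 1"
  shows "nz (1, 0, vector [2 * s, 0]) (k0, k, vector [- s, 0])" "nz (1, 0, vector [0, 2 * s]) (k0, k, vector [0, - s])"
proof -
  let ?x = "kron (eu 4 1 - eu 2 3) (mat 1) :: 'a mat8"
  have xL: "?x \<in> L0" using gradingD(2)[OF Gam_grading] base_unit_neg by fastforce
  have "act ?x hw $ (4, 1) $ (1, 2) $ (3, 1) $ (3, 2) = top_coeff hw"
    by (simp add: act_def sum_idx sum_4 sum_2 mat_def top_coeff_def)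
  moreover have "top_coeff hw \<noteq> 0" using weight4_eq_0[of hw] hw L1_Ext4 by auto
  ultimately have "act ?x hw \<noteq> 0" by auto
  then have "br (0, hw) (?x, 0) \<noteq> 0" by (simp add: br10[OF xL hw(1)] zero_prod_def)
  then have base: "nz (1, 0, vector [2, 0]) (0, 0, vector [- 1, 0])"
    unfolding nz_def using base_double base_unit_neg by blast
  show "nz (1, 0, vector [2 * s, 0]) (k0, k, vector [- s, 0])"
    using nz_gaut[OF one_GL_carrier diag_B_set[OF assms, of 1] base, of 0 "vector [k0, 0]" k]
    by (simp add: gaut_def dot_def red_def parity_sum_def mv2 mult.commute)
  show "nz (1, 0, vector [0, 2 * s]) (k0, k, vector [0, - s])"
    using nz_gaut[OF one_GL_carrier antidiag_B_set[OF _ assms, of 1] base, of 0 "vector [k0, 0]" k]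
    by (simp add: gaut_def dot_def red_def parity_sum_def mv2 mult.commute)
qed

text \<open>The elements commuting with every component of nontorsion degree form an ideal: such an element is
  killed by homogeneous elements of nontorsion degree, and those of torsion degree only permute the
  components in question.\<close>

lemma centralizer:
  assumes x: "x \<in> Gam (k0, k, 0)" "x \<noteq> 0"
  shows "\<exists>k0' k' n. n \<noteq> 0 \<and> (\<exists>y\<in>Gam (k0', k', n). br x y \<noteq> 0)"
proof (rule ccontr)
  assume no: "\<not> ?thesis"
  let ?C = "{x \<in> L. \<forall>k0 k n. n \<noteq> 0 \<longrightarrow> (\<forall>y\<in>Gam (k0, k, n). br x y = 0)}"
  have GL: "y \<in> L" if "y \<in> Gam s" for y s using gradingD(2)[OF Gam_grading] that by blast
  have sub: "subspace ?C"
    by (rule subspaceI) (auto simp: br_add_left br_sc_left GL)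
  have hom: "br z y \<in> ?C" if y: "y \<in> ?C" and z: "z \<in> Gam (k0, k, n)" for y z k0 k n
  proof (cases "n = 0")
    case False
    then have "br y z = 0" using y z by blast
    then have "br z y = 0" using br_skew[of y z] y GL[OF z] by simp
    then show ?thesis using subspace_0[OF sub] by simp
  next
    case True
    have "br (br z y) w = 0" if w: "w \<in> Gam (k0', k', n')" and n': "n' \<noteq> 0" for w k0' k' n'
    proof -
      have yL: "y \<in> L" using y by simp
      have "br z w \<in> Gam ((k0, k, n) + (k0', k', n'))" using gradingD(3)[OF Gam_grading z w] .
      then have "br z w \<in> Gam (k0 + k0', k + k', n')" using True by simp
      then have "br y (br z w) = 0" "br y w = 0" using y n' w by blast+
      then show ?thesis using jacobi'[OF GL[OF z] yL GL[OF w]] br_0_right[OF GL[OF z]] by simp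
    qed
    then show ?thesis using y GL[OF z] by auto
  qed
  have ideal: "br z y \<in> ?C" if z: "z \<in> L" and y: "y \<in> ?C" for z y
  proof -
    obtain S u where u: "finite S" "\<And>i. u i \<in> Gam i" "z = sum u S"
      using grading_decomp[OF Gam_grading z] by metis
    have yL: "y \<in> L" using y by simp
    have "br z y = - br y z" using br_skew[OF yL z] .
    also have "br y z = (\<Sum>i\<in>S. br y (u i))" unfolding u(3)
      by (rule linear_on_L_sum[OF linear_on_L_ad[OF yL]]) (use GL u(2) in blast)
    also have "- \<dots> = (\<Sum>i\<in>S. br (u i) y)" using br_skew[OF yL GL[OF u(2)]] by (simp add: sum_negf)
    also have "\<dots> \<in> ?C"
    proof (rule subspace_sum[OF sub])
      fix i assume "i \<in> S"
      obtain a b c where i: "i = (a, b, c)" by (cases i)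
      show "br (u i) y \<in> ?C" by (rule hom[OF y]) (use u(2)[of i] in \<open>simp only: i\<close>)
    qed
    finally show ?thesis .
  qed
  have simp: "I = {0} \<or> I = L" if "subspace I" "I \<subseteq> L" "\<And>x y. x \<in> L \<Longrightarrow> y \<in> I \<Longrightarrow> br x y \<in> I" for I
    using simple that unfolding simple_lie_algebra_def by blast
  have disj: "?C = {0} \<or> ?C = L" by (rule simp[OF sub _ ideal]) simp_all
  have "(dE, 0) \<notin> ?C"
  proof
    assume "(dE, 0) \<in> ?C"
    moreover have "vector [2, 0] \<noteq> (0 :: int ^ 2)" by (simp add: vec2_eq_iff)
    ultimately have "br (dE, 0) (0, hw) = 0" using base_double by blast
    then show False by (simp add: br01 hw zero_prod_def)
  qed
  moreover have "(dE, 0) \<in> L" by simp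
  ultimately have nL: "?C \<noteq> L" by (metis (no_types))
  have C0: "?C = {0}" by (rule disjE[OF disj], assumption, erule notE[OF nL])
  have "x \<in> ?C" using GL[OF x(1)] no by blast
  then show False using x(2) unfolding C0 by simp
qed

end

section \<open>Fineness and universality\<close>

lemma int_additive_0:
  fixes f :: "int \<Rightarrow> 'h::ab_group_add"
  assumes "\<And>a b. f (a + b) = f a + f b" "f 1 = 0"
  shows "f n = 0"
proof (induction n rule: int_induct[of _ 0])
  case base
  show ?case using assms(1)[of 0 0] by simp
next
  case (step1 i)
  then show ?case by (simp add: assms)
next
  case (step2 i)
  then show ?case using assms(1)[of "i - 1" 1] by (simp add: assms(2))
qed

lemma additive_G6_eqI:
  fixes \<phi> \<psi> :: "G6 \<Rightarrow> 'h::ab_group_add"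
  assumes \<phi>: "\<And>s t. \<phi> (s + t) = \<phi> s + \<phi> t" and \<psi>: "\<And>s t. \<psi> (s + t) = \<psi> s + \<psi> t"
    and eq: "\<phi> (1, 0, 0) = \<psi> (1, 0, 0)" "\<phi> (0, vector [1, 0], 0) = \<psi> (0, vector [1, 0], 0)"
      "\<phi> (0, vector [0, 1], 0) = \<psi> (0, vector [0, 1], 0)" "\<phi> (0, 0, vector [1, 0]) = \<psi> (0, 0, vector [1, 0])"
      "\<phi> (0, 0, vector [0, 1]) = \<psi> (0, 0, vector [0, 1])"
  shows "\<phi> = \<psi>"
proof
  fix s :: G6
  obtain k0 k n where s: "s = (k0, k, n)" by (cases s)
  define \<delta> where "\<delta> s = \<phi> s - \<psi> s" for s
  have add: "\<delta> (s + t) = \<delta> s + \<delta> t" for s t by (simp add: \<delta>_def \<phi> \<psi>)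
  have 0: "\<delta> 0 = 0" using add[of 0 0] by simp
  have n1: "\<delta> (0, 0, vector [m, 0]) = 0" for m
  proof (rule int_additive_0[where f = "\<lambda>m. \<delta> (0, 0, vector [m, 0])"])
    fix a b :: int
    have "(0, 0, vector [a + b, 0]) = (0, 0, vector [a, 0]) + ((0, 0, vector [b, 0]) :: G6)" by (simp add: vec2_eq_iff)
    then show "\<delta> (0, 0, vector [a + b, 0]) = \<delta> (0, 0, vector [a, 0]) + \<delta> (0, 0, vector [b, 0])" by (simp only: add)
  qed (simp add: \<delta>_def eq)
  have n2: "\<delta> (0, 0, vector [0, m]) = 0" for m
  proof (rule int_additive_0[where f = "\<lambda>m. \<delta> (0, 0, vector [0, m])"])
    fix a b :: int
    have "(0, 0, vector [0, a + b]) = (0, 0, vector [0, a]) + ((0, 0, vector [0, b]) :: G6)" by (simp add: vec2_eq_iff)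
    then show "\<delta> (0, 0, vector [0, a + b]) = \<delta> (0, 0, vector [0, a]) + \<delta> (0, 0, vector [0, b])" by (simp only: add)
  qed (simp add: \<delta>_def eq)
  have z: "(vector [0, 0] :: bit ^ 2) = 0" by (simp add: vec2_eq_iff)
  have k0: "\<delta> (c, 0, 0) = 0" and k1: "\<delta> (0, vector [c, 0], 0) = 0" and k2: "\<delta> (0, vector [0, c], 0) = 0" for c :: bit
    using 0 by (cases c; simp add: \<delta>_def eq z zero_prod_def)+
  have "s = (k0, 0, 0) + ((0, vector [k $ 1, 0], 0) + ((0, vector [0, k $ 2], 0) + ((0, 0, vector [n $ 1, 0]) + (0, 0, vector [0, n $ 2]))))"
    unfolding s by (simp add: vec2_eq_iff)
  then have "\<delta> s = 0" by (simp only: add k0 k1 k2 n1 n2) simp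
  then show "\<phi> s = \<psi> s" by (simp add: \<delta>_def)
qed

definition zm :: "int \<Rightarrow> 'h::ab_group_add \<Rightarrow> 'h" where
  "zm m x = x [^]\<^bsub>plus_group\<^esub> m"

lemma zm_add: "zm (m + n) x = zm m x + zm n x" and zm_1: "zm 1 x = x"
  for x :: "'h::ab_group_add"
proof -
  interpret group "plus_group :: 'h monoid" by (rule group_plus_group)
  have x: "x \<in> carrier plus_group" by (simp add: plus_group_def)
  show "zm (m + n) x = zm m x + zm n x" using int_pow_mult[OF x, of m n] by (simp add: zm_def plus_group_def)
  show "zm 1 x = x" using int_pow_1[OF x] by (simp add: zm_def)
qed

lemma zm_0: "zm 0 x = 0" and zm_neg_1: "zm (- 1) x = - (x :: 'h::ab_group_add)"
proof -
  show 0: "zm 0 x = 0" using zm_add[of 0 0 x] by simp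
  show "zm (- 1) x = - x" using zm_add[of "- 1" 1 x] by (simp add: zm_1 0 eq_neg_iff_add_eq_0)
qed

text \<open>The relations between degrees require distinct torsion parts; a third element, avoiding
  two given ones, lets relations with equal torsion parts be compared.\<close>

lemma ex_other_bit2: "\<exists>k :: bit ^ 2. k \<noteq> k1 \<and> k \<noteq> k2"
proof (intro exI conjI notI)
  assume "vector [k1 $ 1 + 1, k2 $ 2 + 1] = k1"
  then have "k1 $ 1 + 1 = k1 $ 1" by (simp add: vec2_eq_iff)
  then show False by simp
next
  assume "vector [k1 $ 1 + 1, k2 $ 2 + 1] = k2"
  then have "k2 $ 2 + 1 = k2 $ 2" by (simp add: vec2_eq_iff)
  then show False by simp
qed

lemma bit_triple_self: "g + g = 0" "g + (g + h) = h" for g h :: "bit \<times> (bit ^ 2)"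
  by (simp_all add: prod_eq_iff vec2_eq_iff)

context E6
begin

section \<open>Gradings whose components lie in components of Gamma_6\<close>

context
  fixes A' :: "'h::ab_group_add \<Rightarrow> 'a elt set"
  assumes A': "grading elt_scale L br A'" and ref: "\<And>V. V \<in> comps A' \<Longrightarrow> \<exists>W\<in>comps Gam. V \<subseteq> W"
begin

text \<open>Each nonzero piece of \<open>x\<close> for \<open>A'\<close> lies in some component of
  \<open>Gam\<close>. Collecting the pieces by these components and comparing with \<open>x\<close>
  itself, which is homogeneous of degree \<open>s\<close>, leaves no piece outside
  \<open>Gam s\<close>.\<close>

lemma homogeneous_refinement:
  assumes x: "x \<in> Gam s"
  shows "\<exists>S y. finite S \<and> (\<forall>g\<in>S. y g \<in> A' g \<and> y g \<in> Gam s \<and> y g \<noteq> 0) \<and> x = sum y S"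
proof -
  have xL: "x \<in> L" using gradingD(2)[OF Gam_grading] x by blast
  obtain S0 y where y: "finite S0" "\<And>g. y g \<in> A' g" "x = sum y S0"
    using grading_decomp[OF A' xL] by metis
  define S where "S = {g \<in> S0. y g \<noteq> 0}"
  have S: "finite S" "x = sum y S"
    using y by (auto simp: S_def intro!: sum.mono_neutral_right)
  have "\<exists>t. A' g \<subseteq> Gam t" if "g \<in> S" for g
  proof -
    have "A' g \<in> comps A'" using that y(2)[of g] by (auto simp: S_def comps_def supp_def)
    then obtain W where "W \<in> comps Gam" "A' g \<subseteq> W" using ref by blast
    then show ?thesis unfolding comps_def by blast
  qed
  then obtain \<tau> where \<tau>: "\<And>g. g \<in> S \<Longrightarrow> A' g \<subseteq> Gam (\<tau> g)" by metis
  define T where "T = insert s (\<tau> ` S)"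
  \<comment> \<open>The part of the decomposition lying in \<open>Gam t\<close>, minus
    \<open>x\<close> when \<open>t = s\<close>: a homogeneous family for \<open>Gam\<close> with sum
    0.\<close>
  define z where "z t = (\<Sum>g\<in>{g \<in> S. \<tau> g = t}. y g) - (if t = s then x else 0)" for t
  have fT: "finite T" by (simp add: T_def S)
  have "z t \<in> Gam t" for t
  proof -
    have "(\<Sum>g\<in>{g \<in> S. \<tau> g = t}. y g) \<in> Gam t"
      by (rule subspace_sum[OF gradingD(1)[OF Gam_grading]]) (use \<tau> y(2) in blast)
    moreover have "(if t = s then x else 0) \<in> Gam t" using x subspace_0[OF gradingD(1)[OF Gam_grading]] by simp
    ultimately show ?thesis unfolding z_def by (rule subspace_diff[OF gradingD(1)[OF Gam_grading]])
  qed
  moreover have "sum z T = 0"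
  proof -
    have "(\<Sum>t\<in>T. \<Sum>g\<in>{g \<in> S. \<tau> g = t}. y g) = sum y S" by (rule sum.group[OF S(1) fT]) (auto simp: T_def)
    moreover have "(\<Sum>t\<in>T. if t = s then x else 0) = x" using fT by (simp add: T_def)
    moreover have "sum z T = (\<Sum>t\<in>T. \<Sum>g\<in>{g \<in> S. \<tau> g = t}. y g) - (\<Sum>t\<in>T. if t = s then x else 0)"
      unfolding sum_subtractf[symmetric] by (rule sum.cong) (simp_all only: z_def)
    ultimately show ?thesis using S(2) by (simp only: diff_self)
  qed
  ultimately have z0: "z t = 0" if "t \<in> T" for t using Gam_indep[OF fT _ _ that, of z] by blast
  have "\<tau> g = s" if g: "g \<in> S" for g
  proof (rule ccontr)
    assume "\<tau> g \<noteq> s"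
    then have "(\<Sum>g'\<in>{g' \<in> S. \<tau> g' = \<tau> g}. y g') = 0" using z0[of "\<tau> g"] g by (simp add: z_def T_def)
    then have "y g = 0" using grading_indep[OF A', of "{g' \<in> S. \<tau> g' = \<tau> g}" y g] S(1) y(2) g by simp
    then show False using g by (simp add: S_def)
  qed
  then have "y g \<in> Gam s" if "g \<in> S" for g using \<tau>[OF that] y(2)[of g] that by auto
  then have "\<forall>g\<in>S. y g \<in> A' g \<and> y g \<in> Gam s \<and> y g \<noteq> 0" using y(2) by (simp add: S_def)
  then show ?thesis using S by blast
qed

lemma common_degree:
  assumes "x \<in> A' g" "x \<in> A' h" "x \<noteq> 0"
  shows "g = h"
proof (rule ccontr)
  assume gh: "g \<noteq> h"
  have "- x \<in> A' h" using subspace_neg[OF gradingD(1)[OF A']] assms(2) by blast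
  then have "(if i = g then x else - x) \<in> A' i" if "i \<in> {g, h}" for i using that assms(1) gh by auto
  moreover have "(\<Sum>i\<in>{g, h}. if i = g then x else - x) = 0" using gh by simp
  ultimately have "(if g = g then x else - x) = 0" by (rule grading_indep[OF A', rotated]) simp_all
  then have "x = 0" by simp
  then show False using assms(3) by simp
qed

text \<open>One nonzero homogeneous piece inside the component spans it, as the component is a line.
  In torsion degree, where components need not be lines, another argument is required.\<close>

lemma ex_line_degree:
  assumes "n \<noteq> 0" "(k0, k, n) \<in> supp Gam"
  shows "\<exists>g. Gam (k0, k, n) \<subseteq> A' g"
proof -
  have "0 \<in> Gam (k0, k, n)" by (rule subspace_0[OF gradingD(1)[OF Gam_grading]])
  then obtain x where x: "x \<in> Gam (k0, k, n)" "x \<noteq> 0" using assms(2) by (auto simp: supp_def)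
  obtain S y where "finite S" "\<forall>g\<in>S. y g \<in> A' g \<and> y g \<in> Gam (k0, k, n) \<and> y g \<noteq> 0" "x = sum y S"
    using homogeneous_refinement[OF x(1)] by blast
  then have y: "finite S" "\<And>g. g \<in> S \<Longrightarrow> y g \<in> A' g" "\<And>g. g \<in> S \<Longrightarrow> y g \<in> Gam (k0, k, n)"
    "\<And>g. g \<in> S \<Longrightarrow> y g \<noteq> 0" "x = sum y S" by simp_all
  then obtain g where g: "g \<in> S" using x(2) by fastforce
  have "z \<in> A' g" if z: "z \<in> Gam (k0, k, n)" for z
  proof -
    obtain c where "z = elt_scale c (y g)" using Gam_line[OF assms(1)] z y(3,4)[OF g] unfolding line_def by blast
    then show ?thesis using subspace_scale[OF gradingD(1)[OF A'] y(2)[OF g]] by simp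
  qed
  then show ?thesis by blast
qed

definition deg :: "G6 \<Rightarrow> 'h" where "deg s = (SOME g. Gam s \<subseteq> A' g)"

lemma deg: "n \<noteq> 0 \<Longrightarrow> (k0, k, n) \<in> supp Gam \<Longrightarrow> Gam (k0, k, n) \<subseteq> A' (deg (k0, k, n))"
  unfolding deg_def using someI_ex[OF ex_line_degree] .

lemma deg_add:
  assumes nz: "nz (k0, k, n) (k0', k', n')" and n: "n \<noteq> 0" "n' \<noteq> 0" "n + n' \<noteq> 0"
  shows "deg (k0 + k0', k + k', n + n') = deg (k0, k, n) + deg (k0', k', n')"
proof -
  obtain x y where xy: "x \<in> Gam (k0, k, n)" "y \<in> Gam (k0', k', n')" "br x y \<noteq> 0" using nz by (auto simp: nz_def)
  then have "x \<in> L" "y \<in> L" using gradingD(2)[OF Gam_grading] by blast+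
  then have 0: "x \<noteq> 0" "y \<noteq> 0" using xy(3) by auto
  have b: "br x y \<in> Gam (k0 + k0', k + k', n + n')" using gradingD(3)[OF Gam_grading xy(1,2)] by simp
  have s: "(k0, k, n) \<in> supp Gam" "(k0', k', n') \<in> supp Gam" "(k0 + k0', k + k', n + n') \<in> supp Gam"
    using xy b 0 by (auto simp: supp_def)
  have "br x y \<in> A' (deg (k0, k, n) + deg (k0', k', n'))"
    using gradingD(3)[OF A'] deg[OF n(1) s(1)] deg[OF n(2) s(2)] xy by blast
  then show ?thesis using common_degree[OF _ _ xy(3)] deg[OF n(3) s(3)] b by blast
qed

text \<open>Write \<open>a\<close>, \<open>b\<close>, \<open>a'\<close>, \<open>b'\<close>, \<open>c\<close> for the degrees of the lines over \<open>e\<^sub>1, e\<^sub>2, -e\<^sub>1, -e\<^sub>2, e\<^sub>1 + e\<^sub>2\<close>, as functions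
  of the torsion part. The nonzero brackets give \<open>a g + b g' + a' g'' = b (g + g' + g'')\<close> whenever \<open>g\<close>, \<open>g'\<close>
  differ in \<open>Z\<^sub>2\<^sup>2\<close>, which makes \<open>b (g + h) - b g\<close> independent of \<open>g\<close> and additive in \<open>h\<close>.\<close>

lemma ex_degree_map: "\<exists>\<phi>. Modules.additive \<phi> \<and> (\<forall>s. Gam s \<subseteq> A' (\<phi> s))"
proof -
  define a where "a g = deg (fst g, snd g, vector [1, 0])" for g
  define a' where "a' g = deg (fst g, snd g, vector [- 1, 0])" for g
  define b where "b g = deg (fst g, snd g, vector [0, 1])" for g
  define b' where "b' g = deg (fst g, snd g, vector [0, - 1])" for g
  define c where "c g = deg (fst g, snd g, vector [1, 1])" for g
  have v0: "vector [x, y] \<noteq> (0 :: int ^ 2)" if "x \<noteq> 0 \<or> y \<noteq> 0" for x y using that by (simp add: vec2_eq_iff)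
  have va: "vector [x, y] + vector [x', y'] = (vector [x + x', y + y'] :: int ^ 2)" for x y x' y' by (simp add: vec2_eq_iff)
  have U1: "deg (k0 + k0', k + k', vector [s1, s2]) = deg (k0, k, vector [s1, 0]) + deg (k0', k', vector [0, s2])"
    if "k \<noteq> k'" "\<bar>s1\<bar> = 1" "\<bar>s2\<bar> = 1" for k0 k0' k k' s1 s2
    using deg_add[OF nz_unit[OF that]] that unfolding va by (simp add: v0)
  have c_ab: "c (g + g') = a g + b g'" if "snd g \<noteq> snd g'" for g g'
    using U1[OF that, of 1 1] by (simp add: a_def b_def c_def)
  have b_ca: "b (h + g) = c h + a' g" and a_cb: "a (h + g) = c h + b' g" if "snd h \<noteq> 0" for h g
    using deg_add[OF nz_corner(1)[OF that]] deg_add[OF nz_corner(2)[OF that]] unfolding va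
    by (simp_all add: a_def b_def c_def a'_def b'_def v0)
  have neq: "snd (g + g') \<noteq> 0" if "snd g \<noteq> snd g'" for g g' :: "bit \<times> (bit ^ 2)"
  proof
    assume "snd (g + g') = 0"
    then have "snd g + (snd g + snd g') = snd g" by simp
    then show False using that by (simp add: vec2_eq_iff)
  qed
  have b_aba: "b (g + g' + g'') = a g + b g' + a' g''" and a_abb: "a (g + g' + g'') = a g + b g' + b' g''"
    if "snd g \<noteq> snd g'" for g g' g''
    using b_ca[OF neq[OF that]] a_cb[OF neq[OF that]] c_ab[OF that] by simp_all
  have ex: "\<exists>g :: bit \<times> (bit ^ 2). snd g \<noteq> k1 \<and> snd g \<noteq> k2" for k1 k2 using ex_other_bit2 by auto
  have a'_neg: "a' g = - a g" for g
  proof -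
    \<comment> \<open>With \<open>g'' = g\<close> the torsion parts cancel and the relation for
      \<open>b\<close> has \<open>b g'\<close> on both sides.\<close>
    obtain g' :: "bit \<times> (bit ^ 2)" where g': "snd g' \<noteq> snd g" using ex by metis
    have "g + g' + g = g'" by (simp add: ac_simps bit_triple_self)
    then have X: "b g' = a g + b g' + a' g" using b_aba[OF g'[symmetric], of g] by (simp only:)
    have "a' g = (a g + b g' + a' g) - b g' - a g" by (simp add: algebra_simps)
    also have "\<dots> = - a g" unfolding X[symmetric] by simp
    finally show ?thesis .
  qed
  have b'_neg: "b' g = - b g" for g
  proof -
    obtain g' :: "bit \<times> (bit ^ 2)" where g': "snd g' \<noteq> snd g" using ex by metis
    have "g' + g + g = g'" by (simp add: ac_simps bit_triple_self)
    then have X: "a g' = a g' + b g + b' g" using a_abb[OF g', of g] by (simp only:)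
    have "b' g = (a g' + b g + b' g) - a g' - b g" by (simp add: algebra_simps)
    also have "\<dots> = - b g" unfolding X[symmetric] by simp
    finally show ?thesis .
  qed
  define \<delta> where "\<delta> h = b h - b 0" for h
  \<comment> \<open>The right side does not mention \<open>g'\<close> and the left side does not
    mention \<open>g\<close>; chaining two instances through a common third element makes the
    difference independent of its base point.\<close>
  have ab: "b (g' + h) - b g' = a g - a (g + h)" if "snd g \<noteq> snd g'" for g g' h
  proof -
    have "g + g' + (g + h) = g' + h" by (simp add: ac_simps bit_triple_self)
    then have "b (g' + h) = a g + b g' + a' (g + h)" using b_aba[OF that, of "g + h"] by (simp only:)
    then show ?thesis by (simp add: a'_neg)
  qed
  have b_\<delta>: "b (g + h) = b g + \<delta> h" for g h
  proof -
    obtain g' :: "bit \<times> (bit ^ 2)" where g': "snd g' \<noteq> snd g" "snd g' \<noteq> 0" using ex by metis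
    then have g'': "snd g' \<noteq> snd (0 :: bit \<times> (bit ^ 2))" by simp
    have e: "b (g + h) - b g = b (0 + h) - b 0" by (rule trans[OF ab[OF g'(1)] ab[OF g'', symmetric]])
    have "b (g + h) = b g + (b (g + h) - b g)" by simp
    also have "\<dots> = b g + \<delta> h" unfolding e \<delta>_def by simp
    finally show ?thesis .
  qed
  have \<delta>_add: "\<delta> (h + h') = \<delta> h + \<delta> h'" for h h' using b_\<delta>[of h h'] by (simp add: \<delta>_def)
  have \<delta>_0: "\<delta> 0 = 0" by (simp add: \<delta>_def)
  \<comment> \<open>\<open>\<delta>\<close> is additive on a group of exponent 2, so its values have
    order at most 2.\<close>
  have \<delta>_neg: "- \<delta> h = \<delta> h" for h
    using \<delta>_add[of h h] by (simp add: bit_triple_self \<delta>_0 neg_eq_iff_add_eq_0)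
  have a_\<delta>: "a h = a 0 + \<delta> h" for h
  proof -
    obtain g' :: "bit \<times> (bit ^ 2)" where g': "snd (0 :: bit \<times> (bit ^ 2)) \<noteq> snd g'" using ex by metis
    have "\<delta> h = a 0 - a h" using ab[OF g', of h] by (simp add: b_\<delta>)
    then have "a h = a 0 - \<delta> h" by simp
    also have "\<dots> = a 0 + \<delta> h" using \<delta>_neg[of h] by (simp only: diff_conv_add_uminus)
    finally show ?thesis .
  qed
  \<comment> \<open>The images of the basis: \<open>\<delta>\<close> on the torsion, and the degrees
    \<open>a 0\<close>, \<open>b 0\<close> of the lines over e_1, e_2 with trivial torsion
    part.\<close>
  define \<phi> where "\<phi> = (\<lambda>(k0, k, n :: int ^ 2). \<delta> (k0, k) + (zm (n $ 1) (a 0) + zm (n $ 2) (b 0)))"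
  have \<phi>_add: "\<phi> (s + t) = \<phi> s + \<phi> t" for s t
  proof -
    obtain k0 k n k0' k' n' where st: "s = (k0, k, n)" "t = (k0', k', n')" by (cases s; cases t) blast
    have "\<delta> (k0 + k0', k + k') = \<delta> (k0, k) + \<delta> (k0', k')" using \<delta>_add[of "(k0, k)" "(k0', k')"] by simp
    then show ?thesis unfolding st by (simp add: \<phi>_def zm_add algebra_simps)
  qed
  have unit: "deg (k0, k, vector [s, 0]) = \<phi> (k0, k, vector [s, 0])" "deg (k0, k, vector [0, s]) = \<phi> (k0, k, vector [0, s])"
    if "\<bar>s\<bar> = 1" for k0 k s
  proof -
    have ab: "a (k0, k) = a 0 + \<delta> (k0, k)" "b (k0, k) = b 0 + \<delta> (k0, k)"
      "a' (k0, k) = - a 0 + \<delta> (k0, k)" "b' (k0, k) = - b 0 + \<delta> (k0, k)"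
      using a_\<delta>[of "(k0, k)"] b_\<delta>[of 0 "(k0, k)"] \<delta>_neg[of "(k0, k)"]
      by (simp_all only: a'_neg b'_neg minus_add_distrib add_0)
    have "s = 1 \<or> s = - 1" using that by linarith
    moreover have "\<phi> (k0, k, vector [1, 0]) = \<delta> (k0, k) + a 0" "\<phi> (k0, k, vector [- 1, 0]) = \<delta> (k0, k) + - a 0"
      "\<phi> (k0, k, vector [0, 1]) = \<delta> (k0, k) + b 0" "\<phi> (k0, k, vector [0, - 1]) = \<delta> (k0, k) + - b 0"
      by (simp_all add: \<phi>_def zm_0 zm_1 zm_neg_1)
    moreover have "deg (k0, k, vector [1, 0]) = a (k0, k)" "deg (k0, k, vector [- 1, 0]) = a' (k0, k)"
      "deg (k0, k, vector [0, 1]) = b (k0, k)" "deg (k0, k, vector [0, - 1]) = b' (k0, k)"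
      by (simp_all only: a_def b_def a'_def b'_def fst_conv snd_conv)
    ultimately show "deg (k0, k, vector [s, 0]) = \<phi> (k0, k, vector [s, 0])" "deg (k0, k, vector [0, s]) = \<phi> (k0, k, vector [0, s])"
      by (elim disjE; simp only: ab add.commute)+
  qed
  have deg_\<phi>: "deg (k0, k, n) = \<phi> (k0, k, n)" if n: "n \<noteq> 0" and s: "(k0, k, n) \<in> supp Gam" for k0 k n
  proof -
    have n_eq: "n = vector [n $ 1, n $ 2]" by (simp add: vec2_eq_iff)
    consider "unit_vec n" | "corner n" "k \<noteq> 0" | "double n" "k0 = 1" "k = 0" using n s supp_Gam by blast
    then show ?thesis
    proof cases
      case 1
      then have "n $ 2 = 0 \<and> \<bar>n $ 1\<bar> = 1 \<or> n $ 1 = 0 \<and> \<bar>n $ 2\<bar> = 1" unfolding unit_vec_def by arith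
      then show ?thesis using unit n_eq by metis
    next
      case 2
      then have s: "\<bar>n $ 1\<bar> = 1" "\<bar>n $ 2\<bar> = 1" by (simp_all add: corner_def)
      have "deg (k0 + 0, k + 0, vector [n $ 1, n $ 2]) = \<phi> (k0, k, vector [n $ 1, 0]) + \<phi> (0, 0, vector [0, n $ 2])"
        unfolding U1[OF 2(2) s] by (simp only: unit s)
      also have "\<dots> = \<phi> (k0, k, vector [n $ 1, n $ 2])" unfolding \<phi>_add[symmetric] by (simp add: va)
      finally show ?thesis using n_eq by simp
    next
      case 3
      have "n $ 1 = 0 \<and> (n $ 2 = 2 \<or> n $ 2 = - 2) \<or> n $ 2 = 0 \<and> (n $ 1 = 2 \<or> n $ 1 = - 2)"
        using 3(1) unfolding double_def corner_def by arith
      then obtain s where s: "\<bar>s\<bar> = 1" "n = vector [2 * s, 0] \<or> n = vector [0, 2 * s]"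
        using that[of 1] that[of "- 1"] by (elim disjE conjE) (auto simp: vec2_eq_iff)
      have s0: "s \<noteq> 0" using s(1) by auto
      \<comment> \<open>Bracketing the line over 2 s e_i with one over -s e_i lands over s e_i,
        whose degree is known; cancelling gives the remaining degree.\<close>
      have d: "deg (1, 0, vector [s, 0]) = deg (1, 0, vector [2 * s, 0]) + deg (0, 0, vector [- s, 0])"
        "deg (1, 0, vector [0, s]) = deg (1, 0, vector [0, 2 * s]) + deg (0, 0, vector [0, - s])"
        using deg_add[OF nz_double(1)[OF s(1), of 0 0]] deg_add[OF nz_double(2)[OF s(1), of 0 0]] s0
        unfolding va by (simp_all add: v0)
      have p: "\<phi> (1, 0, vector [s, 0]) = \<phi> (1, 0, vector [2 * s, 0]) + \<phi> (0, 0, vector [- s, 0])"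
        "\<phi> (1, 0, vector [0, s]) = \<phi> (1, 0, vector [0, 2 * s]) + \<phi> (0, 0, vector [0, - s])"
        unfolding \<phi>_add[symmetric] by (simp_all add: va)
      have ms: "\<bar>- s\<bar> = 1" using s(1) by simp
      have "deg (1, 0, vector [2 * s, 0]) = \<phi> (1, 0, vector [2 * s, 0])"
        by (rule add_right_imp_eq[of _ "deg (0, 0, vector [- s, 0])"], rule trans[OF d(1)[symmetric]])
          (simp only: unit(1)[OF s(1)] p(1) unit(1)[OF ms])
      moreover have "deg (1, 0, vector [0, 2 * s]) = \<phi> (1, 0, vector [0, 2 * s])"
        by (rule add_right_imp_eq[of _ "deg (0, 0, vector [0, - s])"], rule trans[OF d(2)[symmetric]])
          (simp only: unit(2)[OF s(1)] p(2) unit(2)[OF ms])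
      ultimately show ?thesis using s(2) 3(2,3) by blast
    qed
  qed
  have "Gam s \<subseteq> A' (\<phi> s)" for s
  proof
    fix x assume x: "x \<in> Gam s"
    obtain k0 k n where s: "s = (k0, k, n)" by (cases s)
    show "x \<in> A' (\<phi> s)"
    proof (cases "n = 0")
      case False
      show ?thesis
      proof (cases "s \<in> supp Gam")
        case True
        then show ?thesis using deg[OF False] deg_\<phi>[OF False] x unfolding s by auto
      next
        case notin: False
        then have "x = 0" using x by (auto simp: supp_def)
        then show ?thesis using subspace_0[OF gradingD(1)[OF A']] by simp
      qed
    next
      case True
      obtain S y where "finite S" "\<forall>g\<in>S. y g \<in> A' g \<and> y g \<in> Gam s \<and> y g \<noteq> 0" "x = sum y S"
        using homogeneous_refinement[OF x] by blast
      then have y: "finite S" "\<And>g. g \<in> S \<Longrightarrow> y g \<in> A' g" "\<And>g. g \<in> S \<Longrightarrow> y g \<in> Gam s"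
        "\<And>g. g \<in> S \<Longrightarrow> y g \<noteq> 0" "x = sum y S" by simp_all
      \<comment> \<open>By \<open>centralizer\<close> some line \<open>w\<close> of nontorsion
        degree does not commute with \<open>y g\<close>. The degrees of \<open>w\<close> and of the
        bracket are known, and they force the degree of \<open>y g\<close>.\<close>
      have "g = \<phi> s" if g: "g \<in> S" for g
      proof -
        obtain k0' k' n' w where w: "n' \<noteq> 0" "w \<in> Gam (k0', k', n')" "br (y g) w \<noteq> 0"
          using centralizer[of "y g" k0 k] y(3,4)[OF g] unfolding s True by blast
        then have "w \<in> L" "y g \<in> L" using y(3)[OF g] gradingD(2)[OF Gam_grading] by blast+
        then have "w \<noteq> 0" using w(3) by auto
        have b: "br (y g) w \<in> Gam (k0 + k0', k + k', n')"
          using gradingD(3)[OF Gam_grading y(3)[OF g] w(2)] unfolding s True by simp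
        have sup: "(k0', k', n') \<in> supp Gam" "(k0 + k0', k + k', n') \<in> supp Gam"
          using w b \<open>w \<noteq> 0\<close> by (auto simp: supp_def)
        have "br (y g) w \<in> A' (\<phi> (k0 + k0', k + k', n'))" using b deg[OF w(1) sup(2)] deg_\<phi>[OF w(1) sup(2)] by auto
        moreover have "w \<in> A' (\<phi> (k0', k', n'))" using w(2) deg[OF w(1) sup(1)] deg_\<phi>[OF w(1) sup(1)] by auto
        then have "br (y g) w \<in> A' (g + \<phi> (k0', k', n'))" using gradingD(3)[OF A' y(2)[OF g]] by blast
        ultimately have "g + \<phi> (k0', k', n') = \<phi> (k0 + k0', k + k', n')" using common_degree w(3) by blast
        also have "(k0 + k0', k + k', n') = s + (k0', k', n')" unfolding s True by simp
        finally show ?thesis unfolding \<phi>_add by simp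
      qed
      then show ?thesis unfolding y(5) using y(2) by (intro subspace_sum[OF gradingD(1)[OF A']]) auto
    qed
  qed
  moreover have "Modules.additive \<phi>" using \<phi>_add by (rule Modules.additive.intro)
  ultimately show ?thesis by blast
qed

end

text \<open>A proper inclusion of a component \<open>A' g\<close> in \<open>Gam s\<close> would give
  \<open>A' g\<close> inside \<open>A' (\<phi> s)\<close>, hence \<open>g = \<phi> s\<close>; but
  \<open>A' (\<phi> s)\<close> contains all of \<open>Gam s\<close>.\<close>

lemma Gam_fine: "fine_grading TYPE('h::ab_group_add) elt_scale L br Gam"
  unfolding fine_grading_def
proof (intro conjI notI)
  assume "\<exists>A' :: 'h \<Rightarrow> 'a elt set. grading elt_scale L br A' \<and> proper_refinement A' Gam"
  then obtain A' :: "'h \<Rightarrow> 'a elt set" where A': "grading elt_scale L br A'" "proper_refinement A' Gam" by blast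
  then have ref: "\<exists>W\<in>comps Gam. V \<subseteq> W" if "V \<in> comps A'" for V using that by (simp add: proper_refinement_def)
  obtain \<phi> where \<phi>: "\<And>s. Gam s \<subseteq> A' (\<phi> s)" using ex_degree_map[OF A'(1) ref] by blast
  obtain V W where VW: "V \<in> comps A'" "W \<in> comps Gam" "V \<subset> W" using A'(2) unfolding proper_refinement_def by blast
  obtain g s where "g \<in> supp A'" "V = A' g" "W = Gam s" using VW(1,2) unfolding comps_def by blast
  then have gs: "g \<in> supp A'" "A' g \<subset> Gam s" using VW(3) by simp_all
  then have "A' g \<subseteq> A' (\<phi> s)" using \<phi>[of s] by blast
  then have "g = \<phi> s" by (rule grading_inj[OF A'(1) gs(1)])
  then show False using \<phi>[of s] gs(2) by blast
qed (rule Gam_grading)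

text \<open>Components of \<open>A'\<close> are components of \<open>Gam\<close>, so the inclusion
  of \<open>Gam s\<close> in \<open>A' (\<phi> s)\<close> is an equality on the support. Uniqueness
  holds because the support contains the canonical basis of the group and degrees of nonzero
  components are unique.\<close>

lemma Gam_universal: "graded_by_universal_group TYPE('h::ab_group_add) elt_scale L br Gam"
  unfolding graded_by_universal_group_def
proof (intro conjI allI impI)
  fix A' :: "'h \<Rightarrow> 'a elt set"
  assume A': "grading elt_scale L br A' \<and> comps A' = comps Gam"
  then have ref: "\<exists>W\<in>comps Gam. V \<subseteq> W" if "V \<in> comps A'" for V using that by auto
  obtain \<phi> where \<phi>: "Modules.additive \<phi>" "\<And>s. Gam s \<subseteq> A' (\<phi> s)" using ex_degree_map[OF _ ref] A' by blast
  have eq: "A' (\<phi> s) = Gam s" if s: "s \<in> supp Gam" for s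
  proof -
    have "A' (\<phi> s) \<noteq> {0}"
      using \<phi>(2)[of s] s subspace_0[OF gradingD(1)[OF Gam_grading, of s]] by (auto simp: supp_def)
    then have "A' (\<phi> s) \<in> comps A'" by (simp add: comps_def supp_def)
    then obtain t where t: "A' (\<phi> s) = Gam t" using A' by (auto simp: comps_def)
    then have "s = t" using grading_inj[OF Gam_grading s] \<phi>(2)[of s] by simp
    then show ?thesis using t by simp
  qed
  show "\<exists>!\<phi>. Modules.additive \<phi> \<and> (\<forall>s\<in>supp Gam. A' (\<phi> s) = Gam s)"
  proof (rule ex1I[of _ \<phi>])
    show "Modules.additive \<phi> \<and> (\<forall>s\<in>supp Gam. A' (\<phi> s) = Gam s)" using \<phi>(1) eq by blast
    fix \<psi> assume \<psi>: "Modules.additive \<psi> \<and> (\<forall>s\<in>supp Gam. A' (\<psi> s) = Gam s)"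
    have on_supp: "\<psi> s = \<phi> s" if "s \<in> supp Gam" for s
    proof (rule grading_inj[of A'])
      show "grading elt_scale L br A'" using A' ..
      have e: "A' (\<psi> s) = Gam s" using \<psi> that by blast
      show "\<psi> s \<in> supp A'" using that unfolding supp_def mem_Collect_eq e .
      show "A' (\<psi> s) \<subseteq> A' (\<phi> s)" unfolding e eq[OF that] ..
    qed
    show "\<psi> = \<phi>"
    proof (rule additive_G6_eqI)
      show "\<psi> (s + t) = \<psi> s + \<psi> t" "\<phi> (s + t) = \<phi> s + \<phi> t" for s t
        using \<psi> \<phi>(1) unfolding Modules.additive_def by blast+
    qed (rule on_supp, simp add: supp_Gam unit_vec_def)+
  qed
qed (rule Gam_grading)

end

section \<open>The matrices of the Weyl group\<close>

lemma matrix_of_gaut: "matrix_of_aut (gaut p q v A M) = ((1, p, q), (0, A, \<chi> i j. v $ i), (0, 0, M))"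
  by (simp add: matrix_of_aut_def Let_def gaut_def dot_def red_def parity_sum_def vec_eq_iff forall_2
      matrix_vector_mult_def sum_2 axis_def)

lemma finite_bit2: "finite (UNIV :: (bit ^ 2) set)"
proof (rule finite_subset)
  show "(UNIV :: (bit ^ 2) set) \<subseteq> {vector [0, 0], vector [0, 1], vector [1, 0], vector [1, 1]}"
  proof
    fix x :: "bit ^ 2"
    show "x \<in> {vector [0, 0], vector [0, 1], vector [1, 0], vector [1, 1]}"
      by (cases "x $ 1"; cases "x $ 2") (simp_all add: vec2_eq_iff)
  qed
qed simp

lemma mv_axis:
  fixes x y :: "'x::comm_semiring_1 ^ 2"
  shows "(vector [vector [x $ 1, y $ 1], vector [x $ 2, y $ 2]] :: 'x ^ 2 ^ 2) *v vector [1, 0] = x"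
    "(vector [vector [x $ 1, y $ 1], vector [x $ 2, y $ 2]] :: 'x ^ 2 ^ 2) *v vector [0, 1] = y"
  by (simp_all add: vec2_eq_iff matrix_vector_mult_def sum_2)

lemma bit2_add_self: "(x :: bit ^ 2) + x = 0" "x + y + (x + y) = (0 :: bit ^ 2)"
  by (simp_all add: vec2_eq_iff)

definition gauts :: "(G6 \<Rightarrow> G6) set" where
  "gauts = {gaut p q v A M | p q v A M. A \<in> carrier GL_group \<and> M \<in> B_set}"

context E6
begin

lemma induced_auts_supp:
  assumes "\<alpha> \<in> induced_auts elt_scale L br Gam" "s \<in> supp Gam"
  shows "\<alpha> s \<in> supp Gam"
proof -
  obtain f where f: "f \<in> lie_auts elt_scale L br" "induces Gam f \<alpha>"
    using assms(1) by (auto simp: induced_auts_def grading_auts_def)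
  have "f ` Gam s = Gam (\<alpha> s)" using f(2) assms(2) unfolding induces_def by blast
  then show ?thesis using image_eq_0_iff[OF f(1) gradingD(1,2)[OF Gam_grading], of s] assms(2) by (simp add: supp_def)
qed

text \<open>Two features of the support decide. Over twice a unit vector the torsion part is (1; 0),
  which fixes (1, 0, 0) and sends unit vectors to unit vectors. Over a corner exactly the torsion
  parts with k \<noteq> 0 occur, which forces the images of e_1 and e_2 to have the same part in
  Z_2^2.\<close>

lemma induced_auts_gaut:
  assumes \<alpha>: "\<alpha> \<in> induced_auts elt_scale L br Gam"
  shows "\<exists>p q v A M. A \<in> carrier GL_group \<and> M \<in> B_set \<and> \<alpha> = gaut p q v A M"
proof -
  have add: "\<alpha> (s + t) = \<alpha> s + \<alpha> t" for s t
    using \<alpha> unfolding induced_auts_def AutoGroup_plus Modules.additive_def by blast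
  have "bij \<alpha>" using \<alpha> by (simp add: induced_auts_def AutoGroup_plus)
  then have inj: "s = t" if "\<alpha> s = \<alpha> t" for s t using that by (simp add: bij_def inj_eq)
  note supp = induced_auts_supp[OF \<alpha>]
  have \<alpha>0: "\<alpha> 0 = 0" using add[of 0 0] by simp
  have tors: "snd (snd (\<alpha> (k0, k, 0))) = 0" for k0 k
  proof -
    have "\<alpha> (k0, k, 0) + \<alpha> (k0, k, 0) = \<alpha> 0"
      unfolding add[symmetric] by (rule arg_cong[of _ _ \<alpha>]) (simp add: bit2_add_self zero_prod_def)
    then have "snd (snd (\<alpha> (k0, k, 0) + \<alpha> (k0, k, 0))) = 0" by (simp add: \<alpha>0)
    then show ?thesis by (simp add: vec2_eq_iff)
  qed
  have free: "n = 0" if n: "snd (snd (\<alpha> (0, 0, n))) = 0" for n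
  proof -
    have "\<alpha> (0, 0, n + n) = \<alpha> (0, 0, n) + \<alpha> (0, 0, n)" using add[of "(0, 0, n)" "(0, 0, n)"] by simp
    also have "\<dots> = 0" using n by (simp add: prod_eq_iff bit2_add_self)
    finally have "(0, 0, n + n) = (0 :: G6)" using inj[of "(0, 0, n + n)" 0] \<alpha>0 by simp
    then show ?thesis by (simp add: zero_prod_def vec2_eq_iff)
  qed
  obtain u0 u where u: "\<alpha> (1, 0, 0) = (u0, u, 0)" using tors[of 1 0] by (metis prod.collapse)
  \<comment> \<open>Consider the image of (1, 0, 2 n), which lies in the support. Doubling kills the
    torsion of the image of (0, 0, n), so the image is (u0, u, 2 m) with m \<noteq> 0, and among
    nontorsion degrees only the double ones have even coordinates.\<close>
  have unit: "unit_vec m \<and> u0 = 1 \<and> u = 0" if n: "unit_vec n" and m: "\<alpha> (0, 0, n) = (q, v, m)" for n q v m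
  proof -
    have n0: "n \<noteq> 0" using n by (auto simp: unit_vec_def)
    have m0: "m \<noteq> 0" using free[of n] n0 m by auto
    have "double (n + n)" using n unfolding unit_vec_def double_def corner_def vector_add_component by arith
    then have s: "(1, 0, n + n) \<in> supp Gam" by (simp add: supp_Gam)
    have "\<alpha> (1, 0, n + n) = \<alpha> (1, 0, 0) + (\<alpha> (0, 0, n) + \<alpha> (0, 0, n))" unfolding add[symmetric] by simp
    also have "\<dots> = (u0, u, m + m)" by (simp add: u m bit2_add_self)
    finally have "(u0, u, m + m) \<in> supp Gam" using supp[OF s] by simp
    moreover have "m + m \<noteq> 0" using m0 by (simp add: vec2_eq_iff)
    moreover have "\<not> unit_vec (m + m)" "\<not> corner (m + m)"
      unfolding unit_vec_def corner_def vector_add_component by arith+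
    ultimately have "double (m + m) \<and> u0 = 1 \<and> u = 0" unfolding supp_Gam by blast
    moreover have "unit_vec m" if "double (m + m)"
      using that unfolding unit_vec_def double_def corner_def vector_add_component by arith
    ultimately show ?thesis by blast
  qed
  obtain q1 v1 m where 1: "\<alpha> (0, 0, vector [1, 0]) = (q1, v1, m)" by (metis prod_cases3)
  obtain q2 v2 m' where 2: "\<alpha> (0, 0, vector [0, 1]) = (q2, v2, m')" by (metis prod_cases3)
  have units: "unit_vec m" "unit_vec m'" and u1: "u0 = 1" "u = 0"
    using unit[OF _ 1] unit[OF _ 2] by (simp_all add: unit_vec_def)
  have e: "(0, 0, vector [1, 1]) = (0, 0, vector [1, 0]) + ((0, 0, vector [0, 1]) :: G6)"
    "(0, 0, vector [1, 0]) = (0, 0, vector [0, 1]) + ((0, 0, vector [1, - 1]) :: G6)" by (simp_all add: vec2_eq_iff)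
  have add12: "\<alpha> (0, 0, vector [1, 1]) = (q1 + q2, v1 + v2, m + m')" unfolding e(1) add 1 2 by simp
  have add12': "\<alpha> (0, 0, vector [1, 0]) = \<alpha> (0, 0, vector [0, 1]) + \<alpha> (0, 0, vector [1, - 1])"
    by (subst e(2)) (rule add)
  have mm': "m \<noteq> m'" "m \<noteq> - m'"
  proof -
    show "m \<noteq> m'"
    proof
      assume "m = m'"
      then have "snd (snd (\<alpha> (0, 0, vector [1, - 1]))) = 0" using add12' 1 2 by (cases "\<alpha> (0, 0, vector [1, - 1])") simp
      from free[OF this] show False by (simp add: vec2_eq_iff)
    qed
    show "m \<noteq> - m'"
    proof
      assume "m = - m'"
      then have "snd (snd (\<alpha> (0, 0, vector [1, 1]))) = 0" using add12 by simp
      from free[OF this] show False by (simp add: vec2_eq_iff)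
    qed
  qed
  let ?M = "vector [vector [m $ 1, m' $ 1], vector [m $ 2, m' $ 2]] :: int ^ 2 ^ 2"
  have "m $ 2 = 0 \<and> m' $ 1 = 0 \<and> (m $ 1 = 1 \<or> m $ 1 = - 1) \<and> (m' $ 2 = 1 \<or> m' $ 2 = - 1) \<or>
      m $ 1 = 0 \<and> m' $ 2 = 0 \<and> (m $ 2 = 1 \<or> m $ 2 = - 1) \<and> (m' $ 1 = 1 \<or> m' $ 1 = - 1)"
  proof -
    have "n $ 2 = 0 \<and> (n $ 1 = 1 \<or> n $ 1 = - 1) \<or> n $ 1 = 0 \<and> (n $ 2 = 1 \<or> n $ 2 = - 1)" if "unit_vec n" for n
      using that unfolding unit_vec_def by arith
    from this[OF units(1)] this[OF units(2)] mm' show ?thesis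
      by (elim disjE conjE) (simp_all add: vec2_eq_iff)
  qed
  then consider "m $ 2 = 0" "m' $ 1 = 0" "m $ 1 = 1 \<or> m $ 1 = - 1" "m' $ 2 = 1 \<or> m' $ 2 = - 1"
    | "m $ 1 = 0" "m' $ 2 = 0" "m $ 2 = 1 \<or> m $ 2 = - 1" "m' $ 1 = 1 \<or> m' $ 1 = - 1" by blast
  then have "?M \<in> B_set \<and> \<bar>m $ 1 + m' $ 1\<bar> = 1 \<and> \<bar>m $ 2 + m' $ 2\<bar> = 1"
  proof cases
    case 1
    then have "\<bar>m $ 1 + m' $ 1\<bar> = 1" "\<bar>m $ 2 + m' $ 2\<bar> = 1" by linarith+
    moreover have "?M \<in> B_set" unfolding B_set_eq signed_perm_def 1(1,2) using 1(3,4) by blast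
    ultimately show ?thesis by blast
  next
    case 2
    then have "\<bar>m $ 1 + m' $ 1\<bar> = 1" "\<bar>m $ 2 + m' $ 2\<bar> = 1" by linarith+
    moreover have "?M \<in> B_set" unfolding B_set_eq signed_perm_def 2(1,2) using 2(3,4) by blast
    ultimately show ?thesis by blast
  qed
  then have M: "?M \<in> B_set" and corn: "corner (m + m')" by (simp_all add: corner_def)
  define a where "a k = fst (snd (\<alpha> (0, k, 0)))" for k
  have a_add: "a (k + k') = a k + a k'" for k k' using add[of "(0, k, 0)" "(0, k', 0)"] by (simp add: a_def)
  have a_inj: "inj a"
  proof (rule injI)
    fix k k' assume "a k = a k'"
    then have "a (k + k') = 0" by (simp add: a_add bit2_add_self)
    then obtain c where c: "\<alpha> (0, k + k', 0) = (c, 0, 0)" using tors[of 0 "k + k'"] unfolding a_def by (metis prod.collapse)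
    \<comment> \<open>The elements (c, 0, 0) are already their own images, so injectivity of
      \<open>\<alpha>\<close> excludes that another torsion element is sent there.\<close>
    have "\<alpha> (c, 0, 0) = (c, 0, 0)" using u u1 \<alpha>0 by (cases c) (simp_all add: zero_prod_def)
    then have "(0, k + k', 0) = (c, 0, 0 :: int ^ 2)" using c inj by metis
    then have "k + (k + k') = k" by simp
    then show "k = k'" by (simp add: vec2_eq_iff)
  qed
  have v: "v1 = v2"
  proof (rule ccontr)
    assume ne: "v1 \<noteq> v2"
    \<comment> \<open>If \<open>v1\<close> and \<open>v2\<close> differed, some k \<noteq> 0 would
      be sent to \<open>v1 + v2\<close>; then (0, k, (1, 1)), which is in the support, would go to a
      corner with torsion part 0 in Z_2^2, which is not.\<close>
    have "surj a" by (rule finite_UNIV_inj_surj[OF finite_bit2 a_inj])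
    then obtain k where k: "v1 + v2 = a k" by (rule surjE)
    have "k \<noteq> 0"
    proof
      assume "k = 0"
      then have "a k = 0" using a_add[of 0 0] by simp
      then have "v1 + (v1 + v2) = v1" using k by simp
      then show False using ne by (simp add: vec2_eq_iff)
    qed
    moreover have "corner (vector [1, 1])" by (simp add: corner_def)
    ultimately have "(0, k, vector [1, 1]) \<in> supp Gam" by (simp add: supp_Gam)
    then have "\<alpha> ((0, k, 0) + (0, 0, vector [1, 1])) \<in> supp Gam" using supp by simp
    moreover obtain c where "\<alpha> (0, k, 0) = (c, v1 + v2, 0)" using k tors[of 0 k] unfolding a_def by (metis prod.collapse)
    ultimately have "(c + (q1 + q2), 0, m + m') \<in> supp Gam" unfolding add add12 by (simp add: bit2_add_self)
    then show False using corn unfolding supp_Gam by (auto simp: corner_def unit_vec_def double_def vec2_eq_iff)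
  qed
  obtain p1 where p1: "\<alpha> (0, vector [1, 0], 0) = (p1, a (vector [1, 0]), 0)" using tors unfolding a_def by (metis prod.collapse)
  obtain p2 where p2: "\<alpha> (0, vector [0, 1], 0) = (p2, a (vector [0, 1]), 0)" using tors unfolding a_def by (metis prod.collapse)
  let ?A = "vector [vector [a (vector [1, 0]) $ 1, a (vector [0, 1]) $ 1], vector [a (vector [1, 0]) $ 2, a (vector [0, 1]) $ 2]] :: bit ^ 2 ^ 2"
  have eq: "\<alpha> = gaut (vector [p1, p2]) (vector [q1, q2]) v1 ?A ?M"
  proof (rule additive_G6_eqI[OF add])
    show "gaut (vector [p1, p2]) (vector [q1, q2]) v1 ?A ?M (s + t) =
        gaut (vector [p1, p2]) (vector [q1, q2]) v1 ?A ?M s + gaut (vector [p1, p2]) (vector [q1, q2]) v1 ?A ?M t" for s t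
      using additive_gaut unfolding Modules.additive_def by blast
    let ?g = "gaut (vector [p1, p2]) (vector [q1, q2]) v1 ?A ?M"
    show "\<alpha> (1, 0, 0) = ?g (1, 0, 0)"
      unfolding u u1 by (simp add: gaut_def dot_def red_def parity_sum_def)
    show "\<alpha> (0, vector [1, 0], 0) = ?g (0, vector [1, 0], 0)"
      unfolding p1 gaut_def prod.case mv_axis by (simp add: dot_def red_def parity_sum_def)
    show "\<alpha> (0, vector [0, 1], 0) = ?g (0, vector [0, 1], 0)"
      unfolding p2 gaut_def prod.case mv_axis by (simp add: dot_def red_def parity_sum_def)
    show "\<alpha> (0, 0, vector [1, 0]) = ?g (0, 0, vector [1, 0])"
      unfolding 1 gaut_def prod.case mv_axis by (simp add: dot_def red_def parity_sum_def)
    show "\<alpha> (0, 0, vector [0, 1]) = ?g (0, 0, vector [0, 1])"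
      unfolding 2 gaut_def prod.case mv_axis by (simp add: dot_def red_def parity_sum_def v)
  qed
  have "?A *v k = a k" for k
  proof -
    have "a k = fst (snd (gaut (vector [p1, p2]) (vector [q1, q2]) v1 ?A ?M (0, k, 0)))"
      unfolding a_def[of k] by (rule arg_cong[of _ _ "\<lambda>s. fst (snd s)", OF fun_cong[OF eq]])
    also have "\<dots> = ?A *v k" unfolding gaut_def prod.case fst_conv snd_conv by (simp add: parity_sum_def)
    finally show ?thesis by (rule sym)
  qed
  then have "inj ((*v) ?A)" using a_inj by (simp add: inj_def)
  then have "\<exists>B. B ** ?A = mat 1" by (simp only: matrix_left_invertible_injective)
  then have "?A \<in> carrier GL_group" by (simp add: GL_group_def invertible_left_inverse)
  then show ?thesis using M eq by blast
qed

lemma induced_auts_eq_gauts: "induced_auts elt_scale L br Gam = gauts"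
  unfolding gauts_def using induced_auts_gaut gaut_induced(2) by blast

lemma matrix_of_induced_auts: "matrix_of_aut ` induced_auts elt_scale L br Gam = weyl_matrices"
proof -
  have "(\<chi> i j. v $ i) = (vector [vector [v $ 1, v $ 1], vector [v $ 2, v $ 2]] :: bit ^ 2 ^ 2)" for v :: "bit ^ 2"
    by (simp add: vec_eq_iff forall_2)
  moreover have "x = vector [x $ 1, x $ 2]" for x :: "bit ^ 2" by (simp add: vec2_eq_iff)
  ultimately have E: "matrix_of_aut (gaut p q v A M) = ((1, vector [p $ 1, p $ 2], vector [q $ 1, q $ 2]),
      (0, A, vector [vector [v $ 1, v $ 1], vector [v $ 2, v $ 2]]), (0, 0, M))" for p q v A M
    unfolding matrix_of_gaut by metis
  show ?thesis unfolding induced_auts_eq_gauts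
  proof (rule subset_antisym; rule subsetI)
    fix Z assume "Z \<in> matrix_of_aut ` gauts"
    then obtain p q v A M where AM: "A \<in> carrier GL_group" "M \<in> B_set" and Z: "Z = matrix_of_aut (gaut p q v A M)"
      unfolding gauts_def by blast
    show "Z \<in> weyl_matrices" unfolding Z E weyl_matrices_def carrier_B_group using AM by blast
  next
    fix Z assume "Z \<in> weyl_matrices"
    then obtain a b c d e f A M where AM: "A \<in> carrier GL_group" "M \<in> B_set"
      and Z: "Z = ((1, vector [a, b], vector [c, d]), (0, A, vector [vector [e, e], vector [f, f]]), (0, 0, M))"
      unfolding weyl_matrices_def carrier_B_group by blast
    have "Z = matrix_of_aut (gaut (vector [a, b]) (vector [c, d]) (vector [e, f]) A M)" unfolding Z E by simp
    then show "Z \<in> matrix_of_aut ` gauts" unfolding gauts_def using AM by blast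
  qed
qed

end

section \<open>Semidirect products\<close>

text \<open>The action is read off from the commutation rule \<open>norm\<close> in
  \<open>G\<close>. Conjugation on \<open>N\<close> is injective by cancellation, and finiteness of
  \<open>N\<close> makes it bijective. Working with homomorphisms from \<open>N\<close> and
  \<open>K\<close> lets the same lemma serve at all three levels of the decomposition.\<close>

lemma internal_semidirect:
  fixes G (structure)
  assumes G: "group G" and N: "group N" "finite (carrier N)"
    and \<iota>: "\<iota> \<in> hom N G" "inj_on \<iota> (carrier N)" and \<kappa>: "\<kappa> \<in> hom K G"
    and norm: "\<And>k n. k \<in> carrier K \<Longrightarrow> n \<in> carrier N \<Longrightarrow> \<exists>n'\<in>carrier N. \<kappa> k \<otimes> \<iota> n = \<iota> n' \<otimes> \<kappa> k"
    and inj: "\<And>n k n' k'. n \<in> carrier N \<Longrightarrow> n' \<in> carrier N \<Longrightarrow> k \<in> carrier K \<Longrightarrow> k' \<in> carrier K \<Longrightarrow>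
        \<iota> n \<otimes> \<kappa> k = \<iota> n' \<otimes> \<kappa> k' \<Longrightarrow> n = n' \<and> k = k'"
  shows "\<exists>\<theta>\<in>hom K (AutoGroup N). (\<lambda>(n, k). \<iota> n \<otimes> \<kappa> k) \<in> hom (semidirect N K \<theta>) G \<and>
    inj_on (\<lambda>(n, k). \<iota> n \<otimes> \<kappa> k) (carrier N \<times> carrier K) \<and> (\<forall>k\<in>carrier K. \<forall>n\<in>carrier N. \<theta> k n \<in> carrier N)"
proof -
  interpret G: group G by (rule G)
  interpret N: group N by (rule N(1))
  have \<iota>G: "\<iota> n \<in> carrier G" if "n \<in> carrier N" for n using \<iota>(1) that by (auto simp: hom_def)
  have \<kappa>G: "\<kappa> k \<in> carrier G" if "k \<in> carrier K" for k using \<kappa> that by (auto simp: hom_def)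
  have \<iota>m: "\<iota> (n \<otimes>\<^bsub>N\<^esub> n') = \<iota> n \<otimes> \<iota> n'" if "n \<in> carrier N" "n' \<in> carrier N" for n n' using \<iota>(1) that by (auto simp: hom_def)
  have \<kappa>m: "\<kappa> (k \<otimes>\<^bsub>K\<^esub> k') = \<kappa> k \<otimes> \<kappa> k'" if "k \<in> carrier K" "k' \<in> carrier K" for k k' using \<kappa> that by (auto simp: hom_def)
  define c where "c k n = (SOME n'. n' \<in> carrier N \<and> \<kappa> k \<otimes> \<iota> n = \<iota> n' \<otimes> \<kappa> k)" for k n
  have c: "c k n \<in> carrier N" "\<kappa> k \<otimes> \<iota> n = \<iota> (c k n) \<otimes> \<kappa> k" if "k \<in> carrier K" "n \<in> carrier N" for k n
    using someI_ex[of "\<lambda>n'. n' \<in> carrier N \<and> \<kappa> k \<otimes> \<iota> n = \<iota> n' \<otimes> \<kappa> k"] norm[OF that] unfolding c_def by blast+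
  have c_eqI: "c k n = n'" if "\<kappa> k \<in> carrier G" "n' \<in> carrier N" "\<kappa> k \<otimes> \<iota> n = \<iota> n' \<otimes> \<kappa> k" for k n n'
  proof -
    have "c k n \<in> carrier N \<and> \<kappa> k \<otimes> \<iota> n = \<iota> (c k n) \<otimes> \<kappa> k"
      unfolding c_def by (rule someI[of _ n']) (use that in blast)
    then have cN: "c k n \<in> carrier N" and e: "\<iota> (c k n) \<otimes> \<kappa> k = \<iota> n' \<otimes> \<kappa> k" using that by simp_all
    have "\<iota> (c k n) = \<iota> n'" using G.r_cancel[OF e] \<iota>G[OF cN] \<iota>G[OF that(2)] that(1) by blast
    then show ?thesis using inj_onD[OF \<iota>(2)] that(2) cN by blast
  qed
  have c_mult: "c k (n \<otimes>\<^bsub>N\<^esub> n') = c k n \<otimes>\<^bsub>N\<^esub> c k n'" if k: "k \<in> carrier K" and n: "n \<in> carrier N" "n' \<in> carrier N" for k n n'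
  proof (rule c_eqI)
    note g = \<kappa>G[OF k] \<iota>G[OF n(1)] \<iota>G[OF n(2)] \<iota>G[OF c(1)[OF k n(1)]] \<iota>G[OF c(1)[OF k n(2)]]
    have "\<kappa> k \<otimes> \<iota> (n \<otimes>\<^bsub>N\<^esub> n') = (\<kappa> k \<otimes> \<iota> n) \<otimes> \<iota> n'" using g by (simp add: \<iota>m n G.m_assoc)
    also have "\<dots> = \<iota> (c k n) \<otimes> (\<kappa> k \<otimes> \<iota> n')" unfolding c(2)[OF k n(1)] using g by (simp add: G.m_assoc)
    also have "\<dots> = \<iota> (c k n \<otimes>\<^bsub>N\<^esub> c k n') \<otimes> \<kappa> k" unfolding c(2)[OF k n(2)] using g by (simp add: \<iota>m c(1) k n G.m_assoc)
    finally show "\<kappa> k \<otimes> \<iota> (n \<otimes>\<^bsub>N\<^esub> n') = \<iota> (c k n \<otimes>\<^bsub>N\<^esub> c k n') \<otimes> \<kappa> k" .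
  qed (use c k n \<kappa>G in auto)
  have c_comp: "c (k \<otimes>\<^bsub>K\<^esub> k') n = c k (c k' n)" if k: "k \<in> carrier K" "k' \<in> carrier K" and n: "n \<in> carrier N" for k k' n
  proof (rule c_eqI)
    note cn = c(1)[OF k(2) n]
    note g = \<kappa>G[OF k(1)] \<kappa>G[OF k(2)] \<iota>G[OF n] \<iota>G[OF cn] \<iota>G[OF c(1)[OF k(1) cn]]
    show "\<kappa> (k \<otimes>\<^bsub>K\<^esub> k') \<in> carrier G" using g by (simp add: \<kappa>m k)
    have "\<kappa> (k \<otimes>\<^bsub>K\<^esub> k') \<otimes> \<iota> n = \<kappa> k \<otimes> (\<kappa> k' \<otimes> \<iota> n)" using g by (simp add: \<kappa>m k G.m_assoc)
    also have "\<dots> = (\<kappa> k \<otimes> \<iota> (c k' n)) \<otimes> \<kappa> k'" unfolding c(2)[OF k(2) n] using g by (simp add: G.m_assoc)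
    also have "\<dots> = \<iota> (c k (c k' n)) \<otimes> \<kappa> (k \<otimes>\<^bsub>K\<^esub> k')" unfolding c(2)[OF k(1) cn] using g by (simp add: \<kappa>m k G.m_assoc)
    finally show "\<kappa> (k \<otimes>\<^bsub>K\<^esub> k') \<otimes> \<iota> n = \<iota> (c k (c k' n)) \<otimes> \<kappa> (k \<otimes>\<^bsub>K\<^esub> k')" .
    show "c k (c k' n) \<in> carrier N" by (rule c(1)[OF k(1) cn])
  qed
  have c_bij: "bij_betw (c k) (carrier N) (carrier N)" if k: "k \<in> carrier K" for k
  proof -
    have "inj_on (c k) (carrier N)"
    proof (rule inj_onI)
      fix n n' assume n: "n \<in> carrier N" "n' \<in> carrier N" "c k n = c k n'"
      then have e: "\<kappa> k \<otimes> \<iota> n = \<kappa> k \<otimes> \<iota> n'" using c(2)[OF k] by simp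
      have "\<iota> n = \<iota> n'" using G.l_cancel[OF e] \<iota>G n(1,2) \<kappa>G[OF k] by blast
      then show "n = n'" using inj_onD[OF \<iota>(2)] n by blast
    qed
    moreover have "c k ` carrier N \<subseteq> carrier N" using c(1)[OF k] by blast
    ultimately show ?thesis using endo_inj_surj[OF N(2)] by (simp add: bij_betw_def)
  qed
  define \<theta> where "\<theta> k = restrict (c k) (carrier N)" for k
  have \<theta>Bij: "\<theta> k \<in> Bij (carrier N)" if "k \<in> carrier K" for k
    using c_bij[OF that] by (simp add: Bij_def \<theta>_def bij_betw_restrict_eq)
  have "\<theta> \<in> hom K (AutoGroup N)"
  proof (rule homI)
    show "\<theta> k \<in> carrier (AutoGroup N)" if k: "k \<in> carrier K" for k
      using \<theta>Bij[OF k] c_mult[OF k] c(1)[OF k] by (auto simp: AutoGroup_def auto_def hom_def \<theta>_def)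
    fix k k' assume k: "k \<in> carrier K" "k' \<in> carrier K"
    have "\<theta> (k \<otimes>\<^bsub>K\<^esub> k') = compose (carrier N) (\<theta> k) (\<theta> k')"
      using c_comp[OF k] c(1)[OF k(2)] by (auto simp: \<theta>_def compose_def restrict_def)
    then show "\<theta> (k \<otimes>\<^bsub>K\<^esub> k') = \<theta> k \<otimes>\<^bsub>AutoGroup N\<^esub> \<theta> k'"
      using \<theta>Bij k by (simp add: AutoGroup_def BijGroup_def)
  qed
  moreover have "(\<lambda>(n, k). \<iota> n \<otimes> \<kappa> k) \<in> hom (semidirect N K \<theta>) G"
  proof (rule homI)
    fix x assume "x \<in> carrier (semidirect N K \<theta>)"
    then show "(case x of (n, k) \<Rightarrow> \<iota> n \<otimes> \<kappa> k) \<in> carrier G" using \<iota>G \<kappa>G by (auto simp: semidirect_def)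
  next
    fix x y assume "x \<in> carrier (semidirect N K \<theta>)" "y \<in> carrier (semidirect N K \<theta>)"
    then obtain n k n' k' where xy: "x = (n, k)" "y = (n', k')" and n: "n \<in> carrier N" "n' \<in> carrier N"
      and k: "k \<in> carrier K" "k' \<in> carrier K" by (auto simp: semidirect_def)
    note g = \<kappa>G[OF k(1)] \<kappa>G[OF k(2)] \<iota>G[OF n(1)] \<iota>G[OF n(2)] \<iota>G[OF c(1)[OF k(1) n(2)]]
    have "\<iota> (n \<otimes>\<^bsub>N\<^esub> c k n') \<otimes> \<kappa> (k \<otimes>\<^bsub>K\<^esub> k') = \<iota> n \<otimes> (\<iota> (c k n') \<otimes> \<kappa> k) \<otimes> \<kappa> k'"
      using g by (simp add: \<iota>m \<kappa>m k n c(1) G.m_assoc)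
    also have "\<dots> = (\<iota> n \<otimes> \<kappa> k) \<otimes> (\<iota> n' \<otimes> \<kappa> k')"
      unfolding c(2)[OF k(1) n(2), symmetric] using g by (simp add: G.m_assoc)
    finally show "(case x \<otimes>\<^bsub>semidirect N K \<theta>\<^esub> y of (n, k) \<Rightarrow> \<iota> n \<otimes> \<kappa> k) =
        (case x of (n, k) \<Rightarrow> \<iota> n \<otimes> \<kappa> k) \<otimes> (case y of (n, k) \<Rightarrow> \<iota> n \<otimes> \<kappa> k)"
      using n by (simp add: xy semidirect_def \<theta>_def)
  qed
  moreover have "inj_on (\<lambda>(n, k). \<iota> n \<otimes> \<kappa> k) (carrier N \<times> carrier K)" using inj by (auto simp: inj_on_def)
  moreover have "\<forall>k\<in>carrier K. \<forall>n\<in>carrier N. \<theta> k n \<in> carrier N" using c(1) by (simp add: \<theta>_def)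
  ultimately show ?thesis by blast
qed

text \<open>Inverts a bijective homomorphism. Closure of the product in \<open>S\<close> is what
  makes the inverse multiplicative; it is supplied by \<open>semidirect_closed\<close>.\<close>

lemma is_isoI:
  assumes h: "h \<in> hom S G" and bij: "bij_betw h (carrier S) (carrier G)"
    and closed: "\<And>x y. x \<in> carrier S \<Longrightarrow> y \<in> carrier S \<Longrightarrow> x \<otimes>\<^bsub>S\<^esub> y \<in> carrier S"
  shows "G \<cong> S"
proof -
  let ?g = "inv_into (carrier S) h"
  have g: "?g x \<in> carrier S" "h (?g x) = x" if "x \<in> carrier G" for x
    using that bij by (auto simp: bij_betw_def inv_into_into f_inv_into_f)
  have "?g \<in> hom G S"
  proof (rule homI)
    fix x y assume xy: "x \<in> carrier G" "y \<in> carrier G"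
    have "h (?g x \<otimes>\<^bsub>S\<^esub> ?g y) = x \<otimes>\<^bsub>G\<^esub> y" using h g xy by (simp add: hom_def)
    then show "?g (x \<otimes>\<^bsub>G\<^esub> y) = ?g x \<otimes>\<^bsub>S\<^esub> ?g y"
      using bij closed[OF g(1)[OF xy(1)] g(1)[OF xy(2)]] by (metis bij_betw_inv_into_left)
  qed (use g in blast)
  then show ?thesis using bij_betw_inv_into[OF bij] by (auto simp: is_iso_def iso_def)
qed

lemma semidirect_closed:
  assumes "group N" "\<And>k n. k \<in> carrier K \<Longrightarrow> n \<in> carrier N \<Longrightarrow> \<theta> k n \<in> carrier N"
    and "\<And>k k'. k \<in> carrier K \<Longrightarrow> k' \<in> carrier K \<Longrightarrow> k \<otimes>\<^bsub>K\<^esub> k' \<in> carrier K"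
    and "x \<in> carrier (semidirect N K \<theta>)" "y \<in> carrier (semidirect N K \<theta>)"
  shows "x \<otimes>\<^bsub>semidirect N K \<theta>\<^esub> y \<in> carrier (semidirect N K \<theta>)"
  using assms monoid.m_closed[OF group.is_monoid[OF assms(1)]] by (auto simp: semidirect_def)

lemma carrier_semidirect: "carrier (semidirect N K \<theta>) = carrier N \<times> carrier K"
  by (simp add: semidirect_def)

section \<open>The structure of the Weyl group\<close>

lemma carrier_C2: "carrier C2 = {0, 1}" and mult_C2: "x \<otimes>\<^bsub>C2\<^esub> y = (x + y) mod 2"
  by (auto simp: carrier_integer_mod_group)

lemma C2_closed: "x \<in> carrier C2 \<Longrightarrow> y \<in> carrier C2 \<Longrightarrow> x \<otimes>\<^bsub>C2\<^esub> y \<in> carrier C2"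
  by (auto simp: carrier_C2)

lemma bit_of_C2: "a \<in> carrier C2 \<Longrightarrow> b \<in> carrier C2 \<Longrightarrow> of_int (a \<otimes>\<^bsub>C2\<^esub> b) = (of_int a + of_int b :: bit)"
  by (auto simp: carrier_C2)

definition bits2 :: "int \<times> int \<Rightarrow> bit ^ 2" where "bits2 = (\<lambda>(a, b). vector [of_int a, of_int b])"

lemma bits2_mult: "x \<in> carrier (C2 \<times>\<times> C2) \<Longrightarrow> y \<in> carrier (C2 \<times>\<times> C2) \<Longrightarrow>
    bits2 (x \<otimes>\<^bsub>C2 \<times>\<times> C2\<^esub> y) = bits2 x + bits2 y"
  unfolding carrier_DirProd
  by (elim SigmaE) (simp only: mult_DirProd bits2_def prod.case bit_of_C2 vec2_eq_iff vector_add_component vector_2)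

lemma bits2_inj: "x \<in> carrier (C2 \<times>\<times> C2) \<Longrightarrow> y \<in> carrier (C2 \<times>\<times> C2) \<Longrightarrow> bits2 x = bits2 y \<Longrightarrow> x = y"
  by (auto simp: bits2_def carrier_C2 vec2_eq_iff)

lemma bits2_surj: "\<exists>x\<in>carrier (C2 \<times>\<times> C2). bits2 x = v"
proof -
  have *: "\<exists>a\<in>carrier C2. of_int a = (b :: bit)" for b by (cases b) (auto simp: carrier_C2)
  obtain a where a: "a \<in> carrier C2" "of_int a = v $ 1" using * by blast
  obtain b where b: "b \<in> carrier C2" "of_int b = v $ 2" using * by blast
  show ?thesis using a b by (intro bexI[of _ "(a, b)"]) (simp_all add: bits2_def vec2_eq_iff)
qed

lemma group_C2_C2: "group (C2 \<times>\<times> C2)" and finite_C2_C2: "finite (carrier (C2 \<times>\<times> C2))"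
  by (simp_all add: DirProd_group carrier_C2)

section \<open>GL_2 over the field with two elements as the symmetric group S_3\<close>

definition nonzero3 :: "nat \<Rightarrow> bit ^ 2" where
  "nonzero3 i = (if i = 1 then vector [1, 0] else if i = 2 then vector [0, 1] else vector [1, 1])"

definition perm_mat :: "(nat \<Rightarrow> nat) \<Rightarrow> bit ^ 2 ^ 2" where
  "perm_mat \<sigma> = (\<chi> i j. nonzero3 (\<sigma> (if j = 1 then 1 else 2)) $ i)"

lemma atLeast1_3: "{1..3 :: nat} = {1, 2, 3}" by auto

lemma mv_columns: "A *v k = k $ 1 *s (\<chi> i. A $ i $ 1) + k $ 2 *s (\<chi> i. A $ i $ 2)" for A :: "bit ^ 2 ^ 2"
  by (simp add: vec2_eq_iff matrix_vector_mult_def sum_2 mult.commute)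

text \<open>The columns of \<open>perm_mat \<sigma>\<close> are the images of the first two nonzero
  vectors. The third follows because the three nonzero vectors add up to 0, a relation that every
  permutation preserves; so every permutation of them is linear.\<close>

lemma perm_mat_nonzero3:
  assumes \<sigma>: "\<sigma> permutes {1..3}" and i: "i \<in> {1..3}"
  shows "perm_mat \<sigma> *v nonzero3 i = nonzero3 (\<sigma> i)"
proof -
  have "(\<Sum>i\<in>{1..3}. nonzero3 (\<sigma> i)) = (\<Sum>i\<in>{1..3}. nonzero3 i)"
    using sum.permute[OF \<sigma>, of nonzero3] by (simp add: comp_def)
  also have "\<dots> = 0" unfolding atLeast1_3 by (simp add: nonzero3_def vec2_eq_iff)
  finally have 0: "nonzero3 (\<sigma> 1) + (nonzero3 (\<sigma> 2) + nonzero3 (\<sigma> 3)) = 0" unfolding atLeast1_3 by simp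
  have c: "(\<chi> i. perm_mat \<sigma> $ i $ 1) = nonzero3 (\<sigma> 1)" "(\<chi> i. perm_mat \<sigma> $ i $ 2) = nonzero3 (\<sigma> 2)"
    by (simp_all add: perm_mat_def vec2_eq_iff)
  have "nonzero3 (\<sigma> 1) + nonzero3 (\<sigma> 2) = nonzero3 (\<sigma> 1) + nonzero3 (\<sigma> 2) + (nonzero3 (\<sigma> 1) + (nonzero3 (\<sigma> 2) + nonzero3 (\<sigma> 3)))"
    unfolding 0 by simp
  also have "\<dots> = nonzero3 (\<sigma> 3)" by (simp add: vec2_eq_iff ac_simps)
  finally have 3: "nonzero3 (\<sigma> 1) + nonzero3 (\<sigma> 2) = nonzero3 (\<sigma> 3)" .
  have "i = 1 \<or> i = 2 \<or> i = 3" using i by auto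
  then show ?thesis unfolding mv_columns c by (elim disjE) (simp_all add: nonzero3_def[of 1] nonzero3_def[of 2] nonzero3_def[of 3] 3 del: One_nat_def)
qed

lemma nonzero3_inj: "i \<in> {1..3} \<Longrightarrow> j \<in> {1..3} \<Longrightarrow> nonzero3 i = nonzero3 j \<Longrightarrow> i = j"
  unfolding atLeast1_3 by (auto simp: nonzero3_def vec2_eq_iff)

lemma nonzero3_image: "nonzero3 ` {1..3} = UNIV - {0}"
proof (intro equalityI subsetI)
  fix x :: "bit ^ 2" assume "x \<in> UNIV - {0}"
  then have "x = nonzero3 1 \<or> x = nonzero3 2 \<or> x = nonzero3 3"
    by (cases "x $ 1"; cases "x $ 2") (simp_all add: nonzero3_def vec2_eq_iff)
  then show "x \<in> nonzero3 ` {1..3}" by (auto simp: atLeast1_3)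
qed (auto simp: nonzero3_def vec2_eq_iff atLeast1_3)

lemma matrix_eq_nonzero3:
  assumes "\<And>i. i \<in> {1..3} \<Longrightarrow> A *v nonzero3 i = B *v nonzero3 i"
  shows "A = (B :: bit ^ 2 ^ 2)"
  using assms[of 1] assms[of 2] by (simp add: nonzero3_def vec2_eq_iff matrix_vector_mult_def sum_2)

lemma perm_mat_mult:
  assumes "\<sigma> permutes {1..3}" "\<tau> permutes {1..3}"
  shows "perm_mat (\<sigma> \<circ> \<tau>) = perm_mat \<sigma> ** perm_mat \<tau>"
proof (rule matrix_eq_nonzero3)
  fix i :: nat assume i: "i \<in> {1..3}"
  have "\<tau> i \<in> {1..3}" using permutes_in_image[OF assms(2)] i by simp
  then show "perm_mat (\<sigma> \<circ> \<tau>) *v nonzero3 i = (perm_mat \<sigma> ** perm_mat \<tau>) *v nonzero3 i"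
    unfolding matrix_vector_mul_assoc[symmetric]
    using perm_mat_nonzero3 permutes_compose[OF assms(2,1)] assms i by simp
qed

lemma perm_mat_GL: "\<sigma> permutes {1..3} \<Longrightarrow> perm_mat \<sigma> \<in> carrier GL_group"
proof -
  assume \<sigma>: "\<sigma> permutes {1..3}"
  have id: "perm_mat id = mat 1" by (simp add: perm_mat_def nonzero3_def vec2_eq_iff mat_def)
  have "perm_mat \<sigma> ** perm_mat (inv \<sigma>) = mat 1" "perm_mat (inv \<sigma>) ** perm_mat \<sigma> = mat 1"
    using permutes_inv[OF \<sigma>] \<sigma> by (simp_all add: perm_mat_mult[symmetric] permutes_inv_o id)
  then show ?thesis by (auto simp: GL_group_def invertible_def)
qed

lemma perm_mat_inj:
  assumes \<sigma>: "\<sigma> permutes {1..3}" and \<tau>: "\<tau> permutes {1..3}" and eq: "perm_mat \<sigma> = perm_mat \<tau>"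
  shows "\<sigma> = \<tau>"
proof
  fix i
  show "\<sigma> i = \<tau> i"
  proof (cases "i \<in> {1..3}")
    case True
    then have "nonzero3 (\<sigma> i) = nonzero3 (\<tau> i)" using perm_mat_nonzero3[OF \<sigma> True] perm_mat_nonzero3[OF \<tau> True] eq by simp
    then show ?thesis using nonzero3_inj permutes_in_image[OF \<sigma>] permutes_in_image[OF \<tau>] True by blast
  next
    case False
    then show ?thesis using \<sigma> \<tau> by (simp add: permutes_not_in)
  qed
qed

lemma perm_mat_surj:
  assumes "A \<in> carrier GL_group"
  shows "\<exists>\<sigma>. \<sigma> permutes {1..3} \<and> perm_mat \<sigma> = A"
proof -
  obtain A' where A': "A ** A' = mat 1" "A' ** A = mat 1" using assms by (auto simp: GL_group_def invertible_def)
  have inv: "A *v (A' *v x) = x" "A' *v (A *v x) = x" for x by (simp_all add: matrix_vector_mul_assoc A')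
  have bijA: "bij_betw ((*v) A) (UNIV - {0}) (UNIV - {0})"
    by (rule bij_betw_byWitness[of _ "(*v) A'"]) (use inv in \<open>auto, (metis matrix_vector_mult_0_right)+\<close>)
  have bu: "bij_betw nonzero3 {1..3} (UNIV - {0})"
    using nonzero3_image nonzero3_inj by (auto simp: bij_betw_def inj_on_def)
  define \<sigma> where "\<sigma> i = (if i \<in> {1..3} then inv_into {1..3} nonzero3 (A *v nonzero3 i) else i)" for i
  have "bij_betw (inv_into {1..3} nonzero3 \<circ> ((*v) A \<circ> nonzero3)) {1..3} {1..3}"
    by (rule bij_betw_trans[OF bij_betw_trans[OF bu bijA] bij_betw_inv_into[OF bu]])
  then have "bij_betw \<sigma> {1..3} {1..3}"
    by (rule iffD1[OF bij_betw_cong, rotated]) (simp add: \<sigma>_def)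
  then have p: "\<sigma> permutes {1..3}" by (rule bij_imp_permutes) (unfold \<sigma>_def, erule if_not_P)
  have "perm_mat \<sigma> = A"
  proof (rule matrix_eq_nonzero3)
    fix i :: nat assume i: "i \<in> {1..3}"
    have "A *v nonzero3 i \<in> UNIV - {0}" using bij_betwE[OF bijA] bij_betwE[OF bu] i by blast
    then have "nonzero3 (\<sigma> i) = A *v nonzero3 i"
      using i f_inv_into_f[of "A *v nonzero3 i" nonzero3 "{1..3}"] unfolding nonzero3_image by (simp add: \<sigma>_def)
    then show "perm_mat \<sigma> *v nonzero3 i = A *v nonzero3 i" using perm_mat_nonzero3[OF p i] by simp
  qed
  then show ?thesis using p by blast
qed

abbreviation W_gaut :: "(G6 \<Rightarrow> G6) monoid" where
  "W_gaut \<equiv> AutoGroup plus_group \<lparr>carrier := gauts\<rparr>"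

lemma gauts_I: "A \<in> carrier GL_group \<Longrightarrow> M \<in> B_set \<Longrightarrow> gaut p q v A M \<in> gauts"
  unfolding gauts_def by blast

lemma gauts_mult: "\<alpha> \<in> gauts \<Longrightarrow> \<beta> \<in> gauts \<Longrightarrow> \<alpha> \<otimes>\<^bsub>W_gaut\<^esub> \<beta> = \<alpha> \<circ> \<beta>"
proof -
  assume "\<alpha> \<in> gauts" "\<beta> \<in> gauts"
  moreover have "gauts \<subseteq> carrier (AutoGroup plus_group)"
    unfolding gauts_def AutoGroup_plus using additive_gaut gaut_inverse by blast
  ultimately show ?thesis using AutoGroup_plus(2)[of \<alpha> \<beta>] by auto
qed

lemma zero_dot: "dot 0 x = 0" and zero_vm: "0 v* A = (0 :: bit ^ 2)" and vm_one: "x v* mat 1 = (x :: bit ^ 2)"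
  and redM_one: "redM (mat 1) = mat 1"
  by (simp_all add: dot_def vector_matrix_mult_def vec2_eq_iff redM_def mat_def sum_2)

lemma gaut_comp_lin:
  "M' \<in> B_set \<Longrightarrow> gaut 0 0 v A M \<circ> gaut 0 0 v' A' M' = gaut 0 0 (A *v v' + v) (A ** A') (M ** M')"
  by (simp add: gaut_comp zero_dot zero_vm)

lemma gaut_comp_one: "gaut p q v A M \<circ> gaut p' q' 0 (mat 1) (mat 1) = gaut (p' + p) (q' + q) v A M"
  by (simp add: gaut_comp one_B_set vm_one redM_one) (simp add: dot_def)

text \<open>The elements with trivial \<open>v\<close>, \<open>A\<close>, \<open>M\<close> form a
  normal subgroup complemented by those with \<open>p = q = 0\<close>. The factorization yields both
  the commutation rule and the surjectivity wanted in \<open>W_structure\<close>.\<close>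

lemma gaut_factor:
  assumes A: "A \<in> carrier GL_group" and M: "M \<in> B_set"
  shows "\<exists>P Q. gaut p q v A M = gaut P Q 0 (mat 1) (mat 1) \<circ> gaut 0 0 v A M"
proof -
  interpret GL: group "GL_group :: (int ^ 2 ^ 2) monoid" by (rule group_GL)
  obtain A' where A': "A ** A' = mat 1" "A' ** A = mat 1" using A by (auto simp: GL_group_def invertible_def)
  have sub: "subgroup B_set GL_group" unfolding B_set_def by (rule GL.generate_is_subgroup[OF B_gens])
  let ?M' = "m_inv GL_group M"
  have M': "?M' \<in> B_set" by (rule subgroup.m_inv_closed[OF sub M])
  have inv: "M ** ?M' = mat 1" "?M' ** M = mat 1"
    using GL.r_inv[of M] GL.l_inv[of M] subgroup.mem_carrier[OF sub M] by (simp_all add: mult_GL one_GL)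
  \<comment> \<open>The inverse of \<open>gaut 0 0 v A M\<close>; its translation part is the image
    of \<open>v\<close> under the inverse of \<open>A\<close>, with no sign in characteristic
    2.\<close>
  let ?\<beta> = "gaut 0 0 (A' *v v) A' ?M'"
  have "A *v (A' *v v) + v = 0" by (simp add: matrix_vector_mul_assoc A' bit2_add_self)
  then obtain P Q where PQ: "gaut p q v A M \<circ> ?\<beta> = gaut P Q 0 (mat 1) (mat 1)"
    unfolding gaut_comp[OF M'] A' inv by metis
  have "?\<beta> \<circ> gaut 0 0 v A M = id" unfolding gaut_comp_lin[OF M] A' inv by (simp add: bit2_add_self gaut_id)
  then have "gaut p q v A M = (gaut p q v A M \<circ> ?\<beta>) \<circ> gaut 0 0 v A M" by (simp add: comp_assoc)
  then show ?thesis unfolding PQ by blast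
qed

definition sg :: "int \<Rightarrow> int" where "sg a = (if a = 0 then 1 else - 1)"

lemma sg_mult: "a \<in> carrier C2 \<Longrightarrow> b \<in> carrier C2 \<Longrightarrow> sg (a \<otimes>\<^bsub>C2\<^esub> b) = sg a * sg b"
  and sg_abs: "sg a = 1 \<or> sg a = - 1" and sg_inj: "a \<in> carrier C2 \<Longrightarrow> b \<in> carrier C2 \<Longrightarrow> sg a = sg b \<Longrightarrow> a = b"
  by (auto simp: carrier_C2 sg_def)

definition swap_mat :: "int \<Rightarrow> int ^ 2 ^ 2" where "swap_mat a = (if a = 0 then mat 1 else sigma1)"

lemma dg2_mult: "dg2 a b ** dg2 c d = dg2 (a * c) (b * d)"
  and dg2_swap: "dg2 x y ** sigma1 = vector [vector [0, x], vector [y, 0]]" "sigma1 ** dg2 x y = dg2 y x ** sigma1"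
  by (simp_all add: mat2_simps)

lemma dg2_B_set: "dg2 (sg a) (sg b) \<in> B_set"
  unfolding B_set_eq signed_perm_def using sg_abs[of a] sg_abs[of b] by blast

lemma B_set_sub: "M \<in> B_set \<Longrightarrow> M \<in> carrier GL_group"
  using group.generate_in_carrier[OF group_GL B_gens] by (simp add: B_set_def)

text \<open>The signed permutation matrices are the diagonal sign matrices extended by
  \<open>sigma1\<close>, which exchanges the two signs.\<close>

lemma B_structure:
  "\<exists>\<theta>\<in>hom C2 (AutoGroup (C2 \<times>\<times> C2)). \<exists>h\<in>hom (semidirect (C2 \<times>\<times> C2) C2 \<theta>) GL_group.
     bij_betw h (carrier (C2 \<times>\<times> C2) \<times> carrier C2) B_set \<and>
     (\<forall>k\<in>carrier C2. \<forall>n\<in>carrier (C2 \<times>\<times> C2). \<theta> k n \<in> carrier (C2 \<times>\<times> C2))"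
proof -
  let ?\<iota> = "\<lambda>(a, b). dg2 (sg a) (sg b)"
  let ?h = "\<lambda>(n, k). ?\<iota> n \<otimes>\<^bsub>GL_group\<^esub> swap_mat k"
  have swapB: "swap_mat k \<in> B_set" for k by (simp add: swap_mat_def one_B_set sigma_B_set)
  have entries: "dg2 x y = dg2 x' y' \<longleftrightarrow> x = x' \<and> y = y'" for x y x' y' by (auto simp: vec2_eq_iff)
  have h_eq: "?h ((a, b), k) = (if k = 0 then dg2 (sg a) (sg b) else vector [vector [0, sg a], vector [sg b, 0]])" for a b k
    by (simp add: mult_GL swap_mat_def dg2_swap)
  have sg0: "sg a \<noteq> 0" for a by (simp add: sg_def)
  have "\<exists>\<theta>\<in>hom C2 (AutoGroup (C2 \<times>\<times> C2)). ?h \<in> hom (semidirect (C2 \<times>\<times> C2) C2 \<theta>) GL_group \<and>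
      inj_on ?h (carrier (C2 \<times>\<times> C2) \<times> carrier C2) \<and>
      (\<forall>k\<in>carrier C2. \<forall>n\<in>carrier (C2 \<times>\<times> C2). \<theta> k n \<in> carrier (C2 \<times>\<times> C2))"
  proof (rule internal_semidirect[OF group_GL group_C2_C2 finite_C2_C2])
    show "?\<iota> \<in> hom (C2 \<times>\<times> C2) GL_group"
      by (rule homI) (use B_set_sub dg2_B_set in \<open>auto simp: mult_GL dg2_mult sg_mult simp del: mult_integer_mod_group\<close>)
    show "inj_on ?\<iota> (carrier (C2 \<times>\<times> C2))" by (rule inj_onI) (auto simp: entries dest: sg_inj)
    show "swap_mat \<in> hom C2 GL_group"
    proof (rule homI)
      show "swap_mat x \<in> carrier GL_group" for x using B_set_sub swapB by blast
      show "swap_mat (x \<otimes>\<^bsub>C2\<^esub> y) = swap_mat x \<otimes>\<^bsub>GL_group\<^esub> swap_mat y" if "x \<in> carrier C2" "y \<in> carrier C2" for x y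
        using that by (auto simp: carrier_C2 swap_mat_def mult_GL sigma_products)
    qed
    show "\<exists>n'\<in>carrier (C2 \<times>\<times> C2). swap_mat k \<otimes>\<^bsub>GL_group\<^esub> ?\<iota> n = ?\<iota> n' \<otimes>\<^bsub>GL_group\<^esub> swap_mat k"
      if nN: "n \<in> carrier (C2 \<times>\<times> C2)" for k n
    proof -
      obtain a b where n: "n = (a, b)" "a \<in> carrier C2" "b \<in> carrier C2" using nN unfolding carrier_DirProd by blast
      show ?thesis
        using n by (intro bexI[of _ "if k = 0 then (a, b) else (b, a)"]) (auto simp: mult_GL swap_mat_def dg2_swap(2))
    qed
    show "n = n' \<and> k = k'"
      if n: "n \<in> carrier (C2 \<times>\<times> C2)" "n' \<in> carrier (C2 \<times>\<times> C2)" and k: "k \<in> carrier C2" "k' \<in> carrier C2"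
        and eq: "?\<iota> n \<otimes>\<^bsub>GL_group\<^esub> swap_mat k = ?\<iota> n' \<otimes>\<^bsub>GL_group\<^esub> swap_mat k'" for n k n' k'
    proof -
      obtain a b a' b' where nn: "n = (a, b)" "n' = (a', b')" and ab: "a \<in> carrier C2" "b \<in> carrier C2" "a' \<in> carrier C2" "b' \<in> carrier C2"
        using n unfolding carrier_DirProd by blast
      have e: "?h ((a, b), k) = ?h ((a', b'), k')" using eq nn by simp
      have "(k = 0) = (k' = 0) \<and> sg a = sg a' \<and> sg b = sg b'"
        using e sg0 unfolding h_eq by (auto simp: vec2_eq_iff split: if_splits)
      then have "a = a'" "b = b'" "(k = 0) = (k' = 0)" using sg_inj ab by blast+
      then show ?thesis using k unfolding nn carrier_C2 by auto
    qed
  qed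
  then obtain \<theta> where \<theta>: "\<theta> \<in> hom C2 (AutoGroup (C2 \<times>\<times> C2))" "?h \<in> hom (semidirect (C2 \<times>\<times> C2) C2 \<theta>) GL_group"
    "inj_on ?h (carrier (C2 \<times>\<times> C2) \<times> carrier C2)"
    "\<forall>k\<in>carrier C2. \<forall>n\<in>carrier (C2 \<times>\<times> C2). \<theta> k n \<in> carrier (C2 \<times>\<times> C2)" by blast
  have "?h ` (carrier (C2 \<times>\<times> C2) \<times> carrier C2) = B_set"
  proof (intro equalityI subsetI)
    fix M assume "M \<in> ?h ` (carrier (C2 \<times>\<times> C2) \<times> carrier C2)"
    then obtain a b k where "M = ?h ((a, b), k)" by auto
    then show "M \<in> B_set"
      using sg_abs[of a] sg_abs[of b] unfolding h_eq B_set_eq signed_perm_def by (auto split: if_splits)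
  next
    fix M assume "M \<in> B_set"
    then obtain x y where xy: "x = 1 \<or> x = - 1" "y = 1 \<or> y = - 1"
      "M = dg2 x y \<or> M = vector [vector [0, x], vector [y, 0]]"
      unfolding B_set_eq signed_perm_def by blast
    have *: "\<exists>a\<in>carrier C2. sg a = x" if "x = 1 \<or> x = - 1" for x using that by (auto simp: carrier_C2 sg_def)
    obtain a b where ab: "a \<in> carrier C2" "b \<in> carrier C2" "x = sg a" "y = sg b" using *[OF xy(1)] *[OF xy(2)] by metis
    have "M = ?h ((a, b), 0) \<or> M = ?h ((a, b), 1)" using xy(3) unfolding h_eq ab by simp
    moreover have "((a, b), 0) \<in> carrier (C2 \<times>\<times> C2) \<times> carrier C2" "((a, b), 1) \<in> carrier (C2 \<times>\<times> C2) \<times> carrier C2"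
      using ab(1,2) unfolding carrier_DirProd by (auto simp: carrier_C2)
    ultimately show "M \<in> ?h ` (carrier (C2 \<times>\<times> C2) \<times> carrier C2)" by blast
  qed
  then have "bij_betw ?h (carrier (C2 \<times>\<times> C2) \<times> carrier C2) B_set" using \<theta>(3) by (simp add: bij_betw_def)
  then show ?thesis using \<theta> by blast
qed

text \<open>The parameters \<open>v\<close> and \<open>A\<close> compose as affine maps of Z_2^2:
  translations extended by linear maps.\<close>

lemma affine_structure:
  assumes grp: "group W_gaut"
  shows "\<exists>\<theta>\<in>hom (sym_group 3) (AutoGroup (C2 \<times>\<times> C2)).
     (\<lambda>(n, \<sigma>). gaut 0 0 (bits2 n) (perm_mat \<sigma>) (mat 1)) \<in> hom (semidirect (C2 \<times>\<times> C2) (sym_group 3) \<theta>) W_gaut \<and>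
     (\<forall>k\<in>carrier (sym_group 3). \<forall>n\<in>carrier (C2 \<times>\<times> C2). \<theta> k n \<in> carrier (C2 \<times>\<times> C2))"
proof -
  let ?\<iota> = "\<lambda>n. gaut 0 0 (bits2 n) (mat 1) (mat 1)" and ?\<kappa> = "\<lambda>\<sigma>. gaut 0 0 0 (perm_mat \<sigma>) (mat 1)"
  have S3: "carrier (sym_group 3) = {\<sigma>. \<sigma> permutes {1..3}}" "\<sigma> \<otimes>\<^bsub>sym_group 3\<^esub> \<tau> = \<sigma> \<circ> \<tau>" for \<sigma> \<tau>
    by (simp_all add: sym_group_def)
  have \<iota>: "?\<iota> n \<in> gauts" for n by (rule gauts_I[OF one_GL_carrier one_B_set])
  have \<kappa>: "?\<kappa> \<sigma> \<in> gauts" if "\<sigma> permutes {1..3}" for \<sigma> by (rule gauts_I[OF perm_mat_GL[OF that] one_B_set])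
  have prod: "?\<iota> n \<otimes>\<^bsub>W_gaut\<^esub> ?\<kappa> \<sigma> = gaut 0 0 (bits2 n) (perm_mat \<sigma>) (mat 1)" if "\<sigma> permutes {1..3}" for n \<sigma>
    unfolding gauts_mult[OF \<iota> \<kappa>[OF that]] gaut_comp_lin[OF one_B_set] by simp
  have "\<exists>\<theta>\<in>hom (sym_group 3) (AutoGroup (C2 \<times>\<times> C2)).
      (\<lambda>(n, \<sigma>). ?\<iota> n \<otimes>\<^bsub>W_gaut\<^esub> ?\<kappa> \<sigma>) \<in> hom (semidirect (C2 \<times>\<times> C2) (sym_group 3) \<theta>) W_gaut \<and>
      inj_on (\<lambda>(n, \<sigma>). ?\<iota> n \<otimes>\<^bsub>W_gaut\<^esub> ?\<kappa> \<sigma>) (carrier (C2 \<times>\<times> C2) \<times> carrier (sym_group 3)) \<and>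
      (\<forall>k\<in>carrier (sym_group 3). \<forall>n\<in>carrier (C2 \<times>\<times> C2). \<theta> k n \<in> carrier (C2 \<times>\<times> C2))"
  proof (rule internal_semidirect[OF grp group_C2_C2 finite_C2_C2])
    show "?\<iota> \<in> hom (C2 \<times>\<times> C2) W_gaut"
    proof (rule homI)
      fix x y assume xy: "x \<in> carrier (C2 \<times>\<times> C2)" "y \<in> carrier (C2 \<times>\<times> C2)"
      show "?\<iota> (x \<otimes>\<^bsub>C2 \<times>\<times> C2\<^esub> y) = ?\<iota> x \<otimes>\<^bsub>W_gaut\<^esub> ?\<iota> y"
        unfolding gauts_mult[OF \<iota> \<iota>] gaut_comp_lin[OF one_B_set] bits2_mult[OF xy] by (simp add: add.commute)
    qed (simp add: \<iota>)
    show "inj_on ?\<iota> (carrier (C2 \<times>\<times> C2))" by (rule inj_onI) (simp only: gaut_inj bits2_inj)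
    show "?\<kappa> \<in> hom (sym_group 3) W_gaut"
    proof (rule homI)
      fix x y assume "x \<in> carrier (sym_group 3)" "y \<in> carrier (sym_group 3)"
      then have xy: "x permutes {1..3}" "y permutes {1..3}" by (simp_all only: S3 mem_Collect_eq)
      show "?\<kappa> x \<in> carrier W_gaut" using \<kappa>[OF xy(1)] by simp
      show "?\<kappa> (x \<otimes>\<^bsub>sym_group 3\<^esub> y) = ?\<kappa> x \<otimes>\<^bsub>W_gaut\<^esub> ?\<kappa> y"
        unfolding gauts_mult[OF \<kappa>[OF xy(1)] \<kappa>[OF xy(2)]] gaut_comp_lin[OF one_B_set] S3(2) perm_mat_mult[OF xy] by simp
    qed
    fix \<sigma> n assume \<sigma>: "\<sigma> \<in> carrier (sym_group 3)" and n: "n \<in> carrier (C2 \<times>\<times> C2)"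
    obtain n' where n': "n' \<in> carrier (C2 \<times>\<times> C2)" "bits2 n' = perm_mat \<sigma> *v bits2 n" using bits2_surj by blast
    show "\<exists>n'\<in>carrier (C2 \<times>\<times> C2). ?\<kappa> \<sigma> \<otimes>\<^bsub>W_gaut\<^esub> ?\<iota> n = ?\<iota> n' \<otimes>\<^bsub>W_gaut\<^esub> ?\<kappa> \<sigma>"
    proof (rule bexI[OF _ n'(1)])
      have p: "\<sigma> permutes {1..3}" using \<sigma> by (simp only: S3 mem_Collect_eq)
      show "?\<kappa> \<sigma> \<otimes>\<^bsub>W_gaut\<^esub> ?\<iota> n = ?\<iota> n' \<otimes>\<^bsub>W_gaut\<^esub> ?\<kappa> \<sigma>"
        unfolding prod[OF p, of n'] gauts_mult[OF \<kappa>[OF p] \<iota>] gaut_comp_lin[OF one_B_set] by (simp add: n'(2))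
    qed
  next
    fix n \<sigma> n' \<sigma>' assume n: "n \<in> carrier (C2 \<times>\<times> C2)" "n' \<in> carrier (C2 \<times>\<times> C2)"
      and \<sigma>: "\<sigma> \<in> carrier (sym_group 3)" "\<sigma>' \<in> carrier (sym_group 3)"
      and eq: "?\<iota> n \<otimes>\<^bsub>W_gaut\<^esub> ?\<kappa> \<sigma> = ?\<iota> n' \<otimes>\<^bsub>W_gaut\<^esub> ?\<kappa> \<sigma>'"
    have p: "\<sigma> permutes {1..3}" "\<sigma>' permutes {1..3}" using \<sigma> by (simp_all only: S3 mem_Collect_eq)
    show "n = n' \<and> \<sigma> = \<sigma>'"
      using eq bits2_inj[OF n] perm_mat_inj[OF p] unfolding prod[OF p(1)] prod[OF p(2)] gaut_inj by blast
  qed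
  then obtain \<theta> where \<theta>: "\<theta> \<in> hom (sym_group 3) (AutoGroup (C2 \<times>\<times> C2))"
    "(\<lambda>(n, \<sigma>). ?\<iota> n \<otimes>\<^bsub>W_gaut\<^esub> ?\<kappa> \<sigma>) \<in> hom (semidirect (C2 \<times>\<times> C2) (sym_group 3) \<theta>) W_gaut"
    "\<forall>k\<in>carrier (sym_group 3). \<forall>n\<in>carrier (C2 \<times>\<times> C2). \<theta> k n \<in> carrier (C2 \<times>\<times> C2)" by blast
  have "(\<lambda>(n, \<sigma>). gaut 0 0 (bits2 n) (perm_mat \<sigma>) (mat 1)) \<in> hom (semidirect (C2 \<times>\<times> C2) (sym_group 3) \<theta>) W_gaut"
  proof (rule homI)
    fix x assume "x \<in> carrier (semidirect (C2 \<times>\<times> C2) (sym_group 3) \<theta>)"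
    then show "(case x of (n, \<sigma>) \<Rightarrow> gaut 0 0 (bits2 n) (perm_mat \<sigma>) (mat 1)) \<in> carrier W_gaut"
      by (auto simp: carrier_semidirect S3 intro!: gauts_I perm_mat_GL one_B_set)
  next
    let ?S = "semidirect (C2 \<times>\<times> C2) (sym_group 3) \<theta>"
    fix x y assume xy: "x \<in> carrier ?S" "y \<in> carrier ?S"
    have S3c: "\<sigma> \<otimes>\<^bsub>sym_group 3\<^esub> \<tau> \<in> carrier (sym_group 3)"
      if "\<sigma> \<in> carrier (sym_group 3)" "\<tau> \<in> carrier (sym_group 3)" for \<sigma> \<tau>
      using that permutes_compose by (simp add: S3)
    have "x \<otimes>\<^bsub>?S\<^esub> y \<in> carrier ?S"
      by (rule semidirect_closed[OF group_C2_C2 _ S3c xy]) (use \<theta>(3) in blast)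
    then have eq: "(case z of (n, \<sigma>) \<Rightarrow> gaut 0 0 (bits2 n) (perm_mat \<sigma>) (mat 1)) = (case z of (n, \<sigma>) \<Rightarrow> ?\<iota> n \<otimes>\<^bsub>W_gaut\<^esub> ?\<kappa> \<sigma>)"
      if "z \<in> {x, y, x \<otimes>\<^bsub>?S\<^esub> y}" for z
      using that xy by (auto simp only: carrier_semidirect S3 prod split: prod.splits)
    show "(case x \<otimes>\<^bsub>?S\<^esub> y of (n, \<sigma>) \<Rightarrow> gaut 0 0 (bits2 n) (perm_mat \<sigma>) (mat 1)) =
        (case x of (n, \<sigma>) \<Rightarrow> gaut 0 0 (bits2 n) (perm_mat \<sigma>) (mat 1)) \<otimes>\<^bsub>W_gaut\<^esub>
        (case y of (n, \<sigma>) \<Rightarrow> gaut 0 0 (bits2 n) (perm_mat \<sigma>) (mat 1))"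
      using \<theta>(2) xy by (simp only: eq insertI1 insertI2) (simp only: hom_def mem_Collect_eq)
  qed
  then show ?thesis using \<theta>(1,3) by blast
qed

text \<open>The normal subgroup Z_2^4 consists of the parameters \<open>p\<close>, \<open>q\<close>.
  Its complement \<open>p = q = 0\<close> is a direct product of the affine group of Z_2^2 and the
  signed permutations, because \<open>parity_sum\<close> is invariant under the latter.\<close>

lemma W_structure:
  assumes grp: "group W_gaut"
  shows "\<exists>\<theta>1 \<theta>2 \<theta>.
         \<theta>1 \<in> hom (sym_group 3) (AutoGroup (C2 \<times>\<times> C2))
       \<and> \<theta>2 \<in> hom C2 (AutoGroup (C2 \<times>\<times> C2))
       \<and> \<theta> \<in> hom (semidirect (C2 \<times>\<times> C2) (sym_group 3) \<theta>1 \<times>\<times> semidirect (C2 \<times>\<times> C2) C2 \<theta>2)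
               (AutoGroup (C2 \<times>\<times> C2 \<times>\<times> C2 \<times>\<times> C2))
       \<and> B_group \<cong> semidirect (C2 \<times>\<times> C2) C2 \<theta>2
       \<and> W_gaut \<cong> semidirect (C2 \<times>\<times> C2 \<times>\<times> C2 \<times>\<times> C2)
               (semidirect (C2 \<times>\<times> C2) (sym_group 3) \<theta>1 \<times>\<times> semidirect (C2 \<times>\<times> C2) C2 \<theta>2) \<theta>"
proof -
  have S3: "carrier (sym_group 3) = {\<sigma>. \<sigma> permutes {1..3}}" by (simp add: sym_group_def)
  obtain \<theta>1 where \<theta>1: "\<theta>1 \<in> hom (sym_group 3) (AutoGroup (C2 \<times>\<times> C2))"
    and h1: "(\<lambda>(n, \<sigma>). gaut 0 0 (bits2 n) (perm_mat \<sigma>) (mat 1)) \<in> hom (semidirect (C2 \<times>\<times> C2) (sym_group 3) \<theta>1) W_gaut"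
    and c1: "\<forall>k\<in>carrier (sym_group 3). \<forall>n\<in>carrier (C2 \<times>\<times> C2). \<theta>1 k n \<in> carrier (C2 \<times>\<times> C2)"
    using affine_structure[OF grp] by blast
  obtain \<theta>2 h2 where \<theta>2: "\<theta>2 \<in> hom C2 (AutoGroup (C2 \<times>\<times> C2))" and h2: "h2 \<in> hom (semidirect (C2 \<times>\<times> C2) C2 \<theta>2) GL_group"
    and b2: "bij_betw h2 (carrier (C2 \<times>\<times> C2) \<times> carrier C2) B_set"
    and c2: "\<forall>k\<in>carrier C2. \<forall>n\<in>carrier (C2 \<times>\<times> C2). \<theta>2 k n \<in> carrier (C2 \<times>\<times> C2)"
    using B_structure by blast
  let ?S1 = "semidirect (C2 \<times>\<times> C2) (sym_group 3) \<theta>1" and ?S2 = "semidirect (C2 \<times>\<times> C2) C2 \<theta>2"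
  have closed1: "x \<otimes>\<^bsub>?S1\<^esub> y \<in> carrier ?S1" if "x \<in> carrier ?S1" "y \<in> carrier ?S1" for x y
  proof (rule semidirect_closed[OF group_C2_C2 _ _ that])
    show "\<sigma> \<otimes>\<^bsub>sym_group 3\<^esub> \<tau> \<in> carrier (sym_group 3)"
      if "\<sigma> \<in> carrier (sym_group 3)" "\<tau> \<in> carrier (sym_group 3)" for \<sigma> \<tau>
      using that permutes_compose by (simp add: sym_group_def)
  qed (use c1 in blast)
  have closed2: "x \<otimes>\<^bsub>?S2\<^esub> y \<in> carrier ?S2" if "x \<in> carrier ?S2" "y \<in> carrier ?S2" for x y
    by (rule semidirect_closed[OF group_C2_C2 _ C2_closed that]) (use c2 in blast)
  have h2B: "h2 y \<in> B_set" if "y \<in> carrier ?S2" for y using b2 that by (auto simp: carrier_semidirect bij_betw_def)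
  have h2m: "h2 (y \<otimes>\<^bsub>?S2\<^esub> y') = h2 y ** h2 y'" if "y \<in> carrier ?S2" "y' \<in> carrier ?S2" for y y'
    using h2 that by (simp add: hom_def mult_GL)
  have "B_group \<cong> ?S2"
  proof (rule is_isoI[OF _ _ closed2])
    show "h2 \<in> hom ?S2 B_group" by (rule homI) (simp_all add: carrier_B_group h2B h2m, simp add: B_group_def mult_GL)
    show "bij_betw h2 (carrier ?S2) (carrier B_group)" using b2 by (simp add: carrier_B_group carrier_semidirect)
  qed
  let ?N = "C2 \<times>\<times> C2 \<times>\<times> C2 \<times>\<times> C2"
  let ?p = "\<lambda>n :: int \<times> int \<times> int \<times> int. bits2 (fst n, fst (snd n))" and ?q = "\<lambda>n :: int \<times> int \<times> int \<times> int. bits2 (snd (snd n))"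
  let ?\<iota> = "\<lambda>n. gaut (?p n) (?q n) 0 (mat 1) (mat 1)"
  let ?\<kappa> = "\<lambda>z. gaut 0 0 (bits2 (fst (fst z))) (perm_mat (snd (fst z))) (h2 (snd z))"
  have grpN: "group ?N" "finite (carrier ?N)" by (simp_all add: DirProd_group carrier_C2)
  have N: "(fst n, fst (snd n)) \<in> carrier (C2 \<times>\<times> C2)" "snd (snd n) \<in> carrier (C2 \<times>\<times> C2)" if "n \<in> carrier ?N" for n
    using that by auto
  have Nm: "(fst (n \<otimes>\<^bsub>?N\<^esub> n'), fst (snd (n \<otimes>\<^bsub>?N\<^esub> n'))) = (fst n, fst (snd n)) \<otimes>\<^bsub>C2 \<times>\<times> C2\<^esub> (fst n', fst (snd n'))"
    "snd (snd (n \<otimes>\<^bsub>?N\<^esub> n')) = snd (snd n) \<otimes>\<^bsub>C2 \<times>\<times> C2\<^esub> snd (snd n')" for n n'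
    by (cases n; cases n'; simp)+
  \<comment> \<open>\<open>?\<iota>\<close> and \<open>?\<kappa>\<close> embed the normal subgroup
    and the complement; the first two coordinates of \<open>n\<close> encode \<open>p\<close>, the
    last two \<open>q\<close>.\<close>
  have \<iota>: "?\<iota> n \<in> gauts" for n by (rule gauts_I[OF one_GL_carrier one_B_set])
  have K: "bits2 (fst (fst z)) = bits2 (fst (fst z)) \<and> fst (fst z) \<in> carrier (C2 \<times>\<times> C2) \<and> snd (fst z) permutes {1..3} \<and> snd z \<in> carrier ?S2 \<and> fst z \<in> carrier ?S1"
    if "z \<in> carrier (?S1 \<times>\<times> ?S2)" for z using that by (auto simp: carrier_semidirect S3)
  have \<kappa>: "?\<kappa> z \<in> gauts" if "z \<in> carrier (?S1 \<times>\<times> ?S2)" for z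
    using K[OF that] by (intro gauts_I perm_mat_GL h2B) simp_all
  have Kc: "z \<otimes>\<^bsub>?S1 \<times>\<times> ?S2\<^esub> w \<in> carrier (?S1 \<times>\<times> ?S2)" if "z \<in> carrier (?S1 \<times>\<times> ?S2)" "w \<in> carrier (?S1 \<times>\<times> ?S2)" for z w
    using that closed1 closed2 by (cases z; cases w) auto
  have \<kappa>m: "?\<kappa> (z \<otimes>\<^bsub>?S1 \<times>\<times> ?S2\<^esub> w) = ?\<kappa> z \<circ> ?\<kappa> w"
    if zw: "z \<in> carrier (?S1 \<times>\<times> ?S2)" "w \<in> carrier (?S1 \<times>\<times> ?S2)" for z w
  proof -
    let ?g = "\<lambda>x. gaut 0 0 (bits2 (fst x)) (perm_mat (snd x)) (mat 1)"
    have g: "?g x \<in> gauts" if "x \<in> carrier ?S1" for x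
      using that by (intro gauts_I perm_mat_GL one_B_set) (auto simp: carrier_semidirect S3)
    have "?g (fst z \<otimes>\<^bsub>?S1\<^esub> fst w) = ?g (fst z) \<otimes>\<^bsub>W_gaut\<^esub> ?g (fst w)"
      using h1 K[OF zw(1)] K[OF zw(2)] unfolding hom_def mem_Collect_eq case_prod_beta by blast
    also have "\<dots> = ?g (fst z) \<circ> ?g (fst w)" using g K[OF zw(1)] K[OF zw(2)] by (intro gauts_mult) blast+
    finally have "bits2 (fst (fst z \<otimes>\<^bsub>?S1\<^esub> fst w)) = perm_mat (snd (fst z)) *v bits2 (fst (fst w)) + bits2 (fst (fst z))"
      "perm_mat (snd (fst z \<otimes>\<^bsub>?S1\<^esub> fst w)) = perm_mat (snd (fst z)) ** perm_mat (snd (fst w))"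
      unfolding gaut_comp_lin[OF one_B_set] gaut_inj by blast+
    moreover have "z \<otimes>\<^bsub>?S1 \<times>\<times> ?S2\<^esub> w = (fst z \<otimes>\<^bsub>?S1\<^esub> fst w, snd z \<otimes>\<^bsub>?S2\<^esub> snd w)" by (cases z; cases w) simp
    moreover have "h2 (snd z \<otimes>\<^bsub>?S2\<^esub> snd w) = h2 (snd z) ** h2 (snd w)" using h2m K[OF zw(1)] K[OF zw(2)] by blast
    moreover have "h2 (snd w) \<in> B_set" using h2B K[OF zw(2)] by blast
    ultimately show ?thesis by (simp only: gaut_comp_lin fst_conv snd_conv)
  qed
  have surjN: "\<exists>n\<in>carrier ?N. ?\<iota> n = gaut p q 0 (mat 1) (mat 1)" for p q
  proof -
    obtain x where x: "x \<in> carrier (C2 \<times>\<times> C2)" "bits2 x = p" using bits2_surj by blast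
    obtain y where y: "y \<in> carrier (C2 \<times>\<times> C2)" "bits2 y = q" using bits2_surj by blast
    show ?thesis using x y by (intro bexI[of _ "(fst x, snd x, y)"]) auto
  qed
  have \<iota>_inj: "n = n'" if "n \<in> carrier ?N" "n' \<in> carrier ?N" "?\<iota> n = ?\<iota> n'" for n n'
    using bits2_inj[OF N(1)[OF that(1)] N(1)[OF that(2)]] bits2_inj[OF N(2)[OF that(1)] N(2)[OF that(2)]] that(3)
    unfolding gaut_inj by (cases n; cases n') auto
  have "\<exists>\<theta>\<in>hom (?S1 \<times>\<times> ?S2) (AutoGroup ?N). (\<lambda>(n, z). ?\<iota> n \<otimes>\<^bsub>W_gaut\<^esub> ?\<kappa> z) \<in> hom (semidirect ?N (?S1 \<times>\<times> ?S2) \<theta>) W_gaut \<and>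
    inj_on (\<lambda>(n, z). ?\<iota> n \<otimes>\<^bsub>W_gaut\<^esub> ?\<kappa> z) (carrier ?N \<times> carrier (?S1 \<times>\<times> ?S2)) \<and>
    (\<forall>k\<in>carrier (?S1 \<times>\<times> ?S2). \<forall>n\<in>carrier ?N. \<theta> k n \<in> carrier ?N)"
  proof (rule internal_semidirect[OF grp grpN])
    show "?\<iota> \<in> hom ?N W_gaut"
    proof (rule homI)
      fix n n' assume n: "n \<in> carrier ?N" "n' \<in> carrier ?N"
      show "?\<iota> (n \<otimes>\<^bsub>?N\<^esub> n') = ?\<iota> n \<otimes>\<^bsub>W_gaut\<^esub> ?\<iota> n'"
        unfolding gauts_mult[OF \<iota> \<iota>] gaut_comp_one Nm bits2_mult[OF N(1)[OF n(1)] N(1)[OF n(2)]]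
          bits2_mult[OF N(2)[OF n(1)] N(2)[OF n(2)]] by (simp only: add.commute)
    qed (use \<iota> in simp)
    show "inj_on ?\<iota> (carrier ?N)" using \<iota>_inj by (rule inj_onI)
    show "?\<kappa> \<in> hom (?S1 \<times>\<times> ?S2) W_gaut"
    proof (rule homI)
      fix z w assume zw: "z \<in> carrier (?S1 \<times>\<times> ?S2)" "w \<in> carrier (?S1 \<times>\<times> ?S2)"
      show "?\<kappa> z \<in> carrier W_gaut" using \<kappa>[OF zw(1)] by simp
      show "?\<kappa> (z \<otimes>\<^bsub>?S1 \<times>\<times> ?S2\<^esub> w) = ?\<kappa> z \<otimes>\<^bsub>W_gaut\<^esub> ?\<kappa> w"
        unfolding gauts_mult[OF \<kappa>[OF zw(1)] \<kappa>[OF zw(2)]] by (rule \<kappa>m[OF zw])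
    qed
    fix z n assume z: "z \<in> carrier (?S1 \<times>\<times> ?S2)" and n: "n \<in> carrier ?N"
    have AM: "perm_mat (snd (fst z)) \<in> carrier GL_group" "h2 (snd z) \<in> B_set" using K[OF z] perm_mat_GL h2B by blast+
    have "?\<kappa> z \<circ> ?\<iota> n = gaut (?p n) (?q n) (bits2 (fst (fst z))) (perm_mat (snd (fst z))) (h2 (snd z))"
      unfolding gaut_comp_one by simp
    then obtain P Q where "?\<kappa> z \<circ> ?\<iota> n = gaut P Q 0 (mat 1) (mat 1) \<circ> ?\<kappa> z" using gaut_factor[OF AM] by metis
    moreover obtain n' where "n' \<in> carrier ?N" "?\<iota> n' = gaut P Q 0 (mat 1) (mat 1)" using surjN by blast
    ultimately show "\<exists>n'\<in>carrier ?N. ?\<kappa> z \<otimes>\<^bsub>W_gaut\<^esub> ?\<iota> n = ?\<iota> n' \<otimes>\<^bsub>W_gaut\<^esub> ?\<kappa> z"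
      unfolding gauts_mult[OF \<kappa>[OF z] \<iota>] gauts_mult[OF \<iota> \<kappa>[OF z]] by metis
  next
    fix n z n' z' assume n: "n \<in> carrier ?N" "n' \<in> carrier ?N" and z: "z \<in> carrier (?S1 \<times>\<times> ?S2)" "z' \<in> carrier (?S1 \<times>\<times> ?S2)"
      and eq: "?\<iota> n \<otimes>\<^bsub>W_gaut\<^esub> ?\<kappa> z = ?\<iota> n' \<otimes>\<^bsub>W_gaut\<^esub> ?\<kappa> z'"
    have M: "h2 (snd z) \<in> B_set" "h2 (snd z') \<in> B_set" and A: "perm_mat (snd (fst z)) \<in> carrier GL_group"
      using h2B perm_mat_GL K[OF z(1)] K[OF z(2)] by blast+
    note eq' = eq[unfolded gauts_mult[OF \<iota> \<kappa>[OF z(1)]] gauts_mult[OF \<iota> \<kappa>[OF z(2)]]]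
    have "bits2 (fst (fst z)) = bits2 (fst (fst z'))" "perm_mat (snd (fst z)) = perm_mat (snd (fst z'))" "h2 (snd z) = h2 (snd z')"
      using eq' unfolding gaut_comp[OF M(1)] gaut_comp[OF M(2)] gaut_inj by simp_all
    note e = this
    have "fst (fst z) = fst (fst z')"
      by (rule bits2_inj[OF _ _ e(1)]) (use K[OF z(1)] K[OF z(2)] in blast)+
    moreover have "snd (fst z) = snd (fst z')"
      by (rule perm_mat_inj[OF _ _ e(2)]) (use K[OF z(1)] K[OF z(2)] in blast)+
    moreover have "snd z = snd z'"
      by (rule inj_onD[OF bij_betw_imp_inj_on[OF b2] e(3)])
        (use K[OF z(1)] K[OF z(2)] in \<open>simp_all only: carrier_semidirect\<close>)
    ultimately have zz: "z = z'" by (simp add: prod_eq_iff)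
    have "surj (?\<kappa> z)" by (rule bij_is_surj[OF gaut_inverse[OF A M(1)]])
    have eq2: "?\<iota> n \<circ> ?\<kappa> z = ?\<iota> n' \<circ> ?\<kappa> z" using eq' by (simp only: zz)
    have "?\<iota> n = ?\<iota> n'"
    proof
      fix s
      obtain t where t: "s = ?\<kappa> z t" using \<open>surj (?\<kappa> z)\<close> by (rule surjE)
      show "?\<iota> n s = ?\<iota> n' s" unfolding t using fun_cong[OF eq2, of t] by (simp only: comp_apply)
    qed
    then show "n = n' \<and> z = z'" using \<iota>_inj n zz by blast
  qed
  then obtain \<theta> where \<theta>: "\<theta> \<in> hom (?S1 \<times>\<times> ?S2) (AutoGroup ?N)"
    "(\<lambda>(n, z). ?\<iota> n \<otimes>\<^bsub>W_gaut\<^esub> ?\<kappa> z) \<in> hom (semidirect ?N (?S1 \<times>\<times> ?S2) \<theta>) W_gaut"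
    "inj_on (\<lambda>(n, z). ?\<iota> n \<otimes>\<^bsub>W_gaut\<^esub> ?\<kappa> z) (carrier ?N \<times> carrier (?S1 \<times>\<times> ?S2))"
    "\<forall>k\<in>carrier (?S1 \<times>\<times> ?S2). \<forall>n\<in>carrier ?N. \<theta> k n \<in> carrier ?N" by blast
  have carrier_W: "carrier W_gaut = gauts" by simp
  have "W_gaut \<cong> semidirect ?N (?S1 \<times>\<times> ?S2) \<theta>"
  proof (rule is_isoI[OF \<theta>(2)])
    have "gauts \<subseteq> (\<lambda>(n, z). ?\<iota> n \<otimes>\<^bsub>W_gaut\<^esub> ?\<kappa> z) ` (carrier ?N \<times> carrier (?S1 \<times>\<times> ?S2))"
    proof
      fix \<alpha> assume "\<alpha> \<in> gauts"
      then obtain p q v A M where AM: "A \<in> carrier GL_group" "M \<in> B_set" and \<alpha>: "\<alpha> = gaut p q v A M" by (auto simp: gauts_def)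
      obtain P Q where PQ: "\<alpha> = gaut P Q 0 (mat 1) (mat 1) \<circ> gaut 0 0 v A M" using gaut_factor[OF AM] \<alpha> by metis
      obtain n where n: "n \<in> carrier ?N" "?\<iota> n = gaut P Q 0 (mat 1) (mat 1)" using surjN by blast
      obtain x where x: "x \<in> carrier (C2 \<times>\<times> C2)" "bits2 x = v" using bits2_surj by blast
      obtain \<sigma> where \<sigma>: "\<sigma> permutes {1..3}" "perm_mat \<sigma> = A" using perm_mat_surj[OF AM(1)] by blast
      have "M \<in> h2 ` (carrier (C2 \<times>\<times> C2) \<times> carrier C2)" using AM(2) b2 by (simp only: bij_betw_def)
      then obtain y where y: "y \<in> carrier ?S2" "h2 y = M" unfolding carrier_semidirect by blast
      have z: "((x, \<sigma>), y) \<in> carrier (?S1 \<times>\<times> ?S2)" using x \<sigma> y by (simp add: carrier_semidirect S3)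
      have "\<alpha> = ?\<iota> n \<circ> ?\<kappa> ((x, \<sigma>), y)" unfolding PQ n(2) fst_conv snd_conv x(2) \<sigma>(2) y(2) ..
      also have "\<dots> = ?\<iota> n \<otimes>\<^bsub>W_gaut\<^esub> ?\<kappa> ((x, \<sigma>), y)" by (rule gauts_mult[OF \<iota> \<kappa>[OF z], symmetric])
      finally have e: "\<alpha> = ?\<iota> n \<otimes>\<^bsub>W_gaut\<^esub> ?\<kappa> ((x, \<sigma>), y)" .
      have "(n, ((x, \<sigma>), y)) \<in> carrier ?N \<times> carrier (?S1 \<times>\<times> ?S2)" using n(1) z by (rule SigmaI)
      then show "\<alpha> \<in> (\<lambda>(n, z). ?\<iota> n \<otimes>\<^bsub>W_gaut\<^esub> ?\<kappa> z) ` (carrier ?N \<times> carrier (?S1 \<times>\<times> ?S2))"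
        by (rule rev_image_eqI) (simp only: e prod.case)
    qed
    moreover have "(\<lambda>(n, z). ?\<iota> n \<otimes>\<^bsub>W_gaut\<^esub> ?\<kappa> z) ` (carrier ?N \<times> carrier (?S1 \<times>\<times> ?S2)) \<subseteq> gauts"
      using hom_carrier[OF \<theta>(2)] unfolding carrier_semidirect carrier_W .
    ultimately show "bij_betw (\<lambda>(n, z). ?\<iota> n \<otimes>\<^bsub>W_gaut\<^esub> ?\<kappa> z) (carrier (semidirect ?N (?S1 \<times>\<times> ?S2) \<theta>)) (carrier W_gaut)"
      using \<theta>(3) unfolding bij_betw_def carrier_semidirect carrier_W by blast
    fix x y assume xy: "x \<in> carrier (semidirect ?N (?S1 \<times>\<times> ?S2) \<theta>)" "y \<in> carrier (semidirect ?N (?S1 \<times>\<times> ?S2) \<theta>)"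
    show "x \<otimes>\<^bsub>semidirect ?N (?S1 \<times>\<times> ?S2) \<theta>\<^esub> y \<in> carrier (semidirect ?N (?S1 \<times>\<times> ?S2) \<theta>)"
      by (rule semidirect_closed[OF grpN(1) _ Kc xy]) (use \<theta>(4) in blast)
  qed
  then show ?thesis using \<theta>1 \<theta>2 \<theta>(1) \<open>B_group \<cong> ?S2\<close> by blast
qed

theorem proposition5p6:
  fixes L1 :: "('a::{alg_closed_field, field_char_0}) tensor4 set"
    and br :: "'a elt \<Rightarrow> 'a elt \<Rightarrow> 'a elt"
  assumes "is_L1 L1" and "E6_bracket L1 br"
  defines "L \<equiv> L_carrier L1"
    and "\<Gamma> \<equiv> Gamma6 L1"
  defines "W \<equiv> weyl_group elt_scale L br \<Gamma>"
  shows "fine_grading TYPE('h::ab_group_add) elt_scale L br \<Gamma>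
    \<and> graded_by_universal_group TYPE('h) elt_scale L br \<Gamma>
    \<and> (\<exists>\<Phi> \<in> iso W (AutoGroup plus_group \<lparr>carrier := induced_auts elt_scale L br \<Gamma>\<rparr>).
         \<forall>f \<in> grading_auts elt_scale L br \<Gamma>.
           induces \<Gamma> f (\<Phi> (grading_stab elt_scale L br \<Gamma> #>\<^bsub>grading_aut_group elt_scale L br \<Gamma>\<^esub> f)))
    \<and> matrix_of_aut ` induced_auts elt_scale L br \<Gamma> = weyl_matrices
    \<and> (\<exists>\<theta>1 \<theta>2 \<theta>.
         \<theta>1 \<in> hom (sym_group 3) (AutoGroup (C2 \<times>\<times> C2))
       \<and> \<theta>2 \<in> hom C2 (AutoGroup (C2 \<times>\<times> C2))
       \<and> \<theta> \<in> hom (semidirect (C2 \<times>\<times> C2) (sym_group 3) \<theta>1 \<times>\<times> semidirect (C2 \<times>\<times> C2) C2 \<theta>2)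
               (AutoGroup (C2 \<times>\<times> C2 \<times>\<times> C2 \<times>\<times> C2))
       \<and> B_group \<cong> semidirect (C2 \<times>\<times> C2) C2 \<theta>2
       \<and> W \<cong> semidirect (C2 \<times>\<times> C2 \<times>\<times> C2 \<times>\<times> C2)
               (semidirect (C2 \<times>\<times> C2) (sym_group 3) \<theta>1 \<times>\<times> semidirect (C2 \<times>\<times> C2) C2 \<theta>2) \<theta>)"
proof -
  interpret E6 L1 br using assms(1,2) by unfold_locales
  \<comment> \<open>Universality with respect to realizations over the group of the grading itself
    is all that is required to attach an automorphism of the group to each \<open>f\<close>, so the
    type of the other realization is instantiated accordingly.\<close>
  interpret U: universal_grading elt_scale "L_carrier L1" br "Gamma6 L1"
    by unfold_locales (rule Gam_universal)
  note iso = U.weyl_group_iso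
  have is_iso: "weyl_group elt_scale (L_carrier L1) br (Gamma6 L1) \<cong> W_gaut"
    using iso unfolding is_iso_def induced_auts_eq_gauts by blast
  have trans: "W \<cong> S" if "W_gaut \<cong> S" for S :: "((int \<times> int \<times> int \<times> int) \<times> ((int \<times> int) \<times> (nat \<Rightarrow> nat)) \<times> ((int \<times> int) \<times> int)) monoid"
    using iso_trans[OF is_iso that] unfolding W_def L_def \<Gamma>_def .
  have "group W_gaut" using U.group_W_aut unfolding induced_auts_eq_gauts .
  from W_structure[OF this] show ?thesis
    using Gam_fine[where 'h = 'h] Gam_universal[where 'h = 'h] iso matrix_of_induced_auts trans
    unfolding W_def L_def \<Gamma>_def by blast
qed

end
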